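(* Let $X_N=H_N+A_N$ be the deformed inhomogeneous random matrix described in the context. Let $\mathbf q_i$ be a unit eigenvector of $A_N$ associated with the eigenvalue $a_i$, and let $\mu_{X_N}^{\mathbf q_i}$ be the spectral measure of $X_N$ with respect to $\mathbf q_i$, i.e. the unique probability measure with $\int x^m\,\mu_{X_N}^{\mathbf q_i}(dx)=\mathbf q_i^*X_N^m\mathbf q_i$ for all $m\in\mathbb N$. If $(r+1)\sigma_N^*\sqrt{\log N}\to0$ as $N\to\infty$, then for each $1\le i\le r$, $\mu_{X_N}^{\mathbf q_i}$ converges weakly, almost surely, to $$\mu_{a_i}(dx)=\frac{1_{\{|x|\le2\}}}{2\pi}\,\frac{\sqrt{4-x^2}}{a_i^2+1-a_ix}\,dx+1_{\{|a_i|\ge1\}}\Big(1-\frac1{a_i^2}\Big)\delta_{a_i+\frac1{a_i}}(dx),$$ where $1_{\{\cdot\}}$ denotes the indicator function and $\delta$ the Dirac measure.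
   Context: Model. $H_N=\Sigma_N\circ W_N$ (entrywise product) and $X_N=H_N+A_N$, all $N\times N$, where: (A1) $W_N=(W_{ij})$ is a real symmetric or complex Hermitian matrix whose entries on and above the diagonal are independent and symmetrically distributed, with either (real case) $\mathbb E[W_{ii}^2]=2$, $\mathbb E[W_{ij}^2]=1$ for $i\ne j$, or (complex case) $\mathbb E[W_{ii}^2]=1$, $\mathbb E[|W_{ij}|^2]=1$, $\mathbb E[W_{ij}^2]=0$ for $i\neq j$; and $\mathbb E[|W_{ij}|^{2k}]\le\gamma^{k-1}(2k-1)!!$ for all $k\ge2$ and all $i,j$, with some fixed constant $\gamma>0$. (A2) $\Sigma_N=(\sigma_{ij})$ is symmetric with non-negative entries and $\sum_{j=1}^N\sigma_{ij}^2=1$ for all $i$. (A3) $A_N=\sum_{i,j=1}^r a_{ij}E_{m_im_j}$ is deterministic, of the same symmetry as $W_N$, for some $r\in\{1,\dots,N\}$, where $m_1,\dots,m_r\in\{1,\dots,N\}$ are distinct and $E_{ij}$ is the matrix with a single $1$ at position $(i,j)$ and $0$ otherwise. $\sigma_N^*=\max_{1\le i,j\le N}\sigma_{ij}$. *)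

theory Defs
  imports "HOL-Probability.Probability" "Jordan_Normal_Form.Schur_Decomposition"
begin

text \<open>
  Matrices have complex entries and are indexed by \<open>0, \<dots>, N - 1\<close>, as is usual for
  \<^typ>\<open>complex Matrix.mat\<close>. The real symmetric case is the one where all entries are real.
\<close>

datatype symmetry_class = Real_Symmetric | Complex_Hermitian

fun has_symmetry :: "symmetry_class \<Rightarrow> complex Matrix.mat \<Rightarrow> bool" where
  "has_symmetry Real_Symmetric A \<longleftrightarrow>
     square_mat A \<and> transpose_mat A = A \<and> elements_mat A \<subseteq> \<real>"
| "has_symmetry Complex_Hermitian A \<longleftrightarrow> square_mat A \<and> mat_adjoint A = A"


subsection \<open>The random matrix \<open>W\<close>\<close>

definition symmetrically_distributed :: "'w measure \<Rightarrow> ('w \<Rightarrow> complex) \<Rightarrow> bool" where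
  "symmetrically_distributed M Y \<longleftrightarrow> distr M borel (\<lambda>\<omega>. - Y \<omega>) = distr M borel Y"

text \<open>The double factorial \<open>(2k - 1)!! = 1 \<cdot> 3 \<cdots> (2k - 1)\<close>.\<close>

definition odd_double_factorial :: "nat \<Rightarrow> real" where
  "odd_double_factorial k = (\<Prod>j = 1..k. 2 * real j - 1)"

fun entry_variances ::
  "symmetry_class \<Rightarrow> 'w measure \<Rightarrow> nat \<Rightarrow> ('w \<Rightarrow> complex Matrix.mat) \<Rightarrow> bool" where
  "entry_variances Real_Symmetric M N W \<longleftrightarrow>
     (\<forall>i<N. integral\<^sup>L M (\<lambda>\<omega>. (W \<omega> $$ (i, i))\<^sup>2) = 2) \<and>
     (\<forall>i<N. \<forall>j<N. i \<noteq> j \<longrightarrow> integral\<^sup>L M (\<lambda>\<omega>. (W \<omega> $$ (i, j))\<^sup>2) = 1)"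
| "entry_variances Complex_Hermitian M N W \<longleftrightarrow>
     (\<forall>i<N. integral\<^sup>L M (\<lambda>\<omega>. (W \<omega> $$ (i, i))\<^sup>2) = 1) \<and>
     (\<forall>i<N. \<forall>j<N. i \<noteq> j \<longrightarrow>
        integral\<^sup>L M (\<lambda>\<omega>. (cmod (W \<omega> $$ (i, j)))\<^sup>2) = 1 \<and>
        integral\<^sup>L M (\<lambda>\<omega>. (W \<omega> $$ (i, j))\<^sup>2) = 0)"

text \<open>
  Integrability is stated for the moment bounds, because the Bochner integral of a
  non-integrable function is 0 and the bound would then hold trivially.
\<close>

definition sub_gaussian_wigner ::
  "symmetry_class \<Rightarrow> real \<Rightarrow> 'w measure \<Rightarrow> nat \<Rightarrow> ('w \<Rightarrow> complex Matrix.mat) \<Rightarrow> bool" where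
  "sub_gaussian_wigner \<beta> \<gamma> M N W \<longleftrightarrow>
     (\<forall>\<omega>\<in>space M. W \<omega> \<in> carrier_mat N N \<and> has_symmetry \<beta> (W \<omega>)) \<and>
     prob_space.indep_vars M (\<lambda>_. borel) (\<lambda>(i, j) \<omega>. W \<omega> $$ (i, j)) {(i, j). i \<le> j \<and> j < N} \<and>
     (\<forall>i j. i \<le> j \<and> j < N \<longrightarrow> symmetrically_distributed M (\<lambda>\<omega>. W \<omega> $$ (i, j))) \<and>
     entry_variances \<beta> M N W \<and>
     (\<forall>k\<ge>2. \<forall>i<N. \<forall>j<N.
        integrable M (\<lambda>\<omega>. cmod (W \<omega> $$ (i, j)) ^ (2 * k)) \<and>
        integral\<^sup>L M (\<lambda>\<omega>. cmod (W \<omega> $$ (i, j)) ^ (2 * k))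
          \<le> \<gamma> ^ (k - 1) * odd_double_factorial k)"


subsection \<open>The variance profile \<open>\<Sigma>\<close> and the deformation \<open>A\<close>\<close>

definition variance_profile :: "nat \<Rightarrow> real Matrix.mat \<Rightarrow> bool" where
  "variance_profile N S \<longleftrightarrow>
     S \<in> carrier_mat N N \<and> transpose_mat S = S \<and>
     (\<forall>i<N. \<forall>j<N. 0 \<le> S $$ (i, j)) \<and>
     (\<forall>i<N. (\<Sum>j<N. (S $$ (i, j))\<^sup>2) = 1)"

definition max_entry :: "real Matrix.mat \<Rightarrow> real" where
  "max_entry S = Max (elements_mat S)"

definition matrix_unit :: "nat \<Rightarrow> nat \<Rightarrow> nat \<Rightarrow> complex Matrix.mat" where
  "matrix_unit N p q = Matrix.mat N N (\<lambda>(k, l). if k = p \<and> l = q then 1 else 0)"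

text \<open>
  \<open>A = \<Sum>\<^sub>i\<^sub>j a\<^sub>i\<^sub>j E\<^bsub>m\<^sub>i m\<^sub>j\<^esub>\<close>, with the sum over \<open>1 \<le> i, j \<le> r\<close> written out entrywise.
\<close>

definition block_deformation :: "symmetry_class \<Rightarrow> nat \<Rightarrow> nat \<Rightarrow> complex Matrix.mat \<Rightarrow> bool" where
  "block_deformation \<beta> N r A \<longleftrightarrow>
     has_symmetry \<beta> A \<and> 1 \<le> r \<and> r \<le> N \<and>
     (\<exists>a m. inj_on m {1..r} \<and> m ` {1..r} \<subseteq> {..<N} \<and>
        A = Matrix.mat N N (\<lambda>(k, l). \<Sum>i = 1..r. \<Sum>j = 1..r. a i j * matrix_unit N (m i) (m j) $$ (k, l)))"

definition hadamard_product ::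
  "real Matrix.mat \<Rightarrow> complex Matrix.mat \<Rightarrow> complex Matrix.mat" where
  "hadamard_product S B =
     Matrix.mat (dim_row B) (dim_col B) (\<lambda>(i, j). complex_of_real (S $$ (i, j)) * B $$ (i, j))"

definition deformed_matrix ::
  "real Matrix.mat \<Rightarrow> ('w \<Rightarrow> complex Matrix.mat) \<Rightarrow> complex Matrix.mat \<Rightarrow> 'w \<Rightarrow> complex Matrix.mat" where
  "deformed_matrix S W A \<omega> = hadamard_product S (W \<omega>) + A"


subsection \<open>Spectral measures and the limit law\<close>

definition unit_eigenvector :: "complex Matrix.mat \<Rightarrow> complex Matrix.vec \<Rightarrow> real \<Rightarrow> bool" where
  "unit_eigenvector A q a \<longleftrightarrow> eigenvector A q (complex_of_real a) \<and> q \<bullet>c q = 1"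

text \<open>
  \<^term>\<open>u \<bullet>c q\<close> is \<open>\<Sum>\<^sub>k u\<^sub>k \<cdot> cnj q\<^sub>k\<close>, so the right-hand side of the moment identity below is
  \<open>q\<^sup>* X\<^sup>m q\<close>.
\<close>

definition is_spectral_measure ::
  "complex Matrix.mat \<Rightarrow> complex Matrix.vec \<Rightarrow> real measure \<Rightarrow> bool" where
  "is_spectral_measure X q \<mu> \<longleftrightarrow>
     prob_space \<mu> \<and> sets \<mu> = sets borel \<and>
     (\<forall>m::nat. integrable \<mu> (\<lambda>x. x ^ m) \<and>
        complex_of_real (integral\<^sup>L \<mu> (\<lambda>x. x ^ m)) = ((X ^\<^sub>m m) *\<^sub>v q) \<bullet>c q)"

definition spectral_measure ::
  "complex Matrix.mat \<Rightarrow> complex Matrix.vec \<Rightarrow> real measure" where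
  "spectral_measure X q = (THE \<mu>. is_spectral_measure X q \<mu>)"

definition limit_density :: "real \<Rightarrow> real \<Rightarrow> real" where
  "limit_density a x =
     indicator {x. \<bar>x\<bar> \<le> 2} x / (2 * pi) * (sqrt (4 - x\<^sup>2) / (a\<^sup>2 + 1 - a * x))"

definition limit_atom_mass :: "real \<Rightarrow> real" where
  "limit_atom_mass a = indicator {a. \<bar>a\<bar> \<ge> 1} a * (1 - 1 / a\<^sup>2)"

text \<open>
  The sum of an absolutely continuous measure and a multiple of a Dirac measure; that it
  takes the intended values is the lemma \<open>emeasure_limit_measure\<close>.
\<close>

definition limit_measure :: "real \<Rightarrow> real measure" where
  "limit_measure a = measure_of UNIV (sets borel) (\<lambda>B.
     emeasure (density lborel (\<lambda>x. ennreal (limit_density a x))) B +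
     ennreal (limit_atom_mass a) * emeasure (return borel (a + 1 / a)) B)"

lemma sets_limit_measure [simp, measurable_cong]: "sets (limit_measure a) = sets borel"
  unfolding limit_measure_def
  by (metis sets.sets_measure_of_eq space_borel)

lemma space_limit_measure [simp]: "space (limit_measure a) = UNIV"
  unfolding limit_measure_def by (simp add: space_measure_of_conv)

lemma emeasure_limit_measure:
  assumes "B \<in> sets borel"
  shows "emeasure (limit_measure a) B =
    (\<integral>\<^sup>+x\<in>B. ennreal (limit_density a x) \<partial>lborel) +
    ennreal (limit_atom_mass a) * indicator B (a + 1 / a)"
proof -
  let ?f = "\<lambda>x. ennreal (limit_density a x)"
  let ?D = "density lborel ?f"
  let ?R = "return borel (a + 1 / a) :: real measure"
  let ?\<mu> = "\<lambda>B. emeasure ?D B + ennreal (limit_atom_mass a) * emeasure ?R B"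
  have f: "?f \<in> borel_measurable lborel"
    unfolding limit_density_def by measurable
  have "countably_additive (sets (borel :: real measure)) ?\<mu>"
  proof (rule countably_additiveI)
    fix C :: "nat \<Rightarrow> real set"
    assume C: "range C \<subseteq> sets borel" "disjoint_family C"
    have D: "(\<Sum>i. emeasure ?D (C i)) = emeasure ?D (\<Union>i. C i)"
      using C by (intro suminf_emeasure) auto
    have R: "(\<Sum>i. emeasure ?R (C i)) = emeasure ?R (\<Union>i. C i)"
      using C by (intro suminf_emeasure) auto
    show "(\<Sum>i. ?\<mu> (C i)) = ?\<mu> (\<Union>i. C i)"
      by (simp add: suminf_add[symmetric] ennreal_suminf_cmult D R)
  qed
  moreover have "sigma_algebra UNIV (sets (borel :: real measure))"
    using sets.sigma_algebra_axioms[of "borel :: real measure"] by simp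
  ultimately have "emeasure (limit_measure a) B = ?\<mu> B"
    using assms unfolding limit_measure_def
    by (intro emeasure_measure_of_sigma) (auto simp: positive_def)
  also have "emeasure ?D B = (\<integral>\<^sup>+x\<in>B. ?f x \<partial>lborel)"
    using f assms by (intro emeasure_density) auto
  finally show ?thesis using assms by simp
qed

end

theory Submission
  imports Defs "Jordan_Normal_Form.Char_Poly"
begin

text \<open>
  Put \<open>z = \<i>\<eta>\<close> with \<open>\<eta> \<ge> 2\<close>, let \<open>G\<close> be the resolvent of \<open>H\<close> at \<open>z\<close> and let \<open>m\<close> be the root of \<open>z m = 1 + m\<^sup>2\<close>
  with \<open>\<bar>m\<bar> < 1\<close>. Because \<open>A\<close> lives on an \<open>r \<times> r\<close> block and \<open>q\<close> is an eigenvector of \<open>A\<close>, the number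
  \<open>q\<^sup>* (z - X)\<^sup>-\<^sup>1 q\<close> is determined by the entries of \<open>G\<close> in the block and by the forms of \<open>G\<close> with \<open>q\<close>. If \<open>G\<close> were
  exactly \<open>m\<close> there, it would be \<open>m / (1 - a m)\<close>, the Stieltjes transform of the limit law; entrywise
  errors \<open>\<tau>\<close> perturb it by \<open>O (r \<tau>)\<close>, uniformly in \<open>A\<close>.

  The errors have size \<open>\<sigma>\<^sup>* sqrt (log N)\<close>. For the fluctuations, tensorization of entropy and the Herbst
  argument give sub-Gaussian tails with variance proxy \<open>O (\<sigma>\<^sup>*\<^sup>2)\<close> for every form \<open>u\<^sup>* G v\<close>. For the mean,
  the off-diagonal entries vanish by symmetry of the laws, and the diagonal ones solve
  \<open>z g\<^sub>i = 1 + \<Sum>\<^sub>k \<sigma>\<^sub>i\<^sub>k\<^sup>2 g\<^sub>i g\<^sub>k\<close> up to \<open>O (\<sigma>\<^sup>* sqrt (log N))\<close>, whose stable solution is \<open>g\<^sub>i = m\<close>. A union bound and the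
  Borel-Cantelli lemma give almost sure convergence of the Stieltjes transforms on a countable subset of
  the imaginary axis, which suffices for weak convergence.
\<close>

section \<open>The limit law\<close>

text \<open>The entries are unbounded and only their moments are controlled, so no logarithmic
  Sobolev inequality is at hand. Each coordinate instead gets a modified one that keeps the local
  first and second order influence of the entry on the right. Only the sum of the squared influences
  over all entries is of order \<open>smax^2\<close>; a constant bound per entry would be multiplied
  by the number of entries. The price is a bounded range for the exponent and hence for the
  deviation, harmless because the forms of G are bounded by 1.

  Neither r nor the other eigenvalues of A are bounded. Comparing G with m entrywise on the block
  costs one factor r, and the assumption (r + 1) \<open>\<sigma>\<^sup>*\<close> sqrt (log N) -> 0
  is what pays for it.

  Taking \<eta> >= 2 loses nothing, because the transforms on that part of the axis already
  determine weak limits, and it replaces a stability analysis of the equation for the mean by a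
  contraction. Matrices of different size share one probability space without any prescribed
  relation, so only summability of the exceptional probabilities is used.\<close>

lemma cis_product_factor:
  fixes b :: complex
  shows "1 - 2 * b * of_real (cos \<theta>) + b\<^sup>2 = (1 - b * cis \<theta>) * (1 - b * cis (- \<theta>))"
proof -
  have e: "2 * of_real (cos \<theta>) = cis \<theta> + cis (- \<theta>)" "cis \<theta> * cis (- \<theta>) = 1"
    by (simp_all add: complex_eq_iff cis_mult)
  have "(1 - b * cis \<theta>) * (1 - b * cis (- \<theta>)) = 1 - b * (cis \<theta> + cis (- \<theta>)) + b\<^sup>2 * (cis \<theta> * cis (- \<theta>))"
    by (simp add: algebra_simps power2_eq_square del: cis_mult)
  then show ?thesis unfolding e(2) e(1)[symmetric] by simp
qed

lemma poisson_denominator_nonzero: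
  fixes b :: complex
  assumes "norm b < 1"
  shows "1 - 2 * b * of_real (cos \<theta>) + b\<^sup>2 \<noteq> 0"
proof -
  have "b * cis x \<noteq> 1" for x
    using assms by (metis norm_cis norm_mult mult.right_neutral norm_one less_irrefl)
  then show ?thesis by (auto simp: cis_product_factor)
qed

text \<open>For complex b the sines cannot be read off as imaginary parts. Written as differences of
  exponentials over 2 i, they turn the series into a difference of two geometric series in
  \<open>b * cis \<theta>\<close> and \<open>b * cis (- \<theta>)\<close>.\<close>

lemma sin_generating_function:
  fixes b :: complex
  assumes "norm b < 1"
  shows "(\<lambda>n. b ^ n * of_real (sin (real (Suc n) * \<theta>))) sums
    (of_real (sin \<theta>) / (1 - 2 * b * of_real (cos \<theta>) + b\<^sup>2))"
proof -
  let ?e = "cis \<theta>" and ?f = "cis (- \<theta>)"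
  have n: "norm (b * ?e) < 1" "norm (b * ?f) < 1"
    using assms by (auto simp: norm_mult)
  have "(\<lambda>n. (?e * (b * ?e) ^ n - ?f * (b * ?f) ^ n) / (2 * \<i>)) sums
      ((?e * (1 / (1 - b * ?e)) - ?f * (1 / (1 - b * ?f))) / (2 * \<i>))"
    using n by (intro sums_divide sums_diff sums_mult geometric_sums)
  also have "(\<lambda>n. (?e * (b * ?e) ^ n - ?f * (b * ?f) ^ n) / (2 * \<i>)) =
      (\<lambda>n. b ^ n * of_real (sin (real (Suc n) * \<theta>)))"
  proof
    fix n
    have "?e * ?e ^ n = cis (real (Suc n) * \<theta>)" "?f * ?f ^ n = cis (- (real (Suc n) * \<theta>))"
      unfolding Complex.DeMoivre by (simp_all add: cis_mult algebra_simps)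
    then have "(?e * (b * ?e) ^ n - ?f * (b * ?f) ^ n) =
        b ^ n * (cis (real (Suc n) * \<theta>) - cis (- (real (Suc n) * \<theta>)))"
      by (simp only: power_mult_distrib right_diff_distrib mult.left_commute[of _ "b ^ n"])
    also have "cis (real (Suc n) * \<theta>) - cis (- (real (Suc n) * \<theta>)) = 2 * \<i> * of_real (sin (real (Suc n) * \<theta>))"
      by (auto simp: complex_eq_iff)
    finally have "?e * (b * ?e) ^ n - ?f * (b * ?f) ^ n = (b ^ n * of_real (sin (real (Suc n) * \<theta>))) * (2 * \<i>)"
      by (simp only: mult_ac)
    then show "(?e * (b * ?e) ^ n - ?f * (b * ?f) ^ n) / (2 * \<i>) = b ^ n * of_real (sin (real (Suc n) * \<theta>))"
      by (simp only:) (rule nonzero_mult_div_cancel_right, simp)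
  qed
  also have "(?e * (1 / (1 - b * ?e)) - ?f * (1 / (1 - b * ?f))) / (2 * \<i>) =
     of_real (sin \<theta>) / (1 - 2 * b * of_real (cos \<theta>) + b\<^sup>2)"
  proof -
    have nz: "1 - b * ?e \<noteq> 0" "1 - b * ?f \<noteq> 0"
      using poisson_denominator_nonzero[OF assms, of \<theta>] by (auto simp: cis_product_factor)
    have "?e - ?f = 2 * \<i> * of_real (sin \<theta>)" by (auto simp: complex_eq_iff)
    then have "of_real (sin \<theta>) = (?e - ?f) / (2 * \<i>)" by simp
    moreover have "?e * (1 / (1 - b * ?e)) - ?f * (1 / (1 - b * ?f)) = (?e - ?f) / ((1 - b * ?e) * (1 - b * ?f))"
      using nz by (simp add: field_simps)
    ultimately show ?thesis by (simp add: cis_product_factor)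
  qed
  finally show ?thesis .
qed

lemma continuous_on_poisson:
  fixes b :: complex
  assumes "norm b < 1"
  shows "continuous_on S (\<lambda>\<theta>. of_real (sin \<theta>) / (1 - 2 * b * of_real (cos \<theta>) + b\<^sup>2))"
  by (intro continuous_intros) (use poisson_denominator_nonzero[OF assms] in auto)

text \<open>The test function \<phi> stays general because two instances are needed: a single sine,
  where orthogonality leaves one term, and a second Poisson kernel, where a Parseval sum appears.
  The factor |b|^n gives the uniform convergence.\<close>

lemma integral_poisson_sums:
  fixes b :: complex and \<phi> :: "real \<Rightarrow> complex"
  assumes b: "norm b < 1" and c: "continuous_on {0..pi} \<phi>"
  shows "(\<lambda>n. b ^ n * integral {0..pi} (\<lambda>\<theta>. of_real (sin (real (Suc n) * \<theta>)) * \<phi> \<theta>)) sums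
    integral {0..pi} (\<lambda>\<theta>. of_real (sin \<theta>) / (1 - 2 * b * of_real (cos \<theta>) + b\<^sup>2) * \<phi> \<theta>)"
proof -
  obtain C where C: "\<And>x. x \<in> {0..pi} \<Longrightarrow> norm (\<phi> x) \<le> C"
    using compact_imp_bounded[OF compact_continuous_image[OF c compact_Icc]]
    by (force simp: bounded_iff)
  let ?f = "\<lambda>n \<theta>. b ^ n * of_real (sin (real (Suc n) * \<theta>)) * \<phi> \<theta>"
  have lim: "uniform_limit {0..pi} (\<lambda>n x. \<Sum>i<n. ?f i x) (\<lambda>x. suminf (\<lambda>i. ?f i x)) sequentially"
  proof (rule Weierstrass_m_test[where M = "\<lambda>n. norm b ^ n * C"])
    fix n x assume x: "x \<in> {0..pi}"
    have "norm (?f n x) = norm b ^ n * (\<bar>sin (real (Suc n) * x)\<bar> * norm (\<phi> x))"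
      by (simp only: norm_mult norm_power norm_of_real mult.assoc)
    also have "\<dots> \<le> norm b ^ n * (1 * C)"
      using C[OF x] by (intro mult_left_mono mult_mono) (auto intro: order.trans[OF norm_ge_zero])
    finally show "norm (?f n x) \<le> norm b ^ n * C" by simp
  qed (use b in \<open>auto intro!: summable_mult2 summable_geometric\<close>)
  have cn: "continuous_on {0..pi} (\<lambda>x. \<Sum>i<n. ?f i x)" for n
    by (intro continuous_intros c)
  obtain I J where I: "\<And>n. ((\<lambda>x. \<Sum>i<n. ?f i x) has_integral I n) {0..pi}"
    and J: "((\<lambda>x. suminf (\<lambda>i. ?f i x)) has_integral J) {0..pi}" and IJ: "I \<longlonglongrightarrow> J"
    using uniform_limit_integral[OF lim cn] by auto
  have "(\<lambda>x. ?f n x) integrable_on {0..pi}" for n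
    by (intro integrable_continuous_interval continuous_intros c)
  then have "I n = (\<Sum>i<n. integral {0..pi} (?f i))" for n
    using I[of n] by (subst integral_sum[symmetric]) (auto dest: integral_unique)
  then have "I = (\<lambda>n. \<Sum>i<n. b ^ i * integral {0..pi} (\<lambda>\<theta>. of_real (sin (real (Suc i) * \<theta>)) * \<phi> \<theta>))"
    by (simp add: fun_eq_iff mult.assoc)
  moreover have "suminf (\<lambda>i. ?f i x) = of_real (sin x) / (1 - 2 * b * of_real (cos x) + b\<^sup>2) * \<phi> x" for x
    using sums_mult2[OF sin_generating_function[OF b, of x], of "\<phi> x"] by (simp add: sums_iff)
  ultimately show ?thesis
    using IJ J by (auto simp: sums_def dest: integral_unique)
qed

lemma integral_cos_multiple:
  fixes m :: real
  assumes "m \<noteq> 0" "sin (m * pi) = 0"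
  shows "((\<lambda>\<theta>. cos (m * \<theta>)) has_integral 0) {0..pi}"
proof -
  have "((\<lambda>\<theta>. cos (m * \<theta>)) has_integral (sin (m * pi) / m - sin (m * 0) / m)) {0..pi}"
    by (rule fundamental_theorem_of_calculus)
      (auto intro!: derivative_eq_intros simp: has_real_derivative_iff_has_vector_derivative[symmetric] assms)
  then show ?thesis using assms by simp
qed

lemma integral_sin_sin:
  "integral {0..pi} (\<lambda>\<theta>. complex_of_real (sin (real (Suc n) * \<theta>)) * of_real (sin (real (Suc k) * \<theta>))) =
     (if n = k then of_real (pi / 2) else 0)"
proof -
  have sp: "sin ((real (Suc n) - real (Suc k)) * pi) = 0" "sin ((real (Suc n) + real (Suc k)) * pi) = 0"
    using sin_npi_int[of "int n - int k"] sin_npi[of "Suc n + Suc k"] by (simp_all only: of_int_diff of_nat_add of_int_of_nat_eq of_nat_Suc mult.commute[of pi]) simp_all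
  have I2: "((\<lambda>\<theta>. cos ((real (Suc n) + real (Suc k)) * \<theta>)) has_integral 0) {0..pi}"
    by (rule integral_cos_multiple) (use sp in auto)
  have I1: "((\<lambda>\<theta>. cos ((real (Suc n) - real (Suc k)) * \<theta>)) has_integral (if n = k then pi else 0)) {0..pi}"
  proof (cases "n = k")
    case True
    then show ?thesis using has_integral_const_real[of "1::real" 0 pi] by simp
  next
    case False
    then have "((\<lambda>\<theta>. cos ((real (Suc n) - real (Suc k)) * \<theta>)) has_integral 0) {0..pi}"
      by (intro integral_cos_multiple) (use sp in auto)
    then show ?thesis using False by simp
  qed
  have "((\<lambda>\<theta>. (cos ((real (Suc n) - real (Suc k)) * \<theta>) - cos ((real (Suc n) + real (Suc k)) * \<theta>)) / 2)
      has_integral ((if n = k then pi else 0) - 0) / 2) {0..pi}"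
    by (intro has_integral_divide has_integral_diff I1 I2)
  moreover have "(\<lambda>\<theta>. sin (real (Suc n) * \<theta>) * sin (real (Suc k) * \<theta>)) =
     (\<lambda>\<theta>. (cos ((real (Suc n) - real (Suc k)) * \<theta>) - cos ((real (Suc n) + real (Suc k)) * \<theta>)) / 2)"
    by (simp only: sin_times_sin left_diff_distrib distrib_right)
  moreover have "((if n = k then pi else 0) - 0) / 2 = (if n = k then pi / 2 else 0)" by simp
  ultimately have R: "((\<lambda>\<theta>. sin (real (Suc n) * \<theta>) * sin (real (Suc k) * \<theta>))
      has_integral (if n = k then pi / 2 else 0)) {0..pi}"
    by (simp only:)
  have "((\<lambda>\<theta>. of_real (sin (real (Suc n) * \<theta>) * sin (real (Suc k) * \<theta>)) :: complex)
      has_integral of_real (if n = k then pi / 2 else 0)) {0..pi}"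
    by (rule has_integral_of_real[OF R])
  then show ?thesis by (auto dest: integral_unique)
qed

lemma integral_poisson_sin:
  fixes a :: complex
  assumes "norm a < 1"
  shows "integral {0..pi} (\<lambda>\<theta>. of_real (sin \<theta>) / (1 - 2 * a * of_real (cos \<theta>) + a\<^sup>2) * of_real (sin (real (Suc k) * \<theta>))) =
    of_real (pi / 2) * a ^ k"
proof -
  have "continuous_on {0..pi} (\<lambda>\<theta>. complex_of_real (sin (real (Suc k) * \<theta>)))"
    by (intro continuous_intros)
  then have "(\<lambda>n. a ^ n * (if n = k then of_real (pi / 2) else 0)) sums
     integral {0..pi} (\<lambda>\<theta>. of_real (sin \<theta>) / (1 - 2 * a * of_real (cos \<theta>) + a\<^sup>2) * of_real (sin (real (Suc k) * \<theta>)))"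
    using integral_poisson_sums[OF assms, of "\<lambda>\<theta>. of_real (sin (real (Suc k) * \<theta>))"]
    unfolding integral_sin_sin by (simp only:)
  moreover have "(\<lambda>n. a ^ n * (if n = k then of_real (pi / 2) else 0)) sums (a ^ k * of_real (pi / 2))"
    using sums_single[of k "\<lambda>n. a ^ n * of_real (pi / 2)"] by (auto simp: if_distrib[of "(*) _"] cong: if_cong)
  ultimately show ?thesis by (simp only: sums_unique2 mult.commute[of _ "a ^ k"])
qed

text \<open>Parseval for two sine series with coefficients a^n and b^n, so that a geometric series
  in a b remains. Up to sign, one parameter later becomes the eigenvalue a and the other the root
  m.\<close>

lemma integral_poisson_poisson:
  fixes a b :: complex
  assumes a: "norm a < 1" and b: "norm b < 1"
  shows "integral {0..pi} (\<lambda>\<theta>. of_real (sin \<theta>) / (1 - 2 * b * of_real (cos \<theta>) + b\<^sup>2) *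
      (of_real (sin \<theta>) / (1 - 2 * a * of_real (cos \<theta>) + a\<^sup>2))) = of_real (pi / 2) / (1 - a * b)"
proof -
  have "(\<lambda>n. b ^ n * (of_real (pi / 2) * a ^ n)) sums
     integral {0..pi} (\<lambda>\<theta>. of_real (sin \<theta>) / (1 - 2 * b * of_real (cos \<theta>) + b\<^sup>2) *
      (of_real (sin \<theta>) / (1 - 2 * a * of_real (cos \<theta>) + a\<^sup>2)))"
    using integral_poisson_sums[OF b continuous_on_poisson[OF a]]
    unfolding mult.commute[of "complex_of_real (sin (real (Suc _) * _))"] integral_poisson_sin[OF a] .
  moreover have "(\<lambda>n. of_real (pi / 2) * (a * b) ^ n) sums (of_real (pi / 2) * (1 / (1 - a * b)))"
  proof (intro sums_mult geometric_sums)
    show "norm (a * b) < 1"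
      using a b mult_strict_mono[of "norm a" 1 "norm b" 1] by (simp add: norm_mult)
  qed
  moreover have "(\<lambda>n. b ^ n * (of_real (pi / 2) * a ^ n)) = (\<lambda>n. of_real (pi / 2) * (a * b) ^ n)"
    by (auto simp: power_mult_distrib algebra_simps)
  ultimately show ?thesis by (simp only: sums_unique2 times_divide_eq_right mult_1_right)
qed

section \<open>The limit law in the angular coordinate\<close>

definition angular_density :: "real \<Rightarrow> real \<Rightarrow> real" where
  "angular_density a \<theta> = indicator {0..pi} \<theta> * (2 / pi * ((sin \<theta>)\<^sup>2 / (1 + 2 * a * cos \<theta> + a\<^sup>2)))"

lemma angular_denominator_ge: "(sin \<theta>)\<^sup>2 \<le> 1 + 2 * a * cos \<theta> + a\<^sup>2" for a :: real
proof -
  have "1 + 2 * a * cos \<theta> + a\<^sup>2 = (a + cos \<theta>)\<^sup>2 + (sin \<theta>)\<^sup>2"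
    by (simp add: sin_squared_eq power2_eq_square algebra_simps)
  then show ?thesis by simp
qed

text \<open>The bound 2 / pi is the same for every a, although for |a| = 1 the denominator vanishes
  at an endpoint. It serves as the dominating function when |a| tends to 1.\<close>

lemma angular_density_bounds: "0 \<le> angular_density a \<theta>" "angular_density a \<theta> \<le> 2 / pi * indicator {0..pi} \<theta>"
proof -
  let ?q = "(sin \<theta>)\<^sup>2 / (1 + 2 * a * cos \<theta> + a\<^sup>2)"
  have d: "0 \<le> 1 + 2 * a * cos \<theta> + a\<^sup>2"
    using angular_denominator_ge[of \<theta> a] zero_le_power2[of "sin \<theta>"] by linarith
  then have q0: "0 \<le> ?q" by (intro divide_nonneg_nonneg) auto
  moreover have q1: "?q \<le> 1"
    using d angular_denominator_ge[of \<theta> a] by (cases "1 + 2 * a * cos \<theta> + a\<^sup>2 = 0") (auto simp: divide_le_eq_1)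
  ultimately have "0 \<le> 2 / pi * ?q" "2 / pi * ?q \<le> 2 / pi * 1"
    by (auto intro!: mult_left_mono simp del: times_divide_eq_right times_divide_eq_left)
  then show "0 \<le> angular_density a \<theta>" "angular_density a \<theta> \<le> 2 / pi * indicator {0..pi} \<theta>"
    unfolding angular_density_def by (auto simp: indicator_def simp del: times_divide_eq_right times_divide_eq_left)
qed

lemma angular_density_measurable [measurable]: "angular_density a \<in> borel_measurable borel"
  unfolding angular_density_def by measurable

lemma limit_density_measurable [measurable]: "limit_density a \<in> borel_measurable borel"
  unfolding limit_density_def by measurable

text \<open>With x = -2 cos \<theta> the square root becomes 2 sin \<theta>, and so does the
  Jacobian. The minus sign makes the map increasing on [0, pi], which the substitution rule
  requires.\<close>

lemma density_limit_eq_distr: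
  "density lborel (\<lambda>x. ennreal (limit_density a x)) =
   distr (density lborel (\<lambda>\<theta>. ennreal (angular_density a \<theta>))) borel (\<lambda>\<theta>. - 2 * cos \<theta>)"
proof (rule measure_eqI)
  fix B assume "B \<in> sets (density lborel (\<lambda>x. ennreal (limit_density a x)))"
  then have [measurable]: "B \<in> sets borel" by simp
  let ?f = "\<lambda>x. limit_density a x * indicator B x"
  have "emeasure (density lborel (\<lambda>x. ennreal (limit_density a x))) B = (\<integral>\<^sup>+x. ennreal (limit_density a x) * indicator B x \<partial>lborel)"
    by (rule emeasure_density) auto
  also have "\<dots> = (\<integral>\<^sup>+x. ennreal (?f x * indicator {- 2 * cos 0..- 2 * cos pi} x) \<partial>lborel)"
    by (rule nn_integral_cong) (auto simp: limit_density_def indicator_def ennreal_mult')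
  also have "\<dots> = (\<integral>\<^sup>+\<theta>. ennreal (?f (- 2 * cos \<theta>) * (2 * sin \<theta>) * indicator {0..pi} \<theta>) \<partial>lborel)"
  proof (rule nn_integral_substitution)
    show "set_borel_measurable borel {- 2 * cos 0..- 2 * cos pi} ?f"
      unfolding set_borel_measurable_def by measurable
  qed (auto intro!: derivative_eq_intros continuous_intros sin_ge_zero)
  also have "\<dots> = (\<integral>\<^sup>+\<theta>. ennreal (angular_density a \<theta>) * indicator B (- 2 * cos \<theta>) \<partial>lborel)"
  proof (rule nn_integral_cong)
    fix \<theta>
    have "limit_density a (- 2 * cos \<theta>) * (2 * sin \<theta>) = angular_density a \<theta>" if \<theta>: "\<theta> \<in> {0..pi}"
    proof -
      have "sin \<theta> \<ge> 0" using \<theta> by (auto intro: sin_ge_zero)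
      then have "sqrt (4 - (2 * cos \<theta>)\<^sup>2) = 2 * sin \<theta>"
        by (intro real_sqrt_unique) (auto simp: power_mult_distrib sin_squared_eq)
      moreover have "\<bar>cos \<theta>\<bar> \<le> 1" by simp
      ultimately show ?thesis using \<theta>
        by (simp add: limit_density_def angular_density_def abs_mult power2_eq_square algebra_simps)
    qed
    moreover have "angular_density a \<theta> = 0" if "\<theta> \<notin> {0..pi}"
      using that by (simp add: angular_density_def)
    ultimately show "ennreal (?f (- 2 * cos \<theta>) * (2 * sin \<theta>) * indicator {0..pi} \<theta>) = ennreal (angular_density a \<theta>) * indicator B (- 2 * cos \<theta>)"
      by (auto simp: indicator_def)
  qed
  also have "\<dots> = (\<integral>\<^sup>+\<theta>. ennreal (angular_density a \<theta>) * indicator ((\<lambda>\<theta>. - 2 * cos \<theta>) -` B) \<theta> \<partial>lborel)"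
    by (rule nn_integral_cong) (auto simp: indicator_def)
  also have "\<dots> = emeasure (density lborel (\<lambda>\<theta>. ennreal (angular_density a \<theta>))) ((\<lambda>\<theta>. - 2 * cos \<theta>) -` B)"
    using measurable_sets[of "\<lambda>\<theta>. - 2 * cos \<theta>" borel borel B]
    by (subst emeasure_density) (auto simp del: vimage_Collect_eq)
  also have "\<dots> = emeasure (distr (density lborel (\<lambda>\<theta>. ennreal (angular_density a \<theta>))) borel (\<lambda>\<theta>. - 2 * cos \<theta>)) B"
    by (subst emeasure_distr) auto
  finally show "emeasure (density lborel (\<lambda>x. ennreal (limit_density a x))) B =
    emeasure (distr (density lborel (\<lambda>\<theta>. ennreal (angular_density a \<theta>))) borel (\<lambda>\<theta>. - 2 * cos \<theta>)) B" .
qed simp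

text \<open>Inversion a -> 1 / a reduces |a| > 1 to |a| < 1. The factor 1 / a^2 is the mass that
  stays absolutely continuous; the rest sits in the atom.\<close>

lemma angular_density_scale:
  assumes "a \<noteq> 0"
  shows "angular_density a \<theta> = angular_density (1 / a) \<theta> / a\<^sup>2"
proof -
  have "1 + 2 * a * cos \<theta> + a\<^sup>2 = a\<^sup>2 * (1 + 2 * (1 / a) * cos \<theta> + (1 / a)\<^sup>2)"
    using assms by (simp add: field_simps power2_eq_square)
  then show ?thesis unfolding angular_density_def by (simp only: ) simp
qed

text \<open>For |a| < 1 the squared sine is shared between two Poisson kernels with parameters -a
  and -b. On |a| = 1 the expansion in powers of a is no longer dominated, so the value is reached
  along \<open>u n\<close>, which approaches a from inside.\<close>

lemma integral_angular_density_poisson: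
  fixes a :: real and b :: complex
  assumes a: "\<bar>a\<bar> \<le> 1" and b: "norm b < 1"
  shows "(LINT \<theta>|lborel. of_real (angular_density a \<theta>) / (1 + 2 * b * of_real (cos \<theta>) + b\<^sup>2)) = 1 / (1 - of_real a * b)"
proof -
  define K where "K = (\<lambda>\<theta>. 1 / (1 + 2 * b * complex_of_real (cos \<theta>) + b\<^sup>2))"
  have Knz: "1 + 2 * b * complex_of_real (cos \<theta>) + b\<^sup>2 \<noteq> 0" for \<theta>
    using poisson_denominator_nonzero[of "-b" \<theta>] b by simp
  have Kc: "continuous_on S K" for S
    unfolding K_def by (intro continuous_intros) (use Knz in auto)
  have [measurable]: "K \<in> borel_measurable borel"
    using Kc[of UNIV] by (rule borel_measurable_continuous_onI)
  obtain C where C: "\<And>x. x \<in> {0..pi} \<Longrightarrow> norm (K x) \<le> C"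
    using compact_imp_bounded[OF compact_continuous_image[OF Kc compact_Icc]]
    by (force simp: bounded_iff)
  have less: "(LINT \<theta>|lborel. of_real (angular_density c \<theta>) * K \<theta>) = 1 / (1 - of_real c * b)" if c: "\<bar>c\<bar> < 1" for c :: real
  proof -
    let ?g = "\<lambda>\<theta>. of_real (2 / pi) * (of_real (sin \<theta>) / (1 - 2 * (- b) * of_real (cos \<theta>) + (- b)\<^sup>2) *
      (of_real (sin \<theta>) / (1 - 2 * (- of_real c) * of_real (cos \<theta>) + (- of_real c)\<^sup>2)))"
    have nc: "norm (- complex_of_real c) < 1" "norm (- b) < 1" using c b by auto
    have cg: "continuous_on {0..pi} ?g"
      by (intro continuous_intros continuous_on_poisson nc) (use poisson_denominator_nonzero[OF nc(1)] poisson_denominator_nonzero[OF nc(2)] in auto)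
    have "(\<lambda>\<theta>. of_real (angular_density c \<theta>) * K \<theta>) = (\<lambda>\<theta>. indicator {0..pi} \<theta> *\<^sub>R ?g \<theta>)"
      by (auto simp: fun_eq_iff angular_density_def K_def indicator_def power2_eq_square)
    then have "(LINT \<theta>|lborel. of_real (angular_density c \<theta>) * K \<theta>) = (LINT \<theta>:{0..pi}|lborel. ?g \<theta>)"
      by (simp only: set_lebesgue_integral_def)
    also have "\<dots> = integral {0..pi} ?g"
      by (intro set_borel_integral_eq_integral borel_integrable_atLeastAtMost' cg)
    also have "\<dots> = of_real (2 / pi) * (of_real (pi / 2) / (1 - (- of_real c) * (- b)))"
      using integral_poisson_poisson[OF nc] by (simp only: integral_mult_right)
    also have "\<dots> = of_real ((2 / pi) * (pi / 2)) / (1 - of_real c * b)"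
      unfolding of_real_mult by (simp only: times_divide_eq_right[of "complex_of_real _"] minus_mult_minus)
    finally show ?thesis by simp
  qed
  define u where "u n = a * (1 - 1 / real (n + 2))" for n
  have u1: "\<bar>u n\<bar> < 1" for n
  proof -
    have "\<bar>u n\<bar> = \<bar>a\<bar> * (1 - 1 / real (n + 2))"
      unfolding u_def by (simp add: abs_mult)
    also have "\<dots> \<le> 1 * (1 - 1 / real (n + 2))" using a by (intro mult_right_mono) auto
    also have "\<dots> < 1" by simp
    finally show ?thesis .
  qed
  have "(\<lambda>n. 1 / real (n + 2)) \<longlonglongrightarrow> 0"
    using LIMSEQ_ignore_initial_segment[OF lim_1_over_n, of 2] by simp
  then have ul: "u \<longlonglongrightarrow> a"
    unfolding u_def using tendsto_mult[OF tendsto_const tendsto_diff[OF tendsto_const], of _ 0 sequentially a 1] by simp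
  have "(\<lambda>n. LINT \<theta>|lborel. of_real (angular_density (u n) \<theta>) * K \<theta>) \<longlonglongrightarrow> (LINT \<theta>|lborel. of_real (angular_density a \<theta>) * K \<theta>)"
  proof (rule integral_dominated_convergence)
    show "integrable lborel (\<lambda>\<theta>. indicator {0..pi} \<theta> *\<^sub>R (2 / pi * C))"
      using borel_integrable_atLeastAtMost'[of 0 pi "\<lambda>_. 2 / pi * C"] by (simp add: set_integrable_def)
    show "AE \<theta> in lborel. (\<lambda>n. of_real (angular_density (u n) \<theta>) * K \<theta>) \<longlonglongrightarrow> of_real (angular_density a \<theta>) * K \<theta>"
    proof (rule AE_I2)
      fix \<theta>
      have "(\<lambda>n. angular_density (u n) \<theta>) \<longlonglongrightarrow> angular_density a \<theta>"
      proof (cases "sin \<theta> = 0")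
        case False
        then have "1 + 2 * a * cos \<theta> + a\<^sup>2 \<noteq> 0"
          using angular_denominator_ge[of \<theta> a] zero_less_power2[of "sin \<theta>"] by linarith
        then show ?thesis unfolding angular_density_def by (intro tendsto_intros ul)
      qed (simp add: angular_density_def)
      then show "(\<lambda>n. of_real (angular_density (u n) \<theta>) * K \<theta>) \<longlonglongrightarrow> of_real (angular_density a \<theta>) * K \<theta>"
        by (intro tendsto_intros)
    qed
    show "AE \<theta> in lborel. norm (of_real (angular_density (u n) \<theta>) * K \<theta>) \<le> indicator {0..pi} \<theta> *\<^sub>R (2 / pi * C)" for n
    proof (rule AE_I2)
      fix \<theta>
      show "norm (of_real (angular_density (u n) \<theta>) * K \<theta>) \<le> indicator {0..pi} \<theta> *\<^sub>R (2 / pi * C)"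
      proof (cases "\<theta> \<in> {0..pi}")
        case True
        then have "norm (of_real (angular_density (u n) \<theta>) * K \<theta>) \<le> 2 / pi * C"
          using C[OF True] angular_density_bounds[of "u n" \<theta>] unfolding norm_mult norm_of_real
          by (intro mult_mono) auto
        then show ?thesis using True by simp
      qed (simp add: angular_density_def)
    qed
  qed measurable
  moreover have "(\<lambda>n. 1 / (1 - of_real (u n) * b)) \<longlonglongrightarrow> 1 / (1 - of_real a * b)"
  proof (intro tendsto_intros ul)
    have "norm (of_real a * b) < 1"
      using a b mult_left_le_one_le[of "norm b" "\<bar>a\<bar>"] by (auto simp: norm_mult)
    then show "1 - of_real a * b \<noteq> 0" by auto
  qed
  ultimately have "(LINT \<theta>|lborel. of_real (angular_density a \<theta>) * K \<theta>) = 1 / (1 - of_real a * b)"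
    using less[OF u1] by (auto intro: LIMSEQ_unique)
  then show ?thesis by (simp add: K_def)
qed

lemma integrable_angular_density [simp]: "integrable lborel (angular_density a)"
proof (rule Bochner_Integration.integrable_bound)
  show "integrable lborel (\<lambda>\<theta>. indicator {0..pi} \<theta> *\<^sub>R (2 / pi))"
    using borel_integrable_atLeastAtMost'[of 0 pi "\<lambda>_. 2 / pi"] by (simp add: set_integrable_def)
qed (use angular_density_bounds[of a] in \<open>auto simp: mult.commute\<close>)

text \<open>The kernel with b = 0 is constant, so the preceding integral gives mass 1 for |a| <= 1;
  for |a| > 1 inversion leaves 1 / a^2.\<close>

lemma integral_angular_density: "(LINT \<theta>|lborel. angular_density a \<theta>) + limit_atom_mass a = 1"
proof -
  have le: "(LINT \<theta>|lborel. angular_density c \<theta>) = 1" if "\<bar>c\<bar> \<le> 1" for c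
  proof -
    have "complex_of_real (LINT \<theta>|lborel. angular_density c \<theta>) = 1"
      using integral_angular_density_poisson[OF that, of 0] by simp
    then show ?thesis by (simp only: of_real_eq_1_iff)
  qed
  show ?thesis
  proof (cases "\<bar>a\<bar> \<le> 1")
    case True
    then show ?thesis using le[OF True]
      by (cases "\<bar>a\<bar> = 1") (auto simp: limit_atom_mass_def power2_eq_1_iff abs_if split: if_splits)
  next
    case False
    then have "(LINT \<theta>|lborel. angular_density a \<theta>) = 1 / a\<^sup>2"
      using le[of "1 / a"] by (subst angular_density_scale) (auto simp: field_simps)
    then show ?thesis using False by (simp add: limit_atom_mass_def)
  qed
qed

section \<open>Integration against the limit law and its Stieltjes transform\<close>

lemma limit_atom_mass_nonneg: "0 \<le> limit_atom_mass a"
proof (cases "\<bar>a\<bar> \<ge> 1")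
  case True
  then have "1 \<le> a\<^sup>2" using abs_le_square_iff[of 1 a] by simp
  then show ?thesis by (simp add: limit_atom_mass_def divide_le_eq_1)
qed (simp add: limit_atom_mass_def)

text \<open>\<open>limit_measure\<close> is given only by its values on Borel sets, so the formula
  is built up from indicators by monotone approximation.\<close>

lemma nn_integral_limit_measure:
  assumes "f \<in> borel_measurable borel"
  shows "(\<integral>\<^sup>+x. f x \<partial>limit_measure a) =
    (\<integral>\<^sup>+x. ennreal (limit_density a x) * f x \<partial>lborel) + ennreal (limit_atom_mass a) * f (a + 1 / a)"
  using assms
proof (induction rule: borel_measurable_induct)
  case (cong f g)
  then show ?case by (metis (no_types, lifting) ext space_borel UNIV_I)
next
  case (set B)
  then show ?case by (simp add: emeasure_limit_measure)
next
  case (mult u c)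
  have [measurable]: "u \<in> borel_measurable borel" by fact
  have "u \<in> borel_measurable (limit_measure a)" by (simp cong: measurable_cong_sets)
  then show ?case using mult
    by (simp add: nn_integral_cmult mult.left_commute[of "ennreal (limit_density a _)"] distrib_left mult.left_commute)
next
  case (add u v)
  have [measurable]: "u \<in> borel_measurable borel" "v \<in> borel_measurable borel" by fact+
  have "u \<in> borel_measurable (limit_measure a)" "v \<in> borel_measurable (limit_measure a)" by (simp_all cong: measurable_cong_sets)
  then show ?case using add by (simp add: nn_integral_add distrib_left algebra_simps)
next
  case (seq U)
  have [measurable]: "\<And>i. U i \<in> borel_measurable borel" by fact
  have m: "U i \<in> borel_measurable (limit_measure a)" for i by (simp cong: measurable_cong_sets)
  have inc: "incseq (\<lambda>i. \<integral>\<^sup>+x. ennreal (limit_density a x) * U i x \<partial>lborel)"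
    using \<open>incseq U\<close> by (auto simp: incseq_def le_fun_def intro!: nn_integral_mono mult_left_mono)
  have inc2: "incseq (\<lambda>i. ennreal (limit_atom_mass a) * U i (a + 1 / a))"
    using \<open>incseq U\<close> by (auto simp: incseq_def le_fun_def intro!: mult_left_mono)
  have "(\<integral>\<^sup>+x. (SUP i. U i) x \<partial>limit_measure a) = (SUP i. \<integral>\<^sup>+x. U i x \<partial>limit_measure a)"
    unfolding SUP_apply using \<open>incseq U\<close> m by (intro nn_integral_monotone_convergence_SUP) auto
  also have "\<dots> = (SUP i. (\<integral>\<^sup>+x. ennreal (limit_density a x) * U i x \<partial>lborel) + ennreal (limit_atom_mass a) * U i (a + 1 / a))"
    using seq by simp
  also have "\<dots> = (SUP i. \<integral>\<^sup>+x. ennreal (limit_density a x) * U i x \<partial>lborel) + (SUP i. ennreal (limit_atom_mass a) * U i (a + 1 / a))"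
    by (rule ennreal_SUP_add[OF inc inc2])
  also have "(SUP i. \<integral>\<^sup>+x. ennreal (limit_density a x) * U i x \<partial>lborel) = (\<integral>\<^sup>+x. (SUP i. ennreal (limit_density a x) * U i x) \<partial>lborel)"
    using \<open>incseq U\<close> by (intro nn_integral_monotone_convergence_SUP[symmetric]) (auto simp: incseq_def le_fun_def intro!: mult_left_mono)
  finally show ?case by (simp add: SUP_mult_left_ennreal SUP_image image_comp)
qed

lemma nn_integral_limit_measure_angular:
  assumes [measurable]: "f \<in> borel_measurable borel"
  shows "(\<integral>\<^sup>+x. f x \<partial>limit_measure a) =
    (\<integral>\<^sup>+\<theta>. ennreal (angular_density a \<theta>) * f (- 2 * cos \<theta>) \<partial>lborel) + ennreal (limit_atom_mass a) * f (a + 1 / a)"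
proof -
  have "(\<integral>\<^sup>+x. ennreal (limit_density a x) * f x \<partial>lborel) = (\<integral>\<^sup>+x. f x \<partial>density lborel (\<lambda>x. ennreal (limit_density a x)))"
    by (simp add: nn_integral_density)
  also have "\<dots> = (\<integral>\<^sup>+\<theta>. ennreal (angular_density a \<theta>) * f (- 2 * cos \<theta>) \<partial>lborel)"
    unfolding density_limit_eq_distr by (simp add: nn_integral_distr nn_integral_density)
  finally show ?thesis by (simp add: nn_integral_limit_measure)
qed

lemma real_distribution_limit_measure: "real_distribution (limit_measure a)"
proof -
  have "emeasure (limit_measure a) UNIV = (\<integral>\<^sup>+x. 1 \<partial>limit_measure a)" by simp
  also have "\<dots> = (\<integral>\<^sup>+\<theta>. ennreal (angular_density a \<theta>) \<partial>lborel) + ennreal (limit_atom_mass a)"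
    by (subst nn_integral_limit_measure_angular) auto
  also have "\<dots> = ennreal ((LINT \<theta>|lborel. angular_density a \<theta>) + limit_atom_mass a)"
    by (simp add: nn_integral_eq_integral angular_density_bounds limit_atom_mass_nonneg)
  finally show ?thesis
    unfolding real_distribution_def real_distribution_axioms_def
    by (auto intro!: prob_spaceI simp: integral_angular_density)
qed

text \<open>Adding C makes the integrand nonnegative, so the nonnegative integral applies. As
  density and atom have total mass 1, the added constant drops out again.\<close>

lemma integral_limit_measure_real:
  fixes h :: "real \<Rightarrow> real"
  assumes [measurable]: "h \<in> borel_measurable borel" and C: "\<And>x. \<bar>h x\<bar> \<le> C"
  shows "(LINT x|limit_measure a. h x) =
    (LINT \<theta>|lborel. angular_density a \<theta> * h (- 2 * cos \<theta>)) + limit_atom_mass a * h (a + 1 / a)"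
proof -
  interpret real_distribution "limit_measure a" by (rule real_distribution_limit_measure)
  have pos: "0 \<le> h x + C" for x using C[of x] by linarith
  have i: "integrable lborel (\<lambda>\<theta>. angular_density a \<theta> * h (- 2 * cos \<theta>))"
  proof (rule Bochner_Integration.integrable_bound)
    show "integrable lborel (\<lambda>\<theta>. angular_density a \<theta> * C)" by simp
    show "AE \<theta> in lborel. norm (angular_density a \<theta> * h (- 2 * cos \<theta>)) \<le> norm (angular_density a \<theta> * C)"
      using C angular_density_bounds[of a] by (auto simp: abs_mult intro!: mult_left_mono order.trans[OF C])
  qed simp
  have ih: "integrable (limit_measure a) h"
    using C by (intro integrable_const_bound[of _ C]) auto
  have eq: "(LINT x|limit_measure a. h x + C) = (LINT \<theta>|lborel. angular_density a \<theta> * (h (- 2 * cos \<theta>) + C)) + limit_atom_mass a * (h (a + 1 / a) + C)"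
  proof -
    have "(LINT x|limit_measure a. h x + C) = enn2real (\<integral>\<^sup>+x. ennreal (h x + C) \<partial>limit_measure a)"
      using pos by (intro integral_eq_nn_integral) auto
    also have "(\<integral>\<^sup>+x. ennreal (h x + C) \<partial>limit_measure a) =
        (\<integral>\<^sup>+\<theta>. ennreal (angular_density a \<theta> * (h (- 2 * cos \<theta>) + C)) \<partial>lborel) + ennreal (limit_atom_mass a * (h (a + 1 / a) + C))"
      using pos by (subst nn_integral_limit_measure_angular) (auto simp: ennreal_mult angular_density_bounds limit_atom_mass_nonneg)
    also have "(\<integral>\<^sup>+\<theta>. ennreal (angular_density a \<theta> * (h (- 2 * cos \<theta>) + C)) \<partial>lborel) =
        ennreal (LINT \<theta>|lborel. angular_density a \<theta> * (h (- 2 * cos \<theta>) + C))"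
      using i pos angular_density_bounds[of a] by (intro nn_integral_eq_integral AE_I2 mult_nonneg_nonneg) (auto simp: distrib_left)
    finally show ?thesis
      using pos angular_density_bounds[of a] limit_atom_mass_nonneg[of a]
      by (simp add: ennreal_plus[symmetric] del: ennreal_plus)
  qed
  have "(LINT x|limit_measure a. h x + C) = (LINT x|limit_measure a. h x) + C"
    using ih prob_space by simp
  moreover have "(LINT \<theta>|lborel. angular_density a \<theta> * (h (- 2 * cos \<theta>) + C)) =
      (LINT \<theta>|lborel. angular_density a \<theta> * h (- 2 * cos \<theta>)) + (LINT \<theta>|lborel. angular_density a \<theta>) * C"
    using i by (simp add: distrib_left)
  moreover have "(LINT \<theta>|lborel. angular_density a \<theta>) * C + limit_atom_mass a * C = C"
    using integral_angular_density[of a] by (simp add: distrib_right[symmetric])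
  ultimately show ?thesis using eq by (simp add: distrib_left)
qed

lemma integral_limit_measure_complex:
  fixes h :: "real \<Rightarrow> complex"
  assumes [measurable]: "h \<in> borel_measurable borel" and C: "\<And>x. norm (h x) \<le> C"
  shows "(LINT x|limit_measure a. h x) =
    (LINT \<theta>|lborel. of_real (angular_density a \<theta>) * h (- 2 * cos \<theta>)) + of_real (limit_atom_mass a) * h (a + 1 / a)"
proof -
  interpret real_distribution "limit_measure a" by (rule real_distribution_limit_measure)
  have i: "integrable lborel (\<lambda>\<theta>. of_real (angular_density a \<theta>) * h (- 2 * cos \<theta>))"
  proof (rule Bochner_Integration.integrable_bound)
    show "integrable lborel (\<lambda>\<theta>. angular_density a \<theta> * C)" by simp
    show "AE \<theta> in lborel. norm (of_real (angular_density a \<theta>) * h (- 2 * cos \<theta>)) \<le> norm (angular_density a \<theta> * C)"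
      using C angular_density_bounds[of a] by (auto simp: norm_mult abs_mult intro!: mult_left_mono order.trans[OF C])
  qed simp
  have ih: "integrable (limit_measure a) h"
    using C by (intro integrable_const_bound[of _ C]) auto
  have C': "\<bar>Re (h x)\<bar> \<le> C" "\<bar>Im (h x)\<bar> \<le> C" for x
    using C[of x] abs_Re_le_cmod[of "h x"] abs_Im_le_cmod[of "h x"] by linarith+
  show ?thesis
    using integral_limit_measure_real[of "\<lambda>x. Re (h x)" C a] integral_limit_measure_real[of "\<lambda>x. Im (h x)" C a] i ih C'
    by (auto simp: complex_eq_iff simp flip: integral_Re integral_Im)
qed

text \<open>The parameter \<kappa> encodes the root: m = -i \<kappa> satisfies m + 1 / m = i \<eta>
  and |m| < 1, and the right-hand side is m / (1 - a m). In the angle the Stieltjes kernel is m / (1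
  + 2 m cos \<theta> + m^2), the kernel integrated above.\<close>

lemma stieltjes_limit_measure:
  assumes k: "0 < \<kappa>" "\<kappa> < 1" and \<eta>: "\<eta> = 1 / \<kappa> - \<kappa>"
  shows "(LINT x|limit_measure a. 1 / (\<i> * of_real \<eta> - of_real x)) = - \<i> * of_real \<kappa> / (1 + \<i> * of_real (\<kappa> * a))"
proof -
  define m where "m = - \<i> * complex_of_real \<kappa>"
  have m1: "norm m < 1" "m \<noteq> 0" using k by (auto simp: m_def norm_mult)
  have mz: "\<i> * of_real \<eta> = m + 1 / m"
    using k by (simp add: m_def \<eta> field_simps)
  have e0: "\<eta> > 0" using k by (simp add: \<eta> field_simps) (metis mult_strict_mono' mult_1 less_eq_real_def)
  have nz: "\<i> * of_real \<eta> - complex_of_real x \<noteq> 0" for x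
    using e0 by (auto simp: complex_eq_iff)
  have bd: "norm (1 / (\<i> * of_real \<eta> - complex_of_real x)) \<le> 1 / \<eta>" for x
  proof -
    have "\<eta> \<le> norm (\<i> * of_real \<eta> - complex_of_real x)"
      using abs_Im_le_cmod[of "\<i> * of_real \<eta> - complex_of_real x"] e0 by simp
    then show ?thesis using e0 by (simp add: norm_divide frac_le)
  qed
  have cos_eq: "1 / (\<i> * of_real \<eta> - complex_of_real (- 2 * cos \<theta>)) = m / (1 + 2 * m * of_real (cos \<theta>) + m\<^sup>2)" for \<theta>
  proof -
    have "\<i> * of_real \<eta> - complex_of_real (- 2 * cos \<theta>) = (1 + 2 * m * of_real (cos \<theta>) + m\<^sup>2) / m"
      using m1 unfolding mz by (simp add: field_simps power2_eq_square)
    then show ?thesis by simp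
  qed
  have le: "(LINT \<theta>|lborel. of_real (angular_density c \<theta>) * (1 / (\<i> * of_real \<eta> - complex_of_real (- 2 * cos \<theta>)))) = m / (1 - of_real c * m)"
    if "\<bar>c\<bar> \<le> 1" for c
  proof -
    have "(LINT \<theta>|lborel. of_real (angular_density c \<theta>) * (1 / (\<i> * of_real \<eta> - complex_of_real (- 2 * cos \<theta>)))) =
       (LINT \<theta>|lborel. m * (of_real (angular_density c \<theta>) / (1 + 2 * m * of_real (cos \<theta>) + m\<^sup>2)))"
      unfolding cos_eq by (simp add: mult.commute)
    also have "\<dots> = m * (1 / (1 - of_real c * m))"
      using integral_angular_density_poisson[OF that m1(1)] by (simp only: integral_mult_right_zero)
    finally show ?thesis by simp
  qed
  have S: "(LINT x|limit_measure a. 1 / (\<i> * of_real \<eta> - of_real x)) =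
     (LINT \<theta>|lborel. of_real (angular_density a \<theta>) * (1 / (\<i> * of_real \<eta> - complex_of_real (- 2 * cos \<theta>)))) +
     of_real (limit_atom_mass a) * (1 / (\<i> * of_real \<eta> - of_real (a + 1 / a)))"
    by (rule integral_limit_measure_complex[OF _ bd]) measurable
  have rhs: "- \<i> * of_real \<kappa> / (1 + \<i> * of_real (\<kappa> * a)) = m / (1 - of_real a * m)"
    by (simp add: m_def algebra_simps)
  show ?thesis
  proof (cases "\<bar>a\<bar> \<le> 1")
    case True
    then have "limit_atom_mass a = 0"
      by (cases "\<bar>a\<bar> = 1") (auto simp: limit_atom_mass_def power2_eq_1_iff abs_if split: if_splits)
    then show ?thesis using S le[OF True] rhs by simp
  next
    case False
    let ?a = "complex_of_real a"
    have a0: "?a \<noteq> 0" using False by auto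
    have n1: "1 - ?a * m \<noteq> 0" using k by (auto simp: complex_eq_iff m_def)
    have n2: "?a - m \<noteq> 0" using False by (auto simp: complex_eq_iff m_def)
    have "(LINT \<theta>|lborel. of_real (angular_density a \<theta>) * (1 / (\<i> * of_real \<eta> - complex_of_real (- 2 * cos \<theta>)))) =
      (LINT \<theta>|lborel. of_real (1 / a\<^sup>2) * (of_real (angular_density (1 / a) \<theta>) * (1 / (\<i> * of_real \<eta> - complex_of_real (- 2 * cos \<theta>)))))"
      using a0 by (subst angular_density_scale) (auto simp: mult_ac)
    also have "\<dots> = of_real (1 / a\<^sup>2) * (m / (1 - of_real (1 / a) * m))"
      unfolding integral_mult_right_zero using False by (subst le) (auto simp: field_simps)
    also have "\<dots> = m / (?a * (?a - m))"
      using a0 n2 by (simp add: field_simps power2_eq_square)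
    finally have I: "(LINT \<theta>|lborel. of_real (angular_density a \<theta>) * (1 / (\<i> * of_real \<eta> - complex_of_real (- 2 * cos \<theta>)))) =
      m / (?a * (?a - m))" .
    \<comment> \<open>The left side is m + 1 / m - a - 1 / a, which factors. The factor a - m occurs
      in both the continuous part and the atom part, and cancels in their sum.\<close>
    have d: "\<i> * of_real \<eta> - of_real (a + 1 / a) = (1 - ?a * m) * (?a - m) / (?a * m)"
      using m1 a0 unfolding mz by (simp add: field_simps power2_eq_square)
    have mass: "complex_of_real (limit_atom_mass a) = (?a\<^sup>2 - 1) / ?a\<^sup>2"
      using False a0 by (simp add: limit_atom_mass_def field_simps)
    have "m / (?a * (?a - m)) + (?a\<^sup>2 - 1) / ?a\<^sup>2 * (1 / ((1 - ?a * m) * (?a - m) / (?a * m))) = m / (1 - ?a * m)"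
    proof -
      have "m / (?a * (?a - m)) + (?a\<^sup>2 - 1) / ?a\<^sup>2 * (1 / ((1 - ?a * m) * (?a - m) / (?a * m))) =
        (m * (1 - ?a * m) + (?a\<^sup>2 - 1) * m) / (?a * (?a - m) * (1 - ?a * m))"
        using a0 n1 n2 m1 by (simp add: divide_simps power2_eq_square)
      also have "m * (1 - ?a * m) + (?a\<^sup>2 - 1) * m = m * (?a * (?a - m))"
        by (simp add: algebra_simps power2_eq_square)
      finally show ?thesis using a0 n1 n2 by simp
    qed
    then show ?thesis unfolding S I d mass rhs .
  qed
qed

section \<open>Stieltjes transforms and weak convergence\<close>

definition stieltjes_kernel :: "real \<Rightarrow> real \<Rightarrow> complex" where
  "stieltjes_kernel \<eta> x = 1 / (\<i> * of_real \<eta> - of_real x)"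

lemma stieltjes_kernel_measurable [measurable]: "stieltjes_kernel \<eta> \<in> borel_measurable borel"
  unfolding stieltjes_kernel_def by measurable

lemma stieltjes_denominator_nonzero: "\<eta> > 0 \<Longrightarrow> \<i> * of_real \<eta> - complex_of_real x \<noteq> 0"
  by (auto simp: complex_eq_iff)

lemma norm_stieltjes_kernel_le: "\<eta> > 0 \<Longrightarrow> norm (stieltjes_kernel \<eta> x) \<le> 1 / \<eta>"
proof -
  assume e0: "\<eta> > 0"
  have "\<eta> \<le> norm (\<i> * of_real \<eta> - complex_of_real x)"
    using abs_Im_le_cmod[of "\<i> * of_real \<eta> - complex_of_real x"] e0 by simp
  then show ?thesis using e0 by (simp add: norm_divide frac_le stieltjes_kernel_def)
qed

lemma stieltjes_kernel_diff:
  assumes "\<eta> > 0" "\<theta> > 0"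
  shows "stieltjes_kernel \<eta> x - stieltjes_kernel \<theta> x =
    \<i> * of_real (\<theta> - \<eta>) * stieltjes_kernel \<eta> x * stieltjes_kernel \<theta> x"
  using stieltjes_denominator_nonzero[OF assms(1), of x] stieltjes_denominator_nonzero[OF assms(2), of x]
  by (simp add: stieltjes_kernel_def field_simps)

lemma norm_stieltjes_kernel_diff_le:
  assumes "\<eta> \<ge> 1" "\<theta> \<ge> 1"
  shows "norm (stieltjes_kernel \<eta> x - stieltjes_kernel \<theta> x) \<le> \<bar>\<theta> - \<eta>\<bar>"
proof -
  have b: "norm (stieltjes_kernel \<eta> x) \<le> 1" "norm (stieltjes_kernel \<theta> x) \<le> 1"
    using norm_stieltjes_kernel_le[of \<eta> x] norm_stieltjes_kernel_le[of \<theta> x] assms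
    by (auto intro: order.trans simp: divide_le_eq_1)
  have "norm (stieltjes_kernel \<eta> x - stieltjes_kernel \<theta> x) = \<bar>\<theta> - \<eta>\<bar> * norm (stieltjes_kernel \<eta> x) * norm (stieltjes_kernel \<theta> x)"
    using assms by (simp add: stieltjes_kernel_diff norm_mult del: of_real_diff)
  also have "\<dots> \<le> \<bar>\<theta> - \<eta>\<bar> * 1 * 1" using b by (intro mult_mono) auto
  finally show ?thesis by simp
qed

text \<open>The derivative of the k-th power in \<eta> is -i k times the next power, so a difference
  quotient recovers that power. The error is uniform in x and can therefore be integrated against
  any probability measure.\<close>

lemma stieltjes_kernel_power_quotient:
  assumes "\<eta> \<ge> 1" "h > 0" "k \<ge> 1"
  shows "norm ((stieltjes_kernel \<eta> x ^ k - stieltjes_kernel (\<eta> + h) x ^ k) / (\<i> * of_real (h * real k)) -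
    stieltjes_kernel \<eta> x ^ Suc k) \<le> real k * h"
proof -
  let ?r = "stieltjes_kernel \<eta> x" and ?s = "stieltjes_kernel (\<eta> + h) x"
  have b: "norm ?r \<le> 1" "norm ?s \<le> 1"
    using norm_stieltjes_kernel_le[of \<eta> x] norm_stieltjes_kernel_le[of "\<eta> + h" x] assms
    by (auto intro: order.trans simp: divide_le_eq_1)
  have d: "norm (?s - ?r) \<le> h" using norm_stieltjes_kernel_diff_le[of "\<eta> + h" \<eta> x] assms by simp
  have "?r ^ k - ?s ^ k = (?r - ?s) * (\<Sum>j<k. ?s ^ (k - Suc j) * ?r ^ j)"
    by (rule power_diff_sumr2)
  also have "?r - ?s = \<i> * of_real h * ?r * ?s"
    using assms by (subst stieltjes_kernel_diff) auto
  also have "\<dots> * (\<Sum>j<k. ?s ^ (k - Suc j) * ?r ^ j) = \<i> * of_real h * (\<Sum>j<k. ?s ^ (k - j) * ?r ^ Suc j)"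
  proof -
    have "?r * ?s * (\<Sum>j<k. ?s ^ (k - Suc j) * ?r ^ j) = (\<Sum>j<k. ?s ^ (k - j) * ?r ^ Suc j)"
      unfolding sum_distrib_left
    proof (rule sum.cong)
      fix j assume "j \<in> {..<k}"
      then have "k - j = Suc (k - Suc j)" by auto
      then show "?r * ?s * (?s ^ (k - Suc j) * ?r ^ j) = ?s ^ (k - j) * ?r ^ Suc j"
        by (simp only: power_Suc mult_ac)
    qed simp
    then show ?thesis by (simp only: mult.assoc)
  qed
  finally have "(?r ^ k - ?s ^ k) / (\<i> * of_real (h * real k)) = (\<Sum>j<k. ?s ^ (k - j) * ?r ^ Suc j) / of_real (real k)"
    using assms by (simp add: field_simps)
  moreover have "?r ^ Suc k = (\<Sum>j<k. ?r ^ (k - j) * ?r ^ Suc j) / of_real (real k)"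
  proof -
    have "(\<Sum>j<k. ?r ^ (k - j) * ?r ^ Suc j) = (\<Sum>j<k. ?r ^ Suc k)"
      by (rule sum.cong) (auto simp: power_add[symmetric] simp del: power_Suc)
    then show ?thesis using assms by simp
  qed
  ultimately have "(?r ^ k - ?s ^ k) / (\<i> * of_real (h * real k)) - ?r ^ Suc k =
     (\<Sum>j<k. (?s ^ (k - j) - ?r ^ (k - j)) * ?r ^ Suc j) / of_real (real k)"
    by (simp only: diff_divide_distrib[symmetric] sum_subtractf[symmetric] left_diff_distrib)
  also have "norm \<dots> = norm (\<Sum>j<k. (?s ^ (k - j) - ?r ^ (k - j)) * ?r ^ Suc j) / real k"
    by (simp add: norm_divide)
  also have "norm (\<Sum>j<k. (?s ^ (k - j) - ?r ^ (k - j)) * ?r ^ Suc j) \<le> (\<Sum>j<k. real k * h)"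
  proof (rule sum_norm_le)
    fix j assume "j \<in> {..<k}"
    have "norm (?s ^ (k - j) - ?r ^ (k - j)) \<le> real (k - j) * norm (?s - ?r)"
      by (rule norm_power_diff) (use b in auto)
    also have "\<dots> \<le> real k * h" using d assms by (intro mult_mono) auto
    finally have "norm (?s ^ (k - j) - ?r ^ (k - j)) \<le> real k * h" .
    moreover have "norm (?r ^ Suc j) \<le> 1"
      using b by (simp only: norm_power power_le_one norm_ge_zero)
    ultimately have "norm (?s ^ (k - j) - ?r ^ (k - j)) * norm (?r ^ Suc j) \<le> real k * h * 1"
      using assms by (intro mult_mono) auto
    then show "norm ((?s ^ (k - j) - ?r ^ (k - j)) * ?r ^ Suc j) \<le> real k * h"
      by (simp only: norm_mult mult_1_right)
  qed
  finally show ?thesis using assms by (simp add: divide_simps)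
qed

text \<open>With s = y^2 x^2 / (2 n) the error is at most both s and 2, hence at most 4 s / (1 + s).
  Unlike the minimum, this is a rational function of x that a Stieltjes kernel can express, so
  convergence of its integrals is known.\<close>

lemma norm_power_iexp_le:
  fixes x :: real
  assumes "y > 0" "n \<ge> 1"
  shows "norm ((1 / (1 + \<i> * of_real (y * x / real n))) ^ n - iexp (- (y * x)))
    \<le> 4 * (1 - (2 * real n / y\<^sup>2) / (x\<^sup>2 + 2 * real n / y\<^sup>2))"
proof -
  define \<theta> where "\<theta> = y * x / real n"
  define s where "s = y\<^sup>2 * x\<^sup>2 / (2 * real n)"
  let ?a = "1 / (1 + \<i> * complex_of_real \<theta>)" and ?b = "iexp (- \<theta>)"
  have n0: "1 + \<i> * complex_of_real \<theta> \<noteq> 0" by (auto simp: complex_eq_iff)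
  have n1: "1 \<le> norm (1 + \<i> * complex_of_real \<theta>)"
    using abs_Re_le_cmod[of "1 + \<i> * complex_of_real \<theta>"] by simp
  then have a1: "norm ?a \<le> 1" by (simp add: norm_divide divide_le_eq_1)
  have b1: "norm ?b \<le> 1" by simp
  have bn: "?b ^ n = iexp (- (y * x))"
    using assms by (simp add: \<theta>_def exp_of_nat_mult[symmetric])
  have "?a - ?b = (1 - (1 + \<i> * of_real \<theta>) * ?b) * ?a"
    using n0 by (simp add: field_simps)
  also have "1 - (1 + \<i> * of_real \<theta>) * ?b = (iexp \<theta> - (1 + \<i> * of_real \<theta>)) * ?b"
    by (simp add: left_diff_distrib exp_add[symmetric])
  also have "norm ((iexp \<theta> - (1 + \<i> * of_real \<theta>)) * ?b * ?a) \<le> norm (iexp \<theta> - (1 + \<i> * of_real \<theta>)) * 1 * 1"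
    unfolding norm_mult using a1 b1 by (intro mult_mono) auto
  also have "norm (iexp \<theta> - (1 + \<i> * of_real \<theta>)) \<le> \<theta>\<^sup>2 / 2"
    using iexp_approx1[of \<theta> 1] by (simp add: numeral_2_eq_2)
  finally have ab: "norm (?a - ?b) \<le> \<theta>\<^sup>2 / 2" by simp
  have "norm (?a ^ n - ?b ^ n) \<le> real n * norm (?a - ?b)"
    by (rule norm_power_diff[OF a1 b1])
  also have "\<dots> \<le> real n * (\<theta>\<^sup>2 / 2)" using ab by (intro mult_left_mono) auto
  also have "\<dots> = s" using assms by (simp add: \<theta>_def s_def field_simps power2_eq_square)
  finally have le1: "norm (?a ^ n - ?b ^ n) \<le> s" .
  have le2: "norm (?a ^ n - ?b ^ n) \<le> 2"
    using norm_triangle_ineq4[of "?a ^ n" "?b ^ n"] power_le_one[of "norm ?a" n] power_le_one[of "norm ?b" n] a1 b1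
    by (simp add: norm_power)
  have s0: "0 \<le> s" using assms by (simp add: s_def)
  have "norm (?a ^ n - ?b ^ n) \<le> 4 * (s / (1 + s))"
  proof (cases "s \<le> 1")
    case True
    have "s * (1 + s) \<le> s * 4" using True s0 by (intro mult_left_mono) auto
    then have "s \<le> 4 * (s / (1 + s))" using s0 by (simp add: field_simps)
    then show ?thesis using le1 by linarith
  next
    case False
    then have "2 \<le> 4 * (s / (1 + s))" by (simp add: field_simps)
    then show ?thesis using le2 by linarith
  qed
  also have "s / (1 + s) = 1 - 1 / (1 + s)" using s0 by (simp add: field_simps)
  also have "1 / (1 + s) = (2 * real n / y\<^sup>2) / (x\<^sup>2 + 2 * real n / y\<^sup>2)"
  proof -
    have "1 + s = (x\<^sup>2 + 2 * real n / y\<^sup>2) / (2 * real n / y\<^sup>2)"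
      using assms by (simp add: s_def field_simps)
    then show ?thesis by simp
  qed
  finally show ?thesis unfolding bn unfolding \<theta>_def .
qed

lemma norm_diff_less_via:
  fixes A B :: "'a :: real_normed_vector"
  assumes "norm (A - a) < e / 2" "norm (B - b) < e / 4" "norm (A - B) < e / 4"
  shows "norm (a - b) < e"
proof -
  have "a - b = (A - B) - (A - a) + (B - b)" by simp
  also have "norm \<dots> \<le> norm (A - B) + norm (A - a) + norm (B - b)"
    by (meson add_mono norm_triangle_ineq norm_triangle_ineq4 order.refl order.trans)
  finally show ?thesis using assms by linarith
qed

text \<open>
  Differentiating in \<open>\<eta>\<close> gives the convergence of the integrals of all powers of the kernel. For
  \<open>\<zeta> = n / y\<close> the function \<open>(\<i>\<zeta> / (\<i>\<zeta> - x))\<^sup>n = (1 + \<i>yx / n)\<^bsup>-n\<^esup>\<close> approximates \<open>exp (-\<i>yx)\<close>,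
  with an error controlled by \<open>1 - s\<^sup>2 / (x\<^sup>2 + s\<^sup>2)\<close>, which is again a Stieltjes kernel; so the
  characteristic functions converge.
\<close>

theorem weak_conv_of_stieltjes:
  fixes \<mu> :: "nat \<Rightarrow> real measure" and \<nu> :: "real measure"
  assumes rd: "\<And>n. real_distribution (\<mu> n)" "real_distribution \<nu>"
    and S: "\<And>\<eta>. \<eta> > 2 \<Longrightarrow> (\<lambda>n. LINT x|\<mu> n. stieltjes_kernel \<eta> x) \<longlonglongrightarrow> (LINT x|\<nu>. stieltjes_kernel \<eta> x)"
  shows "weak_conv_m \<mu> \<nu>"
proof (rule levy_continuity[OF rd])
  interpret \<mu>: real_distribution "\<mu> n" for n by (rule rd)
  interpret \<nu>: real_distribution \<nu> by (rule rd)
  let ?conv = "\<lambda>f :: real \<Rightarrow> complex. (\<lambda>n. LINT x|\<mu> n. f x) \<longlonglongrightarrow> (LINT x|\<nu>. f x)"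
  have int: "integrable (\<mu> n) f" "integrable \<nu> f"
    if "f \<in> borel_measurable borel" "\<And>x. norm (f x) \<le> C" for f :: "real \<Rightarrow> complex" and C n
    by (intro \<mu>.integrable_const_bound[where B = C] \<nu>.integrable_const_bound[where B = C] AE_I2 that(2); use that(1) in simp)+
  have kb: "norm (stieltjes_kernel \<eta> x ^ k) \<le> 1" if "\<eta> \<ge> 1" for \<eta> x k
  proof -
    have "norm (stieltjes_kernel \<eta> x) \<le> 1 / \<eta>" using that by (intro norm_stieltjes_kernel_le) simp
    also have "\<dots> \<le> 1" using that by simp
    finally show ?thesis unfolding norm_power by (intro power_le_one norm_ge_zero)
  qed
  have ki: "integrable (\<mu> n) (\<lambda>x. stieltjes_kernel \<eta> x ^ k)" "integrable \<nu> (\<lambda>x. stieltjes_kernel \<eta> x ^ k)" if "\<eta> \<ge> 1" for \<eta> n k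
    by (intro int(1)[OF _ kb[OF that]] int(2)[OF _ kb[OF that]]; measurable)+
  have pow: "?conv (\<lambda>x. stieltjes_kernel \<eta> x ^ k)" if "\<eta> > 2" "k \<ge> 1" for \<eta> k
    using that(2,1)
  proof (induction k arbitrary: \<eta> rule: nat_induct_at_least)
    case base
    then show ?case using S by simp
  next
    case (Suc k)
    show ?case
    proof (rule LIMSEQ_I)
      fix e :: real assume e: "e > 0"
      define h where "h = e / (4 * real k)"
      have h: "h > 0" "real k * h = e / 4" using e Suc by (auto simp: h_def)
      let ?g = "\<lambda>x. (stieltjes_kernel \<eta> x ^ k - stieltjes_kernel (\<eta> + h) x ^ k) / (\<i> * of_real (h * real k))"
      have g: "?conv ?g"
        unfolding integral_divide_zero
        using Suc h by (subst (1 2) Bochner_Integration.integral_diff) (auto intro!: tendsto_intros Suc.IH ki)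
      then obtain N where N: "\<And>n. n \<ge> N \<Longrightarrow> norm ((LINT x|\<mu> n. ?g x) - (LINT x|\<nu>. ?g x)) < e / 4"
        using LIMSEQ_D[OF g, of "e / 4"] e by auto
      have gi: "integrable (\<mu> n) ?g" "integrable \<nu> ?g" for n
        using Suc h ki[of \<eta>] ki[of "\<eta> + h"] by auto
      have cl: "norm (?g x - stieltjes_kernel \<eta> x ^ Suc k) \<le> e / 4" for x
        using stieltjes_kernel_power_quotient[of \<eta> h k x] Suc h by simp
      have d1: "norm ((LINT x|\<mu> n. ?g x) - (LINT x|\<mu> n. stieltjes_kernel \<eta> x ^ Suc k)) \<le> e / 4" for n
      proof -
        have "(LINT x|\<mu> n. ?g x) - (LINT x|\<mu> n. stieltjes_kernel \<eta> x ^ Suc k) = (LINT x|\<mu> n. ?g x - stieltjes_kernel \<eta> x ^ Suc k)"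
          using Suc by (intro Bochner_Integration.integral_diff[symmetric] gi ki) auto
        also have "norm \<dots> \<le> (LINT x|\<mu> n. e / 4)"
          using Suc cl by (intro Bochner_Integration.integral_norm_bound_integral Bochner_Integration.integrable_diff gi ki) auto
        also have "(LINT x|\<mu> n. e / 4) = e / 4" using \<mu>.prob_space[of n] by simp
        finally show ?thesis .
      qed
      have d2: "norm ((LINT x|\<nu>. ?g x) - (LINT x|\<nu>. stieltjes_kernel \<eta> x ^ Suc k)) \<le> e / 4"
      proof -
        have "(LINT x|\<nu>. ?g x) - (LINT x|\<nu>. stieltjes_kernel \<eta> x ^ Suc k) = (LINT x|\<nu>. ?g x - stieltjes_kernel \<eta> x ^ Suc k)"
          using Suc by (intro Bochner_Integration.integral_diff[symmetric] gi ki) auto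
        also have "norm \<dots> \<le> (LINT x|\<nu>. e / 4)"
          using Suc cl by (intro Bochner_Integration.integral_norm_bound_integral Bochner_Integration.integrable_diff gi ki) auto
        also have "(LINT x|\<nu>. e / 4) = e / 4" using \<nu>.prob_space by simp
        finally show ?thesis .
      qed
      have "norm ((LINT x|\<mu> n. stieltjes_kernel \<eta> x ^ Suc k) - (LINT x|\<nu>. stieltjes_kernel \<eta> x ^ Suc k)) < e" if "n \<ge> N" for n
        using d1[of n] d2 N[OF that] e by norm
      then show "\<exists>no. \<forall>n\<ge>no. norm ((LINT x|\<mu> n. stieltjes_kernel \<eta> x ^ Suc k) - (LINT x|\<nu>. stieltjes_kernel \<eta> x ^ Suc k)) < e"
        by blast
    qed
  qed
  \<comment> \<open>\<open>D s\<close> is small for |x| far below s and tends to 1 at infinity, so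
    its integral measures escaping mass. As the real part of 1 - i s times the kernel, its integrals
    converge by assumption; this takes the place of a tightness argument.\<close>
  define D where "D s x = 1 - s\<^sup>2 / (x\<^sup>2 + s\<^sup>2)" for s x :: real
  have Dm [measurable]: "D s \<in> borel_measurable borel" for s unfolding D_def by measurable
  have Db: "0 \<le> D s x" "D s x \<le> 1" if "s > 0" for s x
    using that by (auto simp: D_def divide_le_eq_1 add_nonneg_eq_0_iff add_nonneg_pos)
  have DRe: "D s x = Re (1 - \<i> * of_real s * stieltjes_kernel s x)" if "s > 0" for s x
  proof -
    have "stieltjes_kernel s x = - (\<i> * of_real s + of_real x) / of_real (x\<^sup>2 + s\<^sup>2)"
    proof -
      have "(\<i> * of_real s - of_real x) * (\<i> * of_real s + of_real x) = - complex_of_real (x\<^sup>2 + s\<^sup>2)"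
        by (simp add: algebra_simps power2_eq_square)
      moreover have "x\<^sup>2 + s\<^sup>2 \<noteq> 0" using that by (simp add: add_nonneg_eq_0_iff)
      then have "complex_of_real (x\<^sup>2 + s\<^sup>2) \<noteq> 0" unfolding of_real_eq_0_iff .
      moreover have "1 / u = - v / w" if "u * v = - w" "w \<noteq> 0" "u \<noteq> 0" for u v w :: complex
      proof -
        have "w = - (u * v)" using that by simp
        then show ?thesis using that by (simp add: field_simps)
      qed
      ultimately show ?thesis using stieltjes_denominator_nonzero[OF that, of x]
        unfolding stieltjes_kernel_def by blast
    qed
    then show ?thesis by (simp add: D_def power2_eq_square)
  qed
  have Di: "integrable (\<mu> n) (D s)" "integrable \<nu> (D s)" if "s > 0" for s n
    using Db[OF that] by (auto intro!: \<mu>.integrable_const_bound[where B = 1] \<nu>.integrable_const_bound[where B = 1])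
  have Dconv: "(\<lambda>n. LINT x|\<mu> n. D s x) \<longlonglongrightarrow> (LINT x|\<nu>. D s x)" if s: "s > 2" for s
  proof -
    have pu: "measure (\<mu> n) UNIV = 1" "measure \<nu> UNIV = 1" for n
      using \<mu>.prob_space[of n] \<nu>.prob_space by simp_all
    have eq: "(LINT x|\<mu> n. D s x) = Re (1 - \<i> * of_real s * (LINT x|\<mu> n. stieltjes_kernel s x))" for n
      using s ki(1)[of s n 1] by (simp add: DRe pu)
    have eq2: "(LINT x|\<nu>. D s x) = Re (1 - \<i> * of_real s * (LINT x|\<nu>. stieltjes_kernel s x))"
      using s ki(2)[of s 1] by (simp add: DRe pu)
    show ?thesis unfolding eq eq2 using s by (intro tendsto_intros S)
  qed
  \<comment> \<open>Kernels with positive \<eta> approximate only exp (-i y x) with y > 0. The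
    opposite frequencies follow by complex conjugation.\<close>
  have neg: "(\<lambda>n. LINT x|\<mu> n. iexp (- (y * x))) \<longlonglongrightarrow> (LINT x|\<nu>. iexp (- (y * x)))" if y: "y > 0" for y
  proof (rule LIMSEQ_I)
    fix e :: real assume e: "e > 0"
    define s where "s n = sqrt (2 * real (Suc n)) / y" for n
    have s0: "s n > 0" for n using y by (simp add: s_def)
    have s2: "(s n)\<^sup>2 = 2 * real (Suc n) / y\<^sup>2" for n by (simp add: s_def power_divide)
    have zlim: "filterlim (\<lambda>n. real (Suc n) / y) at_top sequentially"
    proof -
      have "filterlim (\<lambda>n. (1 / y) * real (Suc n)) at_top sequentially"
        using y by (intro filterlim_tendsto_pos_mult_at_top[OF tendsto_const] filterlim_compose[OF filterlim_real_sequentially filterlim_Suc]) auto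
      then show ?thesis by simp
    qed
    have slim: "filterlim s at_top sequentially"
    proof -
      have "filterlim (\<lambda>n. sqrt (2 / y * (real (Suc n) / y))) at_top sequentially"
        using y by (intro filterlim_compose[OF sqrt_at_top] filterlim_tendsto_pos_mult_at_top[OF tendsto_const] zlim) auto
      moreover have "sqrt (2 / y * (real (Suc n) / y)) = s n" for n
      proof -
        have "(s n)\<^sup>2 = 2 / y * (real (Suc n) / y)" unfolding s2 by (simp add: power2_eq_square)
        then show ?thesis using less_imp_le[OF s0] by (rule real_sqrt_unique)
      qed
      ultimately show ?thesis by simp
    qed
    have "(\<lambda>n. LINT x|\<nu>. D (s n) x) \<longlonglongrightarrow> (LINT x|\<nu>. 0)"
    proof (rule integral_dominated_convergence[where w = "\<lambda>_. 1"])
      show "AE x in \<nu>. (\<lambda>n. D (s n) x) \<longlonglongrightarrow> 0"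
      proof (rule AE_I2)
        fix x
        have "D (s n) x = x\<^sup>2 / (x\<^sup>2 + (s n)\<^sup>2)" for n
          using s0[of n] by (simp add: D_def field_simps add_nonneg_eq_0_iff)
        moreover have "(\<lambda>n. x\<^sup>2 / (x\<^sup>2 + (s n)\<^sup>2)) \<longlonglongrightarrow> 0"
          by (intro tendsto_divide_0[OF tendsto_const] filterlim_at_top_imp_at_infinity
            filterlim_tendsto_add_at_top[OF tendsto_const] filterlim_pow_at_top slim) auto
        ultimately show "(\<lambda>n. D (s n) x) \<longlonglongrightarrow> 0" by simp
      qed
    qed (use Db s0 in auto)
    then have ev1: "\<forall>\<^sub>F n in sequentially. (LINT x|\<nu>. D (s n) x) < e / 16"
      using e by (auto dest: order_tendstoD(2)[of _ 0 _ "e / 16"])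
    have ev2: "\<forall>\<^sub>F n in sequentially. s n > 2" using slim by (auto simp: filterlim_at_top_dense)
    have ev3: "\<forall>\<^sub>F n in sequentially. real (Suc n) / y > 2" using zlim by (auto simp: filterlim_at_top_dense)
    obtain n where n: "(LINT x|\<nu>. D (s n) x) < e / 16" "s n > 2" "real (Suc n) / y > 2"
      using eventually_happens[OF eventually_conj[OF ev1 eventually_conj[OF ev2 ev3]]] by auto
    define \<zeta> where "\<zeta> = real (Suc n) / y"
    let ?E = "\<lambda>x. (\<i> * of_real \<zeta>) ^ Suc n * stieltjes_kernel \<zeta> x ^ Suc n"
    have E: "?E x = (1 / (1 + \<i> * of_real (y * x / real (Suc n)))) ^ Suc n" for x
    proof -
      have "\<i> * of_real \<zeta> * stieltjes_kernel \<zeta> x = 1 / (1 + \<i> * of_real (y * x / real (Suc n)))"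
      proof -
        have z: "\<zeta> \<noteq> 0" using n(3) unfolding \<zeta>_def by linarith
        then have z2: "complex_of_real \<zeta> \<noteq> 0" unfolding of_real_eq_0_iff .
        have "1 + \<i> * complex_of_real (y * x / real (Suc n)) = 1 + \<i> * of_real (x / \<zeta>)"
          using y by (simp add: \<zeta>_def)
        also have "\<dots> = (\<i> * of_real \<zeta> - of_real x) / (\<i> * of_real \<zeta>)"
          using z z2 by (simp add: field_simps)
        finally show ?thesis by (simp add: stieltjes_kernel_def)
      qed
      then show ?thesis by (simp only: power_mult_distrib[symmetric])
    qed
    have Ei: "integrable (\<mu> N) ?E" "integrable \<nu> ?E" for N
      by (intro integrable_mult_right ki; use n in \<open>simp add: \<zeta>_def\<close>)+
    have Ie: "integrable (\<mu> N) (\<lambda>x. iexp (- (y * x)))" "integrable \<nu> (\<lambda>x. iexp (- (y * x)))" for N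
      by (intro int[of _ 1]; simp)+
    have cl: "norm (?E x - iexp (- (y * x))) \<le> 4 * D (s n) x" for x
      using norm_power_iexp_le[OF y, of "Suc n" x] unfolding E D_def s2 by simp
    have Ec: "(\<lambda>N. LINT x|\<mu> N. ?E x) \<longlonglongrightarrow> (LINT x|\<nu>. ?E x)"
      unfolding integral_mult_right_zero using n by (intro tendsto_intros pow) (auto simp: \<zeta>_def)
    obtain N1 where N1: "\<And>N. N \<ge> N1 \<Longrightarrow> norm ((LINT x|\<mu> N. ?E x) - (LINT x|\<nu>. ?E x)) < e / 4"
      using LIMSEQ_D[OF Ec, of "e / 4"] e by auto
    obtain N2 where N2: "\<And>N. N \<ge> N2 \<Longrightarrow> norm ((LINT x|\<mu> N. D (s n) x) - (LINT x|\<nu>. D (s n) x)) < e / 16"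
      using LIMSEQ_D[OF Dconv[OF n(2)], of "e / 16"] e by auto
    have d1: "norm ((LINT x|\<mu> N. ?E x) - (LINT x|\<mu> N. iexp (- (y * x)))) \<le> 4 * (LINT x|\<mu> N. D (s n) x)" for N
    proof -
      have "norm (LINT x|\<mu> N. ?E x - iexp (- (y * x))) \<le> (LINT x|\<mu> N. 4 * D (s n) x)"
        using cl Di[OF s0] by (intro Bochner_Integration.integral_norm_bound_integral Bochner_Integration.integrable_diff[OF Ei(1) Ie(1)]) auto
      then show ?thesis
        by (simp only: Bochner_Integration.integral_diff[OF Ei(1) Ie(1)] integral_mult_right_zero)
    qed
    have d2: "norm ((LINT x|\<nu>. ?E x) - (LINT x|\<nu>. iexp (- (y * x)))) \<le> 4 * (LINT x|\<nu>. D (s n) x)"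
    proof -
      have "norm (LINT x|\<nu>. ?E x - iexp (- (y * x))) \<le> (LINT x|\<nu>. 4 * D (s n) x)"
        using cl Di[OF s0] by (intro Bochner_Integration.integral_norm_bound_integral Bochner_Integration.integrable_diff[OF Ei(2) Ie(2)]) auto
      then show ?thesis
        by (simp only: Bochner_Integration.integral_diff[OF Ei(2) Ie(2)] integral_mult_right_zero)
    qed
    have "norm ((LINT x|\<mu> N. iexp (- (y * x))) - (LINT x|\<nu>. iexp (- (y * x)))) < e" if "N \<ge> max N1 N2" for N
    proof -
      have "(LINT x|\<mu> N. D (s n) x) < e / 8" using N2[of N] that n(1) unfolding real_norm_def by linarith
      then have "norm ((LINT x|\<mu> N. ?E x) - (LINT x|\<mu> N. iexp (- (y * x)))) < e / 2" using d1[of N] by linarith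
      moreover have "norm ((LINT x|\<nu>. ?E x) - (LINT x|\<nu>. iexp (- (y * x)))) < e / 4" using d2 n(1) by linarith
      moreover have "norm ((LINT x|\<mu> N. ?E x) - (LINT x|\<nu>. ?E x)) < e / 4" using N1[of N] that by auto
      ultimately show ?thesis by (rule norm_diff_less_via)
    qed
    then show "\<exists>no. \<forall>N\<ge>no. norm ((LINT x|\<mu> N. iexp (- (y * x))) - (LINT x|\<nu>. iexp (- (y * x)))) < e" by blast
  qed
  show "(\<lambda>n. char (\<mu> n) t) \<longlonglongrightarrow> char \<nu> t" for t
  proof -
    consider "t = 0" | "t > 0" | "t < 0" by linarith
    then show ?thesis
    proof cases
      case 1
      have "measure (\<mu> n) UNIV = 1" "measure \<nu> UNIV = 1" for n
        using \<mu>.prob_space[of n] \<nu>.prob_space by simp_all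
      then show ?thesis using 1 by (simp add: char_def)
    next
      case 2
      have "char (\<mu> n) t = cnj (LINT x|\<mu> n. iexp (- (t * x)))" "char \<nu> t = cnj (LINT x|\<nu>. iexp (- (t * x)))" for n
      proof -
        have e: "iexp (t * x) = cnj (iexp (- (t * x)))" for x :: real
          by (simp only: cis_conv_exp[symmetric] cis_cnj minus_minus)
        have "char \<rho> t = cnj (LINT x|\<rho>. iexp (- (t * x)))" for \<rho> :: "real measure"
        proof -
          have "char \<rho> t = (LINT x|\<rho>. cnj (iexp (- (t * x))))" unfolding char_def by (simp only: e)
          also have "\<dots> = cnj (LINT x|\<rho>. iexp (- (t * x)))" by (rule Bochner_Integration.integral_cnj)
          finally show ?thesis .
        qed
        then show "char (\<mu> n) t = cnj (LINT x|\<mu> n. iexp (- (t * x)))" "char \<nu> t = cnj (LINT x|\<nu>. iexp (- (t * x)))"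
          by blast+
      qed
      then show ?thesis using tendsto_cnj[OF neg[OF 2]] by simp
    next
      case 3
      then show ?thesis using neg[of "- t"] by (simp add: char_def)
    qed
  qed
qed

section \<open>Spectral measures of Hermitian matrices\<close>

definition hermitian_on :: "nat \<Rightarrow> (nat \<Rightarrow> nat \<Rightarrow> complex) \<Rightarrow> bool" where
  "hermitian_on N H \<longleftrightarrow> (\<forall>i<N. \<forall>j<N. H j i = cnj (H i j))"

text \<open>The value 0 from N on lets vectors be functions supported below N, so that eigenvector
  equations are plain equalities of functions.\<close>

definition mat_apply :: "nat \<Rightarrow> (nat \<Rightarrow> nat \<Rightarrow> complex) \<Rightarrow> (nat \<Rightarrow> complex) \<Rightarrow> nat \<Rightarrow> complex" where
  "mat_apply N H v i = (if i < N then \<Sum>k<N. H i k * v k else 0)"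

definition inner_on :: "nat \<Rightarrow> (nat \<Rightarrow> complex) \<Rightarrow> (nat \<Rightarrow> complex) \<Rightarrow> complex" where
  "inner_on N u v = (\<Sum>i<N. u i * cnj (v i))"

lemma mat_apply_sum: "mat_apply N H (\<lambda>i. \<Sum>l\<in>L. c l * v l i) = (\<lambda>i. \<Sum>l\<in>L. c l * mat_apply N H (v l) i)"
proof
  fix i
  have "(\<Sum>k<N. H i k * (\<Sum>l\<in>L. c l * v l k)) = (\<Sum>l\<in>L. \<Sum>k<N. H i k * (c l * v l k))"
    by (subst sum.swap) (simp add: sum_distrib_left)
  also have "\<dots> = (\<Sum>l\<in>L. c l * (\<Sum>k<N. H i k * v l k))"
    by (simp add: sum_distrib_left mult_ac)
  finally show "mat_apply N H (\<lambda>i. \<Sum>l\<in>L. c l * v l i) i = (\<Sum>l\<in>L. c l * mat_apply N H (v l) i)"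
    by (simp add: mat_apply_def)
qed

lemma mat_apply_diff: "mat_apply N H (\<lambda>i. u i - v i) = (\<lambda>i. mat_apply N H u i - mat_apply N H v i)"
  by (auto simp: mat_apply_def fun_eq_iff right_diff_distrib sum_subtractf)

lemma mat_apply_scale: "mat_apply N H (\<lambda>i. c * v i) = (\<lambda>i. c * mat_apply N H v i)"
  by (auto simp: mat_apply_def fun_eq_iff sum_distrib_left mult_ac)

lemma inner_on_self: "inner_on N v v = of_real (\<Sum>i<N. (cmod (v i))\<^sup>2)"
  by (simp add: inner_on_def complex_mult_cnj cmod_power2)

lemma inner_on_self_eq_0:
  assumes "\<And>i. i \<ge> N \<Longrightarrow> v i = 0" "inner_on N v v = 0"
  shows "v = (\<lambda>_. 0)"
proof
  fix i
  have "(\<Sum>i<N. (cmod (v i))\<^sup>2) = 0" using assms(2) unfolding inner_on_self of_real_eq_0_iff .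
  then show "v i = 0" using assms(1)[of i] by (cases "i < N") (auto simp: sum_nonneg_eq_0_iff)
qed

lemma inner_on_mat_apply:
  assumes "hermitian_on N H"
  shows "inner_on N (mat_apply N H u) v = inner_on N u (mat_apply N H v)"
proof -
  have "inner_on N (mat_apply N H u) v = (\<Sum>i<N. \<Sum>k<N. H i k * u k * cnj (v i))"
    by (simp add: inner_on_def mat_apply_def sum_distrib_right)
  also have "\<dots> = (\<Sum>k<N. \<Sum>i<N. H i k * u k * cnj (v i))" by (rule sum.swap)
  also have "\<dots> = (\<Sum>k<N. \<Sum>i<N. u k * cnj (H k i * v i))"
  proof (intro sum.cong refl)
    fix k i assume "k \<in> {..<N}" "i \<in> {..<N}"
    then have "H i k = cnj (H k i)" using assms unfolding hermitian_on_def by blast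
    then show "H i k * u k * cnj (v i) = u k * cnj (H k i * v i)" by (simp only: complex_cnj_mult mult_ac)
  qed
  also have "\<dots> = inner_on N u (mat_apply N H v)"
    by (simp add: inner_on_def mat_apply_def sum_distrib_left)
  finally show ?thesis .
qed

lemma hermitian_eigenvalue_real:
  assumes "hermitian_on N H" "mat_apply N H v = (\<lambda>i. a * v i)" "v \<noteq> (\<lambda>_. 0)" "\<And>i. i \<ge> N \<Longrightarrow> v i = 0"
  shows "Im a = 0"
proof -
  have "a * inner_on N v v = inner_on N (mat_apply N H v) v"
    by (simp add: assms(2) inner_on_def sum_distrib_left mult.assoc)
  also have "\<dots> = inner_on N v (mat_apply N H v)" by (rule inner_on_mat_apply[OF assms(1)])
  also have "\<dots> = cnj a * inner_on N v v"
    by (simp add: assms(2) inner_on_def sum_distrib_left mult_ac)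
  finally have "a = cnj a" using inner_on_self_eq_0[OF assms(4)] assms(3) by auto
  then show ?thesis by (simp add: complex_eq_iff)
qed

lemma eigenvectors_orthogonal:
  fixes a b :: real
  assumes "hermitian_on N H" "mat_apply N H u = (\<lambda>i. of_real a * u i)" "mat_apply N H v = (\<lambda>i. of_real b * v i)" "a \<noteq> b"
  shows "inner_on N u v = 0"
proof -
  have "of_real a * inner_on N u v = inner_on N (mat_apply N H u) v"
    by (simp add: assms(2) inner_on_def sum_distrib_left mult.assoc)
  also have "\<dots> = inner_on N u (mat_apply N H v)" by (rule inner_on_mat_apply[OF assms(1)])
  also have "\<dots> = of_real b * inner_on N u v"
    by (simp add: assms(3) inner_on_def sum_distrib_left mult_ac)
  finally show ?thesis using assms(4) by simp
qed

fun apply_linear_factors :: "nat \<Rightarrow> (nat \<Rightarrow> nat \<Rightarrow> complex) \<Rightarrow> complex list \<Rightarrow> (nat \<Rightarrow> complex) \<Rightarrow> nat \<Rightarrow> complex" where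
  "apply_linear_factors N H [] v = v"
| "apply_linear_factors N H (a # as) v = apply_linear_factors N H as (\<lambda>i. mat_apply N H v i - a * v i)"

text \<open>Induction on the factors. If (H - a) q is a sum of eigenvectors, the components with
  eigenvalue different from a are divided by l - a and removed from q. The remainder w satisfies (H
  - a)^2 w = 0, and for Hermitian H this forces (H - a) w = 0.\<close>

lemma eigenvector_decomposition_of_annihilated:
  assumes H: "hermitian_on N H"
  shows "apply_linear_factors N H as q = (\<lambda>_. 0) \<Longrightarrow> (\<And>i. i \<ge> N \<Longrightarrow> q i = 0) \<Longrightarrow>
    \<exists>(L :: real set) v. finite L \<and> (\<forall>l\<in>L. mat_apply N H (v l) = (\<lambda>i. of_real l * v l i) \<and> (\<forall>i\<ge>N. v l i = 0)) \<and>
      q = (\<lambda>i. \<Sum>l\<in>L. v l i)"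
proof (induction as arbitrary: q)
  case Nil
  then show ?case by (intro exI[of _ "{}"]) auto
next
  case (Cons a as)
  let ?q = "\<lambda>i. mat_apply N H q i - a * q i"
  have "\<And>i. i \<ge> N \<Longrightarrow> ?q i = 0" using Cons.prems(2) by (simp add: mat_apply_def)
  then have "\<exists>(L :: real set) v. finite L \<and> (\<forall>l\<in>L. mat_apply N H (v l) = (\<lambda>i. of_real l * v l i) \<and> (\<forall>i\<ge>N. v l i = 0)) \<and>
      ?q = (\<lambda>i. \<Sum>l\<in>L. v l i)"
    using Cons.prems(1) by (intro Cons.IH) auto
  then obtain L :: "real set" and v where L: "finite L" "\<And>l. l \<in> L \<Longrightarrow> mat_apply N H (v l) = (\<lambda>i. of_real l * v l i)"
      "\<And>l i. l \<in> L \<Longrightarrow> i \<ge> N \<Longrightarrow> v l i = 0" "?q = (\<lambda>i. \<Sum>l\<in>L. v l i)"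
    by blast
  define L' where "L' = {l \<in> L. complex_of_real l \<noteq> a}"
  define c where "c l = 1 / (complex_of_real l - a)" for l
  define u where "u = (\<lambda>i. \<Sum>l\<in>L'. c l * v l i)"
  define w where "w = (\<lambda>i. q i - u i)"
  define z where "z = (\<lambda>i. mat_apply N H w i - a * w i)"
  have L': "finite L'" "L' \<subseteq> L" using L(1) by (auto simp: L'_def)
  have u_supp: "u i = 0" if "i \<ge> N" for i
    using L(3) L'(2) that by (auto simp: u_def intro!: sum.neutral)
  have w_supp: "w i = 0" if "i \<ge> N" for i
    using u_supp[OF that] Cons.prems(2)[OF that] by (simp add: w_def)
  have z_supp: "z i = 0" if "i \<ge> N" for i
    using w_supp[OF that] that by (simp add: z_def mat_apply_def)
  have Tu: "mat_apply N H u i - a * u i = (\<Sum>l\<in>L'. v l i)" for i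
  proof -
    have "mat_apply N H u i = (\<Sum>l\<in>L'. c l * (of_real l * v l i))"
      unfolding u_def mat_apply_sum using L(2) L'(2) by (intro sum.cong) auto
    then have "mat_apply N H u i - a * u i = (\<Sum>l\<in>L'. c l * (of_real l * v l i) - a * (c l * v l i))"
      by (simp add: u_def sum_distrib_left sum_subtractf)
    also have "\<dots> = (\<Sum>l\<in>L'. v l i)"
    proof (rule sum.cong)
      fix l assume "l \<in> L'"
      then have "complex_of_real l - a \<noteq> 0" by (auto simp: L'_def)
      then have "c l * (of_real l - a) = 1" by (simp add: c_def)
      moreover have "c l * (of_real l * v l i) - a * (c l * v l i) = (c l * (of_real l - a)) * v l i"
        by (simp only: left_diff_distrib right_diff_distrib mult_ac)
      ultimately show "c l * (of_real l * v l i) - a * (c l * v l i) = v l i" by simp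
    qed simp
    finally show ?thesis .
  qed
  have z: "z = (\<lambda>i. \<Sum>l\<in>L - L'. v l i)"
  proof
    fix i
    have "z i = ?q i - (mat_apply N H u i - a * u i)"
      unfolding z_def w_def mat_apply_diff by (simp add: algebra_simps)
    also have "\<dots> = (\<Sum>l\<in>L. v l i) - (\<Sum>l\<in>L'. v l i)" using fun_cong[OF L(4), of i] Tu by simp
    finally show "z i = (\<Sum>l\<in>L - L'. v l i)" using L(1) L' by (simp add: sum_diff)
  qed
  have Tz: "mat_apply N H z = (\<lambda>i. a * z i)"
  proof -
    have "mat_apply N H (\<lambda>i. \<Sum>l\<in>L - L'. 1 * v l i) = (\<lambda>i. \<Sum>l\<in>L - L'. 1 * mat_apply N H (v l) i)"
      by (rule mat_apply_sum)
    also have "\<dots> = (\<lambda>i. \<Sum>l\<in>L - L'. a * v l i)"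
      using L(2) by (intro ext sum.cong) (auto simp: L'_def)
    finally show ?thesis by (simp add: z sum_distrib_left)
  qed
  \<comment> \<open>There are no Jordan blocks: moving H - a across the inner product gives <z, z> =
    <w, (H - a) z> = 0. The eigenvalue a is real as soon as z is nonzero.\<close>
  have z0: "z = (\<lambda>_. 0)"
  proof (rule ccontr)
    assume nz: "z \<noteq> (\<lambda>_. 0)"
    then have "Im a = 0" using hermitian_eigenvalue_real[OF H Tz] z_supp by blast
    then have ca: "cnj a = a" by (simp add: complex_eq_iff)
    have "inner_on N z z = inner_on N (mat_apply N H w) z - a * inner_on N w z"
      by (simp add: z_def inner_on_def sum_subtractf left_diff_distrib sum_distrib_left mult.assoc)
    also have "inner_on N (mat_apply N H w) z = inner_on N w (mat_apply N H z)"
      by (rule inner_on_mat_apply[OF H])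
    also have "\<dots> = a * inner_on N w z"
      unfolding Tz by (simp add: inner_on_def ca sum_distrib_left mult_ac)
    finally show False using inner_on_self_eq_0[OF z_supp] nz by simp
  qed
  then have Tw: "mat_apply N H w = (\<lambda>i. a * w i)" by (simp add: z_def fun_eq_iff)
  have quw: "q i = w i + u i" for i by (simp add: w_def)
  have Tcv: "mat_apply N H (\<lambda>i. c l * v l i) = (\<lambda>i. of_real l * (c l * v l i))" if "l \<in> L'" for l
    unfolding mat_apply_scale using L(2) L'(2) that by (auto simp: mult_ac)
  show ?case
  proof (cases "w = (\<lambda>_. 0)")
    case True
    then have "q = (\<lambda>i. \<Sum>l\<in>L'. c l * v l i)" using quw by (simp add: u_def fun_eq_iff)
    moreover have "\<forall>l\<in>L'. mat_apply N H (\<lambda>i. c l * v l i) = (\<lambda>i. of_real l * (c l * v l i)) \<and> (\<forall>i\<ge>N. c l * v l i = 0)"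
      using Tcv L(3) L'(2) by auto
    ultimately show ?thesis using L'(1)
      by (intro exI[of _ L'] exI[of _ "\<lambda>l i. c l * v l i"]) blast
  next
    case False
    then have a: "a = of_real (Re a)" using hermitian_eigenvalue_real[OF H Tw] w_supp by (simp add: complex_eq_iff)
    then have nL: "Re a \<notin> L'" by (auto simp: L'_def)
    let ?v = "\<lambda>l. if l = Re a then w else (\<lambda>i. c l * v l i)"
    have "(\<Sum>l\<in>insert (Re a) L'. ?v l i) = w i + u i" for i
    proof -
      have "(\<Sum>l\<in>L'. ?v l i) = u i" unfolding u_def using nL by (intro sum.cong) auto
      then show ?thesis using L' nL by simp
    qed
    moreover have "mat_apply N H (?v l) = (\<lambda>i. of_real l * ?v l i) \<and> (\<forall>i\<ge>N. ?v l i = 0)" if "l \<in> insert (Re a) L'" for l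
    proof (cases "l = Re a")
      case True
      then show ?thesis using Tw a w_supp by simp
    next
      case False
      then show ?thesis using that Tcv L(3) L'(2) by auto
    qed
    moreover have "finite (insert (Re a) L')" using L'(1) by simp
    ultimately show ?thesis unfolding fun_eq_iff[of q] quw
      by (intro exI[of _ "insert (Re a) L'"] exI[of _ ?v] conjI ballI allI) (blast, blast, blast, simp only:)
  qed
qed

text \<open>In a basis where X is an upper triangular B, the factor B - B_kk maps vectors supported
  on the first k + 1 coordinates to vectors supported on the first k. After N factors nothing is
  left.\<close>

lemma schur_annihilation:
  assumes X: "X \<in> carrier_mat N N" and q: "q \<in> carrier_vec N"
  shows "\<exists>as. apply_linear_factors N (\<lambda>i j. X $$ (i, j)) as (\<lambda>i. if i < N then q $ i else 0) = (\<lambda>_. 0)"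
proof -
  obtain es where es: "char_poly X = (\<Prod>a\<leftarrow>es. [:- a, 1:])"
    using char_poly_factorized[OF X] by blast
  obtain B where B: "B \<in> carrier_mat N N" "upper_triangular B" "similar_mat X B"
    using schur_decomposition_exists[OF X es] by blast
  obtain P Q where "similar_mat_wit X B P Q" using B(3) by (auto simp: similar_mat_def)
  then have P: "P \<in> carrier_mat N N" "Q \<in> carrier_mat N N" "P * Q = 1\<^sub>m N" "Q * P = 1\<^sub>m N" "X = P * B * Q"
    using similar_mat_witD2[OF X] by auto
  have XP: "X * P = P * B"
  proof -
    have "X * P = P * B * (Q * P)" unfolding P(5) using P B by (simp add: assoc_mult_mat[of _ N N _ N _ N])
    then show ?thesis using P B by simp
  qed
  let ?X = "\<lambda>i j. X $$ (i, j)"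
  let ?f = "\<lambda>v i. if i < N then v $ i else 0"
  have ap: "mat_apply N ?X (?f v) i = ?f (X *\<^sub>v v) i" if "v \<in> carrier_vec N" for v i
    using X that by (simp add: mat_apply_def scalar_prod_def lessThan_atLeast0)
  have kill: "\<exists>as. \<forall>v\<in>carrier_vec N. (\<forall>i. k \<le> i \<longrightarrow> i < N \<longrightarrow> v $ i = 0) \<longrightarrow>
      apply_linear_factors N ?X as (?f (P *\<^sub>v v)) = (\<lambda>_. 0)" if "k \<le> N" for k
    using that
  proof (induction k)
    case 0
    have "?f (P *\<^sub>v v) = (\<lambda>_. 0)" if v: "v \<in> carrier_vec N" "\<forall>i. 0 \<le> i \<longrightarrow> i < N \<longrightarrow> v $ i = 0" for v
      using v P by (auto simp: fun_eq_iff scalar_prod_def intro!: sum.neutral)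
    then show ?case by (intro exI[of _ "[]"]) auto
  next
    case (Suc k)
    then obtain as where as: "\<And>v. v \<in> carrier_vec N \<Longrightarrow> (\<forall>i. k \<le> i \<longrightarrow> i < N \<longrightarrow> v $ i = 0) \<Longrightarrow>
      apply_linear_factors N ?X as (?f (P *\<^sub>v v)) = (\<lambda>_. 0)" by auto
    let ?b = "B $$ (k, k)"
    have "apply_linear_factors N ?X (?b # as) (?f (P *\<^sub>v v)) = (\<lambda>_. 0)"
      if v: "v \<in> carrier_vec N" "\<forall>i. Suc k \<le> i \<longrightarrow> i < N \<longrightarrow> v $ i = 0" for v
    proof -
      let ?v = "B *\<^sub>v v - ?b \<cdot>\<^sub>v v"
      have vc: "?v \<in> carrier_vec N" using B v by auto
      have "P *\<^sub>v ?v = X *\<^sub>v (P *\<^sub>v v) - ?b \<cdot>\<^sub>v (P *\<^sub>v v)"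
      proof -
        have "P *\<^sub>v ?v = P *\<^sub>v (B *\<^sub>v v) - P *\<^sub>v (?b \<cdot>\<^sub>v v)"
          using P B v by (intro mult_minus_distrib_mat_vec[of _ N N]) auto
        also have "P *\<^sub>v (B *\<^sub>v v) = X *\<^sub>v (P *\<^sub>v v)"
          using XP P B X v by (metis assoc_mult_mat_vec)
        also have "P *\<^sub>v (?b \<cdot>\<^sub>v v) = ?b \<cdot>\<^sub>v (P *\<^sub>v v)"
          using P v by (intro mult_mat_vec) auto
        finally show ?thesis .
      qed
      then have e: "(\<lambda>i. mat_apply N ?X (?f (P *\<^sub>v v)) i - ?b * ?f (P *\<^sub>v v) i) = ?f (P *\<^sub>v ?v)"
        using P X v by (subst ap) (auto simp: fun_eq_iff)
      have "?v $ i = 0" if i: "k \<le> i" "i < N" for i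
      proof -
        have "(B *\<^sub>v v) $ i = (\<Sum>j\<in>{0..<N}. B $$ (i, j) * v $ j)"
          using B v i by (simp add: scalar_prod_def)
        also have "\<dots> = (\<Sum>j\<in>{0..<N}. if j = k then B $$ (i, k) * v $ k else 0)"
        proof (rule sum.cong)
          fix j assume j: "j \<in> {0..<N}"
          show "B $$ (i, j) * v $ j = (if j = k then B $$ (i, k) * v $ k else 0)"
          proof (cases "j < k")
            case True
            then show ?thesis using i B(1,2) by (auto simp: upper_triangular_def)
          next
            case False
            then have "j = k \<or> Suc k \<le> j" by linarith
            then show ?thesis using j v(2) by fastforce
          qed
        qed simp
        also have "\<dots> = B $$ (i, k) * v $ k" using i by (simp add: sum.delta)
        finally have "?v $ i = B $$ (i, k) * v $ k - ?b * v $ i" using B v i by simp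
        also have "\<dots> = 0"
        proof (cases "i = k")
          case False
          then show ?thesis using i B(1,2) v(2) by (auto simp: upper_triangular_def)
        qed simp
        finally show ?thesis .
      qed
      then have "apply_linear_factors N ?X as (?f (P *\<^sub>v ?v)) = (\<lambda>_. 0)"
        by (intro as vc) auto
      then show ?thesis by (simp only: apply_linear_factors.simps e)
    qed
    then show ?case by blast
  qed
  obtain as where as: "\<And>v. v \<in> carrier_vec N \<Longrightarrow> apply_linear_factors N ?X as (?f (P *\<^sub>v v)) = (\<lambda>_. 0)"
    using kill[of N] by auto
  have "P *\<^sub>v (Q *\<^sub>v q) = q" using P q by (metis assoc_mult_mat_vec one_mult_mat_vec)
  moreover have "Q *\<^sub>v q \<in> carrier_vec N" using P q by auto
  ultimately have "apply_linear_factors N ?X as (?f q) = (\<lambda>_. 0)" using as[of "Q *\<^sub>v q"] by (simp only:)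
  then show ?thesis by blast
qed

section \<open>Finitely supported measures are determined by their moments\<close>

lemma poly_interpolation_exists:
  fixes g :: "'a :: field \<Rightarrow> 'a"
  assumes "finite L"
  shows "\<exists>p. \<forall>x\<in>L. poly p x = g x"
  using assms
proof (induction L)
  case (insert a L)
  then obtain p where p: "\<forall>x\<in>L. poly p x = g x" by auto
  let ?r = "\<Prod>b\<in>L. [:- b, 1:]"
  have r: "poly ?r a \<noteq> 0" "\<forall>x\<in>L. poly ?r x = 0" using insert by (auto simp: poly_prod)
  define s where "s = p + Polynomial.smult ((g a - poly p a) / poly ?r a) ?r"
  have s: "poly s x = poly p x + (g a - poly p a) / poly ?r a * poly ?r x" for x
    by (simp only: s_def poly_add poly_smult)
  have "poly s a = g a" using r(1) by (simp only: s nonzero_eq_divide_eq times_divide_eq_left nonzero_mult_div_cancel_right) simp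
  moreover have "poly s x = g x" if "x \<in> L" for x using p r(2) that unfolding s by simp
  ultimately show ?case by (intro exI[of _ s]) simp
qed auto

text \<open>The square of a polynomial vanishing on L has integral 0, so the measure lives on L,
  where every indicator agrees with an interpolating polynomial. This gives the uniqueness behind
  the definite description in \<open>spectral_measure\<close>.\<close>

lemma measure_eq_of_finite_moments:
  fixes \<mu> :: "real measure"
  assumes \<mu>: "prob_space \<mu>" "sets \<mu> = sets borel" and L: "finite L"
    and mom: "\<And>m. integrable \<mu> (\<lambda>x. x ^ m) \<and> (LINT x|\<mu>. x ^ m) = (\<Sum>l\<in>L. w l * l ^ m)"
    and B: "B \<in> sets borel"
  shows "measure \<mu> B = (\<Sum>l\<in>L. w l * indicator B l)"
proof -
  interpret prob_space \<mu> by fact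
  have [measurable_cong]: "sets \<mu> = sets borel" by fact
  have [measurable]: "B \<in> sets borel" by fact
  have pm: "poly p \<in> borel_measurable borel" for p :: "real poly"
    by (intro borel_measurable_continuous_onI continuous_on_poly continuous_on_id)
  have P: "integrable \<mu> (poly p)" "(LINT x|\<mu>. poly p x) = (\<Sum>l\<in>L. w l * poly p l)" for p :: "real poly"
  proof -
    have eq: "poly p = (\<lambda>x. \<Sum>i\<le>degree p. coeff p i * x ^ i)" by (rule ext) (rule poly_altdef)
    have mi: "integrable \<mu> (\<lambda>x. x ^ m)" and ml: "(LINT x|\<mu>. x ^ m) = (\<Sum>l\<in>L. w l * l ^ m)" for m
      using mom by blast+
    show "integrable \<mu> (poly p)"
      by (subst eq) (intro Bochner_Integration.integrable_sum integrable_mult_right mi)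
    have "(LINT x|\<mu>. poly p x) = (\<Sum>i\<le>degree p. (LINT x|\<mu>. coeff p i * x ^ i))"
      by (subst eq) (intro Bochner_Integration.integral_sum integrable_mult_right mi)
    also have "\<dots> = (\<Sum>i\<le>degree p. coeff p i * (\<Sum>l\<in>L. w l * l ^ i))"
      by (simp only: integral_mult_right_zero ml)
    also have "\<dots> = (\<Sum>l\<in>L. \<Sum>i\<le>degree p. coeff p i * (w l * l ^ i))"
      unfolding sum_distrib_left by (rule sum.swap)
    also have "\<dots> = (\<Sum>l\<in>L. w l * poly p l)"
      by (simp only: poly_altdef sum_distrib_left mult.left_commute)
    finally show "(LINT x|\<mu>. poly p x) = (\<Sum>l\<in>L. w l * poly p l)" .
  qed
  let ?r = "(\<Prod>b\<in>L. [:- b, 1:])\<^sup>2 :: real poly"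
  have r0: "poly ?r x = 0 \<longleftrightarrow> x \<in> L" for x using L by (auto simp: poly_prod)
  have "(LINT x|\<mu>. poly ?r x) = 0" unfolding P(2) using r0 by (auto intro!: sum.neutral)
  moreover have "AE x in \<mu>. 0 \<le> poly ?r x" by (auto simp: poly_power)
  ultimately have "AE x in \<mu>. poly ?r x = 0"
    using integral_nonneg_eq_0_iff_AE[OF P(1)[of ?r]] by blast
  then have AE: "AE x in \<mu>. x \<in> L" by (simp only: r0)
  obtain p :: "real poly" where p: "\<forall>x\<in>L. poly p x = indicator B x"
    using poly_interpolation_exists[OF L, of "indicator B"] by blast
  have "measure \<mu> B = (LINT x|\<mu>. indicator B x)" using B \<mu>(2) by simp
  also have "\<dots> = (LINT x|\<mu>. poly p x)"
  proof (rule integral_cong_AE)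
    show "poly p \<in> borel_measurable \<mu>" using pm by (simp cong: measurable_cong_sets)
    show "AE x in \<mu>. indicator B x = poly p x" using AE p by (auto elim!: eventually_mono)
  qed simp
  also have "\<dots> = (\<Sum>l\<in>L. w l * indicator B l)" unfolding P(2) using p by (intro sum.cong) auto
  finally show ?thesis .
qed

text \<open>\<open>point_measure\<close> lives on the power set of L; the push-forward moves it to
  the Borel sets of the line.\<close>

definition discrete_real_measure :: "real set \<Rightarrow> (real \<Rightarrow> real) \<Rightarrow> real measure" where
  "discrete_real_measure L w = distr (point_measure L (\<lambda>l. ennreal (w l))) borel (\<lambda>x. x)"

lemma sets_discrete_real_measure: "sets (discrete_real_measure L w) = sets borel"
  by (simp add: discrete_real_measure_def)

lemma integral_discrete_real_measure:
  fixes f :: "real \<Rightarrow> 'b :: {banach, second_countable_topology}"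
  assumes L: "finite L" and w: "\<And>l. w l \<ge> 0" and f: "f \<in> borel_measurable borel"
  shows "(LINT x|discrete_real_measure L w. f x) = (\<Sum>l\<in>L. w l *\<^sub>R f l)" "integrable (discrete_real_measure L w) f"
proof -
  have meas: "(\<lambda>x. x) \<in> point_measure L (\<lambda>l. ennreal (w l)) \<rightarrow>\<^sub>M (borel :: real measure)"
    by (simp add: measurable_point_measure_eq1)
  show "(LINT x|discrete_real_measure L w. f x) = (\<Sum>l\<in>L. w l *\<^sub>R f l)"
    unfolding discrete_real_measure_def integral_distr[OF meas f]
    by (rule lebesgue_integral_point_measure_finite[OF L w])
  show "integrable (discrete_real_measure L w) f"
    unfolding discrete_real_measure_def integrable_distr_eq[OF meas f]
    by (rule integrable_point_measure_finite[OF L])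
qed

text \<open>The atom at an eigenvalue has the squared norm of the component of q in that eigenspace
  as its weight. The transform is expressed through a solution y of (i \<eta> - X) y = q, because
  the analysis of the deformation starts from this linear system.\<close>

theorem spectral_measure_hermitian:
  assumes X: "X \<in> carrier_mat N N" and H: "hermitian_on N (\<lambda>i j. X $$ (i, j))"
    and q: "q \<in> carrier_vec N" and q1: "q \<bullet>c q = 1"
  shows "real_distribution (spectral_measure X q)"
    and "\<And>\<eta>. \<eta> > 0 \<Longrightarrow> \<exists>y. (\<forall>i<N. \<i> * of_real \<eta> * y i - (\<Sum>k<N. X $$ (i, k) * y k) = q $ i) \<and>
      (LINT x|spectral_measure X q. stieltjes_kernel \<eta> x) = (\<Sum>i<N. y i * cnj (q $ i))"
proof -
  let ?X = "\<lambda>i j. X $$ (i, j)"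
  let ?q = "\<lambda>i. if i < N then q $ i else 0"
  obtain as where as: "apply_linear_factors N ?X as ?q = (\<lambda>_. 0)"
    using schur_annihilation[OF X q] by blast
  obtain L :: "real set" and v where L: "finite L" "\<And>l. l \<in> L \<Longrightarrow> mat_apply N ?X (v l) = (\<lambda>i. of_real l * v l i)"
      "\<And>l i. l \<in> L \<Longrightarrow> i \<ge> N \<Longrightarrow> v l i = 0" "?q = (\<lambda>i. \<Sum>l\<in>L. v l i)"
    using eigenvector_decomposition_of_annihilated[OF H as] by auto
  define w where "w l = (\<Sum>i<N. (cmod (v l i))\<^sup>2)" for l
  have w0: "w l \<ge> 0" for l by (simp add: w_def sum_nonneg)
  have orth: "inner_on N (\<lambda>i. \<Sum>l\<in>L. c l * v l i) ?q = (\<Sum>l\<in>L. c l * of_real (w l))" for c :: "real \<Rightarrow> complex"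
  proof -
    have "inner_on N (\<lambda>i. \<Sum>l\<in>L. c l * v l i) ?q = (\<Sum>i<N. \<Sum>l\<in>L. \<Sum>k\<in>L. c l * (v l i * cnj (v k i)))"
      unfolding inner_on_def L(4) by (simp add: sum_product mult.assoc)
    also have "\<dots> = (\<Sum>l\<in>L. \<Sum>k\<in>L. \<Sum>i<N. c l * (v l i * cnj (v k i)))"
      by (subst sum.swap) (intro sum.cong refl sum.swap)
    also have "\<dots> = (\<Sum>l\<in>L. \<Sum>k\<in>L. c l * inner_on N (v l) (v k))"
      by (simp add: inner_on_def sum_distrib_left)
    also have "\<dots> = (\<Sum>l\<in>L. \<Sum>k\<in>L. if k = l then c l * of_real (w l) else 0)"
    proof (intro sum.cong refl)
      fix l k assume lk: "l \<in> L" "k \<in> L"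
      show "c l * inner_on N (v l) (v k) = (if k = l then c l * of_real (w l) else 0)"
        using eigenvectors_orthogonal[OF H L(2)[OF lk(1)] L(2)[OF lk(2)]]
        by (auto simp: inner_on_self w_def)
    qed
    also have "\<dots> = (\<Sum>l\<in>L. c l * of_real (w l))"
      using L(1) by (intro sum.cong refl) (simp add: sum.delta)
    finally show ?thesis .
  qed
  have power: "X ^\<^sub>m m *\<^sub>v q \<in> carrier_vec N \<and> (\<forall>i<N. (X ^\<^sub>m m *\<^sub>v q) $ i = (\<Sum>l\<in>L. of_real (l ^ m) * v l i))" for m
  proof (induction m)
    case 0
    have "X ^\<^sub>m 0 *\<^sub>v q = q" using X q by simp
    moreover have "q $ i = (\<Sum>l\<in>L. v l i)" if "i < N" for i using fun_cong[OF L(4), of i] that by simp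
    ultimately show ?case using q by simp
  next
    case (Suc m)
    have c: "X ^\<^sub>m m \<in> carrier_mat N N" using X by simp
    have "X ^\<^sub>m Suc m *\<^sub>v q = X *\<^sub>v (X ^\<^sub>m m *\<^sub>v q)"
    proof -
      have "X ^\<^sub>m Suc m = X * X ^\<^sub>m m"
        using X by (induction m) (auto simp: assoc_mult_mat[of _ N N _ N _ N])
      then show ?thesis using X q c by (simp add: assoc_mult_mat_vec[of _ N N _ N])
    qed
    moreover have "(X *\<^sub>v (X ^\<^sub>m m *\<^sub>v q)) $ i = (\<Sum>l\<in>L. of_real (l ^ Suc m) * v l i)" if i: "i < N" for i
    proof -
      have "(X *\<^sub>v (X ^\<^sub>m m *\<^sub>v q)) $ i = (\<Sum>k<N. X $$ (i, k) * (\<Sum>l\<in>L. of_real (l ^ m) * v l k))"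
        using X Suc i by (auto simp: scalar_prod_def lessThan_atLeast0 intro!: sum.cong)
      also have "\<dots> = mat_apply N ?X (\<lambda>i. \<Sum>l\<in>L. of_real (l ^ m) * v l i) i"
        using i by (simp add: mat_apply_def)
      also have "\<dots> = (\<Sum>l\<in>L. of_real (l ^ m) * (of_real l * v l i))"
        unfolding mat_apply_sum using L(2) by (intro sum.cong) auto
      finally show ?thesis by (simp add: mult_ac)
    qed
    ultimately show ?case using X Suc by auto
  qed
  have inner: "((X ^\<^sub>m m) *\<^sub>v q) \<bullet>c q = of_real (\<Sum>l\<in>L. w l * l ^ m)" for m
  proof -
    have "((X ^\<^sub>m m) *\<^sub>v q) \<bullet>c q = inner_on N (\<lambda>i. \<Sum>l\<in>L. of_real (l ^ m) * v l i) ?q"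
      using power[of m] q by (auto simp: scalar_prod_def inner_on_def lessThan_atLeast0 intro!: sum.cong)
    also have "\<dots> = of_real (\<Sum>l\<in>L. w l * l ^ m)" unfolding orth by (simp add: mult.commute)
    finally show ?thesis .
  qed
  have w1: "(\<Sum>l\<in>L. w l) = 1"
  proof -
    have "complex_of_real (\<Sum>l\<in>L. w l * l ^ 0) = 1" using inner[of 0] X q q1 by simp
    then show ?thesis unfolding of_real_eq_1_iff by simp
  qed
  define \<mu> where "\<mu> = discrete_real_measure L w"
  have meas: "(\<lambda>x. x) \<in> point_measure L (\<lambda>l. ennreal (w l)) \<rightarrow>\<^sub>M (borel :: real measure)"
    by (simp add: measurable_point_measure_eq1)
  have p\<mu>: "prob_space \<mu>"
  proof
    have "emeasure \<mu> (space \<mu>) = emeasure (point_measure L (\<lambda>l. ennreal (w l))) L"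
      unfolding \<mu>_def discrete_real_measure_def using meas by (subst emeasure_distr) (auto simp: space_point_measure)
    also have "\<dots> = ennreal (\<Sum>l\<in>L. w l)"
      using L(1) w0 by (simp add: emeasure_point_measure_finite)
    finally show "emeasure \<mu> (space \<mu>) = 1" using w1 by simp
  qed
  have spec: "is_spectral_measure X q \<mu>"
    unfolding is_spectral_measure_def
  proof (intro conjI allI p\<mu>)
    show "sets \<mu> = sets borel" by (simp only: \<mu>_def sets_discrete_real_measure)
    fix m :: nat
    have m: "(\<lambda>x :: real. x ^ m) \<in> borel_measurable borel" by measurable
    show "integrable \<mu> (\<lambda>x. x ^ m)"
      unfolding \<mu>_def by (rule integral_discrete_real_measure(2)[OF L(1) w0 m])
    show "complex_of_real (LINT x|\<mu>. x ^ m) = ((X ^\<^sub>m m) *\<^sub>v q) \<bullet>c q"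
      unfolding inner \<mu>_def integral_discrete_real_measure(1)[OF L(1) w0 m] by simp
  qed
  have uniq: "\<rho> = \<mu>" if \<rho>: "is_spectral_measure X q \<rho>" for \<rho>
  proof (rule measure_eqI)
    interpret \<rho>: prob_space \<rho> using \<rho> by (simp add: is_spectral_measure_def)
    interpret \<mu>: prob_space \<mu> by (rule p\<mu>)
    show "sets \<rho> = sets \<mu>" using \<rho> by (simp add: is_spectral_measure_def \<mu>_def sets_discrete_real_measure)
    have "measure \<tau> B = (\<Sum>l\<in>L. w l * indicator B l)" if "is_spectral_measure X q \<tau>" "B \<in> sets borel" for \<tau> B
      using that L(1) unfolding is_spectral_measure_def inner of_real_eq_iff
      by (intro measure_eq_of_finite_moments) auto
    then show "emeasure \<rho> B = emeasure \<mu> B" if "B \<in> sets \<rho>" for B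
      using that \<rho> spec by (simp add: \<rho>.emeasure_eq_measure \<mu>.emeasure_eq_measure is_spectral_measure_def)
  qed
  have eq: "spectral_measure X q = \<mu>"
    unfolding spectral_measure_def by (rule the_equality[where P = "is_spectral_measure X q", OF spec uniq])
  have "sets \<mu> = sets borel" by (simp only: \<mu>_def sets_discrete_real_measure)
  with p\<mu> have rd: "real_distribution \<mu>"
    by (intro real_distribution.intro real_distribution_axioms.intro)
  then show "real_distribution (spectral_measure X q)" by (simp only: eq)
  show "\<exists>y. (\<forall>i<N. \<i> * of_real \<eta> * y i - (\<Sum>k<N. X $$ (i, k) * y k) = q $ i) \<and>
      (LINT x|spectral_measure X q. stieltjes_kernel \<eta> x) = (\<Sum>i<N. y i * cnj (q $ i))" if \<eta>: "\<eta> > 0" for \<eta>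
  proof (intro exI conjI allI impI)
    let ?y = "\<lambda>i. \<Sum>l\<in>L. stieltjes_kernel \<eta> l * v l i"
    fix i assume i: "i < N"
    have "(\<Sum>k<N. X $$ (i, k) * ?y k) = mat_apply N ?X ?y i" using i by (simp add: mat_apply_def)
    also have "\<dots> = (\<Sum>l\<in>L. stieltjes_kernel \<eta> l * (of_real l * v l i))"
      unfolding mat_apply_sum using L(2) by (intro sum.cong) auto
    finally have "\<i> * of_real \<eta> * ?y i - (\<Sum>k<N. X $$ (i, k) * ?y k) =
      (\<Sum>l\<in>L. \<i> * of_real \<eta> * (stieltjes_kernel \<eta> l * v l i) - stieltjes_kernel \<eta> l * (of_real l * v l i))"
      by (simp only: sum_distrib_left sum_subtractf)
    also have "\<dots> = (\<Sum>l\<in>L. v l i)"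
    proof (rule sum.cong)
      fix l
      have "stieltjes_kernel \<eta> l * (\<i> * of_real \<eta> - of_real l) = 1"
        using stieltjes_denominator_nonzero[OF \<eta>, of l] by (simp add: stieltjes_kernel_def)
      then have "stieltjes_kernel \<eta> l * (\<i> * of_real \<eta> - of_real l) * v l i = v l i" by simp
      then show "\<i> * of_real \<eta> * (stieltjes_kernel \<eta> l * v l i) - stieltjes_kernel \<eta> l * (of_real l * v l i) = v l i"
        by (simp only: right_diff_distrib left_diff_distrib mult_ac)
    qed simp
    also have "\<dots> = q $ i" using fun_cong[OF L(4), of i] i by simp
    finally show "\<i> * of_real \<eta> * ?y i - (\<Sum>k<N. X $$ (i, k) * ?y k) = q $ i" .
  next
    let ?y = "\<lambda>i. \<Sum>l\<in>L. stieltjes_kernel \<eta> l * v l i"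
    have "(\<Sum>i<N. ?y i * cnj (q $ i)) = inner_on N ?y ?q"
      unfolding inner_on_def by (intro sum.cong) auto
    also have "\<dots> = (\<Sum>l\<in>L. stieltjes_kernel \<eta> l * of_real (w l))" by (rule orth)
    also have "\<dots> = (LINT x|spectral_measure X q. stieltjes_kernel \<eta> x)"
      unfolding eq \<mu>_def integral_discrete_real_measure(1)[OF L(1) w0 stieltjes_kernel_measurable]
      by (simp add: scaleR_conv_of_real mult.commute)
    finally show "(LINT x|spectral_measure X q. stieltjes_kernel \<eta> x) = (\<Sum>i<N. ?y i * cnj (q $ i))" by simp
  qed
qed

section \<open>Resolvents on the imaginary axis\<close>

definition norm_sq :: "nat \<Rightarrow> (nat \<Rightarrow> complex) \<Rightarrow> real" where
  "norm_sq N v = (\<Sum>i<N. (cmod (v i))\<^sup>2)"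

lemma norm_sq_nonneg [simp]: "0 \<le> norm_sq N v"
  by (simp add: norm_sq_def sum_nonneg)

lemma norm_sq_ge_component: "i < N \<Longrightarrow> (cmod (v i))\<^sup>2 \<le> norm_sq N v"
  unfolding norm_sq_def by (rule member_le_sum) auto

lemma norm_sq_delta: "j < N \<Longrightarrow> norm_sq N (\<lambda>i. if i = j then 1 else 0) = 1"
proof -
  have "norm_sq N (\<lambda>i. if i = j then 1 else 0) = (\<Sum>i<N. if i = j then 1 else 0)"
    unfolding norm_sq_def by (rule sum.cong) auto
  then show "j < N \<Longrightarrow> ?thesis" by simp
qed

lemma cmod_sum_mult_le:
  "(cmod (\<Sum>i\<in>I. a i * b i))\<^sup>2 \<le> (\<Sum>i\<in>I. (cmod (a i))\<^sup>2) * (\<Sum>i\<in>I. (cmod (b i))\<^sup>2)"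
proof -
  have "cmod (\<Sum>i\<in>I. a i * b i) \<le> (\<Sum>i\<in>I. cmod (a i) * cmod (b i))"
    by (rule order.trans[OF norm_sum]) (simp add: norm_mult)
  then have "(cmod (\<Sum>i\<in>I. a i * b i))\<^sup>2 \<le> (\<Sum>i\<in>I. cmod (a i) * cmod (b i))\<^sup>2"
    by (intro power_mono) auto
  also have "\<dots> \<le> (\<Sum>i\<in>I. (cmod (a i))\<^sup>2) * (\<Sum>i\<in>I. (cmod (b i))\<^sup>2)"
    by (rule Cauchy_Schwarz_ineq_sum)
  finally show ?thesis .
qed

lemma hermitian_onD: "hermitian_on N H \<Longrightarrow> i < N \<Longrightarrow> j < N \<Longrightarrow> H j i = cnj (H i j)"
  unfolding hermitian_on_def by blast

lemma hermitian_on_transpose: "hermitian_on N H \<Longrightarrow> hermitian_on N (\<lambda>i j. H j i)"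
  unfolding hermitian_on_def by blast

lemma hermitian_form_real:
  assumes "hermitian_on N H"
  shows "Im (\<Sum>i<N. \<Sum>j<N. cnj (w i) * H i j * w j) = 0"
proof -
  let ?S = "\<Sum>i<N. \<Sum>j<N. cnj (w i) * H i j * w j"
  have "cnj ?S = (\<Sum>i<N. \<Sum>j<N. w i * cnj (H i j) * cnj (w j))" by simp
  also have "\<dots> = (\<Sum>i<N. \<Sum>j<N. cnj (w j) * H j i * w i)"
  proof (intro sum.cong refl)
    fix i j assume "i \<in> {..<N}" "j \<in> {..<N}"
    then have "cnj (H i j) = H j i" using hermitian_onD[OF assms, of i j] by simp
    then show "w i * cnj (H i j) * cnj (w j) = cnj (w j) * H j i * w i" by (simp only: mult_ac)
  qed
  also have "\<dots> = ?S" by (rule sum.swap)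
  finally have "Im ?S = Im (cnj ?S)" by (simp only:)
  also have "\<dots> = - Im ?S" by (rule cnj.simps(2))
  finally show ?thesis by linarith
qed

text \<open>The Hermitian form of H is real, so the inner product of v with w has imaginary part
  exactly \<eta> times the squared norm of w. Cauchy-Schwarz does the rest.\<close>

lemma norm_sq_resolvent_le:
  assumes H: "hermitian_on N H" and \<eta>: "\<eta> > 0"
    and eq: "\<And>i. i < N \<Longrightarrow> \<i> * of_real \<eta> * w i - (\<Sum>j<N. H i j * w j) = v i"
  shows "\<eta>\<^sup>2 * norm_sq N w \<le> norm_sq N v"
proof -
  have "(\<Sum>i<N. cnj (w i) * v i) = (\<Sum>i<N. \<i> * of_real \<eta> * of_real ((cmod (w i))\<^sup>2) - (\<Sum>j<N. cnj (w i) * H i j * w j))"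
  proof (rule sum.cong)
    fix i assume "i \<in> {..<N}"
    then have v: "v i = \<i> * of_real \<eta> * w i - (\<Sum>j<N. H i j * w j)" using eq[of i] by simp
    have "cnj (w i) * v i = \<i> * of_real \<eta> * (w i * cnj (w i)) - cnj (w i) * (\<Sum>j<N. H i j * w j)"
      unfolding v by (simp only: right_diff_distrib mult_ac)
    then show "cnj (w i) * v i = \<i> * of_real \<eta> * of_real ((cmod (w i))\<^sup>2) - (\<Sum>j<N. cnj (w i) * H i j * w j)"
      by (simp only: complex_norm_square sum_distrib_left mult.assoc)
  qed simp
  also have "\<dots> = \<i> * of_real (\<eta> * norm_sq N w) - (\<Sum>i<N. \<Sum>j<N. cnj (w i) * H i j * w j)"
    by (simp add: norm_sq_def sum_subtractf sum_distrib_left mult.assoc)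
  finally have "Im (\<Sum>i<N. cnj (w i) * v i) = \<eta> * norm_sq N w"
    using hermitian_form_real[OF H, of w] by simp
  then have "\<eta> * norm_sq N w \<le> cmod (\<Sum>i<N. cnj (w i) * v i)"
    using abs_Im_le_cmod[of "\<Sum>i<N. cnj (w i) * v i"] by linarith
  then have "(\<eta> * norm_sq N w)\<^sup>2 \<le> (cmod (\<Sum>i<N. cnj (w i) * v i))\<^sup>2"
    using \<eta> by (intro power_mono) auto
  also have "\<dots> \<le> norm_sq N w * norm_sq N v"
    using cmod_sum_mult_le[of "\<lambda>i. cnj (w i)" v "{..<N}"] by (simp add: norm_sq_def)
  finally have *: "norm_sq N w * (\<eta>\<^sup>2 * norm_sq N w) \<le> norm_sq N w * norm_sq N v"
    by (simp add: power2_eq_square mult_ac)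
  show ?thesis
  proof (cases "norm_sq N w = 0")
    case False
    then have "norm_sq N w > 0" using norm_sq_nonneg[of N w] by linarith
    then show ?thesis using * by simp
  qed simp
qed

definition shifted_matrix :: "nat \<Rightarrow> complex \<Rightarrow> (nat \<Rightarrow> nat \<Rightarrow> complex) \<Rightarrow> complex Matrix.mat" where
  "shifted_matrix N z H = Matrix.mat N N (\<lambda>(i, j). (if i = j then z else 0) - H i j)"

text \<open>Cramer's rule makes the entries rational functions of the entries of H, which gives
  measurability at once, and makes the definition total.\<close>

definition resolvent :: "nat \<Rightarrow> complex \<Rightarrow> (nat \<Rightarrow> nat \<Rightarrow> complex) \<Rightarrow> nat \<Rightarrow> nat \<Rightarrow> complex" where
  "resolvent N z H i j = adj_mat (shifted_matrix N z H) $$ (i, j) / Determinant.det (shifted_matrix N z H)"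

lemma shifted_matrix_carrier [simp]: "shifted_matrix N z H \<in> carrier_mat N N"
  by (simp add: shifted_matrix_def)

lemma shifted_matrix_row_sum:
  assumes "i < N"
  shows "(\<Sum>k<N. shifted_matrix N z H $$ (i, k) * w k) = z * w i - (\<Sum>k<N. H i k * w k)"
proof -
  have "(\<Sum>k<N. shifted_matrix N z H $$ (i, k) * w k) = (\<Sum>k<N. (if k = i then z * w i else 0) - H i k * w k)"
    using assms by (intro sum.cong) (auto simp: shifted_matrix_def left_diff_distrib)
  then show ?thesis using assms by (simp add: sum_subtractf sum.delta)
qed

lemma shifted_matrix_col_sum:
  assumes "j < N"
  shows "(\<Sum>k<N. w k * shifted_matrix N z H $$ (k, j)) = z * w j - (\<Sum>k<N. w k * H k j)"
proof -
  have "(\<Sum>k<N. w k * shifted_matrix N z H $$ (k, j)) = (\<Sum>k<N. (if k = j then z * w j else 0) - w k * H k j)"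
    using assms by (intro sum.cong) (auto simp: shifted_matrix_def right_diff_distrib)
  then show ?thesis using assms by (simp add: sum_subtractf sum.delta)
qed

lemma det_shifted_matrix_nonzero:
  assumes H: "hermitian_on N H" and \<eta>: "\<eta> > 0"
  shows "Determinant.det (shifted_matrix N (\<i> * of_real \<eta>) H) \<noteq> 0"
proof
  let ?B = "shifted_matrix N (\<i> * of_real \<eta>) H"
  assume "Determinant.det ?B = 0"
  then obtain v where v: "v \<in> carrier_vec N" "v \<noteq> 0\<^sub>v N" "?B *\<^sub>v v = 0\<^sub>v N"
    using det_0_iff_vec_prod_zero[OF shifted_matrix_carrier] by blast
  have "\<i> * of_real \<eta> * (v $ i) - (\<Sum>j<N. H i j * v $ j) = 0" if "i < N" for i
  proof -
    have "(?B *\<^sub>v v) $ i = (\<Sum>k<N. ?B $$ (i, k) * v $ k)"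
      using v(1) that by (simp add: scalar_prod_def lessThan_atLeast0 shifted_matrix_def)
    then show ?thesis using v(3) that by (simp only: shifted_matrix_row_sum index_zero_vec)
  qed
  then have "\<eta>\<^sup>2 * norm_sq N (\<lambda>i. v $ i) \<le> norm_sq N (\<lambda>i. 0)"
    by (intro norm_sq_resolvent_le[OF H \<eta>]) auto
  moreover have "norm_sq N (\<lambda>i. 0) = 0" by (simp add: norm_sq_def)
  ultimately have "norm_sq N (\<lambda>i. v $ i) \<le> 0"
    using \<eta> by (simp add: mult_le_0_iff)
  then have "norm_sq N (\<lambda>i. v $ i) = 0" by (intro order.antisym norm_sq_nonneg)
  then have v0: "v $ i = 0" if "i < N" for i
    using norm_sq_ge_component[OF that, of "\<lambda>i. v $ i"] by simp
  have "v = 0\<^sub>v N"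
  proof (rule eq_vecI)
    fix i assume "i < dim_vec (0\<^sub>v N :: complex Matrix.vec)"
    then show "v $ i = 0\<^sub>v N $ i" using v0[of i] by simp
  qed (use v(1) in simp)
  then show False using v(2) by blast
qed

context
  fixes N :: nat and H :: "nat \<Rightarrow> nat \<Rightarrow> complex" and \<eta> :: real and G :: "nat \<Rightarrow> nat \<Rightarrow> complex"
  assumes H: "hermitian_on N H" and \<eta>: "\<eta> > 0"
  defines "G \<equiv> resolvent N (\<i> * of_real \<eta>) H"
begin

lemma resolvent_right:
  assumes "i < N" "j < N"
  shows "\<i> * of_real \<eta> * G i j - (\<Sum>k<N. H i k * G k j) = (if i = j then 1 else 0)"
proof -
  let ?B = "shifted_matrix N (\<i> * of_real \<eta>) H"
  have a: "adj_mat ?B \<in> carrier_mat N N" "?B * adj_mat ?B = Determinant.det ?B \<cdot>\<^sub>m 1\<^sub>m N"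
    using adj_mat[OF shifted_matrix_carrier] by blast+
  have "(\<Sum>k<N. ?B $$ (i, k) * adj_mat ?B $$ (k, j)) = (?B * adj_mat ?B) $$ (i, j)"
    using a(1) assms by (simp add: scalar_prod_def lessThan_atLeast0 shifted_matrix_def)
  also have "\<dots> = Determinant.det ?B * (if i = j then 1 else 0)" unfolding a(2) using assms by simp
  finally have "(\<Sum>k<N. ?B $$ (i, k) * G k j) = (if i = j then 1 else 0)"
    using det_shifted_matrix_nonzero[OF H \<eta>] by (simp add: G_def resolvent_def sum_divide_distrib[symmetric])
  then show ?thesis using assms by (simp only: shifted_matrix_row_sum)
qed

lemma resolvent_left:
  assumes "i < N" "j < N"
  shows "\<i> * of_real \<eta> * G i j - (\<Sum>k<N. G i k * H k j) = (if i = j then 1 else 0)"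
proof -
  let ?B = "shifted_matrix N (\<i> * of_real \<eta>) H"
  have a: "adj_mat ?B \<in> carrier_mat N N" "adj_mat ?B * ?B = Determinant.det ?B \<cdot>\<^sub>m 1\<^sub>m N"
    using adj_mat[OF shifted_matrix_carrier] by blast+
  have "(\<Sum>k<N. adj_mat ?B $$ (i, k) * ?B $$ (k, j)) = (adj_mat ?B * ?B) $$ (i, j)"
    using a(1) assms by (simp add: scalar_prod_def lessThan_atLeast0 shifted_matrix_def)
  also have "\<dots> = Determinant.det ?B * (if i = j then 1 else 0)" unfolding a(2) using assms by simp
  finally have "(\<Sum>k<N. G i k * ?B $$ (k, j)) = (if i = j then 1 else 0)"
    using det_shifted_matrix_nonzero[OF H \<eta>] by (simp add: G_def resolvent_def sum_divide_distrib[symmetric])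
  then show ?thesis using assms by (simp only: shifted_matrix_col_sum)
qed

lemma resolvent_unique:
  assumes "\<And>i. i < N \<Longrightarrow> \<i> * of_real \<eta> * y i - (\<Sum>j<N. H i j * y j) = v i" "l < N"
  shows "y l = (\<Sum>i<N. G l i * v i)"
proof -
  have "(\<Sum>i<N. G l i * v i) = (\<Sum>i<N. G l i * (\<i> * of_real \<eta> * y i) - (\<Sum>j<N. G l i * H i j * y j))"
  proof (rule sum.cong)
    fix i assume "i \<in> {..<N}"
    then have v: "v i = \<i> * of_real \<eta> * y i - (\<Sum>j<N. H i j * y j)" using assms(1)[of i] by simp
    show "G l i * v i = G l i * (\<i> * of_real \<eta> * y i) - (\<Sum>j<N. G l i * H i j * y j)"
      unfolding v by (simp only: right_diff_distrib sum_distrib_left mult.assoc)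
  qed simp
  also have "\<dots> = (\<Sum>j<N. G l j * (\<i> * of_real \<eta> * y j)) - (\<Sum>j<N. \<Sum>i<N. G l i * H i j * y j)"
    unfolding sum_subtractf by (subst sum.swap) simp
  also have "\<dots> = (\<Sum>j<N. (\<i> * of_real \<eta> * G l j - (\<Sum>i<N. G l i * H i j)) * y j)"
    by (simp add: left_diff_distrib right_diff_distrib sum_subtractf sum_distrib_left sum_distrib_right mult_ac)
  also have "\<dots> = (\<Sum>j<N. if l = j then y j else 0)"
    using assms(2) by (intro sum.cong refl) (subst resolvent_left, auto)
  finally show ?thesis using assms(2) by simp
qed

lemma norm_sq_resolvent_apply: "\<eta>\<^sup>2 * norm_sq N (\<lambda>i. \<Sum>j<N. G i j * v j) \<le> norm_sq N v"
proof (rule norm_sq_resolvent_le[OF H \<eta>])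
  fix i assume i: "i < N"
  have "(\<Sum>j<N. H i j * (\<Sum>k<N. G j k * v k)) = (\<Sum>k<N. (\<Sum>j<N. H i j * G j k) * v k)"
    unfolding sum_distrib_left sum_distrib_right by (subst sum.swap) (simp add: mult.assoc)
  then have "\<i> * of_real \<eta> * (\<Sum>j<N. G i j * v j) - (\<Sum>j<N. H i j * (\<Sum>k<N. G j k * v k)) =
      (\<Sum>k<N. (\<i> * of_real \<eta> * G i k - (\<Sum>j<N. H i j * G j k)) * v k)"
    by (simp add: left_diff_distrib sum_subtractf sum_distrib_left mult.assoc)
  also have "\<dots> = (\<Sum>k<N. if i = k then v k else 0)"
    using i by (intro sum.cong refl) (subst resolvent_right, auto)
  finally show "\<i> * of_real \<eta> * (\<Sum>j<N. G i j * v j) - (\<Sum>j<N. H i j * (\<Sum>k<N. G j k * v k)) = v i"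
    using i by simp
qed

lemma norm_sq_apply_resolvent: "\<eta>\<^sup>2 * norm_sq N (\<lambda>j. \<Sum>i<N. u i * G i j) \<le> norm_sq N u"
proof (rule norm_sq_resolvent_le[OF hermitian_on_transpose[OF H] \<eta>])
  fix j assume j: "j < N"
  have "(\<Sum>i<N. H i j * (\<Sum>k<N. u k * G k i)) = (\<Sum>k<N. u k * (\<Sum>i<N. G k i * H i j))"
    unfolding sum_distrib_left by (subst sum.swap) (simp add: mult_ac)
  then have "\<i> * of_real \<eta> * (\<Sum>i<N. u i * G i j) - (\<Sum>i<N. H i j * (\<Sum>k<N. u k * G k i)) =
      (\<Sum>k<N. u k * (\<i> * of_real \<eta> * G k j - (\<Sum>i<N. G k i * H i j)))"
    by (simp add: right_diff_distrib sum_subtractf sum_distrib_left mult_ac)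
  also have "\<dots> = (\<Sum>k<N. if k = j then u k else 0)"
    using j by (intro sum.cong refl) (subst resolvent_left, auto)
  finally show "\<i> * of_real \<eta> * (\<Sum>i<N. u i * G i j) - (\<Sum>i<N. H i j * (\<Sum>k<N. u k * G k i)) = u j"
    using j by simp
qed

lemma cmod_resolvent_le:
  assumes "i < N" "j < N"
  shows "cmod (G i j) \<le> 1 / \<eta>"
proof -
  have "(\<Sum>k<N. G i k * (if k = j then 1 else 0)) = G i j" for i
  proof -
    have "(\<Sum>k<N. G i k * (if k = j then 1 else 0)) = (\<Sum>k<N. if k = j then G i k else 0)"
      by (rule sum.cong) auto
    then show ?thesis using assms(2) by simp
  qed
  then have "\<eta>\<^sup>2 * norm_sq N (\<lambda>i. G i j) \<le> 1"
    using norm_sq_resolvent_apply[of "\<lambda>k. if k = j then 1 else 0"] norm_sq_delta[OF assms(2)] by simp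
  moreover have "\<eta>\<^sup>2 * (cmod (G i j))\<^sup>2 \<le> \<eta>\<^sup>2 * norm_sq N (\<lambda>i. G i j)"
    using norm_sq_ge_component[OF assms(1), of "\<lambda>i. G i j"] by (intro mult_left_mono) auto
  ultimately have "(\<eta> * cmod (G i j))\<^sup>2 \<le> 1\<^sup>2" by (simp add: power_mult_distrib)
  then have "\<eta> * cmod (G i j) \<le> 1" by (rule power2_le_imp_le) simp
  then show ?thesis using \<eta> by (simp add: field_simps)
qed

end

section \<open>The resolvent identity and the change of a single entry\<close>

lemma resolvent_identity:
  assumes H: "hermitian_on N H" and H': "hermitian_on N H'" and \<eta>: "\<eta> > 0" and ij: "i < N" "j < N"
  defines "G \<equiv> resolvent N (\<i> * of_real \<eta>) H" and "G' \<equiv> resolvent N (\<i> * of_real \<eta>) H'"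
  shows "G i j - G' i j = (\<Sum>k<N. \<Sum>l<N. G i k * (H k l - H' k l) * G' l j)"
proof -
  have "G i j = (\<Sum>k<N. G i k * (if k = j then 1 else 0))"
  proof -
    have "(\<Sum>k<N. G i k * (if k = j then 1 else 0)) = (\<Sum>k<N. if k = j then G i k else 0)"
      by (rule sum.cong) auto
    then show ?thesis using ij by simp
  qed
  also have "\<dots> = (\<Sum>k<N. G i k * (\<i> * of_real \<eta> * G' k j - (\<Sum>l<N. H' k l * G' l j)))"
    using ij unfolding G'_def by (intro sum.cong refl) (subst resolvent_right[OF H' \<eta>], auto)
  also have "\<dots> = (\<Sum>k<N. \<i> * of_real \<eta> * G i k * G' k j) - (\<Sum>k<N. \<Sum>l<N. G i k * H' k l * G' l j)"
    by (simp add: right_diff_distrib sum_subtractf sum_distrib_left mult_ac)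
  finally have 1: "G i j = (\<Sum>k<N. \<i> * of_real \<eta> * G i k * G' k j) - (\<Sum>k<N. \<Sum>l<N. G i k * H' k l * G' l j)" .
  have "G' i j = (\<Sum>l<N. (if i = l then 1 else 0) * G' l j)"
  proof -
    have "(\<Sum>l<N. (if i = l then 1 else 0) * G' l j) = (\<Sum>l<N. if i = l then G' l j else 0)"
      by (rule sum.cong) auto
    then show ?thesis using ij by simp
  qed
  also have "\<dots> = (\<Sum>l<N. (\<i> * of_real \<eta> * G i l - (\<Sum>k<N. G i k * H k l)) * G' l j)"
    using ij unfolding G_def by (intro sum.cong refl) (subst resolvent_left[OF H \<eta>], auto)
  also have "\<dots> = (\<Sum>l<N. \<i> * of_real \<eta> * G i l * G' l j) - (\<Sum>l<N. \<Sum>k<N. G i k * H k l * G' l j)"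
    by (simp add: left_diff_distrib right_diff_distrib sum_subtractf sum_distrib_right sum_distrib_left mult_ac)
  also have "(\<Sum>l<N. \<Sum>k<N. G i k * H k l * G' l j) = (\<Sum>k<N. \<Sum>l<N. G i k * H k l * G' l j)"
    by (rule sum.swap)
  finally have 2: "G' i j = (\<Sum>l<N. \<i> * of_real \<eta> * G i l * G' l j) - (\<Sum>k<N. \<Sum>l<N. G i k * H k l * G' l j)" .
  show ?thesis unfolding 1 2
    by (simp add: right_diff_distrib left_diff_distrib sum_subtractf)
qed

definition row_form :: "nat \<Rightarrow> (nat \<Rightarrow> complex) \<Rightarrow> (nat \<Rightarrow> nat \<Rightarrow> complex) \<Rightarrow> nat \<Rightarrow> complex" where
  "row_form N u G j = (\<Sum>i<N. u i * G i j)"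

definition col_form :: "nat \<Rightarrow> (nat \<Rightarrow> nat \<Rightarrow> complex) \<Rightarrow> (nat \<Rightarrow> complex) \<Rightarrow> nat \<Rightarrow> complex" where
  "col_form N G v i = (\<Sum>j<N. G i j * v j)"

definition bilinear_form :: "nat \<Rightarrow> (nat \<Rightarrow> complex) \<Rightarrow> (nat \<Rightarrow> nat \<Rightarrow> complex) \<Rightarrow> (nat \<Rightarrow> complex) \<Rightarrow> complex" where
  "bilinear_form N u G v = (\<Sum>i<N. \<Sum>j<N. u i * G i j * v j)"

lemma bilinear_form_row: "bilinear_form N u G v = (\<Sum>j<N. row_form N u G j * v j)"
  unfolding bilinear_form_def row_form_def sum_distrib_right by (rule sum.swap)

lemma bilinear_form_col: "bilinear_form N u G v = (\<Sum>i<N. u i * col_form N G v i)"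
  unfolding bilinear_form_def col_form_def sum_distrib_left by (simp add: mult.assoc)

lemma sum_mult_delta:
  fixes f :: "nat \<Rightarrow> complex"
  assumes "j < N"
  shows "(\<Sum>k<N. f k * (if k = j then 1 else 0)) = f j" "(\<Sum>k<N. (if k = j then 1 else 0) * f k) = f j"
proof -
  have "(\<Sum>k<N. f k * (if k = j then 1 else 0)) = (\<Sum>k<N. if k = j then f k else 0)"
    "(\<Sum>k<N. (if k = j then 1 else 0) * f k) = (\<Sum>k<N. if k = j then f k else 0)"
    by (rule sum.cong; auto)+
  then show "(\<Sum>k<N. f k * (if k = j then 1 else 0)) = f j" "(\<Sum>k<N. (if k = j then 1 else 0) * f k) = f j"
    using assms by simp_all
qed

lemma bilinear_form_delta_right: "j < N \<Longrightarrow> bilinear_form N u G (\<lambda>k. if k = j then 1 else 0) = row_form N u G j"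
  unfolding bilinear_form_row by (rule sum_mult_delta)

lemma bilinear_form_delta_left: "i < N \<Longrightarrow> bilinear_form N (\<lambda>k. if k = i then 1 else 0) G v = col_form N G v i"
  unfolding bilinear_form_col by (rule sum_mult_delta)

lemma row_form_delta: "i < N \<Longrightarrow> row_form N (\<lambda>k. if k = i then 1 else 0) G j = G i j"
  unfolding row_form_def by (rule sum_mult_delta)

lemma col_form_delta: "j < N \<Longrightarrow> col_form N G (\<lambda>k. if k = j then 1 else 0) i = G i j"
  unfolding col_form_def by (rule sum_mult_delta)

lemma sum_swap_pairs:
  "(\<Sum>i\<in>A. \<Sum>j\<in>B. \<Sum>k\<in>C. \<Sum>l\<in>D. F i j k l) = (\<Sum>k\<in>C. \<Sum>l\<in>D. \<Sum>i\<in>A. \<Sum>j\<in>B. F i j k l)"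
proof -
  have "(\<Sum>i\<in>A. \<Sum>j\<in>B. \<Sum>k\<in>C. \<Sum>l\<in>D. F i j k l) = (\<Sum>i\<in>A. \<Sum>k\<in>C. \<Sum>j\<in>B. \<Sum>l\<in>D. F i j k l)"
    by (rule sum.cong[OF refl]) (rule sum.swap)
  also have "\<dots> = (\<Sum>k\<in>C. \<Sum>i\<in>A. \<Sum>j\<in>B. \<Sum>l\<in>D. F i j k l)" by (rule sum.swap)
  also have "\<dots> = (\<Sum>k\<in>C. \<Sum>i\<in>A. \<Sum>l\<in>D. \<Sum>j\<in>B. F i j k l)"
    by (rule sum.cong[OF refl], rule sum.cong[OF refl], rule sum.swap)
  also have "\<dots> = (\<Sum>k\<in>C. \<Sum>l\<in>D. \<Sum>i\<in>A. \<Sum>j\<in>B. F i j k l)"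
    by (rule sum.cong[OF refl]) (rule sum.swap)
  finally show ?thesis .
qed

text \<open>One independent entry of a Hermitian matrix moves the pair (p, q), (q, p). The case p =
  q is included: sums run over the set of the two index pairs, which then has one element.\<close>

locale entry_perturbation =
  fixes N :: nat and H H' :: "nat \<Rightarrow> nat \<Rightarrow> complex" and \<eta> :: real and p q :: nat and d :: real
  assumes H: "hermitian_on N H" and H': "hermitian_on N H'" and \<eta>: "\<eta> > 0"
    and pq: "p < N" "q < N"
    and agree: "\<And>k l. k < N \<Longrightarrow> l < N \<Longrightarrow> (k, l) \<noteq> (p, q) \<Longrightarrow> (k, l) \<noteq> (q, p) \<Longrightarrow> H k l = H' k l"
    and d: "cmod (H p q - H' p q) \<le> d"
begin

abbreviation "G \<equiv> resolvent N (\<i> * of_real \<eta>) H"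
abbreviation "G' \<equiv> resolvent N (\<i> * of_real \<eta>) H'"

lemma flip: "entry_perturbation N H' H \<eta> p q d"
  by unfold_locales (use H H' \<eta> pq agree d in \<open>auto simp: norm_minus_commute\<close>)

lemma d_nonneg: "0 \<le> d" using d norm_ge_zero[of "H p q - H' p q"] by linarith

lemma d_transpose: "cmod (H q p - H' q p) \<le> d"
proof -
  have "H q p - H' q p = cnj (H p q - H' p q)"
    using hermitian_onD[OF H pq] hermitian_onD[OF H' pq] by simp
  then show ?thesis using d by (simp only: complex_mod_cnj)
qed

text \<open>The two resolvents sit on different sides, G on the left and G' on the right. Together
  with \<open>flip\<close> this allows a choice of the point at which the row and column forms in an
  estimate are evaluated.\<close>

lemma bilinear_form_diff:
  "bilinear_form N u G v - bilinear_form N u G' v =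
    (\<Sum>(k, l)\<in>{(p, q), (q, p)}. row_form N u G k * (H k l - H' k l) * col_form N G' v l)"
proof -
  have "bilinear_form N u G v - bilinear_form N u G' v = (\<Sum>i<N. \<Sum>j<N. u i * (G i j - G' i j) * v j)"
    by (simp add: bilinear_form_def right_diff_distrib left_diff_distrib sum_subtractf)
  also have "\<dots> = (\<Sum>i<N. \<Sum>j<N. \<Sum>k<N. \<Sum>l<N. (u i * G i k) * (H k l - H' k l) * (G' l j * v j))"
    by (intro sum.cong refl) (simp add: resolvent_identity[OF H H' \<eta>] sum_distrib_left sum_distrib_right mult_ac)
  also have "\<dots> = (\<Sum>k<N. \<Sum>l<N. \<Sum>i<N. \<Sum>j<N. (u i * G i k) * (H k l - H' k l) * (G' l j * v j))"
    by (rule sum_swap_pairs)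
  also have "\<dots> = (\<Sum>k<N. \<Sum>l<N. row_form N u G k * (H k l - H' k l) * col_form N G' v l)"
    unfolding row_form_def col_form_def by (intro sum.cong refl) (simp add: sum_distrib_left sum_distrib_right mult_ac)
  also have "\<dots> = (\<Sum>(k, l)\<in>{..<N} \<times> {..<N}. row_form N u G k * (H k l - H' k l) * col_form N G' v l)"
    by (rule sum.cartesian_product)
  also have "\<dots> = (\<Sum>(k, l)\<in>{(p, q), (q, p)}. row_form N u G k * (H k l - H' k l) * col_form N G' v l)"
  proof (rule sum.mono_neutral_right)
    show "\<forall>x\<in>{..<N} \<times> {..<N} - {(p, q), (q, p)}. (case x of (k, l) \<Rightarrow> row_form N u G k * (H k l - H' k l) * col_form N G' v l) = 0"
    proof
      fix x assume x: "x \<in> {..<N} \<times> {..<N} - {(p, q), (q, p)}"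
      obtain k l where kl: "x = (k, l)" by (cases x)
      have "H k l = H' k l" using x unfolding kl by (intro agree) auto
      then show "(case x of (k, l) \<Rightarrow> row_form N u G k * (H k l - H' k l) * col_form N G' v l) = 0" unfolding kl by simp
    qed
  qed (use pq in auto)
  finally show ?thesis .
qed

lemma cmod_bilinear_form_diff_le:
  "cmod (bilinear_form N u G v - bilinear_form N u G' v) \<le>
    d * (cmod (row_form N u G p) * cmod (col_form N G' v q) + cmod (row_form N u G q) * cmod (col_form N G' v p))"
proof -
  have t: "cmod (row_form N u G k * (H k l - H' k l) * col_form N G' v l) \<le> d * (cmod (row_form N u G k) * cmod (col_form N G' v l))"
    if "cmod (H k l - H' k l) \<le> d" for k l
    using mult_right_mono[OF that, of "cmod (row_form N u G k) * cmod (col_form N G' v l)"]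
    by (simp add: norm_mult mult_ac)
  show ?thesis
  proof (cases "p = q")
    case True
    then show ?thesis unfolding bilinear_form_diff
      using t[OF d] d_nonneg by (auto simp: distrib_left intro: order.trans)
  next
    case False
    then show ?thesis unfolding bilinear_form_diff
      using t[OF d] t[OF d_transpose] by (auto simp: distrib_left intro!: norm_triangle_le add_mono)
  qed
qed

text \<open>The bound is in terms of the row form itself at p and q, and not a constant. This
  preserves square summability over the entries, on which the variance bound rests.\<close>

lemma cmod_row_form_diff_le:
  assumes "j < N"
  shows "cmod (row_form N u G j - row_form N u G' j) \<le> d * (cmod (row_form N u G p) + cmod (row_form N u G q)) / \<eta>"
proof -
  have "cmod (G' q j) \<le> 1 / \<eta>" "cmod (G' p j) \<le> 1 / \<eta>"
    using cmod_resolvent_le[OF H' \<eta>] pq assms by auto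
  then have "cmod (row_form N u G p) * cmod (G' q j) + cmod (row_form N u G q) * cmod (G' p j) \<le>
     cmod (row_form N u G p) * (1 / \<eta>) + cmod (row_form N u G q) * (1 / \<eta>)"
    by (intro add_mono mult_left_mono) auto
  then have "d * (cmod (row_form N u G p) * cmod (G' q j) + cmod (row_form N u G q) * cmod (G' p j)) \<le>
     d * (cmod (row_form N u G p) * (1 / \<eta>) + cmod (row_form N u G q) * (1 / \<eta>))"
    by (rule mult_left_mono[OF _ d_nonneg])
  then show ?thesis
    using cmod_bilinear_form_diff_le[of u "\<lambda>k. if k = j then 1 else 0"] assms
    by (simp add: bilinear_form_delta_right col_form_delta add_divide_distrib distrib_left)
qed

lemma cmod_col_form_diff_le:
  assumes "i < N"
  shows "cmod (col_form N G v i - col_form N G' v i) \<le> d * (cmod (col_form N G' v p) + cmod (col_form N G' v q)) / \<eta>"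
proof -
  have "cmod (G i p) \<le> 1 / \<eta>" "cmod (G i q) \<le> 1 / \<eta>"
    using cmod_resolvent_le[OF H \<eta>] pq assms by auto
  then have "cmod (G i p) * cmod (col_form N G' v q) + cmod (G i q) * cmod (col_form N G' v p) \<le>
     (1 / \<eta>) * cmod (col_form N G' v q) + (1 / \<eta>) * cmod (col_form N G' v p)"
    by (intro add_mono mult_right_mono) auto
  then have "d * (cmod (G i p) * cmod (col_form N G' v q) + cmod (G i q) * cmod (col_form N G' v p)) \<le>
     d * ((1 / \<eta>) * cmod (col_form N G' v q) + (1 / \<eta>) * cmod (col_form N G' v p))"
    by (rule mult_left_mono[OF _ d_nonneg])
  then show ?thesis
    using cmod_bilinear_form_diff_le[of "\<lambda>k. if k = i then 1 else 0" v] assms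
    by (simp add: bilinear_form_delta_left row_form_delta add_divide_distrib distrib_left add.commute)
qed

lemma resolvent_entry_diff:
  assumes "p \<noteq> q" "i < N" "j < N"
  shows "G i j - G' i j = G i p * (H p q - H' p q) * G' q j + G i q * (H q p - H' q p) * G' p j"
  using bilinear_form_diff[of "\<lambda>k. if k = i then 1 else 0" "\<lambda>k. if k = j then 1 else 0"] assms
  by (simp add: bilinear_form_delta_left row_form_delta col_form_delta)

lemma cmod_resolvent_entry_diff_le:
  assumes "i < N" "j < N"
  shows "cmod (G i j - G' i j) \<le> 2 * d / \<eta>\<^sup>2"
proof -
  have "cmod (G i p) \<le> 1 / \<eta>" "cmod (G i q) \<le> 1 / \<eta>"
    using cmod_resolvent_le[OF H \<eta>] pq assms by auto
  then have "d * (cmod (G i p) + cmod (G i q)) / \<eta> \<le> d * (1 / \<eta> + 1 / \<eta>) / \<eta>"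
    using d_nonneg \<eta> by (intro divide_right_mono mult_left_mono) auto
  also have "\<dots> = 2 * d / \<eta>\<^sup>2" by (simp add: power2_eq_square)
  finally show ?thesis
    using cmod_row_form_diff_le[OF assms(2), of "\<lambda>k. if k = i then 1 else 0"] assms
    by (simp add: row_form_delta)
qed

end

section \<open>Deformations of finite rank\<close>

lemma L2_set_cmod_triangle:
  "L2_set (\<lambda>x. cmod (f x + g x)) B \<le> L2_set (\<lambda>x. cmod (f x)) B + L2_set (\<lambda>x. cmod (g x)) B"
  by (rule order.trans[OF L2_set_mono L2_set_triangle_ineq]) (auto intro: norm_triangle_ineq)

lemma L2_set_cmod_mult: "L2_set (\<lambda>x. cmod (c * f x)) B = cmod c * L2_set (\<lambda>x. cmod (f x)) B"
  by (simp add: norm_mult L2_set_right_distrib)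

lemma cmod_sum_mult_le_L2_set:
  "cmod (\<Sum>x\<in>B. f x * g x) \<le> L2_set (\<lambda>x. cmod (f x)) B * L2_set (\<lambda>x. cmod (g x)) B"
proof -
  have "cmod (\<Sum>x\<in>B. f x * g x) \<le> (\<Sum>x\<in>B. \<bar>cmod (f x)\<bar> * \<bar>cmod (g x)\<bar>)"
    by (rule order.trans[OF norm_sum]) (simp add: norm_mult)
  then show ?thesis by (rule order.trans[OF _ L2_set_mult_ineq])
qed

lemma L2_set_constant: "0 \<le> c \<Longrightarrow> L2_set (\<lambda>_. c) B = sqrt (real (card B)) * c"
  by (simp add: L2_set_def real_sqrt_mult)

text \<open>
  The coercivity that replaces a bound on the norm of \<open>A\<close>: for Hermitian \<open>A\<close>, \<open>1 + \<i>\<kappa>A\<close> dominates \<open>\<kappa>A\<close>.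
\<close>

lemma skew_shift_norm_le:
  fixes A :: "nat \<Rightarrow> nat \<Rightarrow> complex" and e :: "nat \<Rightarrow> complex" and \<kappa> :: real
  assumes herm: "\<And>x y. x \<in> B \<Longrightarrow> y \<in> B \<Longrightarrow> A y x = cnj (A x y)"
  defines "w \<equiv> \<lambda>x. \<Sum>y\<in>B. A x y * e y"
  shows "(\<kappa> * L2_set (\<lambda>x. cmod (w x)) B)\<^sup>2 \<le> (L2_set (\<lambda>x. cmod (e x + \<i> * of_real \<kappa> * w x)) B)\<^sup>2"
proof -
  have Im: "Im (\<Sum>x\<in>B. cnj (e x) * w x) = 0"
  proof -
    let ?S = "\<Sum>x\<in>B. cnj (e x) * w x"
    have S: "?S = (\<Sum>x\<in>B. \<Sum>y\<in>B. cnj (e x) * A x y * e y)"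
      by (simp add: w_def sum_distrib_left mult.assoc)
    have "cnj ?S = (\<Sum>x\<in>B. \<Sum>y\<in>B. e x * cnj (A x y) * cnj (e y))" unfolding S by simp
    also have "\<dots> = (\<Sum>x\<in>B. \<Sum>y\<in>B. cnj (e y) * A y x * e x)"
    proof (intro sum.cong refl)
      fix x y assume "x \<in> B" "y \<in> B"
      then have "cnj (A x y) = A y x" using herm[of x y] by simp
      then show "e x * cnj (A x y) * cnj (e y) = cnj (e y) * A y x * e x" by (simp only: mult_ac)
    qed
    also have "\<dots> = ?S" unfolding S by (rule sum.swap)
    finally have "Im ?S = Im (cnj ?S)" by (simp only:)
    also have "\<dots> = - Im ?S" by (rule cnj.simps(2))
    finally show ?thesis by linarith
  qed
  have pt: "(cmod (e x + \<i> * of_real \<kappa> * w x))\<^sup>2 = (cmod (e x))\<^sup>2 + \<kappa>\<^sup>2 * (cmod (w x))\<^sup>2 - 2 * \<kappa> * Im (cnj (e x) * w x)" for x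
    unfolding cmod_power2 by (simp add: power2_eq_square algebra_simps)
  have "(L2_set (\<lambda>x. cmod (e x + \<i> * of_real \<kappa> * w x)) B)\<^sup>2 = (\<Sum>x\<in>B. (cmod (e x + \<i> * of_real \<kappa> * w x))\<^sup>2)"
    by (simp add: L2_set_def sum_nonneg)
  also have "\<dots> = (\<Sum>x\<in>B. (cmod (e x))\<^sup>2) + \<kappa>\<^sup>2 * (\<Sum>x\<in>B. (cmod (w x))\<^sup>2) - 2 * \<kappa> * Im (\<Sum>x\<in>B. cnj (e x) * w x)"
    unfolding pt Im_sum sum_distrib_left by (simp only: sum.distrib sum_subtractf)
  also have "\<dots> \<ge> \<kappa>\<^sup>2 * (\<Sum>x\<in>B. (cmod (w x))\<^sup>2)" unfolding Im by (simp add: sum_nonneg)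
  finally show ?thesis by (simp add: L2_set_def sum_nonneg power_mult_distrib)
qed

text \<open>On the block, y = G (q + A y). With m in place of G the solution would be c q, so e = y
  - c q satisfies (1 + i \<kappa> A) e = \<epsilon> there. Coercivity bounds \<kappa> A e by
  \<epsilon> for any Hermitian A. The additive error \<tau> loses a factor r in norm, whereas the
  relative diagonal error \<rho> does not.\<close>

theorem finite_rank_perturbation_bound:
  fixes a \<eta> \<kappa> \<tau> \<rho> :: real and r :: nat
  assumes k: "0 < \<kappa>" and \<eta>: "0 < \<eta>" and H: "hermitian_on N H" and A: "hermitian_on N A"
    and B: "B \<subseteq> {..<N}" "card B \<le> r" "1 \<le> r"
    and supp: "\<And>k l. k < N \<Longrightarrow> l < N \<Longrightarrow> \<not> (k \<in> B \<and> l \<in> B) \<Longrightarrow> A k l = 0"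
    and q1: "norm_sq N q = 1" and Aq: "\<And>k. k < N \<Longrightarrow> (\<Sum>l<N. A k l * q l) = of_real a * q k"
    and y: "\<And>k. k < N \<Longrightarrow> \<i> * of_real \<eta> * y k - (\<Sum>l<N. (H k l + A k l) * y l) = q k"
  defines "G \<equiv> resolvent N (\<i> * of_real \<eta>) H" and "m \<equiv> - \<i> * complex_of_real \<kappa>"
  defines "c \<equiv> m / (1 - of_real a * m)" and "qs \<equiv> \<lambda>k. cnj (q k)"
  assumes nn: "0 \<le> \<tau>" "0 \<le> \<rho>"
    and GB: "\<And>x b. x \<in> B \<Longrightarrow> b \<in> B \<Longrightarrow> cmod (G x b - (if x = b then m else 0)) \<le> \<tau> + (if x = b then \<rho> else 0)"
    and Gq: "\<And>x. x \<in> B \<Longrightarrow> cmod (col_form N G q x - m * q x) \<le> \<tau> + \<rho> * cmod (q x)"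
    and qG: "\<And>x. x \<in> B \<Longrightarrow> cmod (row_form N qs G x - m * qs x) \<le> \<tau> + \<rho> * cmod (q x)"
    and qGq: "cmod (bilinear_form N qs G q - m) \<le> \<tau> + \<rho>"
    and small: "real r * \<tau> + \<rho> \<le> \<kappa> / 2"
  shows "cmod ((\<Sum>i<N. y i * cnj (q i)) - c) \<le> (real r * \<tau> + \<rho>) * (4 + 4 * cmod (c * of_real a))"
proof -
  define \<delta> where "\<delta> = real r * \<tau> + \<rho>"
  have \<delta>0: "0 \<le> \<delta>" using nn by (simp add: \<delta>_def)
  have finB: "finite B" using B(1) finite_subset by blast
  have BN: "x < N" if "x \<in> B" for x using B(1) that by auto
  let ?n = "\<lambda>f. L2_set (\<lambda>x. cmod (f x)) B"
  have n0: "0 \<le> ?n f" for f by (rule L2_set_nonneg)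
  have sqr: "sqrt (real (card B)) * sqrt (real (card B)) \<le> real r" using B(2) by simp
  have "sqrt (real (card B)) \<le> sqrt (real r)" using B(2) by simp
  also have "\<dots> \<le> real r" using B(3) by (intro real_le_lsqrt) (auto simp: power2_eq_square)
  finally have sqr1: "sqrt (real (card B)) \<le> real r" .
  have qB: "?n q \<le> 1"
  proof -
    have "(\<Sum>x\<in>B. (cmod (q x))\<^sup>2) \<le> norm_sq N q"
      unfolding norm_sq_def using B(1) by (intro sum_mono2) auto
    then show ?thesis using q1 by (simp add: L2_set_def)
  qed
  define p where "p x = (\<Sum>b\<in>B. A x b * y b)" for x
  have restr: "(\<Sum>l<N. A x l * v l) = (if x \<in> B then \<Sum>b\<in>B. A x b * v b else 0)" if "x < N" for x v
  proof (cases "x \<in> B")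
    case True
    have "(\<Sum>l<N. A x l * v l) = (\<Sum>b\<in>B. A x b * v b)"
      using B(1) supp[OF that] by (intro sum.mono_neutral_right) auto
    then show ?thesis using True by simp
  next
    case False
    then show ?thesis using supp[OF that] by (auto intro!: sum.neutral)
  qed
  define P where "P x = (if x \<in> B then p x else 0)" for x
  have yG: "y x = col_form N G q x + col_form N G P x" if x: "x < N" for x
  proof -
    have "\<i> * of_real \<eta> * y k - (\<Sum>j<N. H k j * y j) = q k + P k" if k: "k < N" for k
      using y[OF k] restr[OF k, of y] by (simp add: P_def p_def distrib_right sum.distrib algebra_simps split: if_splits)
    then have "y x = (\<Sum>i<N. G x i * (q i + P i))" unfolding G_def by (rule resolvent_unique[OF H \<eta> _ x])
    then show ?thesis by (simp add: col_form_def distrib_left sum.distrib)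
  qed
  have sumP: "(\<Sum>l<N. f l * P l) = (\<Sum>b\<in>B. f b * p b)" for f :: "nat \<Rightarrow> complex"
  proof -
    have "(\<Sum>l<N. f l * P l) = (\<Sum>b\<in>B. f b * P b)"
      using B(1) by (intro sum.mono_neutral_right) (auto simp: P_def)
    then show ?thesis by (simp add: P_def)
  qed
  define D where "D x b = G x b - (if x = b then m else 0)" for x b
  define \<epsilon>1 where "\<epsilon>1 x = col_form N G q x - m * q x" for x
  define \<epsilon>2 where "\<epsilon>2 x = (\<Sum>b\<in>B. D x b * p b)" for x
  define \<epsilon> where "\<epsilon> x = \<epsilon>1 x + \<epsilon>2 x" for x
  have y_eq: "y x = m * q x + m * p x + \<epsilon> x" if x: "x \<in> B" for x
  proof -
    have "(\<Sum>b\<in>B. G x b * p b) = (\<Sum>b\<in>B. D x b * p b + (if x = b then m * p b else 0))"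
      by (intro sum.cong refl) (auto simp: D_def left_diff_distrib)
    then have "(\<Sum>b\<in>B. G x b * p b) = \<epsilon>2 x + m * p x"
      using finB x by (simp add: \<epsilon>2_def sum.distrib)
    then show ?thesis using yG[OF BN[OF x]] sumP[of "G x"] by (simp add: \<epsilon>_def \<epsilon>1_def col_form_def)
  qed
  have sump: "(\<Sum>b\<in>B. cmod (p b)) \<le> sqrt (real (card B)) * ?n p"
    using L2_set_mult_ineq[of "\<lambda>_. 1" "\<lambda>b. cmod (p b)" B] by (simp add: L2_set_constant)
  have e1: "?n \<epsilon>1 \<le> \<delta>"
  proof -
    have "?n \<epsilon>1 \<le> L2_set (\<lambda>x. \<tau> + \<rho> * cmod (q x)) B"
      using Gq by (intro L2_set_mono) (auto simp: \<epsilon>1_def)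
    also have "\<dots> \<le> L2_set (\<lambda>_. \<tau>) B + L2_set (\<lambda>x. \<rho> * cmod (q x)) B" by (rule L2_set_triangle_ineq)
    also have "\<dots> = sqrt (real (card B)) * \<tau> + \<rho> * ?n q"
      using nn by (simp add: L2_set_constant L2_set_right_distrib)
    also have "\<dots> \<le> real r * \<tau> + \<rho> * 1" using nn sqr1 qB by (intro add_mono mult_right_mono mult_left_mono)
    finally show ?thesis by (simp add: \<delta>_def)
  qed
  \<comment> \<open>Entries of size \<tau> on the block give a matrix of norm at most r \<tau>: the
    sum over b and the norm over x each contribute sqrt (card B).\<close>
  have e2: "?n \<epsilon>2 \<le> \<delta> * ?n p"
  proof -
    have "cmod (\<epsilon>2 x) \<le> \<tau> * (\<Sum>b\<in>B. cmod (p b)) + \<rho> * cmod (p x)" if x: "x \<in> B" for x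
    proof -
      have "cmod (\<epsilon>2 x) \<le> (\<Sum>b\<in>B. cmod (D x b) * cmod (p b))"
        unfolding \<epsilon>2_def by (rule order.trans[OF norm_sum]) (simp add: norm_mult)
      also have "\<dots> \<le> (\<Sum>b\<in>B. (\<tau> + (if x = b then \<rho> else 0)) * cmod (p b))"
        using GB[OF x] unfolding D_def by (intro sum_mono mult_right_mono) auto
      also have "\<dots> = (\<Sum>b\<in>B. \<tau> * cmod (p b) + (if x = b then \<rho> * cmod (p b) else 0))"
        by (intro sum.cong refl) (auto simp: distrib_right)
      also have "\<dots> = \<tau> * (\<Sum>b\<in>B. cmod (p b)) + \<rho> * cmod (p x)"
        using finB x by (simp add: sum.distrib sum_distrib_left)
      finally show ?thesis .
    qed
    then have "?n \<epsilon>2 \<le> L2_set (\<lambda>x. \<tau> * (\<Sum>b\<in>B. cmod (p b)) + \<rho> * cmod (p x)) B"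
      by (intro L2_set_mono) auto
    also have "\<dots> \<le> L2_set (\<lambda>_. \<tau> * (\<Sum>b\<in>B. cmod (p b))) B + L2_set (\<lambda>x. \<rho> * cmod (p x)) B" by (rule L2_set_triangle_ineq)
    also have "\<dots> = sqrt (real (card B)) * (\<tau> * (\<Sum>b\<in>B. cmod (p b))) + \<rho> * ?n p"
      using nn by (simp add: L2_set_constant L2_set_right_distrib sum_nonneg)
    also have "\<dots> \<le> sqrt (real (card B)) * (\<tau> * (sqrt (real (card B)) * ?n p)) + \<rho> * ?n p"
      using nn sump by (intro add_mono mult_left_mono) auto
    also have "\<dots> = (sqrt (real (card B)) * sqrt (real (card B))) * (\<tau> * ?n p) + \<rho> * ?n p" by (simp only: mult_ac)
    also have "\<dots> \<le> real r * (\<tau> * ?n p) + \<rho> * ?n p"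
      using nn sqr n0 by (intro add_mono mult_right_mono order.refl mult_nonneg_nonneg)
    finally show ?thesis by (simp add: \<delta>_def algebra_simps)
  qed
  have "?n \<epsilon> \<le> ?n \<epsilon>1 + ?n \<epsilon>2" unfolding \<epsilon>_def by (rule L2_set_cmod_triangle)
  also have "\<dots> \<le> \<delta> * (1 + ?n p)" using e1 e2 by (simp add: distrib_left)
  finally have e12: "?n \<epsilon> \<le> \<delta> * (1 + ?n p)" .
  define e where "e x = y x - c * q x" for x
  define w where "w x = (\<Sum>b\<in>B. A x b * e b)" for x
  have AqB: "(\<Sum>b\<in>B. A x b * q b) = of_real a * q x" if "x \<in> B" for x
    using Aq[OF BN[OF that]] restr[OF BN[OF that], of q] that by simp
  have pw: "p x = w x + c * of_real a * q x" if x: "x \<in> B" for x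
  proof -
    have "w x = p x - c * (\<Sum>b\<in>B. A x b * q b)"
      by (simp add: w_def e_def p_def right_diff_distrib sum_subtractf sum_distrib_left mult_ac)
    then show ?thesis using AqB[OF x] by simp
  qed
  have mnz: "1 - of_real a * m \<noteq> 0" by (simp add: m_def complex_eq_iff)
  then have c_eq: "c = m + m * c * of_real a" unfolding c_def by (simp add: field_simps)
  \<comment> \<open>The terms in q cancel by c = m + m c a, which says that c q solves the equation
    in which G is replaced by m.\<close>
  have eps: "\<epsilon> x = e x + \<i> * of_real \<kappa> * w x" if x: "x \<in> B" for x
  proof -
    have "\<epsilon> x = y x - m * q x - m * p x" using y_eq[OF x] by simp
    also have "\<dots> = e x + (c - m - m * c * of_real a) * q x - m * w x"
      unfolding pw[OF x] e_def by (simp add: algebra_simps)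
    also have "c - m - m * c * of_real a = 0" using c_eq by (simp add: algebra_simps)
    finally show ?thesis by (simp add: m_def)
  qed
  have kw: "\<kappa> * ?n w \<le> ?n \<epsilon>"
  proof -
    have "(\<kappa> * ?n w)\<^sup>2 \<le> (L2_set (\<lambda>x. cmod (e x + \<i> * of_real \<kappa> * w x)) B)\<^sup>2"
      unfolding w_def by (rule skew_shift_norm_le) (use hermitian_onD[OF A] BN in blast)
    also have "L2_set (\<lambda>x. cmod (e x + \<i> * of_real \<kappa> * w x)) B = ?n \<epsilon>"
      using eps by (intro L2_set_cong) auto
    finally show ?thesis using n0 by (rule power2_le_imp_le)
  qed
  let ?ca = "cmod (c * of_real a)"
  have np: "?n p \<le> ?n w + ?ca"
  proof -
    have "?n p = ?n (\<lambda>x. w x + c * of_real a * q x)" using pw by (intro L2_set_cong) auto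
    also have "\<dots> \<le> ?n w + ?n (\<lambda>x. c * of_real a * q x)" by (rule L2_set_cmod_triangle)
    also have "?n (\<lambda>x. c * of_real a * q x) = ?ca * ?n q" by (rule L2_set_cmod_mult)
    also have "\<dots> \<le> ?ca * 1" using qB by (intro mult_left_mono) auto
    finally show ?thesis by simp
  qed
  have nw: "?n w \<le> ?n \<epsilon> / \<kappa>" using kw k by (simp add: field_simps)
  \<comment> \<open>The error \<epsilon> depends on p = A y and hence on itself. The assumption
    \<open>small\<close> limits this feedback to half of its norm, so it can be absorbed.\<close>
  have dk: "\<delta> * (?n \<epsilon> / \<kappa>) \<le> ?n \<epsilon> / 2"
  proof -
    have "\<delta> * (?n \<epsilon> / \<kappa>) \<le> \<kappa> / 2 * (?n \<epsilon> / \<kappa>)"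
      using small k n0 by (intro mult_right_mono) (auto simp: \<delta>_def)
    then show ?thesis using k by simp
  qed
  have Q: "?n \<epsilon> \<le> 2 * \<delta> * (1 + ?ca)"
  proof -
    have "?n \<epsilon> \<le> \<delta> * (1 + (?n \<epsilon> / \<kappa> + ?ca))"
      using e12 np nw \<delta>0 by (intro order.trans[OF e12] mult_left_mono) auto
    then have "?n \<epsilon> \<le> \<delta> * (1 + ?ca) + \<delta> * (?n \<epsilon> / \<kappa>)" by (simp add: algebra_simps)
    then show ?thesis using dk by linarith
  qed
  have dP: "\<delta> * ?n p \<le> \<delta> * (1 + 2 * ?ca)"
  proof -
    have "\<delta> * ?n p \<le> \<delta> * (?n \<epsilon> / \<kappa> + ?ca)" using np nw \<delta>0 by (intro mult_left_mono) auto
    also have "\<dots> \<le> ?n \<epsilon> / 2 + \<delta> * ?ca" using dk by (simp add: distrib_left)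
    also have "\<dots> \<le> \<delta> * (1 + ?ca) + \<delta> * ?ca" using Q by simp
    finally show ?thesis by (simp add: algebra_simps)
  qed
  \<comment> \<open>Outside B the eigenvector equation reads a q_k = 0, so that a q, though perhaps
    not q, is supported on the block.\<close>
  have aq: "(\<Sum>b\<in>B. qs b * (of_real a * q b)) = of_real a"
  proof -
    have "(\<Sum>b\<in>B. qs b * (of_real a * q b)) = (\<Sum>k<N. qs k * (of_real a * q k))"
    proof (rule sum.mono_neutral_left)
      show "\<forall>k\<in>{..<N} - B. qs k * (of_real a * q k) = 0"
      proof
        fix k assume "k \<in> {..<N} - B"
        then have "of_real a * q k = 0" using Aq[of k] restr[of k q] by simp
        then show "qs k * (of_real a * q k) = 0" by (simp only: mult_zero_right)
      qed
    qed (use B in auto)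
    also have "\<dots> = of_real a * (\<Sum>k<N. of_real ((cmod (q k))\<^sup>2))"
      unfolding sum_distrib_left by (intro sum.cong refl) (simp only: qs_def complex_norm_square mult_ac)
    also have "(\<Sum>k<N. complex_of_real ((cmod (q k))\<^sup>2)) = of_real (norm_sq N q)"
      by (simp add: norm_sq_def)
    finally show ?thesis using q1 by simp
  qed
  have "(\<Sum>i<N. y i * cnj (q i)) = (\<Sum>i<N. qs i * (col_form N G q i + col_form N G P i))"
    by (intro sum.cong refl) (simp add: yG qs_def mult.commute)
  also have "\<dots> = bilinear_form N qs G q + bilinear_form N qs G P"
    by (simp only: bilinear_form_col distrib_left sum.distrib)
  also have "bilinear_form N qs G P = (\<Sum>b\<in>B. row_form N qs G b * p b)"
    unfolding bilinear_form_row by (rule sumP)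
  also have "\<dots> = (\<Sum>b\<in>B. (row_form N qs G b - m * qs b) * p b) + m * (\<Sum>b\<in>B. qs b * p b)"
    by (simp add: left_diff_distrib right_diff_distrib sum_subtractf sum_distrib_left mult_ac)
  also have "(\<Sum>b\<in>B. qs b * p b) = (\<Sum>b\<in>B. qs b * w b) + c * (\<Sum>b\<in>B. qs b * (of_real a * q b))"
    unfolding sum_distrib_left sum.distrib[symmetric] by (intro sum.cong refl) (simp add: pw algebra_simps)
  finally have total: "(\<Sum>i<N. y i * cnj (q i)) - c = (bilinear_form N qs G q - m) +
      ((\<Sum>b\<in>B. (row_form N qs G b - m * qs b) * p b) + m * (\<Sum>b\<in>B. qs b * w b))"
    unfolding aq by (subst c_eq) (simp add: algebra_simps)
  have t1: "cmod (bilinear_form N qs G q - m) \<le> \<delta>"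
    using qGq mult_right_mono[of 1 "real r" \<tau>] B(3) nn by (simp add: \<delta>_def)
  have t2: "cmod (\<Sum>b\<in>B. (row_form N qs G b - m * qs b) * p b) \<le> \<delta> * ?n p"
  proof -
    have "?n (\<lambda>b. row_form N qs G b - m * qs b) \<le> L2_set (\<lambda>x. \<tau> + \<rho> * cmod (q x)) B"
      using qG by (intro L2_set_mono) auto
    also have "\<dots> \<le> L2_set (\<lambda>_. \<tau>) B + L2_set (\<lambda>x. \<rho> * cmod (q x)) B" by (rule L2_set_triangle_ineq)
    also have "\<dots> = sqrt (real (card B)) * \<tau> + \<rho> * ?n q"
      using nn by (simp add: L2_set_constant L2_set_right_distrib)
    also have "\<dots> \<le> real r * \<tau> + \<rho> * 1" using nn sqr1 qB by (intro add_mono mult_right_mono mult_left_mono)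
    finally have "?n (\<lambda>b. row_form N qs G b - m * qs b) \<le> \<delta>" by (simp add: \<delta>_def)
    then have "?n (\<lambda>b. row_form N qs G b - m * qs b) * ?n p \<le> \<delta> * ?n p" using n0 by (intro mult_right_mono)
    then show ?thesis by (rule order.trans[OF cmod_sum_mult_le_L2_set])
  qed
  have t3: "cmod (m * (\<Sum>b\<in>B. qs b * w b)) \<le> ?n \<epsilon>"
  proof -
    have "cmod (\<Sum>b\<in>B. qs b * w b) \<le> ?n qs * ?n w" by (rule cmod_sum_mult_le_L2_set)
    also have "?n qs = ?n q" by (simp add: qs_def)
    also have "?n q * ?n w \<le> 1 * ?n w" using qB n0 by (intro mult_right_mono)
    finally have "cmod (m * (\<Sum>b\<in>B. qs b * w b)) \<le> \<kappa> * ?n w"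
      using k by (simp add: norm_mult m_def)
    then show ?thesis using kw by linarith
  qed
  have "cmod ((\<Sum>i<N. y i * cnj (q i)) - c) \<le> \<delta> + (\<delta> * ?n p + ?n \<epsilon>)"
    unfolding total by (intro norm_triangle_le add_mono t1 t2 t3)
  also have "\<dots> \<le> \<delta> + (\<delta> * (1 + 2 * ?ca) + 2 * \<delta> * (1 + ?ca))" using dP Q by linarith
  also have "\<dots> = \<delta> * (4 + 4 * ?ca)" by (simp add: algebra_simps)
  finally show ?thesis by (simp add: \<delta>_def)
qed

section \<open>Subadditivity of entropy and the Herbst argument\<close>

definition entropy_of :: "'a measure \<Rightarrow> ('a \<Rightarrow> real) \<Rightarrow> real" where
  "entropy_of M F = (LINT x|M. F x * ln (F x)) - (LINT x|M. F x) * ln (LINT x|M. F x)"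

text \<open>Modelled on exponentials of bounded functions. The bounds hold at every point and not
  just almost everywhere, so they survive fixing some of the coordinates.\<close>

definition bounded_pos :: "'a measure \<Rightarrow> ('a \<Rightarrow> real) \<Rightarrow> real \<Rightarrow> real \<Rightarrow> bool" where
  "bounded_pos M F c C \<longleftrightarrow> F \<in> borel_measurable M \<and> 0 < c \<and> (\<forall>x. c \<le> F x \<and> F x \<le> C)"

lemma bounded_posD:
  assumes "bounded_pos M F c C"
  shows "F \<in> borel_measurable M" "0 < c" "c \<le> F x" "F x \<le> C" "0 < F x" "\<bar>F x\<bar> \<le> C" "0 < C"
    "\<bar>ln (F x)\<bar> \<le> \<bar>ln c\<bar> + \<bar>ln C\<bar>"
proof -
  show a: "F \<in> borel_measurable M" "0 < c" "c \<le> F x" "F x \<le> C" using assms by (auto simp: bounded_pos_def)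
  then show b: "0 < F x" "\<bar>F x\<bar> \<le> C" "0 < C" by auto
  have "ln c \<le> ln (F x)" "ln (F x) \<le> ln C" using a b by auto
  then show "\<bar>ln (F x)\<bar> \<le> \<bar>ln c\<bar> + \<bar>ln C\<bar>" by linarith
qed

text \<open>Every entropy inequality below is an integrated form of ln t <= t - 1. The next four
  lemmas insert the ratio t suited to each, and the free constant k is later chosen so that the
  linear terms cancel after integration.\<close>

lemma mult_ln_le_mult_minus_one: "0 < f \<Longrightarrow> 0 < t \<Longrightarrow> f * ln t \<le> f * (t - 1)" for f t :: real
  by (intro mult_left_mono ln_le_minus_one) auto

lemma mult_ln_le_quadratic:
  fixes f k :: real
  assumes f: "0 < f" and k: "0 < k"
  shows "f * ln f \<le> f * ln k + f * f / k - f"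
  using mult_ln_le_mult_minus_one[of f "f / k"] assms by (simp add: ln_div algebra_simps)

lemma mult_le_entropy_dual:
  fixes f k y :: real
  assumes f: "0 < f" and k: "0 < k"
  shows "f * y \<le> f * ln f - f * ln k - f + k * exp y"
  using mult_ln_le_mult_minus_one[of f "k * exp y / f"] assms by (simp add: ln_div ln_mult algebra_simps)

lemma neg_mult_ln_le_sqrt:
  fixes f k :: real
  assumes f: "0 < f" and k: "0 < k"
  shows "- f * ln f / 2 \<le> f * ln k + sqrt f / k - f"
proof -
  have s: "0 < sqrt f" "sqrt f * sqrt f = f" using f by simp_all
  have "f * (1 / (sqrt f * k)) = sqrt f / k"
  proof -
    have "f * (1 / (sqrt f * k)) = (sqrt f * sqrt f) * (1 / (sqrt f * k))" by (simp only: s(2))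
    also have "\<dots> = sqrt f / k" using s(1) k by (simp del: real_sqrt_mult_self)
    finally show ?thesis .
  qed
  moreover have "ln (1 / (sqrt f * k)) = - (ln f / 2 + ln k)"
    using s f k by (simp add: ln_div ln_mult ln_sqrt)
  ultimately show ?thesis using mult_ln_le_mult_minus_one[of f "1 / (sqrt f * k)"] s f k
    by (simp add: right_diff_distrib distrib_left)
qed

lemma mult_ln_ratio_le:
  fixes f m n e :: real
  assumes f: "0 < f" and p: "0 < m" "0 < n" and e: "0 < e"
  shows "f * ln m + f * ln n - f * ln e + f - n * m / e \<le> f * ln f"
proof -
  have "f * (n * m / (e * f)) = n * m / e" using f by simp
  moreover have "ln (n * m / (e * f)) = ln n + ln m - (ln e + ln f)"
    using p e f by (simp add: ln_div ln_mult)
  moreover have "0 < n * m / (e * f)" using p e f by simp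
  ultimately show ?thesis using mult_ln_le_mult_minus_one[of f "n * m / (e * f)"] f
    by (simp add: right_diff_distrib distrib_left)
qed

lemma (in prob_space) integrable_of_bound:
  fixes f :: "'a \<Rightarrow> 'b :: {banach, second_countable_topology}"
  assumes "f \<in> borel_measurable M" "\<And>x. norm (f x) \<le> B"
  shows "integrable M f"
  using assms by (intro integrable_const_bound[where B = B]) auto

lemma (in prob_space) integral_between:
  fixes f :: "'a \<Rightarrow> real"
  assumes "f \<in> borel_measurable M" "\<And>x. c \<le> f x" "\<And>x. f x \<le> C"
  shows "c \<le> (LINT x|M. f x)" "(LINT x|M. f x) \<le> C"
proof -
  have "\<bar>f x\<bar> \<le> \<bar>c\<bar> + \<bar>C\<bar>" for x using assms(2,3)[of x] by linarith
  then have i: "integrable M f" using assms(1) by (intro integrable_of_bound[of _ "\<bar>c\<bar> + \<bar>C\<bar>"]) auto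
  show "c \<le> (LINT x|M. f x)" using integral_mono[of M "\<lambda>_. c" f] i assms(2) by (simp add: prob_space)
  show "(LINT x|M. f x) \<le> C" using integral_mono[of M f "\<lambda>_. C"] i assms(3) by (simp add: prob_space)
qed

lemma (in prob_space) bounded_pos_integrable:
  assumes "bounded_pos M F c C"
  shows "integrable M F" "integrable M (\<lambda>x. F x * ln (F x))" "integrable M (\<lambda>x. F x * F x)"
proof -
  note b = bounded_posD[OF assms]
  have [measurable]: "F \<in> borel_measurable M" by (rule b)
  show "integrable M F" using b by (intro integrable_of_bound[of _ C]) auto
  have "\<bar>F x * ln (F x)\<bar> \<le> C * (\<bar>ln c\<bar> + \<bar>ln C\<bar>)" for x
    unfolding abs_mult using b(6)[of x] b(7) b(8)[of x] by (intro mult_mono) auto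
  then show "integrable M (\<lambda>x. F x * ln (F x))" by (intro integrable_of_bound) auto
  have "\<bar>F x * F x\<bar> \<le> C * C" for x
    unfolding abs_mult using b(6)[of x] b(7) by (intro mult_mono) auto
  then show "integrable M (\<lambda>x. F x * F x)" by (intro integrable_of_bound) auto
qed

lemma (in prob_space) bounded_pos_integral_pos:
  assumes "bounded_pos M F c C"
  shows "c \<le> (LINT x|M. F x)" "(LINT x|M. F x) \<le> C" "0 < (LINT x|M. F x)"
  using integral_between[of F c C] bounded_posD[OF assms] by (auto intro: less_le_trans)

text \<open>Jensen's inequality for the logarithm under the law with density F / E F.\<close>

lemma (in prob_space) entropy_le_ln_second_moment:
  assumes F: "bounded_pos M F c C"
  shows "entropy_of M F \<le> (LINT x|M. F x) * ln ((LINT x|M. F x * F x) / (LINT x|M. F x)\<^sup>2)"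
proof -
  note b = bounded_posD[OF F] and i = bounded_pos_integrable[OF F]
  let ?E = "LINT x|M. F x" and ?E2 = "LINT x|M. F x * F x"
  have E: "0 < ?E" by (rule bounded_pos_integral_pos[OF F])
  have E2: "0 < ?E2"
  proof -
    have "c * c \<le> F x * F x" for x using b(2) b(3)[of x] b(5)[of x] by (intro mult_mono) auto
    then have "c * c \<le> ?E2" using integral_mono[of M "\<lambda>_. c * c"] i(3) by (simp add: prob_space)
    then show ?thesis using b(2) mult_pos_pos[of c c] by linarith
  qed
  let ?k = "?E2 / ?E"
  have k: "0 < ?k" using E E2 by simp
  have pt: "F x * ln (F x) \<le> F x * ln ?k + F x * F x / ?k - F x" for x
    by (rule mult_ln_le_quadratic[OF b(5) k])
  have "(LINT x|M. F x * ln (F x)) \<le> (LINT x|M. F x * ln ?k + F x * F x / ?k - F x)"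
    using i pt by (intro integral_mono) auto
  also have "\<dots> = ?E * ln ?k + ?E2 / ?k - ?E" using i by simp
  also have "?E2 / ?k = ?E" using E E2 by simp
  finally have "entropy_of M F \<le> ?E * ln ?k - ?E * ln ?E" by (simp add: entropy_of_def)
  also have "\<dots> = ?E * ln (?E2 / ?E\<^sup>2)" using E E2 by (simp add: ln_div ln_mult power2_eq_square algebra_simps)
  finally show ?thesis .
qed

text \<open>The Gibbs variational principle. Y may be unbounded, hence the separate integrability
  assumptions; it is applied to a multiple of |w|^2 to bound the second moment under a tilted
  law.\<close>

lemma (in prob_space) entropy_duality:
  assumes F: "bounded_pos M F c C" and Y: "integrable M (\<lambda>x. exp (Y x))" and FY: "integrable M (\<lambda>x. F x * Y x)"
  shows "(LINT x|M. F x * Y x) \<le> entropy_of M F + (LINT x|M. F x) * ln (LINT x|M. exp (Y x))"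
proof -
  note b = bounded_posD[OF F] and i = bounded_pos_integrable[OF F]
  let ?E = "LINT x|M. F x" and ?K = "LINT x|M. exp (Y x)"
  have E: "0 < ?E" by (rule bounded_pos_integral_pos[OF F])
  have K: "0 < ?K"
  proof -
    have "?K \<noteq> 0"
    proof
      assume "?K = 0"
      then have "AE x in M. exp (Y x) = 0" using integral_nonneg_eq_0_iff_AE[OF Y] by simp
      then show False using prob_space by (simp add: AE_False)
    qed
    moreover have "0 \<le> ?K" by (rule Bochner_Integration.integral_nonneg) simp
    ultimately show ?thesis by linarith
  qed
  let ?k = "?E / ?K"
  have k: "0 < ?k" using E K by simp
  have pt: "F x * Y x \<le> F x * ln (F x) - F x * ln ?k - F x + ?k * exp (Y x)" for x
    by (rule mult_le_entropy_dual[OF b(5) k])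
  have "(LINT x|M. F x * Y x) \<le> (LINT x|M. F x * ln (F x) - F x * ln ?k - F x + ?k * exp (Y x))"
    using i Y FY pt by (intro integral_mono) auto
  also have "\<dots> = (LINT x|M. F x * ln (F x)) - ?E * ln ?k - ?E + ?k * ?K" using i Y by simp
  also have "?k * ?K = ?E" using K by simp
  finally show ?thesis using E K by (simp add: entropy_of_def ln_div algebra_simps)
qed

text \<open>For F = exp (s f) and \<psi> s = ln E exp (s f) this bounds \<psi> s - 2 \<psi> (s / 2)
  by entropy over mean. Comparing s with s / 2 in place of a derivative lets the Herbst argument run
  without differentiating under the integral.\<close>

lemma (in prob_space) ln_integral_le_entropy:
  assumes F: "bounded_pos M F c C"
  shows "(LINT x|M. F x) * (ln (LINT x|M. F x) - 2 * ln (LINT x|M. sqrt (F x))) \<le> entropy_of M F"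
proof -
  note b = bounded_posD[OF F] and i = bounded_pos_integrable[OF F]
  let ?E = "LINT x|M. F x" and ?S = "LINT x|M. sqrt (F x)"
  have E: "0 < ?E" by (rule bounded_pos_integral_pos[OF F])
  have [measurable]: "F \<in> borel_measurable M" by (rule b)
  have sF: "bounded_pos M (\<lambda>x. sqrt (F x)) (sqrt c) (sqrt C)"
    using F by (auto simp: bounded_pos_def)
  have S: "0 < ?S" by (rule bounded_pos_integral_pos[OF sF])
  let ?k = "?S / ?E"
  have k: "0 < ?k" using E S by simp
  have pt: "- F x * ln (F x) / 2 \<le> F x * ln ?k + sqrt (F x) / ?k - F x" for x
    by (rule neg_mult_ln_le_sqrt[OF b(5) k])
  have "(LINT x|M. - F x * ln (F x) / 2) \<le> (LINT x|M. F x * ln ?k + sqrt (F x) / ?k - F x)"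
  proof (rule integral_mono)
    show "integrable M (\<lambda>x. - F x * ln (F x) / 2)" using i(2) by simp
    show "integrable M (\<lambda>x. F x * ln ?k + sqrt (F x) / ?k - F x)"
      using i bounded_pos_integrable(1)[OF sF] by simp
  qed (rule pt)
  also have "\<dots> = ?E * ln ?k + ?S / ?k - ?E" using i bounded_pos_integrable(1)[OF sF] by simp
  also have "?S / ?k = ?E" using E S by simp
  finally have "- (LINT x|M. F x * ln (F x)) \<le> 2 * ?E * ln ?k" by simp
  then show ?thesis using E S by (simp add: entropy_of_def ln_div algebra_simps)
qed

section \<open>Tensorization of entropy\<close>

locale two_prob_spaces = M1: prob_space M1 + M2: prob_space M2 for M1 :: "'a measure" and M2 :: "'b measure"
begin

sublocale P: pair_prob_space M1 M2 ..

text \<open>The difference of the two sides is the relative entropy of F with respect to n m / E,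
  the normalized product of its marginals, and so is nonnegative.\<close>

lemma entropy_pair_le:
  assumes F: "bounded_pos (M1 \<Otimes>\<^sub>M M2) F c C"
  shows "entropy_of (M1 \<Otimes>\<^sub>M M2) F \<le>
    (LINT y|M2. entropy_of M1 (\<lambda>x. F (x, y))) + (LINT x|M1. entropy_of M2 (\<lambda>y. F (x, y)))"
proof -
  note b = bounded_posD[OF F]
  have Fm [measurable]: "F \<in> borel_measurable (M1 \<Otimes>\<^sub>M M2)" by (rule b)
  define m where "m y = (LINT x|M1. F (x, y))" for y
  define n where "n x = (LINT y|M2. F (x, y))" for x
  have Fx: "bounded_pos M1 (\<lambda>x. F (x, y)) c C" if "y \<in> space M2" for y
    using F that by (auto simp: bounded_pos_def)
  have Fy: "bounded_pos M2 (\<lambda>y. F (x, y)) c C" if "x \<in> space M1" for x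
    using F that by (auto simp: bounded_pos_def)
  have mm [measurable]: "m \<in> borel_measurable M2" unfolding m_def by measurable
  have nm [measurable]: "n \<in> borel_measurable M1" unfolding n_def by measurable
  have m_b: "c \<le> m y" "m y \<le> C" "0 < m y" if "y \<in> space M2" for y
    unfolding m_def by (rule M1.bounded_pos_integral_pos[OF Fx[OF that]])+
  have n_b: "c \<le> n x" "n x \<le> C" "0 < n x" if "x \<in> space M1" for x
    unfolding n_def by (rule M2.bounded_pos_integral_pos[OF Fy[OF that]])+
  let ?I = "\<lambda>f. LINT z|(M1 \<Otimes>\<^sub>M M2). f z"
  let ?B = "\<bar>ln c\<bar> + \<bar>ln C\<bar>"
  have lnb: "\<bar>ln t\<bar> \<le> ?B" if "c \<le> t" "t \<le> C" for t
  proof -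
    have "ln c \<le> ln t" "ln t \<le> ln C" using that b(2) by auto
    then show ?thesis by linarith
  qed
  have bd: "integrable (M1 \<Otimes>\<^sub>M M2) f" if "f \<in> borel_measurable (M1 \<Otimes>\<^sub>M M2)" "\<And>z. z \<in> space (M1 \<Otimes>\<^sub>M M2) \<Longrightarrow> \<bar>f z\<bar> \<le> K" for f :: "'a \<times> 'b \<Rightarrow> real" and K
    using that by (intro P.integrable_const_bound[where B = K]) auto
  have bm: "\<bar>s * t\<bar> \<le> C * ?B" if "\<bar>s\<bar> \<le> C" "\<bar>t\<bar> \<le> ?B" for s t :: real
    unfolding abs_mult using that b(7) by (intro mult_mono) auto
  have i1: "integrable (M1 \<Otimes>\<^sub>M M2) F" and i2: "integrable (M1 \<Otimes>\<^sub>M M2) (\<lambda>z. F z * ln (F z))"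
    by (rule P.bounded_pos_integrable[OF F])+
  have i3: "integrable (M1 \<Otimes>\<^sub>M M2) (\<lambda>z. F z * ln (m (snd z)))"
    using b(6) lnb m_b by (intro bd[of _ "C * ?B"] bm) (auto simp: space_pair_measure)
  have i4: "integrable (M1 \<Otimes>\<^sub>M M2) (\<lambda>z. F z * ln (n (fst z)))"
    using b(6) lnb n_b by (intro bd[of _ "C * ?B"] bm) (auto simp: space_pair_measure)
  have i5: "integrable (M1 \<Otimes>\<^sub>M M2) (\<lambda>z. n (fst z) * m (snd z))"
  proof (rule bd[of _ "C * C"])
    fix z assume "z \<in> space (M1 \<Otimes>\<^sub>M M2)"
    then have "\<bar>n (fst z)\<bar> \<le> C" "\<bar>m (snd z)\<bar> \<le> C" using n_b m_b by (force simp: space_pair_measure)+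
    then show "\<bar>n (fst z) * m (snd z)\<bar> \<le> C * C" unfolding abs_mult using b(7) by (intro mult_mono) auto
  qed measurable
  let ?E = "?I F"
  have E: "0 < ?E" by (rule P.bounded_pos_integral_pos[OF F])
  have fst: "?I f = (LINT x|M1. (LINT y|M2. f (x, y)))" and snd: "?I f = (LINT y|M2. (LINT x|M1. f (x, y)))"
    if "integrable (M1 \<Otimes>\<^sub>M M2) f" for f :: "'a \<times> 'b \<Rightarrow> real"
    using P.integral_fst'[OF that] P.integral_snd[of "\<lambda>x y. f (x, y)"] that by simp_all
  have ent1: "(LINT y|M2. entropy_of M1 (\<lambda>x. F (x, y))) = ?I (\<lambda>z. F z * ln (F z)) - ?I (\<lambda>z. F z * ln (m (snd z)))"
  proof -
    have "(LINT y|M2. entropy_of M1 (\<lambda>x. F (x, y))) = (LINT y|M2. (LINT x|M1. F (x, y) * ln (F (x, y)) - F (x, y) * ln (m y)))"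
    proof (rule Bochner_Integration.integral_cong)
      fix y assume y: "y \<in> space M2"
      show "entropy_of M1 (\<lambda>x. F (x, y)) = (LINT x|M1. F (x, y) * ln (F (x, y)) - F (x, y) * ln (m y))"
        using M1.bounded_pos_integrable[OF Fx[OF y]] by (simp add: entropy_of_def m_def)
    qed simp
    also have "\<dots> = ?I (\<lambda>z. F z * ln (F z) - F z * ln (m (snd z)))"
      using i2 i3 by (subst snd) auto
    finally show ?thesis using i2 i3 by simp
  qed
  have ent2: "(LINT x|M1. entropy_of M2 (\<lambda>y. F (x, y))) = ?I (\<lambda>z. F z * ln (F z)) - ?I (\<lambda>z. F z * ln (n (fst z)))"
  proof -
    have "(LINT x|M1. entropy_of M2 (\<lambda>y. F (x, y))) = (LINT x|M1. (LINT y|M2. F (x, y) * ln (F (x, y)) - F (x, y) * ln (n x)))"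
    proof (rule Bochner_Integration.integral_cong)
      fix x assume x: "x \<in> space M1"
      show "entropy_of M2 (\<lambda>y. F (x, y)) = (LINT y|M2. F (x, y) * ln (F (x, y)) - F (x, y) * ln (n x))"
        using M2.bounded_pos_integrable[OF Fy[OF x]] by (simp add: entropy_of_def n_def)
    qed simp
    also have "\<dots> = ?I (\<lambda>z. F z * ln (F z) - F z * ln (n (fst z)))"
      using i2 i4 by (subst fst) auto
    finally show ?thesis using i2 i4 by simp
  qed
  have nm: "?I (\<lambda>z. n (fst z) * m (snd z)) = ?E * ?E"
  proof -
    have "?I (\<lambda>z. n (fst z) * m (snd z)) = (LINT x|M1. n x) * (LINT y|M2. m y)"
      by (subst fst[OF i5]) simp
    then show ?thesis using fst[OF i1] snd[OF i1] by (simp add: m_def n_def)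
  qed
  have pt: "F z * ln (m (snd z)) + F z * ln (n (fst z)) - F z * ln ?E + F z - n (fst z) * m (snd z) / ?E \<le> F z * ln (F z)"
    if z: "z \<in> space (M1 \<Otimes>\<^sub>M M2)" for z
  proof -
    have p: "0 < m (snd z)" "0 < n (fst z)" using z m_b n_b by (auto simp: space_pair_measure)
    show ?thesis by (rule mult_ln_ratio_le[OF b(5) p E])
  qed
  have "?I (\<lambda>z. F z * ln (m (snd z)) + F z * ln (n (fst z)) - F z * ln ?E + F z - n (fst z) * m (snd z) / ?E) \<le> ?I (\<lambda>z. F z * ln (F z))"
    using i1 i2 i3 i4 i5 pt by (intro integral_mono) auto
  also have "?I (\<lambda>z. F z * ln (m (snd z)) + F z * ln (n (fst z)) - F z * ln ?E + F z - n (fst z) * m (snd z) / ?E) =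
     ?I (\<lambda>z. F z * ln (m (snd z))) + ?I (\<lambda>z. F z * ln (n (fst z))) - ?E * ln ?E + ?E - (?E * ?E) / ?E"
    using i1 i2 i3 i4 i5 by (simp add: nm)
  finally show ?thesis unfolding ent1 ent2 using E by (simp add: entropy_of_def)
qed

end

lemma measurable_PiM_update:
  assumes "j \<in> J"
  shows "(\<lambda>p. (fst p)(j := snd p)) \<in> (PiM J \<nu> \<Otimes>\<^sub>M \<nu> j) \<rightarrow>\<^sub>M PiM J \<nu>"
  using assms by (intro measurable_fun_upd[where J = J]) auto

lemma measurable_PiM_insert_update:
  "(\<lambda>p. (snd p)(k := fst p)) \<in> (\<nu> k \<Otimes>\<^sub>M PiM I \<nu>) \<rightarrow>\<^sub>M PiM (insert k I) \<nu>"
  by (intro measurable_fun_upd[where J = I]) auto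

lemma abs_entropy_of_le:
  assumes "prob_space M" and F: "bounded_pos M F c C"
  shows "\<bar>entropy_of M F\<bar> \<le> 2 * (C * (\<bar>ln c\<bar> + \<bar>ln C\<bar>))"
proof -
  interpret prob_space M by fact
  note b = bounded_posD[OF F]
  let ?B = "\<bar>ln c\<bar> + \<bar>ln C\<bar>"
  have [measurable]: "F \<in> borel_measurable M" by (rule b)
  have "\<bar>F x * ln (F x)\<bar> \<le> C * ?B" for x
    unfolding abs_mult using b(6)[of x] b(7) b(8)[of x] by (intro mult_mono) auto
  then have "- (C * ?B) \<le> F x * ln (F x)" "F x * ln (F x) \<le> C * ?B" for x
    by (simp_all only: abs_le_iff) (metis minus_le_iff)
  then have 1: "\<bar>LINT x|M. F x * ln (F x)\<bar> \<le> C * ?B"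
    using integral_between[of "\<lambda>x. F x * ln (F x)" "- (C * ?B)" "C * ?B"] by (auto simp: abs_le_iff)
  have e: "c \<le> (LINT x|M. F x)" "(LINT x|M. F x) \<le> C" "0 < (LINT x|M. F x)"
    by (rule bounded_pos_integral_pos[OF F])+
  have "ln c \<le> ln (LINT x|M. F x)" "ln (LINT x|M. F x) \<le> ln C" using e b(2) by auto
  then have "\<bar>ln (LINT x|M. F x)\<bar> \<le> ?B" by linarith
  then have 2: "\<bar>(LINT x|M. F x) * ln (LINT x|M. F x)\<bar> \<le> C * ?B"
    unfolding abs_mult using e b(7) by (intro mult_mono) auto
  show ?thesis unfolding entropy_of_def using 1 2 by linarith
qed

lemma entropy_of_parametric_measurable [measurable (raw)]:
  assumes "prob_space M" and [measurable]: "(\<lambda>p. F (fst p) (snd p)) \<in> borel_measurable (N \<Otimes>\<^sub>M M)"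
  shows "(\<lambda>x. entropy_of M (F x)) \<in> borel_measurable N"
proof -
  interpret prob_space M by fact
  have [measurable]: "(\<lambda>(x, y). F x y) \<in> borel_measurable (N \<Otimes>\<^sub>M M)"
    using assms(2) by (simp add: case_prod_beta')
  show ?thesis unfolding entropy_of_def by measurable
qed

context
  fixes \<nu> :: "'i \<Rightarrow> 'a measure"
  assumes \<nu>: "\<And>k. prob_space (\<nu> k)"
begin

lemma prob_space_PiM_all: "prob_space (PiM I \<nu>)"
  by (rule prob_space_PiM) (rule \<nu>)

lemma integral_PiM_insert:
  fixes g :: "('i \<Rightarrow> 'a) \<Rightarrow> 'b :: {banach, second_countable_topology}"
  assumes g: "g \<in> borel_measurable (PiM (insert k I) \<nu>)" and B: "\<And>x. norm (g x) \<le> B"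
  shows "(LINT x|PiM (insert k I) \<nu>. g x) = (LINT p|(\<nu> k \<Otimes>\<^sub>M PiM I \<nu>). g ((snd p)(k := fst p)))"
    and "(LINT x|PiM (insert k I) \<nu>. g x) = (LINT x|PiM I \<nu>. (LINT y|\<nu> k. g (x(k := y))))"
    and "(LINT x|PiM (insert k I) \<nu>. g x) = (LINT y|\<nu> k. (LINT x|PiM I \<nu>. g (x(k := y))))"
proof -
  interpret M1: prob_space "\<nu> k" by (rule \<nu>)
  interpret M2: prob_space "PiM I \<nu>" by (rule prob_space_PiM_all)
  interpret two_prob_spaces "\<nu> k" "PiM I \<nu>" ..
  have d: "distr (\<nu> k \<Otimes>\<^sub>M PiM I \<nu>) (PiM (insert k I) \<nu>) (\<lambda>p. (snd p)(k := fst p)) = PiM (insert k I) \<nu>"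
    using distr_pair_PiM_eq_PiM[of I \<nu> k] \<nu> by (simp add: case_prod_beta')
  show 1: "(LINT x|PiM (insert k I) \<nu>. g x) = (LINT p|(\<nu> k \<Otimes>\<^sub>M PiM I \<nu>). g ((snd p)(k := fst p)))"
    by (subst d[symmetric], subst integral_distr[OF measurable_PiM_insert_update g]) (rule refl)
  have gm: "(\<lambda>p. g ((snd p)(k := fst p))) \<in> borel_measurable (\<nu> k \<Otimes>\<^sub>M PiM I \<nu>)"
    using measurable_compose[OF measurable_PiM_insert_update g] by simp
  have i: "integrable (\<nu> k \<Otimes>\<^sub>M PiM I \<nu>) (\<lambda>p. g ((snd p)(k := fst p)))"
    by (rule P.integrable_of_bound[OF gm B])
  show "(LINT x|PiM (insert k I) \<nu>. g x) = (LINT x|PiM I \<nu>. (LINT y|\<nu> k. g (x(k := y))))"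
    unfolding 1 using P.integral_snd[of "\<lambda>y x. g (x(k := y))"] i by (simp add: case_prod_beta')
  show "(LINT x|PiM (insert k I) \<nu>. g x) = (LINT y|\<nu> k. (LINT x|PiM I \<nu>. g (x(k := y))))"
    unfolding 1 using P.integral_fst'[OF i] by simp
qed

lemma bounded_pos_PiM_update:
  assumes "bounded_pos (PiM I \<nu>) F c C" "k \<in> I" "x \<in> space (PiM I \<nu>)"
  shows "bounded_pos (\<nu> k) (\<lambda>y. F (x(k := y))) c C"
proof -
  have "(\<lambda>y. x(k := y)) \<in> \<nu> k \<rightarrow>\<^sub>M PiM I \<nu>"
    using assms by (intro measurable_fun_upd[where J = I]) auto
  from measurable_compose[OF this, of F borel] show ?thesis using assms(1) by (auto simp: bounded_pos_def)
qed

lemma entropy_PiM_update_measurable: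
  assumes F: "F \<in> borel_measurable (PiM I \<nu>)" and k: "k \<in> I"
  shows "(\<lambda>x. entropy_of (\<nu> k) (\<lambda>y. F (x(k := y)))) \<in> borel_measurable (PiM I \<nu>)"
  using measurable_compose[OF measurable_PiM_update[OF k] F]
  by (intro entropy_of_parametric_measurable[OF \<nu>]) simp

theorem entropy_PiM_le:
  assumes "finite I" and "bounded_pos (PiM I \<nu>) F c C"
  shows "entropy_of (PiM I \<nu>) F \<le> (\<Sum>k\<in>I. LINT x|PiM I \<nu>. entropy_of (\<nu> k) (\<lambda>y. F (x(k := y))))"
  using assms
proof (induction I arbitrary: F rule: finite_induct)
  case empty
  interpret prob_space "PiM {} \<nu>" by (rule prob_space_PiM_all)
  have sp: "space (PiM {} \<nu>) = {\<lambda>_. undefined}" by (simp add: space_PiM)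
  have c: "(LINT x|PiM {} \<nu>. h x) = h (\<lambda>_. undefined)" for h :: "('i \<Rightarrow> 'a) \<Rightarrow> real"
  proof -
    have "(LINT x|PiM {} \<nu>. h x) = (LINT x|PiM {} \<nu>. h (\<lambda>_. undefined))"
      by (rule Bochner_Integration.integral_cong) (simp_all add: sp)
    then show ?thesis using prob_space by simp
  qed
  show ?case by (simp add: entropy_of_def c)
next
  case (insert k I)
  let ?J = "insert k I"
  interpret M1: prob_space "\<nu> k" by (rule \<nu>)
  interpret M2: prob_space "PiM I \<nu>" by (rule prob_space_PiM_all)
  interpret two_prob_spaces "\<nu> k" "PiM I \<nu>" ..
  note b = bounded_posD[OF insert.prems]
  let ?K = "2 * (C * (\<bar>ln c\<bar> + \<bar>ln C\<bar>))"
  let ?F' = "\<lambda>p. F ((snd p)(k := fst p))"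
  have Fm [measurable]: "F \<in> borel_measurable (PiM ?J \<nu>)" by (rule b)
  have F'm: "?F' \<in> borel_measurable (\<nu> k \<Otimes>\<^sub>M PiM I \<nu>)"
    using measurable_compose[OF measurable_PiM_insert_update Fm] by simp
  have F': "bounded_pos (\<nu> k \<Otimes>\<^sub>M PiM I \<nu>) ?F' c C"
    using F'm insert.prems by (auto simp: bounded_pos_def)
  have Fl: "norm (F x * ln (F x)) \<le> C * (\<bar>ln c\<bar> + \<bar>ln C\<bar>)" for x
    unfolding real_norm_def abs_mult using b(6)[of x] b(7) b(8)[of x] by (intro mult_mono) auto
  have Fn: "norm (F x) \<le> C" for x using b(6)[of x] by simp
  have Flm: "(\<lambda>x. F x * ln (F x)) \<in> borel_measurable (PiM ?J \<nu>)" by measurable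
  define E where "E j x = entropy_of (\<nu> j) (\<lambda>t. F (x(j := t)))" for j x
  \<comment> \<open>Integrability is derived from bounds valid at all points, and \<open>E j\<close>
    is bounded only on the space. Cutting it off to 0 outside changes no integral.\<close>
  define g where "g j x = (if x \<in> space (PiM ?J \<nu>) then E j x else 0)" for j x
  have Em: "E j \<in> borel_measurable (PiM ?J \<nu>)" if "j \<in> ?J" for j
    unfolding E_def by (rule entropy_PiM_update_measurable[OF Fm that])
  have gm: "g j \<in> borel_measurable (PiM ?J \<nu>)" if "j \<in> ?J" for j
    using Em[OF that] by (subst measurable_cong[where g = "E j"]) (auto simp: g_def)
  have gb: "norm (g j x) \<le> ?K" if "j \<in> ?J" for j x
  proof (cases "x \<in> space (PiM ?J \<nu>)")
    case True
    have "\<bar>E j x\<bar> \<le> ?K"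
      unfolding E_def by (rule abs_entropy_of_le[OF \<nu> bounded_pos_PiM_update[OF insert.prems that True]])
    then show ?thesis using True by (simp add: g_def)
  qed (use b(7) in \<open>simp add: g_def\<close>)
  have up: "x(k := y) \<in> space (PiM ?J \<nu>)" if "x \<in> space (PiM I \<nu>)" "y \<in> space (\<nu> k)" for x y
    using measurable_space[OF measurable_PiM_insert_update, of "(y, x)" \<nu> k I] that by (simp add: space_pair_measure)
  have gE: "(LINT x|PiM ?J \<nu>. g j x) = (LINT x|PiM ?J \<nu>. E j x)" for j
    by (rule Bochner_Integration.integral_cong) (auto simp: g_def)
  have "entropy_of (PiM ?J \<nu>) F = entropy_of (\<nu> k \<Otimes>\<^sub>M PiM I \<nu>) ?F'"
    unfolding entropy_of_def by (simp only: integral_PiM_insert(1)[OF Fm Fn] integral_PiM_insert(1)[OF Flm Fl])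
  also have "\<dots> \<le> (LINT x|PiM I \<nu>. entropy_of (\<nu> k) (\<lambda>y. F (x(k := y)))) + (LINT y|\<nu> k. entropy_of (PiM I \<nu>) (\<lambda>x. F (x(k := y))))"
    using entropy_pair_le[OF F'] by (simp only: fst_conv snd_conv)
  also have "(LINT x|PiM I \<nu>. entropy_of (\<nu> k) (\<lambda>y. F (x(k := y)))) = (LINT x|PiM ?J \<nu>. E k x)"
  proof -
    have "(LINT x|PiM ?J \<nu>. E k x) = (LINT x|PiM I \<nu>. (LINT y|\<nu> k. g k (x(k := y))))"
      unfolding gE[symmetric] by (rule integral_PiM_insert(2)[OF gm gb]) auto
    also have "\<dots> = (LINT x|PiM I \<nu>. (LINT y|\<nu> k. E k x))"
    proof (intro Bochner_Integration.integral_cong refl)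
      fix x y assume "x \<in> space (PiM I \<nu>)" "y \<in> space (\<nu> k)"
      then have "g k (x(k := y)) = E k (x(k := y))" using up by (simp add: g_def)
      also have "\<dots> = E k x" unfolding E_def by (simp only: fun_upd_upd)
      finally show "g k (x(k := y)) = E k x" .
    qed
    also have "\<dots> = (LINT x|PiM I \<nu>. E k x)" using M1.prob_space by simp
    finally show ?thesis by (simp only: E_def)
  qed
  also have "(LINT y|\<nu> k. entropy_of (PiM I \<nu>) (\<lambda>x. F (x(k := y)))) \<le> (\<Sum>j\<in>I. LINT x|PiM ?J \<nu>. E j x)"
  proof -
    have g'm: "(\<lambda>p. g j ((snd p)(k := fst p))) \<in> borel_measurable (\<nu> k \<Otimes>\<^sub>M PiM I \<nu>)" if "j \<in> I" for j
      by (rule measurable_compose[OF measurable_PiM_insert_update gm]) (use that in simp)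
    have g'i: "integrable (\<nu> k \<Otimes>\<^sub>M PiM I \<nu>) (\<lambda>p. g j ((snd p)(k := fst p)))" if "j \<in> I" for j
      by (rule P.integrable_of_bound[OF g'm gb]) (use that in auto)
    have Fyb: "bounded_pos (PiM I \<nu>) (\<lambda>x. F (x(k := y))) c C" if y: "y \<in> space (\<nu> k)" for y
    proof -
      have "(\<lambda>x. F (x(k := y))) \<in> borel_measurable (PiM I \<nu>)"
        using measurable_compose[OF measurable_Pair1'[OF y, of "PiM I \<nu>"] F'm] by (simp only: fst_conv snd_conv)
      then show ?thesis using insert.prems unfolding bounded_pos_def by blast
    qed
    have step: "entropy_of (PiM I \<nu>) (\<lambda>x. F (x(k := y))) \<le> (\<Sum>j\<in>I. LINT x|PiM I \<nu>. g j (x(k := y)))" if y: "y \<in> space (\<nu> k)" for y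
    proof -
      have "entropy_of (PiM I \<nu>) (\<lambda>x. F (x(k := y))) \<le> (\<Sum>j\<in>I. LINT x|PiM I \<nu>. entropy_of (\<nu> j) (\<lambda>t. F (x(j := t, k := y))))"
        by (rule insert.IH[OF Fyb[OF y]])
      also have "\<dots> = (\<Sum>j\<in>I. LINT x|PiM I \<nu>. g j (x(k := y)))"
      proof (intro sum.cong Bochner_Integration.integral_cong refl)
        fix j x assume j: "j \<in> I" and x: "x \<in> space (PiM I \<nu>)"
        have "x(j := t, k := y) = x(k := y, j := t)" for t using j insert.hyps by (intro fun_upd_twist) auto
        then have "entropy_of (\<nu> j) (\<lambda>t. F (x(j := t, k := y))) = E j (x(k := y))" by (simp only: E_def)
        then show "entropy_of (\<nu> j) (\<lambda>t. F (x(j := t, k := y))) = g j (x(k := y))" using up[OF x y] by (simp only: g_def if_True)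
      qed
      finally show ?thesis .
    qed
    have em: "(\<lambda>y. entropy_of (PiM I \<nu>) (\<lambda>x. F (x(k := y)))) \<in> borel_measurable (\<nu> k)"
      by (rule entropy_of_parametric_measurable[OF prob_space_PiM_all F'm])
    have ei: "integrable (\<nu> k) (\<lambda>y. entropy_of (PiM I \<nu>) (\<lambda>x. F (x(k := y))))"
      using abs_entropy_of_le[OF prob_space_PiM_all Fyb]
      by (intro M1.integrable_const_bound[where B = ?K] em AE_I2) (simp only: real_norm_def)
    have fi: "integrable (\<nu> k) (\<lambda>y. LINT x|PiM I \<nu>. g j (x(k := y)))" if "j \<in> I" for j
      using P.integrable_fst'[OF g'i[OF that]] by (simp only: fst_conv snd_conv)
    have "(LINT y|\<nu> k. entropy_of (PiM I \<nu>) (\<lambda>x. F (x(k := y)))) \<le> (LINT y|\<nu> k. (\<Sum>j\<in>I. LINT x|PiM I \<nu>. g j (x(k := y))))"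
      by (rule integral_mono[OF ei Bochner_Integration.integrable_sum[OF fi] step])
    also have "\<dots> = (\<Sum>j\<in>I. LINT y|\<nu> k. (LINT x|PiM I \<nu>. g j (x(k := y))))"
      by (rule Bochner_Integration.integral_sum) (rule fi)
    also have "\<dots> = (\<Sum>j\<in>I. LINT x|PiM ?J \<nu>. g j x)"
    proof (rule sum.cong[OF refl])
      fix j assume "j \<in> I"
      then have j: "j \<in> ?J" by simp
      show "(LINT y|\<nu> k. (LINT x|PiM I \<nu>. g j (x(k := y)))) = (LINT x|PiM ?J \<nu>. g j x)"
        by (rule integral_PiM_insert(3)[OF gm[OF j] gb[OF j], symmetric])
    qed
    finally show ?thesis by (simp only: gE)
  qed
  finally have "entropy_of (PiM ?J \<nu>) F \<le> (LINT x|PiM ?J \<nu>. E k x) + (\<Sum>j\<in>I. LINT x|PiM ?J \<nu>. E j x)"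
    by simp
  then show ?case unfolding sum.insert[OF insert.hyps] E_def .
qed

end

section \<open>The Herbst argument\<close>

lemma exp_le_quadratic:
  fixes x :: real
  assumes "x \<le> 1"
  shows "exp x \<le> 1 + x + x\<^sup>2"
proof (cases "0 \<le> x")
  case True
  then show ?thesis using exp_bound assms by blast
next
  case False
  define y where "y = - x"
  have y: "0 \<le> y" using False by (simp add: y_def)
  have e: "1 + y + y\<^sup>2 / 2 \<le> exp y" by (rule exp_lower_Taylor_quadratic[OF y])
  have n: "0 \<le> 1 - y + y\<^sup>2"
  proof -
    have "1 - y + y\<^sup>2 = (y - 1 / 2)\<^sup>2 + 3 / 4" by (simp add: power2_eq_square algebra_simps)
    then show ?thesis by simp
  qed
  have "1 \<le> (1 - y + y\<^sup>2) * (1 + y + y\<^sup>2 / 2)"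
  proof -
    have "(1 - y + y\<^sup>2) * (1 + y + y\<^sup>2 / 2) = 1 + (y\<^sup>2 + y ^ 3 + y ^ 4) / 2"
      by (simp add: field_simps power2_eq_square power3_eq_cube power4_eq_xxxx)
    then show ?thesis using y by simp
  qed
  also have "\<dots> \<le> (1 - y + y\<^sup>2) * exp y" by (rule mult_left_mono[OF e n])
  finally have "exp (- y) \<le> 1 - y + y\<^sup>2" by (simp add: exp_minus field_simps)
  then show ?thesis by (simp add: y_def)
qed

lemma (in prob_space) integral_exp_bounds:
  fixes f :: "'a \<Rightarrow> real"
  assumes [measurable]: "f \<in> borel_measurable M" and K: "\<And>x. \<bar>f x\<bar> \<le> K"
  shows "bounded_pos M (\<lambda>x. exp (s * f x)) (exp (- (\<bar>s\<bar> * K))) (exp (\<bar>s\<bar> * K))"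
    and "exp (s * (LINT x|M. f x)) \<le> (LINT x|M. exp (s * f x))"
    and "\<bar>s\<bar> * K \<le> 1 \<Longrightarrow> (LINT x|M. exp (s * f x)) \<le> exp (s * (LINT x|M. f x) + s\<^sup>2 * K\<^sup>2)"
proof -
  have sK: "\<bar>s * f x\<bar> \<le> \<bar>s\<bar> * K" for x unfolding abs_mult using K by (intro mult_left_mono) auto
  then have "- (\<bar>s\<bar> * K) \<le> s * f x" "s * f x \<le> \<bar>s\<bar> * K" for x
    by (simp_all only: abs_le_iff) (metis minus_le_iff)
  then show b: "bounded_pos M (\<lambda>x. exp (s * f x)) (exp (- (\<bar>s\<bar> * K))) (exp (\<bar>s\<bar> * K))"
    by (auto simp: bounded_pos_def)
  have i: "integrable M f" "integrable M (\<lambda>x. exp (s * f x))"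
    using integrable_of_bound[OF assms(1), of K] K bounded_pos_integrable(1)[OF b] by simp_all
  let ?m = "LINT x|M. f x"
  have pt: "exp (s * ?m) * (1 + (s * f x - s * ?m)) \<le> exp (s * f x)" for x
  proof -
    have "1 + (s * f x - s * ?m) \<le> exp (s * f x - s * ?m)" by (rule exp_ge_add_one_self)
    then have "exp (s * ?m) * (1 + (s * f x - s * ?m)) \<le> exp (s * ?m) * exp (s * f x - s * ?m)" by simp
    then show ?thesis by (simp add: exp_add[symmetric])
  qed
  have "(LINT x|M. exp (s * ?m) * (1 + (s * f x - s * ?m))) \<le> (LINT x|M. exp (s * f x))"
    using i pt by (intro integral_mono) auto
  moreover have "(LINT x|M. exp (s * ?m) * (1 + (s * f x - s * ?m))) = exp (s * ?m)"
    using i by (simp add: prob_space)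
  ultimately show "exp (s * ?m) \<le> (LINT x|M. exp (s * f x))" by simp
  show "(LINT x|M. exp (s * f x)) \<le> exp (s * ?m + s\<^sup>2 * K\<^sup>2)" if sk1: "\<bar>s\<bar> * K \<le> 1"
  proof -
    have pt: "exp (s * f x) \<le> 1 + s * f x + s\<^sup>2 * K\<^sup>2" for x
    proof -
      have "\<bar>s * f x\<bar> \<le> 1" using sK[of x] sk1 by linarith
      then have "exp (s * f x) \<le> 1 + s * f x + (s * f x)\<^sup>2"
        by (intro exp_le_quadratic) auto
      also have "(s * f x)\<^sup>2 = \<bar>s * f x\<bar>\<^sup>2" by simp
      also have "\<dots> \<le> (\<bar>s\<bar> * K)\<^sup>2" by (intro power_mono sK) simp
      finally show ?thesis by (simp add: power_mult_distrib)
    qed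
    have "(LINT x|M. exp (s * f x)) \<le> (LINT x|M. 1 + s * f x + s\<^sup>2 * K\<^sup>2)"
      using i pt by (intro integral_mono) auto
    also have "\<dots> = 1 + (s * ?m + s\<^sup>2 * K\<^sup>2)" using i by (simp add: prob_space)
    also have "\<dots> \<le> exp (s * ?m + s\<^sup>2 * K\<^sup>2)" by (rule exp_ge_add_one_self)
    finally show ?thesis .
  qed
qed

text \<open>Halving the argument repeatedly gives \<psi> t <= 2^n \<psi> (t / 2^n) plus v t^2 times
  a partial geometric sum, whose limit is the factor 2. The first term tends to t times the mean.
  Entropy bounds are assumed on (0, t] only, because the modified inequality holds only for small
  exponents.\<close>

theorem (in prob_space) herbst:
  fixes f :: "'a \<Rightarrow> real"
  assumes f: "f \<in> borel_measurable M" and K: "\<And>x. \<bar>f x\<bar> \<le> K"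
    and ent: "\<And>s. 0 < s \<Longrightarrow> s \<le> t \<Longrightarrow> entropy_of M (\<lambda>x. exp (s * f x)) \<le> v * s\<^sup>2 * (LINT x|M. exp (s * f x))"
    and l: "0 < t" and v: "0 \<le> v"
  shows "(LINT x|M. exp (t * f x)) \<le> exp (t * (LINT x|M. f x) + 2 * v * t\<^sup>2)"
proof -
  define \<psi> where "\<psi> s = ln (LINT x|M. exp (s * f x))" for s
  let ?m = "LINT x|M. f x"
  have K0: "0 \<le> K" using K[of undefined] by linarith
  have pos: "0 < (LINT x|M. exp (s * f x))" for s
    by (rule bounded_pos_integral_pos[OF integral_exp_bounds(1)[OF f K]])
  have half: "\<psi> s \<le> 2 * \<psi> (s / 2) + v * s\<^sup>2" if s: "0 < s" "s \<le> t" for s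
  proof -
    have sq: "sqrt (exp (s * f x)) = exp (s / 2 * f x)" for x
      by (intro real_sqrt_unique) (simp_all add: exp_double[symmetric])
    have "(LINT x|M. exp (s * f x)) * (\<psi> s - 2 * \<psi> (s / 2)) \<le> entropy_of M (\<lambda>x. exp (s * f x))"
      using ln_integral_le_entropy[OF integral_exp_bounds(1)[OF f K, of s]] unfolding sq \<psi>_def .
    also have "\<dots> \<le> (LINT x|M. exp (s * f x)) * (v * s\<^sup>2)" using ent[OF s] by (simp add: mult_ac)
    finally have "\<psi> s - 2 * \<psi> (s / 2) \<le> v * s\<^sup>2" using pos[of s] by simp
    then show ?thesis by simp
  qed
  have iter: "\<psi> t \<le> 2 ^ n * \<psi> (t / 2 ^ n) + v * t\<^sup>2 * (2 - 2 / 2 ^ n)" for n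
  proof (induction n)
    case (Suc n)
    have "t * 1 \<le> t * 2 ^ n" using l by (intro mult_left_mono) auto
    then have h: "\<psi> (t / 2 ^ n) \<le> 2 * \<psi> (t / 2 ^ n / 2) + v * (t / 2 ^ n)\<^sup>2"
      using l by (intro half) (auto simp: field_simps)
    have "\<psi> t \<le> 2 ^ n * \<psi> (t / 2 ^ n) + v * t\<^sup>2 * (2 - 2 / 2 ^ n)" by (rule Suc)
    also have "\<dots> \<le> 2 ^ n * (2 * \<psi> (t / 2 ^ n / 2) + v * (t / 2 ^ n)\<^sup>2) + v * t\<^sup>2 * (2 - 2 / 2 ^ n)"
      using h by (intro add_right_mono mult_left_mono) auto
    also have "\<dots> = 2 ^ Suc n * \<psi> (t / 2 ^ Suc n) + v * t\<^sup>2 * (2 - 2 / 2 ^ Suc n)"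
      by (simp add: field_simps power2_eq_square)
    finally show ?case .
  qed simp
  have small: "2 ^ n * \<psi> (t / 2 ^ n) \<le> t * ?m + t\<^sup>2 * K\<^sup>2 / 2 ^ n" if n: "t * K \<le> 2 ^ n" for n
  proof -
    let ?s = "t / 2 ^ n"
    have "\<bar>?s\<bar> * K \<le> 1" using n l by (simp add: field_simps)
    then have "(LINT x|M. exp (?s * f x)) \<le> exp (?s * ?m + ?s\<^sup>2 * K\<^sup>2)"
      by (rule integral_exp_bounds(3)[OF f K])
    then have "\<psi> ?s \<le> ?s * ?m + ?s\<^sup>2 * K\<^sup>2"
      unfolding \<psi>_def using pos[of ?s] by (metis ln_exp ln_le_cancel_iff exp_gt_zero)
    then have "2 ^ n * \<psi> ?s \<le> 2 ^ n * (?s * ?m + ?s\<^sup>2 * K\<^sup>2)" by (intro mult_left_mono) auto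
    also have "\<dots> = t * ?m + t\<^sup>2 * K\<^sup>2 / 2 ^ n" by (simp add: field_simps power2_eq_square)
    finally show ?thesis .
  qed
  have "\<psi> t \<le> t * ?m + 2 * v * t\<^sup>2"
  proof (rule LIMSEQ_le_const)
    have "(\<lambda>n. (1 / 2) ^ n :: real) \<longlonglongrightarrow> 0" by (rule LIMSEQ_realpow_zero) auto
    then have "(\<lambda>n. t * ?m + t\<^sup>2 * K\<^sup>2 * (1 / 2) ^ n + v * t\<^sup>2 * 2) \<longlonglongrightarrow> t * ?m + t\<^sup>2 * K\<^sup>2 * 0 + v * t\<^sup>2 * 2"
      by (intro tendsto_add tendsto_mult tendsto_const)
    then show "(\<lambda>n. t * ?m + t\<^sup>2 * K\<^sup>2 * (1 / 2) ^ n + v * t\<^sup>2 * 2) \<longlonglongrightarrow> t * ?m + 2 * v * t\<^sup>2"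
      by (simp add: mult_ac)
    obtain n0 where n0: "t * K \<le> 2 ^ n0" using real_arch_pow[of 2 "t * K"] by (auto intro: less_imp_le)
    have "\<psi> t \<le> t * ?m + t\<^sup>2 * K\<^sup>2 * (1 / 2) ^ n + v * t\<^sup>2 * 2" if "n \<ge> n0" for n
    proof -
      have "(2 :: real) ^ n0 \<le> 2 ^ n" using that by (intro power_increasing) auto
      then have a: "2 ^ n * \<psi> (t / 2 ^ n) \<le> t * ?m + t\<^sup>2 * K\<^sup>2 / 2 ^ n" using n0 by (intro small) linarith
      have "v * t\<^sup>2 * (2 - 2 / 2 ^ n) \<le> v * t\<^sup>2 * 2" using v by (intro mult_left_mono) auto
      then show ?thesis using a iter[of n] by (simp add: power_one_over)
    qed
    then show "\<exists>N. \<forall>n\<ge>N. \<psi> t \<le> t * ?m + t\<^sup>2 * K\<^sup>2 * (1 / 2) ^ n + v * t\<^sup>2 * 2" by blast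
  qed
  then have "exp (\<psi> t) \<le> exp (t * ?m + 2 * v * t\<^sup>2)" by simp
  then show ?thesis using pos[of t] by (simp add: \<psi>_def)
qed

section \<open>Sub-Gaussian laws\<close>

lemma odd_double_factorial_Suc: "odd_double_factorial (Suc k) = odd_double_factorial k * (2 * real k + 1)"
  by (simp add: odd_double_factorial_def)

lemma odd_double_factorial_0 [simp]: "odd_double_factorial 0 = 1"
  by (simp add: odd_double_factorial_def)

lemma odd_double_factorial_pos: "0 < odd_double_factorial k"
  by (induction k) (auto simp: odd_double_factorial_Suc intro!: mult_pos_pos)

lemma fact_double_eq: "fact (2 * k) = (2 :: real) ^ k * fact k * odd_double_factorial k"
  by (induction k) (auto simp: odd_double_factorial_Suc algebra_simps)

lemma odd_double_factorial_le: "odd_double_factorial k \<le> 2 ^ k * fact k"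
proof (induction k)
  case (Suc k)
  have "odd_double_factorial k * (2 * real k + 1) \<le> (2 ^ k * fact k) * (2 * real k + 2)"
    using Suc odd_double_factorial_pos[of k] by (intro mult_mono) auto
  then show ?case by (simp add: odd_double_factorial_Suc algebra_simps)
qed simp

lemma cosh_even_sums: "(\<lambda>p. x ^ (2 * p) / fact (2 * p)) sums cosh (x :: real)"
proof -
  have "strict_mono (\<lambda>p :: nat. 2 * p)" by (auto simp: strict_mono_def)
  then have "(\<lambda>p. (if even (2 * p) then x ^ (2 * p) /\<^sub>R fact (2 * p) else 0)) sums cosh x"
    by (subst sums_mono_reindex) (use cosh_converges[of x] in \<open>auto elim!: evenE\<close>)
  then show ?thesis by (simp add: divide_inverse mult.commute)
qed

text \<open>For a centred variable the linear term integrates to 0 and what remains is even, which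
  suits assumptions on even moments only.\<close>

lemma exp_le_cosh: "exp x \<le> x + 2 * cosh x - 1" for x :: real
proof -
  have "1 + - x \<le> exp (- x)" by (rule exp_ge_add_one_self)
  moreover have "2 * cosh x = exp x + exp (- x)" by (simp add: cosh_def)
  ultimately show ?thesis by linarith
qed

lemma cosh_add_le: "cosh (x + y) \<le> (cosh (2 * x) + cosh (2 * y)) / 2" for x y :: real
proof -
  have "cosh (2 * x) + cosh (2 * y) = 2 * (cosh (x + y) * cosh (x - y))"
  proof -
    have "cosh (2 * x) = cosh ((x + y) + (x - y))" "cosh (2 * y) = cosh ((x + y) - (x - y))" by simp_all
    then show ?thesis by (simp only: cosh_add[of "x + y" "x - y"] cosh_diff[of "x + y" "x - y"])
  qed
  moreover have "cosh (x + y) * 1 \<le> cosh (x + y) * cosh (x - y)"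
    by (intro mult_left_mono) (auto simp: cosh_real_ge_1)
  ultimately show ?thesis by simp
qed

lemma cosh_le_of_abs_le: "\<bar>x\<bar> \<le> y \<Longrightarrow> cosh x \<le> cosh (y :: real)"
  using cosh_real_nonneg_le_iff[of "\<bar>x\<bar>" y] by (simp add: cosh_real_abs)

locale subgaussian_law = prob_space \<nu> for \<nu> :: "complex measure" +
  fixes g :: real
  assumes sets_law [measurable_cong, simp]: "sets \<nu> = sets borel"
    and g: "0 < g"
    and moment_integrable: "\<And>p. integrable \<nu> (\<lambda>w. cmod w ^ (2 * p))"
    and moment_le: "\<And>p. (LINT w|\<nu>. cmod w ^ (2 * p)) \<le> g ^ p * odd_double_factorial p"
begin

text \<open>Power series in |w| with nonnegative coefficients are integrated term by term against
  the moment bounds. The exponents \<open>e p\<close> vary so that functions of |w|^2 are covered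
  too.\<close>

lemma moment_series:
  assumes S: "\<And>t. (\<lambda>p. c p * t ^ (2 * e p)) sums F t" and c: "\<And>p. 0 \<le> c p"
    and d: "\<And>p. c p * (g ^ e p * odd_double_factorial (e p)) \<le> d p" and D: "d sums D"
  shows "integrable \<nu> (\<lambda>w. F (cmod w))" "(LINT w|\<nu>. F (cmod w)) \<le> D"
proof -
  let ?f = "\<lambda>p w. c p * cmod w ^ (2 * e p)"
  have le: "(LINT w|\<nu>. ?f p w) \<le> d p" for p
  proof -
    have "(LINT w|\<nu>. ?f p w) = c p * (LINT w|\<nu>. cmod w ^ (2 * e p))" by simp
    also have "\<dots> \<le> c p * (g ^ e p * odd_double_factorial (e p))" using moment_le c by (intro mult_left_mono)
    finally show ?thesis using d[of p] by linarith
  qed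
  have n: "norm (?f p w) = ?f p w" for p w using c[of p] by simp
  have i: "integrable \<nu> (?f p)" for p using moment_integrable by simp
  have nn: "0 \<le> (LINT w|\<nu>. ?f p w)" for p using c[of p] by (intro Bochner_Integration.integral_nonneg) simp
  have "norm (LINT w|\<nu>. norm (?f p w)) \<le> d p" for p
    unfolding n unfolding real_norm_def abs_of_nonneg[OF nn] by (rule le)
  then have sm: "summable (\<lambda>p. LINT w|\<nu>. norm (?f p w))"
    by (rule summable_comparison_test'[OF sums_summable[OF D]])
  have ae: "AE w in \<nu>. summable (\<lambda>p. norm (?f p w))"
    unfolding n using sums_summable[OF S] by (intro AE_I2)
  have F: "(\<Sum>p. ?f p w) = F (cmod w)" for w by (rule sums_unique[OF S, symmetric])
  show "integrable \<nu> (\<lambda>w. F (cmod w))" using integrable_suminf[OF i ae sm] unfolding F .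
  have "(\<lambda>p. LINT w|\<nu>. ?f p w) sums (LINT w|\<nu>. F (cmod w))" using sums_integral[OF i ae sm] unfolding F .
  from sums_le[OF le this D] show "(LINT w|\<nu>. F (cmod w)) \<le> D" .
qed

lemma integral_cosh_le:
  shows "integrable \<nu> (\<lambda>w. cosh (s * cmod w))" "(LINT w|\<nu>. cosh (s * cmod w)) \<le> exp (g * s\<^sup>2 / 2)"
proof -
  have S: "(\<lambda>p. s ^ (2 * p) / fact (2 * p) * t ^ (2 * p)) sums cosh (s * t)" for t
    using cosh_even_sums[of "s * t"] by (simp add: power_mult_distrib)
  have c: "0 \<le> s ^ (2 * p) / fact (2 * p)" for p by (simp add: power_mult)
  have d: "s ^ (2 * p) / fact (2 * p) * (g ^ p * odd_double_factorial p) \<le> (g * s\<^sup>2 / 2) ^ p /\<^sub>R fact p" for p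
    using odd_double_factorial_pos[of p] unfolding fact_double_eq
    by (simp add: power_mult_distrib power_divide power_mult[symmetric] field_simps)
  show "integrable \<nu> (\<lambda>w. cosh (s * cmod w))" "(LINT w|\<nu>. cosh (s * cmod w)) \<le> exp (g * s\<^sup>2 / 2)"
    using moment_series[OF S c d exp_converges] by simp_all
qed

text \<open>|w|^2 is merely sub-exponential: (4p - 1)!! divided by (2p)! grows geometrically, so the
  series converges only for s small compared with 1 / g.\<close>

lemma integral_cosh_square_le:
  assumes x: "(2 * s * g)\<^sup>2 \<le> 1 / 2"
  shows "integrable \<nu> (\<lambda>w. cosh (s * (cmod w)\<^sup>2))" "(LINT w|\<nu>. cosh (s * (cmod w)\<^sup>2)) \<le> 1 + 2 * (2 * s * g)\<^sup>2"
proof -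
  let ?x = "(2 * s * g)\<^sup>2"
  have S: "(\<lambda>p. s ^ (2 * p) / fact (2 * p) * t ^ (2 * (2 * p))) sums cosh (s * t\<^sup>2)" for t
    using cosh_even_sums[of "s * t\<^sup>2"] by (simp add: power_mult_distrib power_mult[symmetric])
  have c: "0 \<le> s ^ (2 * p) / fact (2 * p)" for p by (simp add: power_mult)
  have d: "s ^ (2 * p) / fact (2 * p) * (g ^ (2 * p) * odd_double_factorial (2 * p)) \<le> ?x ^ p" for p
  proof -
    have "s ^ (2 * p) / fact (2 * p) * (g ^ (2 * p) * odd_double_factorial (2 * p)) \<le>
        s ^ (2 * p) / fact (2 * p) * (g ^ (2 * p) * (2 ^ (2 * p) * fact (2 * p)))"
      using odd_double_factorial_le c g by (intro mult_left_mono) auto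
    also have "\<dots> = ?x ^ p" by (simp add: power_mult_distrib power_mult)
    finally show ?thesis .
  qed
  have "?x ^ p = ?x ^ p" for p ..
  have D: "(\<lambda>p. ?x ^ p) sums (1 / (1 - ?x))" using x by (intro geometric_sums) simp
  have "1 / (1 - ?x) \<le> 1 + 2 * ?x"
  proof -
    have "0 \<le> ?x * (1 - 2 * ?x)" using x by (intro mult_nonneg_nonneg) auto
    then have "1 \<le> (1 + 2 * ?x) * (1 - ?x)" by (simp add: algebra_simps)
    then show ?thesis using x by (simp add: divide_le_eq)
  qed
  then show "integrable \<nu> (\<lambda>w. cosh (s * (cmod w)\<^sup>2))" "(LINT w|\<nu>. cosh (s * (cmod w)\<^sup>2)) \<le> 1 + 2 * ?x"
    using moment_series[OF S c d D] by (auto intro: order.trans)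
qed

text \<open>By (2p - 1)!! <= 2^p p! the choice 1 / (4 g) gives a geometric series of ratio 1/2. Its
  sum 2 has logarithm below 1, the value used in the duality bound.\<close>

lemma integral_exp_square_le:
  shows "integrable \<nu> (\<lambda>w. exp ((cmod w)\<^sup>2 / (4 * g)))" "(LINT w|\<nu>. exp ((cmod w)\<^sup>2 / (4 * g))) \<le> 2"
proof -
  have S: "(\<lambda>p. (1 / (4 * g)) ^ p / fact p * t ^ (2 * p)) sums exp (t\<^sup>2 / (4 * g))" for t :: real
  proof -
    have "(\<lambda>p. (t\<^sup>2 / (4 * g)) ^ p /\<^sub>R fact p) sums exp (t\<^sup>2 / (4 * g))" by (rule exp_converges)
    moreover have "(\<lambda>p. (t\<^sup>2 / (4 * g)) ^ p /\<^sub>R fact p) = (\<lambda>p. (1 / (4 * g)) ^ p / fact p * t ^ (2 * p))"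
    proof
      fix p
      have "t\<^sup>2 / (4 * g) = (1 / (4 * g)) * t\<^sup>2" by simp
      then have "(t\<^sup>2 / (4 * g)) ^ p = (1 / (4 * g)) ^ p * t ^ (2 * p)"
        by (simp only: power_mult_distrib power_mult)
      then show "(t\<^sup>2 / (4 * g)) ^ p /\<^sub>R fact p = (1 / (4 * g)) ^ p / fact p * t ^ (2 * p)"
        by (simp only: real_scaleR_def divide_inverse mult_ac)
    qed
    ultimately show ?thesis by simp
  qed
  have c: "0 \<le> (1 / (4 * g)) ^ p / fact p" for p using g by simp
  have d: "(1 / (4 * g)) ^ p / fact p * (g ^ p * odd_double_factorial p) \<le> (1 / 2) ^ p" for p
  proof -
    have "(1 / (4 * g)) ^ p / fact p * (g ^ p * odd_double_factorial p) \<le> (1 / (4 * g)) ^ p / fact p * (g ^ p * (2 ^ p * fact p))"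
      using odd_double_factorial_le c g by (intro mult_left_mono) auto
    also have "\<dots> = ((1 / (4 * g)) * (g * 2)) ^ p" by (simp only: power_mult_distrib) simp
    also have "(1 / (4 * g)) * (g * 2) = 1 / 2" using g by simp
    finally show ?thesis .
  qed
  have D: "(\<lambda>p. (1 / 2 :: real) ^ p) sums (1 / (1 - 1 / 2))" by (intro geometric_sums) simp
  show "integrable \<nu> (\<lambda>w. exp ((cmod w)\<^sup>2 / (4 * g)))" "(LINT w|\<nu>. exp ((cmod w)\<^sup>2 / (4 * g))) \<le> 2"
    using moment_series[OF S c d D] by simp_all
qed

text \<open>The variation of f from its value at 0 has a linear part, allowed for all s, and a
  quadratic part, allowed for small s only. \<open>cosh_add_le\<close> is used twice: to separate
  this variation from its mean, which Jensen then bounds by the variation itself, and to separate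
  the two parts.\<close>

lemma integral_exp_centered_le:
  fixes f :: "complex \<Rightarrow> real"
  assumes fm [measurable]: "f \<in> borel_measurable borel" and K: "\<And>w. \<bar>f w\<bar> \<le> K"
    and lip: "\<And>w. \<bar>f w - f 0\<bar> \<le> a * cmod w + c * (cmod w)\<^sup>2" and ac: "0 \<le> a" "0 \<le> c" and s: "0 \<le> s"
    and small: "(8 * s * c * g)\<^sup>2 \<le> 1 / 2"
  shows "(LINT w|\<nu>. exp (s * f w)) \<le> exp (s * (LINT w|\<nu>. f w) + 8 * g * s\<^sup>2 * a\<^sup>2 + 128 * g\<^sup>2 * s\<^sup>2 * c\<^sup>2)"
proof -
  let ?m = "LINT w|\<nu>. f w"
  define \<delta> where "\<delta> w = f w - f 0" for w
  have [measurable]: "\<delta> \<in> borel_measurable borel" unfolding \<delta>_def by measurable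
  have fi: "integrable \<nu> f" using K by (intro integrable_of_bound[of f K]) auto
  have \<delta>K: "\<bar>\<delta> w\<bar> \<le> 2 * K" for w using K[of w] K[of 0] by (simp add: \<delta>_def)
  have coshi: "integrable \<nu> (\<lambda>w. cosh (r * h w))" if "h \<in> borel_measurable borel" "\<And>w. \<bar>h w\<bar> \<le> B" for h :: "complex \<Rightarrow> real" and r B
  proof (rule integrable_of_bound)
    show "(\<lambda>w. cosh (r * h w)) \<in> borel_measurable \<nu>"
      unfolding cosh_def using that(1) by measurable
    show "norm (cosh (r * h w)) \<le> cosh (\<bar>r\<bar> * B)" for w
    proof -
      have "\<bar>r * h w\<bar> \<le> \<bar>r\<bar> * B" unfolding abs_mult using that(2) by (intro mult_left_mono) auto
      then show ?thesis using cosh_le_of_abs_le[of "r * h w" "\<bar>r\<bar> * B"] cosh_real_nonneg[of "r * h w"] by simp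
    qed
  qed
  have ex: "exp (r * (LINT w|\<nu>. \<delta> w)) \<le> (LINT w|\<nu>. exp (r * \<delta> w))" for r
    by (rule integral_exp_bounds(2)[of \<delta> "2 * K"]) (use \<delta>K in auto)
  have exi: "integrable \<nu> (\<lambda>w. exp (r * \<delta> w))" for r
    by (rule bounded_pos_integrable(1)[OF integral_exp_bounds(1)[of \<delta> "2 * K"]]) (use \<delta>K in auto)
  have jensen: "cosh (r * (LINT w|\<nu>. \<delta> w)) \<le> (LINT w|\<nu>. cosh (r * \<delta> w))" for r
  proof -
    have "(LINT w|\<nu>. cosh (r * \<delta> w)) = ((LINT w|\<nu>. exp (r * \<delta> w)) + (LINT w|\<nu>. exp (- r * \<delta> w))) / 2"
      using exi[of r] exi[of "- r"] by (simp add: cosh_def)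
    then show ?thesis using ex[of r] ex[of "- r"] by (simp add: cosh_def)
  qed
  define X where "X w = s * (f w - ?m)" for w
  have m\<delta>: "(LINT w|\<nu>. \<delta> w) = ?m - f 0" using fi by (simp add: \<delta>_def prob_space)
  have X\<delta>: "X w = s * \<delta> w + - (s * (LINT w|\<nu>. \<delta> w))" for w unfolding m\<delta> by (simp add: X_def \<delta>_def algebra_simps)
  have Xm [measurable]: "X \<in> borel_measurable borel" unfolding X_def by measurable
  have mb: "\<bar>?m\<bar> \<le> K" using integral_between[of f "- K" K] K by (auto simp: abs_le_iff minus_le_iff)
  have XB: "\<bar>X w\<bar> \<le> s * (2 * K)" for w
    unfolding X_def abs_mult using K[of w] mb s by (intro mult_mono) auto
  have Xi: "integrable \<nu> X" using fi by (simp add: X_def[abs_def])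
  have EX: "(LINT w|\<nu>. X w) = 0" using fi by (simp add: X_def prob_space)
  have c1: "(LINT w|\<nu>. cosh (X w)) \<le> (LINT w|\<nu>. cosh (2 * s * \<delta> w))"
  proof -
    have "(LINT w|\<nu>. cosh (X w)) \<le> (LINT w|\<nu>. (cosh (2 * s * \<delta> w) + cosh (2 * s * (LINT w|\<nu>. \<delta> w))) / 2)"
    proof (rule integral_mono)
      show "integrable \<nu> (\<lambda>w. cosh (X w))" using coshi[OF Xm XB, of 1] by simp
      show "integrable \<nu> (\<lambda>w. (cosh (2 * s * \<delta> w) + cosh (2 * s * (LINT w|\<nu>. \<delta> w))) / 2)"
        using coshi[of \<delta> "2 * K" "2 * s"] \<delta>K by simp
      show "cosh (X w) \<le> (cosh (2 * s * \<delta> w) + cosh (2 * s * (LINT w|\<nu>. \<delta> w))) / 2" for w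
        unfolding X\<delta> using cosh_add_le[of "s * \<delta> w" "- (s * (LINT w|\<nu>. \<delta> w))"] by (simp add: mult.assoc)
    qed
    also have "\<dots> = ((LINT w|\<nu>. cosh (2 * s * \<delta> w)) + cosh (2 * s * (LINT w|\<nu>. \<delta> w))) / 2"
      using coshi[of \<delta> "2 * K" "2 * s"] \<delta>K by (simp add: prob_space)
    finally show ?thesis using jensen[of "2 * s"] by simp
  qed
  have c2: "(LINT w|\<nu>. cosh (2 * s * \<delta> w)) \<le> (exp (8 * g * s\<^sup>2 * a\<^sup>2) + (1 + 128 * g\<^sup>2 * s\<^sup>2 * c\<^sup>2)) / 2"
  proof -
    have sm: "(2 * (4 * s * c) * g)\<^sup>2 \<le> 1 / 2" using small by (simp add: mult_ac)
    have "(LINT w|\<nu>. cosh (2 * s * \<delta> w)) \<le> (LINT w|\<nu>. (cosh (4 * s * a * cmod w) + cosh (4 * s * c * (cmod w)\<^sup>2)) / 2)"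
    proof (rule integral_mono)
      show "integrable \<nu> (\<lambda>w. cosh (2 * s * \<delta> w))" using coshi[of \<delta> "2 * K" "2 * s"] \<delta>K by simp
      show "integrable \<nu> (\<lambda>w. (cosh (4 * s * a * cmod w) + cosh (4 * s * c * (cmod w)\<^sup>2)) / 2)"
        using integral_cosh_le(1)[of "4 * s * a"] integral_cosh_square_le(1)[OF sm] by simp
      show "cosh (2 * s * \<delta> w) \<le> (cosh (4 * s * a * cmod w) + cosh (4 * s * c * (cmod w)\<^sup>2)) / 2" for w
      proof -
        have "\<bar>2 * s * \<delta> w\<bar> \<le> 2 * s * (a * cmod w + c * (cmod w)\<^sup>2)"
          using lip[of w] s unfolding abs_mult \<delta>_def by (intro mult_mono) auto
        then have "cosh (2 * s * \<delta> w) \<le> cosh (2 * s * (a * cmod w + c * (cmod w)\<^sup>2))" by (rule cosh_le_of_abs_le)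
        also have "\<dots> = cosh (2 * s * a * cmod w + 2 * s * c * (cmod w)\<^sup>2)" by (simp add: algebra_simps)
        also have "\<dots> \<le> (cosh (2 * (2 * s * a * cmod w)) + cosh (2 * (2 * s * c * (cmod w)\<^sup>2))) / 2" by (rule cosh_add_le)
        finally show ?thesis by (simp add: mult_ac)
      qed
    qed
    also have "\<dots> = ((LINT w|\<nu>. cosh (4 * s * a * cmod w)) + (LINT w|\<nu>. cosh (4 * s * c * (cmod w)\<^sup>2))) / 2"
      using integral_cosh_le(1)[of "4 * s * a"] integral_cosh_square_le(1)[OF sm] by simp
    also have "\<dots> \<le> (exp (g * (4 * s * a)\<^sup>2 / 2) + (1 + 2 * (2 * (4 * s * c) * g)\<^sup>2)) / 2"
      using integral_cosh_le(2)[of "4 * s * a"] integral_cosh_square_le(2)[OF sm] by simp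
    finally show ?thesis by (simp add: power_mult_distrib mult_ac)
  qed
  have "(LINT w|\<nu>. exp (X w)) \<le> (LINT w|\<nu>. X w + 2 * cosh (X w) - 1)"
  proof (rule integral_mono)
    show "integrable \<nu> (\<lambda>w. exp (X w))"
      using bounded_pos_integrable(1)[OF integral_exp_bounds(1)[of X "s * (2 * K)" 1]] XB by simp
    show "integrable \<nu> (\<lambda>w. X w + 2 * cosh (X w) - 1)" using Xi coshi[OF Xm XB, of 1] by simp
  qed (rule exp_le_cosh)
  also have "\<dots> = 2 * (LINT w|\<nu>. cosh (X w)) - 1" using Xi EX coshi[OF Xm XB, of 1] by (simp add: prob_space)
  also have "\<dots> \<le> exp (8 * g * s\<^sup>2 * a\<^sup>2) + 128 * g\<^sup>2 * s\<^sup>2 * c\<^sup>2"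
  proof -
    have h: "2 * u - 1 \<le> v + w" if "u \<le> (v + (1 + w)) / 2" for u v w :: real using that by simp
    show ?thesis by (rule h[OF order.trans[OF c1 c2]])
  qed
  also have "\<dots> \<le> exp (8 * g * s\<^sup>2 * a\<^sup>2) * (1 + 128 * g\<^sup>2 * s\<^sup>2 * c\<^sup>2)"
  proof -
    have "1 \<le> exp (8 * g * s\<^sup>2 * a\<^sup>2)" using g by simp
    then have "1 * (128 * g\<^sup>2 * s\<^sup>2 * c\<^sup>2) \<le> exp (8 * g * s\<^sup>2 * a\<^sup>2) * (128 * g\<^sup>2 * s\<^sup>2 * c\<^sup>2)"
      by (intro mult_right_mono) auto
    then show ?thesis by (simp add: distrib_left)
  qed
  also have "\<dots> \<le> exp (8 * g * s\<^sup>2 * a\<^sup>2) * exp (128 * g\<^sup>2 * s\<^sup>2 * c\<^sup>2)"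
    by (intro mult_left_mono exp_ge_add_one_self) auto
  finally have "exp (s * ?m) * (LINT w|\<nu>. exp (X w)) \<le> exp (s * ?m) * (exp (8 * g * s\<^sup>2 * a\<^sup>2) * exp (128 * g\<^sup>2 * s\<^sup>2 * c\<^sup>2))"
    by (intro mult_left_mono) auto
  moreover have "exp (s * ?m) * (LINT w|\<nu>. exp (X w)) = (LINT w|\<nu>. exp (s * f w))"
    unfolding integral_mult_right_zero[symmetric] X_def by (simp add: exp_add[symmetric] right_diff_distrib)
  ultimately show ?thesis by (simp add: exp_add mult.assoc)
qed

text \<open>
  The difficulty is that \<open>s * a\<close> need not be bounded, so that \<open>exp (s * f w)\<close> may tilt the law strongly.
  The second moment under the tilted law is controlled through entropy duality, which shows that the law
  keeps half of its tilted mass on the region where \<open>a\<close> and \<open>c\<close> are comparable to \<open>\<alpha>\<close> and \<open>\<beta>\<close>.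
\<close>

text \<open>
  A modified logarithmic Sobolev inequality: \<open>\<alpha>\<close> and \<open>\<beta>\<close> stand for the first and second order
  variation of \<open>f\<close> at the current point, \<open>a\<close> and \<open>c\<close> for those at \<open>0\<close>. The two are comparable only for
  \<open>r \<bar>w\<bar> \<le> 1\<close>, an event that carries most of the mass of the tilted law. The right-hand side must
  involve \<open>\<alpha>\<close> and \<open>\<beta>\<close>, not their suprema, as only the sum of their squares over all matrix entries
  is small.
\<close>

theorem entropy_exp_le:
  fixes f \<alpha> \<beta> :: "complex \<Rightarrow> real"
  assumes fm [measurable]: "f \<in> borel_measurable borel" and K: "\<And>w. \<bar>f w\<bar> \<le> K"
    and am [measurable]: "\<alpha> \<in> borel_measurable borel" and \<alpha>: "\<And>w. \<bar>\<alpha> w\<bar> \<le> L"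
    and bm [measurable]: "\<beta> \<in> borel_measurable borel" and \<beta>: "\<And>w. \<bar>\<beta> w\<bar> \<le> L"
    and lip: "\<And>w. \<bar>f w - f 0\<bar> \<le> a * cmod w + c * (cmod w)\<^sup>2" and ac: "0 \<le> a" "0 \<le> c" and s: "0 \<le> s" and r: "0 \<le> r"
    and a_le: "\<And>w. r * cmod w \<le> 1 \<Longrightarrow> a \<le> \<alpha> w + 6 * c * cmod w"
    and c_le: "\<And>w. r * cmod w \<le> 1 \<Longrightarrow> c \<le> \<beta> w"
    and small1: "73728 * g\<^sup>2 * c\<^sup>2 * s\<^sup>2 \<le> 1"
    and small2: "r\<^sup>2 * (8 * g * ((32 * g * a\<^sup>2 + 512 * g\<^sup>2 * c\<^sup>2) * s\<^sup>2 + 1)) \<le> 1"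
  shows "entropy_of \<nu> (\<lambda>w. exp (s * f w)) \<le>
    s\<^sup>2 * (LINT w|\<nu>. exp (s * f w) * (256 * g * (\<alpha> w)\<^sup>2 + 149504 * g\<^sup>2 * (\<beta> w)\<^sup>2))"
proof -
  define F where "F w = exp (s * f w)" for w
  define v where "v = 32 * g * a\<^sup>2 + 512 * g\<^sup>2 * c\<^sup>2"
  have Fm [measurable]: "F \<in> borel_measurable borel" unfolding F_def by measurable
  have fm': "f \<in> borel_measurable \<nu>" by simp
  have Fb: "bounded_pos \<nu> F (exp (- (\<bar>s\<bar> * K))) (exp (\<bar>s\<bar> * K))"
    unfolding F_def by (rule integral_exp_bounds(1)[OF fm' K])
  define CF where "CF = exp (\<bar>s\<bar> * K)"
  have F0: "0 < F w" and F1: "F w \<le> CF" for w using bounded_posD(5,4)[OF Fb] by (auto simp: CF_def)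
  have CF0: "0 \<le> CF" by (simp add: CF_def)
  define S where "S = (LINT w|\<nu>. F w)"
  have S: "0 < S" unfolding S_def by (rule bounded_pos_integral_pos(3)[OF Fb])
  have v0: "0 \<le> v" using g by (simp add: v_def)
  have Fi: "integrable \<nu> F" by (rule bounded_pos_integrable(1)[OF Fb])
  have Fmul: "integrable \<nu> (\<lambda>w. F w * h w)" if "h \<in> borel_measurable borel" "\<And>w. \<bar>h w\<bar> \<le> B" for h and B
  proof (rule integrable_of_bound)
    show "norm (F w * h w) \<le> CF * B" for w
      using F0[of w] F1[of w] that(2)[of w] CF0 by (simp add: abs_mult) (intro mult_mono, auto)
  qed (use that(1) in simp)
  \<comment> \<open>A crude bound first, with the coefficients a and c at 0, from the exponential
    moment at 2 s. The remainder of the proof trades a and c for tilted averages of \<alpha> and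
    \<beta>.\<close>
  have ent: "entropy_of \<nu> F \<le> S * (v * s\<^sup>2)"
  proof -
    let ?m = "LINT w|\<nu>. f w"
    have FF: "F w * F w = exp ((2 * s) * f w)" for w by (simp add: F_def exp_add[symmetric])
    have "(8 * (2 * s) * c * g)\<^sup>2 = 256 * (g\<^sup>2 * c\<^sup>2 * s\<^sup>2)" by (simp add: power_mult_distrib mult_ac)
    then have sm: "(8 * (2 * s) * c * g)\<^sup>2 \<le> 1 / 2" using small1 by (simp add: mult.assoc)
    have 2: "(LINT w|\<nu>. F w * F w) \<le> exp (2 * s * ?m + v * s\<^sup>2)"
      unfolding FF using integral_exp_centered_le[OF fm K lip ac _ sm] s
      by (simp add: v_def algebra_simps)
    have 1: "exp (s * ?m) \<le> S" unfolding S_def F_def by (rule integral_exp_bounds(2)[OF fm' K])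
    have "(exp (s * ?m))\<^sup>2 \<le> S\<^sup>2" by (intro power_mono 1) simp
    then have "exp (2 * s * ?m) \<le> S\<^sup>2" by (simp add: exp_double[symmetric] mult.assoc)
    then have "(LINT w|\<nu>. F w * F w) \<le> S\<^sup>2 * exp (v * s\<^sup>2)"
      using 2 by (intro order.trans[OF 2]) (simp add: exp_add mult_right_mono)
    then have q: "(LINT w|\<nu>. F w * F w) / S\<^sup>2 \<le> exp (v * s\<^sup>2)" using S by (simp add: field_simps)
    have E2: "0 < (LINT w|\<nu>. F w * F w)"
      unfolding FF by (rule bounded_pos_integral_pos(3)[OF integral_exp_bounds(1)[OF fm' K]])
    have "ln ((LINT w|\<nu>. F w * F w) / S\<^sup>2) \<le> ln (exp (v * s\<^sup>2))"
      using q E2 S by (intro ln_mono) (auto intro!: divide_pos_pos)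
    then have "S * ln ((LINT w|\<nu>. F w * F w) / S\<^sup>2) \<le> S * (v * s\<^sup>2)" using S by (intro mult_left_mono) auto
    then show ?thesis using entropy_le_ln_second_moment[OF Fb] unfolding S_def by linarith
  qed
  have wi: "integrable \<nu> (\<lambda>w. (cmod w)\<^sup>2)" using moment_integrable[of 1] by simp
  have Fwi: "integrable \<nu> (\<lambda>w. F w * (cmod w)\<^sup>2)"
  proof (rule Bochner_Integration.integrable_bound)
    show "integrable \<nu> (\<lambda>w. CF * (cmod w)\<^sup>2)" using wi by simp
    show "AE w in \<nu>. norm (F w * (cmod w)\<^sup>2) \<le> norm (CF * (cmod w)\<^sup>2)"
    proof (rule AE_I2)
      fix w
      have "F w * (cmod w)\<^sup>2 \<le> CF * (cmod w)\<^sup>2" using F1[of w] by (intro mult_right_mono) auto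
      then show "norm (F w * (cmod w)\<^sup>2) \<le> norm (CF * (cmod w)\<^sup>2)" using F0[of w] CF0 by simp
    qed
  qed measurable
  \<comment> \<open>Twice the bound on the second moment under the tilted law, so by Markov half of
    the tilted mass has |w|^2 <= \<open>\<kappa>2\<close>. The assumption \<open>small2\<close>
    places this region inside r |w| <= 1.\<close>
  define \<kappa>2 where "\<kappa>2 = 8 * g * (v * s\<^sup>2 + 1)"
  have \<kappa>0: "0 < \<kappa>2" using g v0 by (auto simp: \<kappa>2_def intro!: mult_pos_pos add_nonneg_pos)
  have tilt: "(LINT w|\<nu>. F w * (cmod w)\<^sup>2) \<le> S * \<kappa>2 / 2"
  proof -
    let ?Y = "\<lambda>w :: complex. (cmod w)\<^sup>2 / (4 * g)"
    have FYi: "integrable \<nu> (\<lambda>w. F w * ?Y w)" using Fwi by simp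
    have "(LINT w|\<nu>. F w * ?Y w) \<le> entropy_of \<nu> F + S * ln (LINT w|\<nu>. exp (?Y w))"
      unfolding S_def by (rule entropy_duality[OF Fb integral_exp_square_le(1) FYi])
    also have "\<dots> \<le> S * (v * s\<^sup>2) + S * 1"
    proof (intro add_mono ent mult_left_mono)
      have p: "1 \<le> (LINT w|\<nu>. exp (?Y w))"
        using integral_mono[of \<nu> "\<lambda>_. 1" "\<lambda>w. exp (?Y w)"] integral_exp_square_le(1) g by (simp add: prob_space)
      have "ln (LINT w|\<nu>. exp (?Y w)) \<le> (LINT w|\<nu>. exp (?Y w)) - 1" using p by (intro ln_le_minus_one) simp
      then show "ln (LINT w|\<nu>. exp (?Y w)) \<le> 1" using integral_exp_square_le(2) by linarith
    qed (use S in simp)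
    finally have "(LINT w|\<nu>. F w * (cmod w)\<^sup>2) / (4 * g) \<le> S * (v * s\<^sup>2 + 1)" by (simp add: distrib_left)
    then show ?thesis using g by (simp add: \<kappa>2_def field_simps)
  qed
  define J where "J w = (if (cmod w)\<^sup>2 \<le> \<kappa>2 then 1 else 0 :: real)" for w
  have Jm [measurable]: "J \<in> borel_measurable borel" unfolding J_def by measurable
  have Jb: "\<bar>J w\<bar> \<le> 1" "0 \<le> J w" "J w \<le> 1" for w by (auto simp: J_def)
  have J: "S / 2 \<le> (LINT w|\<nu>. F w * J w)"
  proof -
    have pt: "F w - F w * (cmod w)\<^sup>2 / \<kappa>2 \<le> F w * J w" for w
    proof (cases "(cmod w)\<^sup>2 \<le> \<kappa>2")
      case True
      then show ?thesis using F0[of w] \<kappa>0 by (simp add: J_def)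
    next
      case False
      then have "F w * 1 \<le> F w * ((cmod w)\<^sup>2 / \<kappa>2)" using F0[of w] \<kappa>0 by (intro mult_left_mono) auto
      then show ?thesis using False by (simp add: J_def)
    qed
    have "(LINT w|\<nu>. F w - F w * (cmod w)\<^sup>2 / \<kappa>2) \<le> (LINT w|\<nu>. F w * J w)"
      using Fi Fwi Fmul[OF Jm Jb(1)] pt by (intro integral_mono) auto
    moreover have "(LINT w|\<nu>. F w - F w * (cmod w)\<^sup>2 / \<kappa>2) = S - (LINT w|\<nu>. F w * (cmod w)\<^sup>2) / \<kappa>2"
      using Fi Fwi by (simp add: S_def)
    moreover have "(LINT w|\<nu>. F w * (cmod w)\<^sup>2) / \<kappa>2 \<le> S / 2" using tilt \<kappa>0 by (simp add: field_simps)
    ultimately show ?thesis by linarith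
  qed
  have reg: "r * cmod w \<le> 1" if "(cmod w)\<^sup>2 \<le> \<kappa>2" for w
  proof -
    have "(r * cmod w)\<^sup>2 = r\<^sup>2 * (cmod w)\<^sup>2" by (simp add: power_mult_distrib)
    also have "\<dots> \<le> r\<^sup>2 * \<kappa>2" using that by (intro mult_left_mono) auto
    also have "\<dots> \<le> 1\<^sup>2" using small2 by (simp add: \<kappa>2_def v_def)
    finally show ?thesis by (rule power2_le_imp_le) simp
  qed
  have sqm: "(\<lambda>w. (\<alpha> w)\<^sup>2) \<in> borel_measurable borel" "(\<lambda>w. (\<beta> w)\<^sup>2) \<in> borel_measurable borel" by measurable
  have sqb: "\<bar>(\<alpha> w)\<^sup>2\<bar> \<le> L\<^sup>2" "\<bar>(\<beta> w)\<^sup>2\<bar> \<le> L\<^sup>2" for w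
    using power_mono[OF \<alpha>[of w], of 2] power_mono[OF \<beta>[of w], of 2] by simp_all
  define P where "P = (LINT w|\<nu>. F w * (\<alpha> w)\<^sup>2)"
  define Q where "Q = (LINT w|\<nu>. F w * (\<beta> w)\<^sup>2)"
  note Pi = Fmul[OF sqm(1) sqb(1)] and Qi = Fmul[OF sqm(2) sqb(2)]
  have aS: "a\<^sup>2 * S \<le> 4 * P + 144 * c\<^sup>2 * \<kappa>2 * S"
  proof -
    have pt: "a\<^sup>2 * (F w * J w) \<le> 2 * (F w * (\<alpha> w)\<^sup>2) + 72 * c\<^sup>2 * \<kappa>2 * F w" for w
    proof (cases "(cmod w)\<^sup>2 \<le> \<kappa>2")
      case True
      have "a \<le> \<alpha> w + 6 * c * cmod w" by (rule a_le[OF reg[OF True]])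
      then have "a\<^sup>2 \<le> (\<alpha> w + 6 * c * cmod w)\<^sup>2" using ac by (intro power_mono)
      also have "\<dots> \<le> 2 * (\<alpha> w)\<^sup>2 + 2 * (6 * c * cmod w)\<^sup>2"
      proof -
        have "0 \<le> (\<alpha> w - 6 * c * cmod w)\<^sup>2" by simp
        then show ?thesis by (simp add: power2_sum power2_diff)
      qed
      also have "\<dots> = 2 * (\<alpha> w)\<^sup>2 + 72 * c\<^sup>2 * (cmod w)\<^sup>2" by (simp add: power_mult_distrib)
      also have "\<dots> \<le> 2 * (\<alpha> w)\<^sup>2 + 72 * c\<^sup>2 * \<kappa>2" using True by (intro add_left_mono mult_left_mono) auto
      finally have "F w * a\<^sup>2 \<le> F w * (2 * (\<alpha> w)\<^sup>2 + 72 * c\<^sup>2 * \<kappa>2)" using F0[of w] by (intro mult_left_mono) auto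
      then show ?thesis using True by (simp add: J_def algebra_simps)
    next
      case False
      then show ?thesis using F0[of w] \<kappa>0 by (simp add: J_def)
    qed
    have "a\<^sup>2 * (S / 2) \<le> a\<^sup>2 * (LINT w|\<nu>. F w * J w)" using J by (intro mult_left_mono) auto
    also have "\<dots> = (LINT w|\<nu>. a\<^sup>2 * (F w * J w))" by simp
    also have "\<dots> \<le> (LINT w|\<nu>. 2 * (F w * (\<alpha> w)\<^sup>2) + 72 * c\<^sup>2 * \<kappa>2 * F w)"
      using Fmul[OF Jm Jb(1)] Pi Fi pt by (intro integral_mono) auto
    also have "\<dots> = 2 * P + 72 * c\<^sup>2 * \<kappa>2 * S" using Pi Fi by (simp add: P_def S_def)
    finally show ?thesis by simp
  qed
  have cS: "c\<^sup>2 * S \<le> 2 * Q"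
  proof -
    have pt: "c\<^sup>2 * (F w * J w) \<le> F w * (\<beta> w)\<^sup>2" for w
    proof (cases "(cmod w)\<^sup>2 \<le> \<kappa>2")
      case True
      have "c\<^sup>2 \<le> (\<beta> w)\<^sup>2" using c_le[OF reg[OF True]] ac by (intro power_mono)
      then show ?thesis using F0[of w] True by (simp add: J_def mult.commute)
    next
      case False
      then show ?thesis using F0[of w] by (simp add: J_def)
    qed
    have "c\<^sup>2 * (S / 2) \<le> c\<^sup>2 * (LINT w|\<nu>. F w * J w)" using J by (intro mult_left_mono) auto
    also have "\<dots> = (LINT w|\<nu>. c\<^sup>2 * (F w * J w))" by simp
    also have "\<dots> \<le> Q" unfolding Q_def using Fmul[OF Jm Jb(1)] Qi pt by (intro integral_mono) auto
    finally show ?thesis by simp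
  qed
  have "v * S \<le> 256 * g * P + 149504 * g\<^sup>2 * Q"
  proof -
    have "32 * g * (a\<^sup>2 * S) \<le> 32 * g * (4 * P + 144 * c\<^sup>2 * \<kappa>2 * S)" using aS g by (intro mult_left_mono) auto
    then have 1: "v * S \<le> 128 * g * P + 36864 * g\<^sup>2 * c\<^sup>2 * (v * s\<^sup>2 + 1) * S + 512 * g\<^sup>2 * c\<^sup>2 * S"
      by (simp add: v_def \<kappa>2_def algebra_simps power2_eq_square)
    \<comment> \<open>Since \<open>\<kappa>2\<close> contains v, the bound on a^2 S brings back v S,
      with coefficient 36864 = 32 * 144 * 8. By \<open>small1\<close> this is at most half of v S;
      absorbing it doubles the remaining constants.\<close>
    have "(73728 * g\<^sup>2 * c\<^sup>2 * s\<^sup>2) * (v * S) \<le> 1 * (v * S)" using small1 v0 S by (intro mult_right_mono) auto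
    then have 2: "2 * (36864 * g\<^sup>2 * c\<^sup>2 * (v * s\<^sup>2) * S) \<le> v * S" by (simp add: mult_ac)
    have "36864 * g\<^sup>2 * c\<^sup>2 * (v * s\<^sup>2 + 1) * S = 36864 * g\<^sup>2 * c\<^sup>2 * (v * s\<^sup>2) * S + 36864 * (g\<^sup>2 * (c\<^sup>2 * S))"
      by (simp add: algebra_simps)
    then have 3: "v * S \<le> 256 * g * P + 74752 * (g\<^sup>2 * (c\<^sup>2 * S))" using 1 2 by linarith
    have "g\<^sup>2 * (c\<^sup>2 * S) \<le> g\<^sup>2 * (2 * Q)" using cS by (intro mult_left_mono) auto
    then show ?thesis using 3 by linarith
  qed
  then have "s\<^sup>2 * (v * S) \<le> s\<^sup>2 * (256 * g * P + 149504 * g\<^sup>2 * Q)" by (intro mult_left_mono) auto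
  also have "256 * g * P + 149504 * g\<^sup>2 * Q = (LINT w|\<nu>. F w * (256 * g * (\<alpha> w)\<^sup>2 + 149504 * g\<^sup>2 * (\<beta> w)\<^sup>2))"
  proof -
    have "(LINT w|\<nu>. F w * (256 * g * (\<alpha> w)\<^sup>2 + 149504 * g\<^sup>2 * (\<beta> w)\<^sup>2)) =
       (LINT w|\<nu>. 256 * g * (F w * (\<alpha> w)\<^sup>2) + 149504 * g\<^sup>2 * (F w * (\<beta> w)\<^sup>2))"
      by (intro Bochner_Integration.integral_cong refl) (simp add: algebra_simps)
    then show ?thesis using Pi Qi by (simp add: P_def Q_def)
  qed
  finally have "S * (v * s\<^sup>2) \<le> s\<^sup>2 * (LINT w|\<nu>. F w * (256 * g * (\<alpha> w)\<^sup>2 + 149504 * g\<^sup>2 * (\<beta> w)\<^sup>2))"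
    by (simp add: mult_ac)
  then have "entropy_of \<nu> F \<le> s\<^sup>2 * (LINT w|\<nu>. F w * (256 * g * (\<alpha> w)\<^sup>2 + 149504 * g\<^sup>2 * (\<beta> w)\<^sup>2))"
    by (rule order.trans[OF ent])
  then show ?thesis unfolding F_def[abs_def] .
qed

lemma low_moments:
  assumes g1: "1 \<le> g"
  shows "integrable \<nu> (\<lambda>w. cmod w)" "integrable \<nu> (\<lambda>w. (cmod w)\<^sup>2)" "integrable \<nu> (\<lambda>w. cmod w ^ 3)"
    and "(LINT w|\<nu>. cmod w) \<le> g" "(LINT w|\<nu>. (cmod w)\<^sup>2) \<le> g" "(LINT w|\<nu>. cmod w ^ 3) \<le> 2 * g\<^sup>2"
proof -
  have m: "(\<lambda>w. cmod w ^ p) \<in> borel_measurable \<nu>" for p by measurable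
  show i2: "integrable \<nu> (\<lambda>w. (cmod w)\<^sup>2)" using moment_integrable[of 1] by simp
  have i4: "integrable \<nu> (\<lambda>w. cmod w ^ 4)" using moment_integrable[of 2] by simp
  show l2: "(LINT w|\<nu>. (cmod w)\<^sup>2) \<le> g" using moment_le[of 1] by (simp add: odd_double_factorial_def)
  have l4: "(LINT w|\<nu>. cmod w ^ 4) \<le> 3 * g\<^sup>2"
  proof -
    have "odd_double_factorial 2 = 3" by (simp add: odd_double_factorial_def numeral_2_eq_2)
    then show ?thesis using moment_le[of 2] by simp
  qed
  have b1: "t \<le> 1 / 2 + t\<^sup>2 / 2" for t :: real
    using zero_le_power2[of "t - 1"] by (simp add: power2_diff)
  have b3: "t ^ 3 \<le> t\<^sup>2 / 2 + t ^ 4 / 2" for t :: real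
  proof -
    have "t\<^sup>2 * t \<le> t\<^sup>2 * (1 / 2 + t\<^sup>2 / 2)" by (rule mult_left_mono[OF b1]) simp
    then show ?thesis by (simp add: algebra_simps power_numeral_reduce)
  qed
  have j1: "integrable \<nu> (\<lambda>w. 1 / 2 + (cmod w)\<^sup>2 / 2)" and j3: "integrable \<nu> (\<lambda>w. (cmod w)\<^sup>2 / 2 + cmod w ^ 4 / 2)"
    using i2 i4 by auto
  show i1: "integrable \<nu> (\<lambda>w. cmod w)"
    by (rule Bochner_Integration.integrable_bound[OF j1]) (use m[of 1] b1 in \<open>auto intro: order.trans[OF b1]\<close>)
  show i3: "integrable \<nu> (\<lambda>w. cmod w ^ 3)"
    by (rule Bochner_Integration.integrable_bound[OF j3 m]) (use b3 in \<open>auto intro: order.trans[OF b3]\<close>)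
  have "(LINT w|\<nu>. cmod w) \<le> (LINT w|\<nu>. 1 / 2 + (cmod w)\<^sup>2 / 2)" by (rule integral_mono[OF i1 j1 b1])
  also have "\<dots> = 1 / 2 + (LINT w|\<nu>. (cmod w)\<^sup>2) / 2" using i2 prob_space by simp
  finally show "(LINT w|\<nu>. cmod w) \<le> g" using l2 g1 by linarith
  have "(LINT w|\<nu>. cmod w ^ 3) \<le> (LINT w|\<nu>. (cmod w)\<^sup>2 / 2 + cmod w ^ 4 / 2)" by (rule integral_mono[OF i3 j3 b3])
  also have "\<dots> = (LINT w|\<nu>. (cmod w)\<^sup>2) / 2 + (LINT w|\<nu>. cmod w ^ 4) / 2" using i2 i4 by simp
  finally have "(LINT w|\<nu>. cmod w ^ 3) \<le> g / 2 + 3 * g\<^sup>2 / 2" using l2 l4 by linarith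
  moreover have "g * 1 \<le> g * g" using g1 by (intro mult_left_mono) auto
  ultimately show "(LINT w|\<nu>. cmod w ^ 3) \<le> 2 * g\<^sup>2" by (simp add: power2_eq_square)
qed

end

section \<open>Concentration of the resolvent\<close>

lemma det_mat_measurable:
  assumes "\<And>i j. i < n \<Longrightarrow> j < n \<Longrightarrow> (\<lambda>x. A x i j) \<in> borel_measurable M"
  shows "(\<lambda>x. Determinant.det (Matrix.mat n n (\<lambda>(i, j). A x i j :: complex))) \<in> borel_measurable M"
proof -
  have "Determinant.det (Matrix.mat n n (\<lambda>(i, j). A x i j)) =
      (\<Sum>p\<in>{p. p permutes {0..<n}}. signof p * (\<Prod>i = 0..<n. A x i (p i)))" for x
  proof -
    have "Determinant.det (Matrix.mat n n (\<lambda>(i, j). A x i j)) =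
      (\<Sum>p\<in>{p. p permutes {0..<n}}. signof p * (\<Prod>i = 0..<n. Matrix.mat n n (\<lambda>(i, j). A x i j) $$ (i, p i)))"
      by (rule det_def') simp
    also have "\<dots> = (\<Sum>p\<in>{p. p permutes {0..<n}}. signof p * (\<Prod>i = 0..<n. A x i (p i)))"
    proof (intro sum.cong prod.cong refl arg_cong2[where f = "(*)"])
      fix p i assume "p \<in> {p. p permutes {0..<n}}" "i \<in> {0..<n}"
      then have "i < n" "p i < n" using permutes_in_image[of p "{0..<n}" i] by auto
      then show "Matrix.mat n n (\<lambda>(i, j). A x i j) $$ (i, p i) = A x i (p i)" by simp
    qed
    finally show ?thesis .
  qed
  moreover have "(\<lambda>x. \<Prod>i = 0..<n. A x i (p i)) \<in> borel_measurable M" if "p permutes {0..<n}" for p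
  proof (rule borel_measurable_prod)
    fix i assume "i \<in> {0..<n}"
    then have "i < n" "p i < n" using permutes_in_image[OF that, of i] by auto
    then show "(\<lambda>x. A x i (p i)) \<in> borel_measurable M" by (rule assms)
  qed
  ultimately show ?thesis
    by (simp only:) (intro borel_measurable_sum borel_measurable_times borel_measurable_const; simp)
qed

lemma resolvent_measurable:
  assumes m: "\<And>i j. i < N \<Longrightarrow> j < N \<Longrightarrow> (\<lambda>x. H x i j) \<in> borel_measurable M" and ij: "i < N" "j < N"
  shows "(\<lambda>x. resolvent N z (H x) i j) \<in> borel_measurable M"
proof -
  let ?A = "\<lambda>x i j. (if i = j then z else 0) - H x i j"
  have A: "(\<lambda>x. ?A x i j) \<in> borel_measurable M" if "i < N" "j < N" for i j
    using m[OF that] by (intro borel_measurable_diff borel_measurable_const)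
  have d: "(\<lambda>x. Determinant.det (shifted_matrix N z (H x))) \<in> borel_measurable M"
    unfolding shifted_matrix_def by (rule det_mat_measurable) (rule A)
  have adj: "adj_mat (shifted_matrix N z (H x)) $$ (i, j) =
     (-1) ^ (j + i) * Determinant.det (Matrix.mat (N - 1) (N - 1) (\<lambda>(i', j'). ?A x (insert_index j i') (insert_index i j')))" for x
  proof -
    have "adj_mat (shifted_matrix N z (H x)) $$ (i, j) = cofactor (shifted_matrix N z (H x)) j i"
      using ij by (simp add: adj_mat_def shifted_matrix_def)
    also have "mat_delete (shifted_matrix N z (H x)) j i = Matrix.mat (N - 1) (N - 1) (\<lambda>(i', j'). ?A x (insert_index j i') (insert_index i j'))"
      using ij by (intro eq_matI) (auto simp: mat_delete_def shifted_matrix_def insert_index_def)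
    then have "cofactor (shifted_matrix N z (H x)) j i = (-1) ^ (j + i) * Determinant.det (Matrix.mat (N - 1) (N - 1) (\<lambda>(i', j'). ?A x (insert_index j i') (insert_index i j')))"
      by (simp only: cofactor_def)
    finally show ?thesis .
  qed
  have "(\<lambda>x. Determinant.det (Matrix.mat (N - 1) (N - 1) (\<lambda>(i', j'). ?A x (insert_index j i') (insert_index i j')))) \<in> borel_measurable M"
  proof (rule det_mat_measurable)
    fix i' j' assume "i' < N - 1" "j' < N - 1"
    then have "insert_index j i' < N" "insert_index i j' < N" by (auto simp: insert_index_def)
    then show "(\<lambda>x. ?A x (insert_index j i') (insert_index i j')) \<in> borel_measurable M" by (rule A)
  qed
  then show ?thesis unfolding resolvent_def adj
    by (intro borel_measurable_divide d borel_measurable_times borel_measurable_const)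
qed

lemma cmod_component_le_of_norm_sq:
  assumes "i < N" "\<eta>\<^sup>2 * norm_sq N w \<le> 1" "0 < \<eta>"
  shows "cmod (w i) \<le> 1 / \<eta>"
proof -
  have "\<eta>\<^sup>2 * (cmod (w i))\<^sup>2 \<le> \<eta>\<^sup>2 * norm_sq N w"
    using norm_sq_ge_component[OF assms(1), of w] by (intro mult_left_mono) auto
  then have "(\<eta> * cmod (w i))\<^sup>2 \<le> 1\<^sup>2" using assms(2) by (simp add: power_mult_distrib)
  then have "\<eta> * cmod (w i) \<le> 1" by (rule power2_le_imp_le) simp
  then show ?thesis using assms(3) by (simp add: field_simps)
qed

lemma product_perturbation:
  fixes a0 a1 b0 b1 e f :: real
  assumes "a0 \<le> a1 + e" "a1 \<le> a0 + e" "b0 \<le> b1 + f" "0 \<le> a1" "0 \<le> b0" "0 \<le> f"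
  shows "a0 * b0 \<le> a1 * b1 + a0 * f + e * f + e * b0"
proof -
  have "a0 * b0 \<le> (a1 + e) * b0" "a1 * b0 \<le> a1 * (b1 + f)" "a1 * f \<le> (a0 + e) * f"
    using assms by (auto intro: mult_right_mono mult_left_mono)
  then show ?thesis by (simp add: algebra_simps)
qed

text \<open>The variance is fixed above the diagonal only: the real and complex cases differ on the
  diagonal, whose contribution is an error of order \<open>smax^2\<close>. Every index carries a
  law, also those outside the upper triangle, to fit the product measure lemmas.\<close>

locale profile_model =
  fixes N :: nat and \<sigma> :: "nat \<Rightarrow> nat \<Rightarrow> real" and \<nu> :: "nat \<times> nat \<Rightarrow> complex measure" and g smax \<eta> :: real
  assumes sigma_sym: "\<And>i j. i < N \<Longrightarrow> j < N \<Longrightarrow> \<sigma> j i = \<sigma> i j"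
    and sigma_nonneg: "\<And>i j. i < N \<Longrightarrow> j < N \<Longrightarrow> 0 \<le> \<sigma> i j"
    and sigma_le: "\<And>i j. i < N \<Longrightarrow> j < N \<Longrightarrow> \<sigma> i j \<le> smax"
    and sigma_row: "\<And>i. i < N \<Longrightarrow> (\<Sum>j<N. (\<sigma> i j)\<^sup>2) = 1"
    and law: "\<And>k. subgaussian_law (\<nu> k) g"
    and law_sym: "\<And>k. distr (\<nu> k) borel (\<lambda>w. - w) = \<nu> k"
    and law_var: "\<And>i j. i < j \<Longrightarrow> j < N \<Longrightarrow> (LINT w|\<nu> (i, j). (cmod w)\<^sup>2) = 1"
    and g_ge: "1 \<le> g" and eta_ge: "2 \<le> \<eta>" and N_pos: "0 < N"
begin

definition coords :: "(nat \<times> nat) set" where "coords = {(i, j). i \<le> j \<and> j < N}"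

definition ensemble :: "(nat \<times> nat \<Rightarrow> complex) measure" where "ensemble = PiM coords \<nu>"

text \<open>
  Coordinates of the sample space carry complex values; on the diagonal only the real part is used, so
  that \<open>hmat\<close> is Hermitian at every point and not just almost everywhere.
\<close>

definition hmat :: "(nat \<times> nat \<Rightarrow> complex) \<Rightarrow> nat \<Rightarrow> nat \<Rightarrow> complex" where
  "hmat x i j = (if i < j then of_real (\<sigma> i j) * x (i, j) else if i = j then of_real (\<sigma> i i * Re (x (i, i)))
     else of_real (\<sigma> i j) * cnj (x (j, i)))"

definition green :: "(nat \<times> nat \<Rightarrow> complex) \<Rightarrow> nat \<Rightarrow> nat \<Rightarrow> complex" where
  "green x = resolvent N (\<i> * of_real \<eta>) (hmat x)"

lemma finite_coords: "finite coords"
proof (rule finite_subset)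
  show "coords \<subseteq> {..<N} \<times> {..<N}" by (auto simp: coords_def)
qed simp

lemma coordsD: "(p, q) \<in> coords \<Longrightarrow> p < N" "(p, q) \<in> coords \<Longrightarrow> q < N" "(p, q) \<in> coords \<Longrightarrow> p \<le> q"
  by (auto simp: coords_def)

lemma prob_space_law: "prob_space (\<nu> k)" using law[of k] by (simp add: subgaussian_law_def)

lemma sets_law [measurable_cong, simp]: "sets (\<nu> k) = sets borel"
  using law[of k] by (rule subgaussian_law.sets_law)

lemma space_law [simp]: "space (\<nu> k) = UNIV"
  using sets_eq_imp_space_eq[OF sets_law[of k]] by simp

sublocale ensemble: prob_space ensemble
  unfolding ensemble_def by (rule prob_space_PiM_all) (rule prob_space_law)

lemma component_measurable: "k \<in> coords \<Longrightarrow> (\<lambda>x. x k) \<in> borel_measurable ensemble"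
  unfolding ensemble_def using measurable_component_singleton[of k coords \<nu>] by (simp cong: measurable_cong_sets)

lemma hmat_cong: "x (i, j) = x' (i, j) \<Longrightarrow> x (j, i) = x' (j, i) \<Longrightarrow> hmat x i j = hmat x' i j"
  by (auto simp: hmat_def)

lemma hmat_measurable:
  assumes "i < N" "j < N"
  shows "(\<lambda>x. hmat x i j) \<in> borel_measurable ensemble"
proof -
  have "(i, j) \<in> coords" if "i \<le> j" using assms that by (simp add: coords_def)
  moreover have "(j, i) \<in> coords" if "\<not> i \<le> j" using assms that by (simp add: coords_def)
  moreover have cnj: "cnj \<in> borel_measurable borel" by (intro borel_measurable_continuous_onI continuous_intros)
  moreover have of_real: "complex_of_real \<in> borel_measurable borel" by (intro borel_measurable_continuous_onI continuous_intros)
  ultimately show ?thesis unfolding hmat_def using component_measurable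
    by (cases "i < j"; cases "i = j") (auto intro!: borel_measurable_times borel_measurable_const measurable_compose[OF _ cnj]
        measurable_compose[OF _ of_real] measurable_compose[OF _ borel_measurable_Re])
qed

lemma hmat_hermitian: "hermitian_on N (hmat x)"
  unfolding hermitian_on_def
proof (intro allI impI)
  fix i j assume "i < N" "j < N"
  then show "hmat x j i = cnj (hmat x i j)"
    using sigma_sym[of i j] by (cases i j rule: linorder_cases) (auto simp: hmat_def)
qed

lemma eta_pos: "0 < \<eta>" using eta_ge by simp

lemma green_measurable: "i < N \<Longrightarrow> j < N \<Longrightarrow> (\<lambda>x. green x i j) \<in> borel_measurable ensemble"
  unfolding green_def by (intro resolvent_measurable hmat_measurable)

lemma entry_perturbation_hmat:
  assumes k: "(p, q) \<in> coords"
  shows "entry_perturbation N (hmat (x((p, q) := y))) (hmat (x((p, q) := 0))) \<eta> p q (\<sigma> p q * cmod y)"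
proof
  note pq = coordsD[OF k]
  show "p < N" "q < N" by (rule pq)+
  fix i j assume ij: "(i, j) \<noteq> (p, q)" "(i, j) \<noteq> (q, p)"
  then have "(i, j) \<noteq> (p, q)" "(j, i) \<noteq> (p, q)" by auto
  then show "hmat (x((p, q) := y)) i j = hmat (x((p, q) := 0)) i j"
    by (intro hmat_cong) (simp_all only: fun_upd_other not_False_eq_True)
next
  note pq = coordsD[OF k]
  have s: "0 \<le> \<sigma> p q" using sigma_nonneg pq by blast
  show "cmod (hmat (x((p, q) := y)) p q - hmat (x((p, q) := 0)) p q) \<le> \<sigma> p q * cmod y"
  proof (cases "p = q")
    case True
    then show ?thesis using s by (auto simp: hmat_def norm_mult intro!: mult_left_mono abs_Re_le_cmod)
  next
    case False
    then have "p < q" using pq(3) by simp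
    then show ?thesis using s by (simp add: hmat_def norm_mult)
  qed
qed (use hmat_hermitian eta_pos in auto)

lemma sigma_le_one: "i < N \<Longrightarrow> j < N \<Longrightarrow> \<sigma> i j \<le> 1"
proof -
  assume ij: "i < N" "j < N"
  have "(\<sigma> i j)\<^sup>2 \<le> (\<Sum>j<N. (\<sigma> i j)\<^sup>2)" using ij by (intro member_le_sum) auto
  then have "(\<sigma> i j)\<^sup>2 \<le> 1\<^sup>2" using sigma_row[OF ij(1)] by simp
  then show ?thesis by (rule power2_le_imp_le) simp
qed

lemma smax_pos: "0 < smax"
proof (rule ccontr)
  assume "\<not> 0 < smax"
  then have "\<sigma> 0 j = 0" if "j < N" for j
    using sigma_le[OF N_pos that] sigma_nonneg[OF N_pos that] by linarith
  then have "(\<Sum>j<N. (\<sigma> 0 j)\<^sup>2) = 0" by (intro sum.neutral) auto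
  then show False using sigma_row[OF N_pos] by simp
qed

lemma sigma_sq_le: "i < N \<Longrightarrow> j < N \<Longrightarrow> (\<sigma> i j)\<^sup>2 \<le> smax\<^sup>2"
  using sigma_le sigma_nonneg by (intro power_mono)

section \<open>The influence of one entry on a bilinear form\<close>

context
  fixes u v :: "nat \<Rightarrow> complex"
  assumes u: "norm_sq N u \<le> 1" and v: "norm_sq N v \<le> 1"
begin

definition rowabs :: "(nat \<times> nat \<Rightarrow> complex) \<Rightarrow> nat \<Rightarrow> real" where
  "rowabs x i = cmod (row_form N u (green x) i)"
definition colabs :: "(nat \<times> nat \<Rightarrow> complex) \<Rightarrow> nat \<Rightarrow> real" where
  "colabs x i = cmod (col_form N (green x) v i)"
definition re_form :: "(nat \<times> nat \<Rightarrow> complex) \<Rightarrow> real" where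
  "re_form x = Re (bilinear_form N u (green x) v)"

lemma rowabs_sum: "\<eta>\<^sup>2 * (\<Sum>i<N. (rowabs x i)\<^sup>2) \<le> 1"
  using norm_sq_apply_resolvent[OF hmat_hermitian eta_pos, of u x] u
  by (simp add: norm_sq_def rowabs_def row_form_def green_def)

lemma colabs_sum: "\<eta>\<^sup>2 * (\<Sum>i<N. (colabs x i)\<^sup>2) \<le> 1"
  using norm_sq_resolvent_apply[OF hmat_hermitian eta_pos, of x v] v
  by (simp add: norm_sq_def colabs_def col_form_def green_def)

lemma rowabs_bounds: "i < N \<Longrightarrow> rowabs x i \<le> 1 / \<eta>" "0 \<le> rowabs x i"
  using cmod_component_le_of_norm_sq[of i N \<eta> "row_form N u (green x)"] rowabs_sum[of x] eta_pos
  by (auto simp: rowabs_def norm_sq_def)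

lemma colabs_bounds: "i < N \<Longrightarrow> colabs x i \<le> 1 / \<eta>" "0 \<le> colabs x i"
  using cmod_component_le_of_norm_sq[of i N \<eta> "col_form N (green x) v"] colabs_sum[of x] eta_pos
  by (auto simp: colabs_def norm_sq_def)

lemma eta_half: "1 / \<eta> \<le> 1 / 2" using eta_ge by (simp add: field_simps)

lemma cmod_form_le: "cmod (bilinear_form N u (green x) v) \<le> 1"
proof -
  have "(\<Sum>i<N. (colabs x i)\<^sup>2) \<le> 1"
  proof -
    have "1 * (\<Sum>i<N. (colabs x i)\<^sup>2) \<le> \<eta>\<^sup>2 * (\<Sum>i<N. (colabs x i)\<^sup>2)"
      using eta_ge by (intro mult_right_mono sum_nonneg) (auto simp: one_le_power)
    then show ?thesis using colabs_sum[of x] by simp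
  qed
  then have "norm_sq N u * (\<Sum>i<N. (colabs x i)\<^sup>2) \<le> 1 * 1"
    using u by (intro mult_mono sum_nonneg) auto
  moreover have "(cmod (bilinear_form N u (green x) v))\<^sup>2 \<le> norm_sq N u * (\<Sum>i<N. (colabs x i)\<^sup>2)"
    unfolding bilinear_form_col norm_sq_def colabs_def by (rule cmod_sum_mult_le)
  ultimately have "(cmod (bilinear_form N u (green x) v))\<^sup>2 \<le> 1\<^sup>2" by simp
  then show ?thesis by (rule power2_le_imp_le) simp
qed

lemma abs_re_form_le: "\<bar>re_form x\<bar> \<le> 1"
  using cmod_form_le[of x] abs_Re_le_cmod[of "bilinear_form N u (green x) v"] by (simp add: re_form_def)

lemma row_form_measurable: "i < N \<Longrightarrow> (\<lambda>x. row_form N u (green x) i) \<in> borel_measurable ensemble"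
  unfolding row_form_def by (intro borel_measurable_sum borel_measurable_times borel_measurable_const green_measurable) auto

lemma col_form_measurable: "i < N \<Longrightarrow> (\<lambda>x. col_form N (green x) v i) \<in> borel_measurable ensemble"
  unfolding col_form_def by (intro borel_measurable_sum borel_measurable_times borel_measurable_const green_measurable) auto

lemma form_measurable: "(\<lambda>x. bilinear_form N u (green x) v) \<in> borel_measurable ensemble"
  unfolding bilinear_form_def by (intro borel_measurable_sum borel_measurable_times borel_measurable_const green_measurable) auto

lemma re_form_measurable: "re_form \<in> borel_measurable ensemble"
  unfolding re_form_def[abs_def] using measurable_compose[OF form_measurable borel_measurable_Re] .

text \<open>Bounds the derivative of u G v in the entry k: the resolvent identity puts the row form
  at one index and the column form at the other, and an entry moves with its transpose.\<close>

definition first_order :: "nat \<times> nat \<Rightarrow> (nat \<times> nat \<Rightarrow> complex) \<Rightarrow> real" where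
  "first_order k x = \<sigma> (fst k) (snd k) * (rowabs x (fst k) * colabs x (snd k) + rowabs x (snd k) * colabs x (fst k))"

text \<open>The quadratic coefficient is a product of row and column forms; the column forms are
  bounded by a constant. With \<sigma>^2 in front, the row forms alone still have squares summing to
  order \<open>smax^2\<close>.\<close>

definition second_order :: "nat \<times> nat \<Rightarrow> (nat \<times> nat \<Rightarrow> complex) \<Rightarrow> real" where
  "second_order k x = (\<sigma> (fst k) (snd k))\<^sup>2 * (rowabs x (fst k) + rowabs x (snd k))"

lemma first_order_measurable: "k \<in> coords \<Longrightarrow> first_order k \<in> borel_measurable ensemble"
  unfolding first_order_def[abs_def] rowabs_def colabs_def
  by (intro borel_measurable_times borel_measurable_add borel_measurable_const measurable_compose[OF _ borel_measurable_norm] row_form_measurable col_form_measurable)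
     (auto simp: coords_def)

lemma second_order_measurable: "k \<in> coords \<Longrightarrow> second_order k \<in> borel_measurable ensemble"
  unfolding second_order_def[abs_def] rowabs_def
  by (intro borel_measurable_times borel_measurable_add borel_measurable_const measurable_compose[OF _ borel_measurable_norm] row_form_measurable)
     (auto simp: coords_def)

lemma order_bounds:
  assumes "(p, q) \<in> coords"
  shows "0 \<le> first_order (p, q) x" "first_order (p, q) x \<le> \<sigma> p q / 2" "0 \<le> second_order (p, q) x" "second_order (p, q) x \<le> 1"
proof -
  note pq = coordsD[OF assms]
  have s: "0 \<le> \<sigma> p q" "\<sigma> p q \<le> 1" using sigma_nonneg sigma_le_one pq by auto
  have b: "rowabs x i \<le> 1 / 2" "colabs x i \<le> 1 / 2" if "i < N" for i
    using rowabs_bounds(1)[OF that, of x] colabs_bounds(1)[OF that, of x] eta_half by linarith+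
  show "0 \<le> first_order (p, q) x" "0 \<le> second_order (p, q) x"
    using s rowabs_bounds(2) colabs_bounds(2) by (auto simp: first_order_def second_order_def intro!: mult_nonneg_nonneg add_nonneg_nonneg)
  have "rowabs x p * colabs x q + rowabs x q * colabs x p \<le> 1 / 2 * (1 / 2) + 1 / 2 * (1 / 2)"
    using b pq rowabs_bounds(2) colabs_bounds(2) by (intro add_mono mult_mono) auto
  then have "\<sigma> p q * (rowabs x p * colabs x q + rowabs x q * colabs x p) \<le> \<sigma> p q * (1 / 2)"
    using s by (intro mult_left_mono) auto
  then show "first_order (p, q) x \<le> \<sigma> p q / 2" by (simp add: first_order_def)
  have "(\<sigma> p q)\<^sup>2 * (rowabs x p + rowabs x q) \<le> 1 * (1 / 2 + 1 / 2)"
    using s b pq rowabs_bounds(2) by (intro mult_mono add_mono add_nonneg_nonneg) (auto simp: power_le_one)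
  then show "second_order (p, q) x \<le> 1" by (simp add: second_order_def)
qed

text \<open>The first claim comes from two uses of the resolvent identity, the second one for the
  column forms. The next two go back from the point 0 to the current point y, as long as \<sigma>
  |y| <= 1; these are the hypotheses of \<open>entropy_exp_le\<close> with r = \<sigma>.\<close>

lemma one_coordinate_comparison:
  fixes x :: "nat \<times> nat \<Rightarrow> complex" and y :: complex
  assumes k: "(p, q) \<in> coords"
  defines "x0 \<equiv> x((p, q) := 0)" and "xy \<equiv> x((p, q) := y)"
  defines "a \<equiv> first_order (p, q) x0"
    and "c \<equiv> (\<sigma> p q)\<^sup>2 * ((rowabs x0 p + rowabs x0 q) * (colabs x0 p + colabs x0 q)) / \<eta>"
  shows "\<bar>re_form xy - re_form x0\<bar> \<le> a * cmod y + c * (cmod y)\<^sup>2"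
    and "\<sigma> p q * cmod y \<le> 1 \<Longrightarrow> a \<le> first_order (p, q) xy + 6 * c * cmod y"
    and "\<sigma> p q * cmod y \<le> 1 \<Longrightarrow> c \<le> second_order (p, q) xy"
    and "0 \<le> c" and "c \<le> (\<sigma> p q)\<^sup>2 / 2"
proof -
  note pq = coordsD[OF k]
  have s: "0 \<le> \<sigma> p q" using sigma_nonneg pq by blast
  interpret E: entry_perturbation N "hmat xy" "hmat x0" \<eta> p q "\<sigma> p q * cmod y"
    unfolding xy_def x0_def by (rule entry_perturbation_hmat[OF k])
  interpret E': entry_perturbation N "hmat x0" "hmat xy" \<eta> p q "\<sigma> p q * cmod y" by (rule E.flip)
  define d where "d = \<sigma> p q * cmod y"
  have d0: "0 \<le> d" using s by (simp add: d_def)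
  define S where "S = rowabs x0 p + rowabs x0 q"
  define T where "T = colabs x0 p + colabs x0 q"
  note nn = rowabs_bounds(2) colabs_bounds(2)
  have ST0: "0 \<le> S" "0 \<le> T" using nn by (auto simp: S_def T_def intro: add_nonneg_nonneg)
  have ST1: "S \<le> 1" "T \<le> 1"
    using rowabs_bounds(1)[OF pq(1), of x0] rowabs_bounds(1)[OF pq(2), of x0]
      colabs_bounds(1)[OF pq(1), of x0] colabs_bounds(1)[OF pq(2), of x0] eta_half
    unfolding S_def T_def by linarith+
  have c_eq: "c = (\<sigma> p q)\<^sup>2 * (S * T) / \<eta>" by (simp add: c_def S_def T_def)
  show c0: "0 \<le> c" unfolding c_eq using ST0 eta_pos by simp
  have STle: "S * T / \<eta> \<le> 1 / 2"
  proof -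
    have "S * T * (1 / \<eta>) \<le> 1 * 1 * (1 / 2)" using ST0 ST1 eta_half eta_pos by (intro mult_mono) auto
    then show ?thesis by simp
  qed
  have "(\<sigma> p q)\<^sup>2 * (S * T / \<eta>) \<le> (\<sigma> p q)\<^sup>2 * (1 / 2)" by (intro mult_left_mono STle) simp
  then show "c \<le> (\<sigma> p q)\<^sup>2 / 2" by (simp add: c_eq)
  have col: "\<bar>colabs xy i - colabs x0 i\<bar> \<le> d * T / \<eta>" if "i < N" for i
    using E.cmod_col_form_diff_le[OF that, of v]
      norm_triangle_ineq3[of "col_form N (green xy) v i" "col_form N (green x0) v i"]
    by (simp add: colabs_def T_def d_def green_def)
  have row0: "\<bar>rowabs xy i - rowabs x0 i\<bar> \<le> d * S / \<eta>" if "i < N" for i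
    using E'.cmod_row_form_diff_le[OF that, of u]
      norm_triangle_ineq3[of "row_form N u (green x0) i" "row_form N u (green xy) i"]
    by (simp add: rowabs_def S_def d_def green_def abs_minus_commute)
  \<comment> \<open>Same difference as in \<open>row0\<close>, now measured by the forms at y. As
    \<sigma> |y| / \<eta> <= 1/2, it yields S <= 2 \<open>Sy\<close>, that is, control of the forms
    at 0 by those at y.\<close>
  have row1: "\<bar>rowabs xy i - rowabs x0 i\<bar> \<le> d * (rowabs xy p + rowabs xy q) / \<eta>" if "i < N" for i
    using E.cmod_row_form_diff_le[OF that, of u]
      norm_triangle_ineq3[of "row_form N u (green xy) i" "row_form N u (green x0) i"]
    by (simp add: rowabs_def d_def green_def)
  show "\<bar>re_form xy - re_form x0\<bar> \<le> a * cmod y + c * (cmod y)\<^sup>2"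
  proof -
    have "\<bar>re_form xy - re_form x0\<bar> \<le> cmod (bilinear_form N u (green x0) v - bilinear_form N u (green xy) v)"
      using abs_Re_le_cmod[of "bilinear_form N u (green x0) v - bilinear_form N u (green xy) v"]
      by (simp add: re_form_def abs_minus_commute)
    also have "\<dots> \<le> d * (rowabs x0 p * colabs xy q + rowabs x0 q * colabs xy p)"
      using E'.cmod_bilinear_form_diff_le[of u v] by (simp add: rowabs_def colabs_def d_def green_def)
    also have "\<dots> \<le> d * (rowabs x0 p * (colabs x0 q + d * T / \<eta>) + rowabs x0 q * (colabs x0 p + d * T / \<eta>))"
      using col[OF pq(1)] col[OF pq(2)] nn d0 by (intro mult_left_mono add_mono) (auto simp: abs_le_iff)
    also have "\<dots> = d * (rowabs x0 p * colabs x0 q + rowabs x0 q * colabs x0 p) + d\<^sup>2 * (S * T) / \<eta>"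
      by (simp add: S_def algebra_simps power2_eq_square add_divide_distrib)
    also have "\<dots> = a * cmod y + c * (cmod y)\<^sup>2"
      by (simp add: a_def first_order_def c_eq d_def power_mult_distrib)
    finally show ?thesis .
  qed
  show "a \<le> first_order (p, q) xy + 6 * c * cmod y" if d1: "\<sigma> p q * cmod y \<le> 1"
  proof -
    have dl: "d \<le> 1" using d1 by (simp add: d_def)
    define e where "e = d * S / \<eta>"
    define f where "f = d * T / \<eta>"
    have ef: "0 \<le> e" "0 \<le> f" using d0 ST0 eta_pos by (auto simp: e_def f_def)
    have pair: "rowabs x0 i * colabs x0 j \<le> rowabs xy i * colabs xy j + rowabs x0 i * f + e * f + e * colabs x0 j"
      if ij: "i < N" "j < N" for i j
      using row0[OF ij(1)] col[OF ij(2)]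
      by (intro product_perturbation nn ef) (auto simp: abs_le_iff e_def f_def)
    have "rowabs x0 p * colabs x0 q + rowabs x0 q * colabs x0 p \<le>
       rowabs xy p * colabs xy q + rowabs xy q * colabs xy p + (S * f + 2 * (e * f) + e * T)"
      using pair[OF pq(1) pq(2)] pair[OF pq(2) pq(1)] by (simp add: S_def T_def algebra_simps)
    also have "S * f + 2 * (e * f) + e * T = d * (S * T) / \<eta> * (2 + 2 * (d * (1 / \<eta>)))"
      using eta_pos by (simp add: e_def f_def field_simps)
    also have "\<dots> \<le> d * (S * T) / \<eta> * 6"
    proof (intro mult_left_mono)
      have "d * (1 / \<eta>) \<le> 1 * 1" using dl d0 eta_half eta_pos by (intro mult_mono) auto
      then show "2 + 2 * (d * (1 / \<eta>)) \<le> 6" by simp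
      show "0 \<le> d * (S * T) / \<eta>" using d0 ST0 eta_pos by simp
    qed
    finally have "\<sigma> p q * (rowabs x0 p * colabs x0 q + rowabs x0 q * colabs x0 p) \<le>
      \<sigma> p q * (rowabs xy p * colabs xy q + rowabs xy q * colabs xy p + d * (S * T) / \<eta> * 6)"
      using s by (intro mult_left_mono) auto
    then show ?thesis by (simp add: a_def first_order_def c_eq d_def power2_eq_square algebra_simps)
  qed
  show "c \<le> second_order (p, q) xy" if d1: "\<sigma> p q * cmod y \<le> 1"
  proof -
    have dl: "d \<le> 1" using d1 by (simp add: d_def)
    define Sy where "Sy = rowabs xy p + rowabs xy q"
    have S0: "0 \<le> Sy" using nn by (auto simp: Sy_def intro: add_nonneg_nonneg)
    have "d * Sy / \<eta> = d * (1 / \<eta>) * Sy" by simp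
    also have "\<dots> \<le> 1 * (1 / 2) * Sy" using dl d0 eta_half eta_pos S0 by (intro mult_right_mono mult_mono) auto
    finally have h: "d * Sy / \<eta> \<le> Sy / 2" by simp
    have "S \<le> Sy + 2 * (d * Sy / \<eta>)"
      using row1[OF pq(1)] row1[OF pq(2)] unfolding Sy_def[symmetric] by (auto simp: S_def Sy_def abs_le_iff)
    then have "S \<le> 2 * Sy" using h by linarith
    then have "S * (T * (1 / \<eta>)) \<le> (2 * Sy) * (1 * (1 / 2))"
      using ST0 ST1 S0 eta_half eta_pos by (intro mult_mono) auto
    also have "\<dots> = Sy" by simp
    finally have "(\<sigma> p q)\<^sup>2 * (S * (T * (1 / \<eta>))) \<le> (\<sigma> p q)\<^sup>2 * Sy" by (intro mult_left_mono) auto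
    moreover have "c = (\<sigma> p q)\<^sup>2 * (S * (T * (1 / \<eta>)))" by (simp add: c_eq)
    ultimately show ?thesis by (simp add: second_order_def Sy_def)
  qed
qed

end

section \<open>Resampling a coordinate and the entropy of a form\<close>

lemma ensemble_update:
  assumes "k \<in> coords" "x \<in> space ensemble"
  shows "(\<lambda>y. x(k := y)) \<in> \<nu> k \<rightarrow>\<^sub>M ensemble"
  using assms unfolding ensemble_def by (intro measurable_fun_upd[where J = coords]) auto

lemma update_measurable:
  assumes k: "k \<in> coords" and x: "x \<in> space ensemble" and f: "f \<in> borel_measurable ensemble"
  shows "(\<lambda>y. f (x(k := y))) \<in> borel_measurable borel"
  using measurable_compose[OF ensemble_update[OF k x] f] by (simp cong: measurable_cong_sets)

text \<open>Overwriting coordinate k by an independent copy preserves the product law, because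
  inserting k into \<open>coords\<close> changes nothing.\<close>

lemma integral_resample:
  fixes f :: "(nat \<times> nat \<Rightarrow> complex) \<Rightarrow> 'b :: {banach, second_countable_topology}"
  assumes k: "k \<in> coords" and f: "integrable ensemble f"
  shows "(LINT x|ensemble. f x) = (LINT x|ensemble. (LINT y|\<nu> k. f (x(k := y))))"
    and "integrable ensemble (\<lambda>x. LINT y|\<nu> k. f (x(k := y)))"
proof -
  interpret K: prob_space "\<nu> k" by (rule prob_space_law)
  interpret two_prob_spaces "\<nu> k" ensemble ..
  have i: "insert k coords = coords" using k by (rule insert_absorb)
  have d: "distr (\<nu> k \<Otimes>\<^sub>M ensemble) ensemble (\<lambda>p. (snd p)(k := fst p)) = ensemble"
    using distr_pair_PiM_eq_PiM[of coords \<nu> k] prob_space_law by (simp add: case_prod_beta' i ensemble_def)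
  have m: "(\<lambda>p. (snd p)(k := fst p)) \<in> (\<nu> k \<Otimes>\<^sub>M ensemble) \<rightarrow>\<^sub>M ensemble"
    using measurable_PiM_insert_update[of k \<nu> coords] by (simp add: i ensemble_def)
  have fm: "f \<in> borel_measurable ensemble" using f by (rule borel_measurable_integrable)
  have fi: "integrable (\<nu> k \<Otimes>\<^sub>M ensemble) (\<lambda>p. f ((snd p)(k := fst p)))"
    using f integrable_distr_eq[OF m, of f] fm by (simp add: d)
  have "(LINT x|ensemble. f x) = (LINT p|(\<nu> k \<Otimes>\<^sub>M ensemble). f ((snd p)(k := fst p)))"
    using integral_distr[OF m fm] by (simp add: d)
  then show "(LINT x|ensemble. f x) = (LINT x|ensemble. (LINT y|\<nu> k. f (x(k := y))))"
    using P.integral_snd[of "\<lambda>y x. f (x(k := y))"] fi by (simp add: case_prod_beta')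
  show "integrable ensemble (\<lambda>x. LINT y|\<nu> k. f (x(k := y)))"
    using P.integrable_snd[of "\<lambda>y x. f (x(k := y))"] fi by (simp add: case_prod_beta')
qed

text \<open>
  The sum over all entries of the bounds in \<open>entropy_exp_le\<close> is at most
  \<open>256 g \<cdot> smax\<^sup>2 / 4 + 149504 g\<^sup>2 \<cdot> smax\<^sup>2\<close>.
\<close>

definition variance_proxy :: real where "variance_proxy = 150000 * g\<^sup>2 * smax\<^sup>2"

lemma variance_proxy_pos: "0 < variance_proxy"
  using g_ge smax_pos by (auto simp: variance_proxy_def intro!: mult_pos_pos)

text \<open>Row and column forms have squared norm at most 1 / \<eta>^2 <= 1/4. The first order sum
  factors into two such norms. The second order sum spends one \<sigma>^2 on \<open>smax^2\<close>
  and sums the other along a row to 1.\<close>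

lemma order_sum_le:
  assumes u: "norm_sq N u \<le> 1" and v: "norm_sq N v \<le> 1"
  shows "(\<Sum>k\<in>coords. 256 * g * (first_order u v k x)\<^sup>2 + 149504 * g\<^sup>2 * (second_order u k x)\<^sup>2) \<le> variance_proxy"
proof -
  let ?s = "rowabs u x" and ?t = "colabs v x"
  have sub: "coords \<subseteq> {..<N} \<times> {..<N}" by (auto simp: coords_def)
  have Ss: "(\<Sum>i<N. (?s i)\<^sup>2) \<le> 1 / 4" and St: "(\<Sum>i<N. (?t i)\<^sup>2) \<le> 1 / 4"
  proof -
    have e: "4 \<le> \<eta>\<^sup>2" using power_mono[OF eta_ge, of 2] by simp
    have "4 * (\<Sum>i<N. (?s i)\<^sup>2) \<le> \<eta>\<^sup>2 * (\<Sum>i<N. (?s i)\<^sup>2)" "4 * (\<Sum>i<N. (?t i)\<^sup>2) \<le> \<eta>\<^sup>2 * (\<Sum>i<N. (?t i)\<^sup>2)"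
      using e by (auto intro!: mult_right_mono sum_nonneg)
    then show "(\<Sum>i<N. (?s i)\<^sup>2) \<le> 1 / 4" "(\<Sum>i<N. (?t i)\<^sup>2) \<le> 1 / 4"
      using rowabs_sum[OF u v, of x] colabs_sum[OF u v, of x] by linarith+
  qed
  have s0: "0 \<le> (\<Sum>i<N. (?s i)\<^sup>2)" "0 \<le> (\<Sum>i<N. (?t i)\<^sup>2)" by (auto intro: sum_nonneg)
  have fo: "(\<Sum>k\<in>coords. (first_order u v k x)\<^sup>2) \<le> smax\<^sup>2 * (1 / 4)"
  proof -
    have "(\<Sum>k\<in>coords. (first_order u v k x)\<^sup>2) \<le> (\<Sum>k\<in>{..<N} \<times> {..<N}. (first_order u v k x)\<^sup>2)"
      using sub by (intro sum_mono2) auto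
    also have "\<dots> = (\<Sum>p<N. \<Sum>q<N. (first_order u v (p, q) x)\<^sup>2)"
      by (simp add: sum.cartesian_product)
    also have "\<dots> \<le> (\<Sum>p<N. \<Sum>q<N. 2 * smax\<^sup>2 * ((?s p)\<^sup>2 * (?t q)\<^sup>2 + (?t p)\<^sup>2 * (?s q)\<^sup>2))"
    proof (intro sum_mono)
      fix p q assume "p \<in> {..<N}" "q \<in> {..<N}"
      then have "(\<sigma> p q)\<^sup>2 \<le> smax\<^sup>2" by (intro sigma_sq_le) auto
      moreover have "(?s p * ?t q + ?s q * ?t p)\<^sup>2 \<le> 2 * ((?s p)\<^sup>2 * (?t q)\<^sup>2 + (?t p)\<^sup>2 * (?s q)\<^sup>2)"
      proof -
        have "0 \<le> (?s p * ?t q - ?s q * ?t p)\<^sup>2" by simp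
        then show ?thesis by (simp add: power2_sum power2_diff power_mult_distrib mult_ac)
      qed
      ultimately have "(\<sigma> p q)\<^sup>2 * (?s p * ?t q + ?s q * ?t p)\<^sup>2 \<le> smax\<^sup>2 * (2 * ((?s p)\<^sup>2 * (?t q)\<^sup>2 + (?t p)\<^sup>2 * (?s q)\<^sup>2))"
        by (intro mult_mono) auto
      moreover have "(first_order u v (p, q) x)\<^sup>2 = (\<sigma> p q)\<^sup>2 * (?s p * ?t q + ?s q * ?t p)\<^sup>2"
        by (simp only: first_order_def[OF u v] fst_conv snd_conv power_mult_distrib)
      ultimately show "(first_order u v (p, q) x)\<^sup>2 \<le> 2 * smax\<^sup>2 * ((?s p)\<^sup>2 * (?t q)\<^sup>2 + (?t p)\<^sup>2 * (?s q)\<^sup>2)"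
        by (simp only: mult_ac)
    qed
    also have "\<dots> = 2 * smax\<^sup>2 * ((\<Sum>p<N. (?s p)\<^sup>2) * (\<Sum>q<N. (?t q)\<^sup>2) + (\<Sum>p<N. (?t p)\<^sup>2) * (\<Sum>q<N. (?s q)\<^sup>2))"
    proof -
      have "(\<Sum>p<N. \<Sum>q<N. 2 * smax\<^sup>2 * ((?s p)\<^sup>2 * (?t q)\<^sup>2 + (?t p)\<^sup>2 * (?s q)\<^sup>2)) =
          2 * smax\<^sup>2 * (\<Sum>p<N. \<Sum>q<N. ((?s p)\<^sup>2 * (?t q)\<^sup>2 + (?t p)\<^sup>2 * (?s q)\<^sup>2))"
        by (simp only: sum_distrib_left)
      also have "(\<Sum>p<N. \<Sum>q<N. ((?s p)\<^sup>2 * (?t q)\<^sup>2 + (?t p)\<^sup>2 * (?s q)\<^sup>2)) =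
          (\<Sum>p<N. \<Sum>q<N. (?s p)\<^sup>2 * (?t q)\<^sup>2) + (\<Sum>p<N. \<Sum>q<N. (?t p)\<^sup>2 * (?s q)\<^sup>2)"
        by (simp only: sum.distrib)
      finally show ?thesis by (simp only: sum_product)
    qed
    also have "\<dots> \<le> 2 * smax\<^sup>2 * (1 / 4 * (1 / 4) + 1 / 4 * (1 / 4))"
      using Ss St s0 by (intro mult_left_mono add_mono mult_mono) auto
    finally show ?thesis by simp
  qed
  have so: "(\<Sum>k\<in>coords. (second_order u k x)\<^sup>2) \<le> smax\<^sup>2"
  proof -
    have "(\<Sum>k\<in>coords. (second_order u k x)\<^sup>2) \<le> (\<Sum>k\<in>{..<N} \<times> {..<N}. (second_order u k x)\<^sup>2)"
      using sub by (intro sum_mono2) auto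
    also have "\<dots> = (\<Sum>p<N. \<Sum>q<N. (second_order u (p, q) x)\<^sup>2)"
      by (simp add: sum.cartesian_product)
    also have "\<dots> \<le> (\<Sum>p<N. \<Sum>q<N. 2 * smax\<^sup>2 * ((\<sigma> p q)\<^sup>2 * (?s p)\<^sup>2 + (\<sigma> q p)\<^sup>2 * (?s q)\<^sup>2))"
    proof (intro sum_mono)
      fix p q assume pq: "p \<in> {..<N}" "q \<in> {..<N}"
      then have "(\<sigma> p q)\<^sup>2 \<le> smax\<^sup>2" by (intro sigma_sq_le) auto
      then have "(\<sigma> p q)\<^sup>2 * (\<sigma> p q)\<^sup>2 \<le> smax\<^sup>2 * (\<sigma> p q)\<^sup>2" by (intro mult_right_mono) auto
      moreover have "(?s p + ?s q)\<^sup>2 \<le> 2 * ((?s p)\<^sup>2 + (?s q)\<^sup>2)"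
        using sum_squares_bound[of "?s p" "?s q"] by (simp add: power2_sum)
      ultimately have "((\<sigma> p q)\<^sup>2 * (\<sigma> p q)\<^sup>2) * (?s p + ?s q)\<^sup>2 \<le> (smax\<^sup>2 * (\<sigma> p q)\<^sup>2) * (2 * ((?s p)\<^sup>2 + (?s q)\<^sup>2))"
        by (rule mult_mono) simp_all
      moreover have "\<sigma> q p = \<sigma> p q" using pq by (intro sigma_sym) auto
      ultimately show "(second_order u (p, q) x)\<^sup>2 \<le> 2 * smax\<^sup>2 * ((\<sigma> p q)\<^sup>2 * (?s p)\<^sup>2 + (\<sigma> q p)\<^sup>2 * (?s q)\<^sup>2)"
        by (simp add: second_order_def[OF u v] power_mult_distrib power2_eq_square algebra_simps)
    qed
    also have "\<dots> = 2 * smax\<^sup>2 * ((\<Sum>p<N. \<Sum>q<N. (\<sigma> p q)\<^sup>2 * (?s p)\<^sup>2) + (\<Sum>p<N. \<Sum>q<N. (\<sigma> q p)\<^sup>2 * (?s q)\<^sup>2))"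
      by (simp only: sum.distrib[symmetric] sum_distrib_left)
    also have "(\<Sum>p<N. \<Sum>q<N. (\<sigma> q p)\<^sup>2 * (?s q)\<^sup>2) = (\<Sum>p<N. \<Sum>q<N. (\<sigma> p q)\<^sup>2 * (?s p)\<^sup>2)" by (rule sum.swap)
    also have "(\<Sum>p<N. \<Sum>q<N. (\<sigma> p q)\<^sup>2 * (?s p)\<^sup>2) = (\<Sum>p<N. (?s p)\<^sup>2)"
      by (intro sum.cong refl) (simp add: sum_distrib_right[symmetric] sigma_row)
    also have "2 * smax\<^sup>2 * ((\<Sum>p<N. (?s p)\<^sup>2) + (\<Sum>p<N. (?s p)\<^sup>2)) \<le> 2 * smax\<^sup>2 * (1 / 4 + 1 / 4)"
      using Ss by (intro mult_left_mono add_mono) auto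
    finally show ?thesis by simp
  qed
  have "(\<Sum>k\<in>coords. 256 * g * (first_order u v k x)\<^sup>2 + 149504 * g\<^sup>2 * (second_order u k x)\<^sup>2) =
    256 * g * (\<Sum>k\<in>coords. (first_order u v k x)\<^sup>2) + 149504 * g\<^sup>2 * (\<Sum>k\<in>coords. (second_order u k x)\<^sup>2)"
    by (simp only: sum.distrib sum_distrib_left)
  also have "\<dots> \<le> 256 * g * (smax\<^sup>2 * (1 / 4)) + 149504 * g\<^sup>2 * smax\<^sup>2"
    using fo so g_ge by (intro add_mono mult_left_mono) auto
  also have "\<dots> \<le> 64 * (g\<^sup>2 * smax\<^sup>2) + 149504 * (g\<^sup>2 * smax\<^sup>2)"
  proof -
    have "g * 1 \<le> g * g" using g_ge by (intro mult_left_mono) auto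
    then have "g * smax\<^sup>2 \<le> g\<^sup>2 * smax\<^sup>2" by (intro mult_right_mono) (auto simp: power2_eq_square)
    then show ?thesis by simp
  qed
  also have "\<dots> \<le> variance_proxy" by (simp add: variance_proxy_def)
  finally show ?thesis .
qed

text \<open>Tensorization reduces to one entry at a time. The modified inequality bounds that
  entropy by a resampled integral, and resampling turns it back into an integral over the ensemble,
  where the influences add up to \<open>variance_proxy\<close>.\<close>

lemma entropy_re_form_le:
  assumes u: "norm_sq N u \<le> 1" and v: "norm_sq N v \<le> 1" and small: "16 * g * smax\<^sup>2 \<le> 1"
    and s: "0 < s" "s * smax\<^sup>2 * g\<^sup>2 \<le> 1 / 300"
  shows "entropy_of ensemble (\<lambda>x. exp (s * re_form u v x)) \<le> variance_proxy * s\<^sup>2 * (LINT x|ensemble. exp (s * re_form u v x))"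
proof -
  let ?f = "re_form u v"
  define F where "F x = exp (s * ?f x)" for x
  define G where "G k x = F x * (256 * g * (first_order u v k x)\<^sup>2 + 149504 * g\<^sup>2 * (second_order u k x)\<^sup>2)" for k x
  note fm = re_form_measurable[OF u v]
  have Fb: "bounded_pos ensemble F (exp (- (\<bar>s\<bar> * 1))) (exp (\<bar>s\<bar> * 1))"
    unfolding F_def by (rule ensemble.integral_exp_bounds(1)[OF fm abs_re_form_le[OF u v]])
  note Fp = bounded_posD[OF Fb]
  have Gm: "G k \<in> borel_measurable ensemble" if "k \<in> coords" for k
    unfolding G_def
    by (intro borel_measurable_times borel_measurable_add borel_measurable_power borel_measurable_const Fp(1)
        first_order_measurable[OF u v that] second_order_measurable[OF u v that])
  have ob: "0 \<le> first_order u v k x" "first_order u v k x \<le> 1" "0 \<le> second_order u k x" "second_order u k x \<le> 1" if "k \<in> coords" for k x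
  proof -
    obtain p q where k: "k = (p, q)" by (cases k)
    have pq: "(p, q) \<in> coords" using that k by simp
    have "\<sigma> p q \<le> 1" using coordsD[OF pq] by (intro sigma_le_one)
    then show "0 \<le> first_order u v k x" "first_order u v k x \<le> 1" "0 \<le> second_order u k x" "second_order u k x \<le> 1"
      using order_bounds[OF u v pq, of x] unfolding k by linarith+
  qed
  have Gb: "norm (G k x) \<le> exp (\<bar>s\<bar> * 1) * (256 * g + 149504 * g\<^sup>2)" if k: "k \<in> coords" for k x
  proof -
    have "(first_order u v k x)\<^sup>2 \<le> 1" "(second_order u k x)\<^sup>2 \<le> 1"
      using ob[OF k, of x] by (auto simp: power_le_one)
    then have "256 * g * (first_order u v k x)\<^sup>2 + 149504 * g\<^sup>2 * (second_order u k x)\<^sup>2 \<le> 256 * g * 1 + 149504 * g\<^sup>2 * 1"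
      using g_ge by (intro add_mono mult_left_mono) auto
    then have "G k x \<le> exp (\<bar>s\<bar> * 1) * (256 * g + 149504 * g\<^sup>2)"
      unfolding G_def using Fp(4,5)[of x] g_ge by (intro mult_mono) auto
    moreover have "0 \<le> G k x" unfolding G_def using Fp(5)[of x] g_ge by auto
    ultimately show ?thesis by simp
  qed
  have one: "entropy_of (\<nu> k) (\<lambda>y. F (x(k := y))) \<le> s\<^sup>2 * (LINT y|\<nu> k. G k (x(k := y)))"
    if k: "k \<in> coords" and x: "x \<in> space ensemble" for k x
  proof -
    obtain p q where kpq: "k = (p, q)" by (cases k)
    have pq: "(p, q) \<in> coords" using k kpq by simp
    note pqN = coordsD[OF pq]
    interpret L: subgaussian_law "\<nu> k" g by (rule law)
    let ?x0 = "x(k := 0)"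
    define a where "a = first_order u v k ?x0"
    define c where "c = (\<sigma> p q)\<^sup>2 * ((rowabs u ?x0 p + rowabs u ?x0 q) * (colabs v ?x0 p + colabs v ?x0 q)) / \<eta>"
    note cmp = one_coordinate_comparison[OF u v pq, where x = x, folded kpq, folded a_def c_def]
    have sg: "0 \<le> \<sigma> p q" "(\<sigma> p q)\<^sup>2 \<le> smax\<^sup>2" using sigma_nonneg sigma_sq_le pqN by auto
    have a0: "0 \<le> a" "a \<le> \<sigma> p q / 2" using order_bounds(1,2)[OF u v pq, of ?x0] by (auto simp: a_def kpq)
    have c0: "0 \<le> c" "c \<le> (\<sigma> p q)\<^sup>2 / 2" using cmp(4,5) by auto
    \<comment> \<open>Both smallness conditions reduce to z. With z <= 1/300 the first costs 18432
      z^2; the second costs 1088 z^2 plus 8 g \<open>smax^2\<close>, which is at most 1/2.\<close>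
    define z where "z = g\<^sup>2 * (s * (\<sigma> p q)\<^sup>2)"
    have z0: "0 \<le> z" using s g_ge by (simp add: z_def)
    have "s * (\<sigma> p q)\<^sup>2 \<le> s * smax\<^sup>2" by (rule mult_left_mono[OF sg(2) less_imp_le[OF s(1)]])
    then have "z \<le> g\<^sup>2 * (s * smax\<^sup>2)" unfolding z_def by (rule mult_left_mono) simp
    then have z1: "z \<le> 1 / 300" using s(2) by (simp add: mult_ac)
    have z2: "z\<^sup>2 \<le> (1 / 300)\<^sup>2" by (rule power_mono[OF z1 z0])
    have small1: "73728 * g\<^sup>2 * c\<^sup>2 * s\<^sup>2 \<le> 1"
    proof -
      have "c\<^sup>2 \<le> ((\<sigma> p q)\<^sup>2 / 2)\<^sup>2" using c0 by (intro power_mono)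
      then have "g\<^sup>2 * s\<^sup>2 * c\<^sup>2 \<le> g\<^sup>2 * s\<^sup>2 * ((\<sigma> p q)\<^sup>2 / 2)\<^sup>2" by (intro mult_left_mono) auto
      also have "\<dots> \<le> g\<^sup>2 * (g\<^sup>2 * s\<^sup>2 * ((\<sigma> p q)\<^sup>2 / 2)\<^sup>2)"
        using mult_right_mono[of 1 "g\<^sup>2" "g\<^sup>2 * s\<^sup>2 * ((\<sigma> p q)\<^sup>2 / 2)\<^sup>2"] g_ge by (simp add: one_le_power)
      also have "\<dots> = z\<^sup>2 / 4" by (simp add: z_def power2_eq_square)
      finally have "g\<^sup>2 * s\<^sup>2 * c\<^sup>2 \<le> z\<^sup>2 / 4" .
      then show ?thesis using z2 by (simp add: mult_ac power_divide)
    qed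
    have small2: "(\<sigma> p q)\<^sup>2 * (8 * g * ((32 * g * a\<^sup>2 + 512 * g\<^sup>2 * c\<^sup>2) * s\<^sup>2 + 1)) \<le> 1"
    proof -
      have a2: "a\<^sup>2 \<le> (\<sigma> p q)\<^sup>2 / 4"
        using power_mono[OF a0(2,1), of 2] by (simp add: power_divide)
      have s1: "(\<sigma> p q)\<^sup>2 \<le> 1" using sg(1) sigma_le_one[OF pqN(1,2)] by (simp add: power_le_one)
      have "c\<^sup>2 \<le> ((\<sigma> p q)\<^sup>2 / 2)\<^sup>2" using c0 by (intro power_mono)
      also have "\<dots> = (\<sigma> p q)\<^sup>2 * (\<sigma> p q)\<^sup>2 / 4" by (simp add: power2_eq_square)
      also have "\<dots> \<le> 1 * (\<sigma> p q)\<^sup>2 / 4" using s1 by (intro divide_right_mono mult_right_mono) auto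
      finally have c2: "c\<^sup>2 \<le> (\<sigma> p q)\<^sup>2 / 4" by simp
      have gg: "g * 1 \<le> g * g" using g_ge by (intro mult_left_mono) auto
      have "32 * g * a\<^sup>2 + 512 * g\<^sup>2 * c\<^sup>2 \<le> 32 * g\<^sup>2 * ((\<sigma> p q)\<^sup>2 / 4) + 512 * g\<^sup>2 * ((\<sigma> p q)\<^sup>2 / 4)"
        using a2 c2 gg g_ge by (intro add_mono mult_mono) (auto simp: power2_eq_square)
      then have V: "32 * g * a\<^sup>2 + 512 * g\<^sup>2 * c\<^sup>2 \<le> 136 * g\<^sup>2 * (\<sigma> p q)\<^sup>2" by simp
      have "(\<sigma> p q)\<^sup>2 * (8 * g * ((32 * g * a\<^sup>2 + 512 * g\<^sup>2 * c\<^sup>2) * s\<^sup>2 + 1)) \<le>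
         (\<sigma> p q)\<^sup>2 * (8 * g * ((136 * g\<^sup>2 * (\<sigma> p q)\<^sup>2) * s\<^sup>2 + 1))"
        using V g_ge by (intro mult_left_mono add_right_mono mult_right_mono) auto
      also have "\<dots> = 1088 * (g * (g\<^sup>2 * (s * (\<sigma> p q)\<^sup>2)\<^sup>2)) + 8 * g * (\<sigma> p q)\<^sup>2"
        by (simp add: algebra_simps power2_eq_square)
      also have "\<dots> \<le> 1088 * z\<^sup>2 + 8 * g * smax\<^sup>2"
      proof -
        have "g * (g\<^sup>2 * (s * (\<sigma> p q)\<^sup>2)\<^sup>2) \<le> g\<^sup>2 * (g\<^sup>2 * (s * (\<sigma> p q)\<^sup>2)\<^sup>2)"
          using gg by (intro mult_right_mono) (auto simp: power2_eq_square)
        also have "\<dots> = z\<^sup>2" by (simp add: z_def power2_eq_square)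
        finally have "g * (g\<^sup>2 * (s * (\<sigma> p q)\<^sup>2)\<^sup>2) \<le> z\<^sup>2" .
        moreover have "8 * g * (\<sigma> p q)\<^sup>2 \<le> 8 * g * smax\<^sup>2" using sg g_ge by (intro mult_left_mono) auto
        ultimately show ?thesis by linarith
      qed
      also have "\<dots> \<le> 1" using z2 small by (simp add: power_divide)
      finally show ?thesis .
    qed
    have "entropy_of (\<nu> k) (\<lambda>y. exp (s * ?f (x(k := y)))) \<le>
      s\<^sup>2 * (LINT y|\<nu> k. exp (s * ?f (x(k := y))) * (256 * g * (first_order u v k (x(k := y)))\<^sup>2 + 149504 * g\<^sup>2 * (second_order u k (x(k := y)))\<^sup>2))"
    proof (rule L.entropy_exp_le[where K = 1 and L = 1 and a = a and c = c and r = "\<sigma> p q"])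
      show "(\<lambda>y. ?f (x(k := y))) \<in> borel_measurable borel" by (rule update_measurable[OF k x fm])
      show "(\<lambda>y. first_order u v k (x(k := y))) \<in> borel_measurable borel" by (rule update_measurable[OF k x first_order_measurable[OF u v k]])
      show "(\<lambda>y. second_order u k (x(k := y))) \<in> borel_measurable borel" by (rule update_measurable[OF k x second_order_measurable[OF u v k]])
      show "\<bar>?f (x(k := w))\<bar> \<le> 1" for w by (rule abs_re_form_le[OF u v])
      show "\<bar>first_order u v k (x(k := w))\<bar> \<le> 1" "\<bar>second_order u k (x(k := w))\<bar> \<le> 1" for w using ob[OF k] by auto
      show "\<bar>?f (x(k := w)) - ?f (x(k := 0))\<bar> \<le> a * cmod w + c * (cmod w)\<^sup>2" for w by (rule cmp(1))
      show "a \<le> first_order u v k (x(k := w)) + 6 * c * cmod w" if "\<sigma> p q * cmod w \<le> 1" for w by (rule cmp(2)[OF that])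
      show "c \<le> second_order u k (x(k := w))" if "\<sigma> p q * cmod w \<le> 1" for w by (rule cmp(3)[OF that])
    qed (use a0 c0 s sg small1 small2 in auto)
    then show ?thesis by (simp only: F_def G_def)
  qed
  have Gi: "integrable ensemble (G k)" if "k \<in> coords" for k
    by (rule ensemble.integrable_of_bound[OF Gm Gb]) (use that in auto)
  have "entropy_of ensemble F \<le> (\<Sum>k\<in>coords. LINT x|ensemble. entropy_of (\<nu> k) (\<lambda>y. F (x(k := y))))"
    using Fb unfolding ensemble_def by (intro entropy_PiM_le[OF prob_space_law finite_coords])
  also have "\<dots> \<le> (\<Sum>k\<in>coords. s\<^sup>2 * (LINT x|ensemble. G k x))"
  proof (rule sum_mono)
    fix k assume k: "k \<in> coords"
    note Gr = integral_resample[OF k Gi[OF k]]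
    have "(LINT x|ensemble. entropy_of (\<nu> k) (\<lambda>y. F (x(k := y)))) \<le> (LINT x|ensemble. s\<^sup>2 * (LINT y|\<nu> k. G k (x(k := y))))"
    proof (rule integral_mono')
      show "integrable ensemble (\<lambda>x. s\<^sup>2 * (LINT y|\<nu> k. G k (x(k := y))))" using Gr(2) by simp
      show "0 \<le> s\<^sup>2 * (LINT y|\<nu> k. G k (x(k := y)))" for x
        using Fp(5) g_ge by (intro mult_nonneg_nonneg Bochner_Integration.integral_nonneg) (auto simp: G_def less_imp_le)
    qed (rule one[OF k])
    then show "(LINT x|ensemble. entropy_of (\<nu> k) (\<lambda>y. F (x(k := y)))) \<le> s\<^sup>2 * (LINT x|ensemble. G k x)"
      using Gr(1) by simp
  qed
  also have "\<dots> = s\<^sup>2 * (LINT x|ensemble. (\<Sum>k\<in>coords. G k x))"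
    using Gi by (simp add: sum_distrib_left)
  also have "\<dots> \<le> s\<^sup>2 * (LINT x|ensemble. F x * variance_proxy)"
  proof (intro mult_left_mono integral_mono)
    show "integrable ensemble (\<lambda>x. \<Sum>k\<in>coords. G k x)" using Gi by auto
    show "integrable ensemble (\<lambda>x. F x * variance_proxy)" using ensemble.bounded_pos_integrable(1)[OF Fb] by simp
    show "(\<Sum>k\<in>coords. G k x) \<le> F x * variance_proxy" for x
      unfolding G_def sum_distrib_left[symmetric] using order_sum_le[OF u v, of x] Fp(5)[of x] by (intro mult_left_mono) auto
  qed simp
  also have "\<dots> = variance_proxy * s\<^sup>2 * (LINT x|ensemble. F x)" by simp
  finally show ?thesis unfolding F_def .
qed

theorem re_form_upper_tail:
  assumes u: "norm_sq N u \<le> 1" and v: "norm_sq N v \<le> 1" and small: "16 * g * smax\<^sup>2 \<le> 1"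
    and t: "0 < t" "t \<le> 2000"
  shows "measure ensemble {x \<in> space ensemble. (LINT x|ensemble. re_form u v x) + t \<le> re_form u v x} \<le> exp (- t\<^sup>2 / (8 * variance_proxy))"
proof -
  let ?f = "re_form u v" and ?V = variance_proxy
  let ?m = "LINT x|ensemble. ?f x"
  note V = variance_proxy_pos
  \<comment> \<open>The minimizer of 2 V s^2 - s t. With V = 150000 g^2 \<open>smax^2\<close> the
    condition on s becomes t / 600000 <= 1 / 300, which is the bound t <= 2000.\<close>
  define s where "s = t / (4 * ?V)"
  have s0: "0 < s" using t V by (simp add: s_def)
  have s1: "s * smax\<^sup>2 * g\<^sup>2 \<le> 1 / 300"
  proof -
    have "s * smax\<^sup>2 * g\<^sup>2 = t / 600000" using smax_pos g_ge by (simp add: s_def variance_proxy_def)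
    then show ?thesis using t by simp
  qed
  have H: "(LINT x|ensemble. exp (s * ?f x)) \<le> exp (s * ?m + 2 * ?V * s\<^sup>2)"
  proof (rule ensemble.herbst[OF re_form_measurable[OF u v] abs_re_form_le[OF u v] _ s0])
    fix r assume r: "0 < r" "r \<le> s"
    have "r * smax\<^sup>2 * g\<^sup>2 \<le> s * smax\<^sup>2 * g\<^sup>2" using r by (intro mult_right_mono) auto
    then show "entropy_of ensemble (\<lambda>x. exp (r * ?f x)) \<le> ?V * r\<^sup>2 * (LINT x|ensemble. exp (r * ?f x))"
      using s1 by (intro entropy_re_form_le[OF u v small r(1)]) linarith
  qed (use V in simp)
  have Fb: "bounded_pos ensemble (\<lambda>x. exp (s * ?f x)) (exp (- (\<bar>s\<bar> * 1))) (exp (\<bar>s\<bar> * 1))"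
    by (rule ensemble.integral_exp_bounds(1)[OF re_form_measurable[OF u v] abs_re_form_le[OF u v]])
  have "measure ensemble {x \<in> space ensemble. ?m + t \<le> ?f x} \<le> measure ensemble {x \<in> space ensemble. exp (s * (?m + t)) \<le> exp (s * ?f x)}"
  proof (rule ensemble.finite_measure_mono)
    show "{x \<in> space ensemble. exp (s * (?m + t)) \<le> exp (s * ?f x)} \<in> sets ensemble"
      using re_form_measurable[OF u v, measurable] by measurable
  qed (use s0 in auto)
  also have "\<dots> \<le> (LINT x|ensemble. exp (s * ?f x)) / exp (s * (?m + t))"
    using integral_Markov_inequality_measure[OF ensemble.bounded_pos_integrable(1)[OF Fb], of "{}" "exp (s * (?m + t))"] by simp
  also have "\<dots> \<le> exp (s * ?m + 2 * ?V * s\<^sup>2) / exp (s * (?m + t))" using H by (intro divide_right_mono) auto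
  also have "\<dots> = exp (2 * ?V * s\<^sup>2 - s * t)" by (simp add: exp_diff[symmetric] algebra_simps)
  also have "2 * ?V * s\<^sup>2 - s * t = - t\<^sup>2 / (8 * ?V)" using V by (simp add: s_def field_simps power2_eq_square)
  finally show ?thesis .
qed

section \<open>The mean resolvent\<close>

text \<open>If |w| >= 2 t, one of Re w, -Re w, Im w, -Im w is at least t. Multiplying u by a unit c
  rotates the form, so the one-sided bound for real parts covers all four cases.\<close>

theorem form_tail:
  assumes u: "norm_sq N u \<le> 1" and v: "norm_sq N v \<le> 1" and small: "16 * g * smax\<^sup>2 \<le> 1"
    and t: "0 < t" "t \<le> 2000"
  shows "measure ensemble {x \<in> space ensemble. 2 * t \<le> cmod (bilinear_form N u (green x) v -
    (LINT x|ensemble. bilinear_form N u (green x) v))} \<le> 4 * exp (- t\<^sup>2 / (8 * variance_proxy))"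
proof -
  let ?Z = "\<lambda>x. bilinear_form N u (green x) v"
  let ?m = "LINT x|ensemble. ?Z x"
  let ?p = "exp (- t\<^sup>2 / (8 * variance_proxy))"
  note Zm [measurable] = form_measurable[OF u v]
  have Zi: "integrable ensemble ?Z" by (rule ensemble.integrable_of_bound[OF Zm cmod_form_le[OF u v]])
  define D where "D c = {x \<in> space ensemble. t \<le> Re (c * (?Z x - ?m))}" for c :: complex
  have Dm: "D c \<in> sets ensemble" for c unfolding D_def by measurable
  have D: "measure ensemble (D c) \<le> ?p" if c: "cmod c = 1" for c
  proof -
    let ?u = "\<lambda>i. c * u i"
    have u': "norm_sq N ?u \<le> 1" using u c by (simp add: norm_sq_def norm_mult)
    have e: "re_form ?u v x = Re (c * ?Z x)" for x
      by (simp add: re_form_def[OF u' v] bilinear_form_def sum_distrib_left mult.assoc)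
    have m: "(LINT x|ensemble. re_form ?u v x) = Re (c * ?m)"
      unfolding e using Zi by (subst integral_Re) auto
    have "D c = {x \<in> space ensemble. (LINT x|ensemble. re_form ?u v x) + t \<le> re_form ?u v x}"
      unfolding m by (auto simp: D_def e right_diff_distrib)
    then show ?thesis using re_form_upper_tail[OF u' v small t] by simp
  qed
  have sub: "{x \<in> space ensemble. 2 * t \<le> cmod (?Z x - ?m)} \<subseteq> (D 1 \<union> D (- 1)) \<union> (D \<i> \<union> D (- \<i>))"
  proof
    fix x assume x: "x \<in> {x \<in> space ensemble. 2 * t \<le> cmod (?Z x - ?m)}"
    define w where "w = ?Z x - ?m"
    have "2 * t \<le> \<bar>Re w\<bar> + \<bar>Im w\<bar>" using x cmod_le[of w] by (simp add: w_def)
    then have "t \<le> Re (1 * w) \<or> t \<le> Re (- 1 * w) \<or> t \<le> Re (\<i> * w) \<or> t \<le> Re (- \<i> * w)" by auto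
    then show "x \<in> (D 1 \<union> D (- 1)) \<union> (D \<i> \<union> D (- \<i>))" using x unfolding D_def w_def by blast
  qed
  have un: "measure ensemble (A \<union> B) \<le> measure ensemble A + measure ensemble B"
    if "A \<in> sets ensemble" "B \<in> sets ensemble" for A B
    by (rule measure_Un_le[OF that])
  have "measure ensemble {x \<in> space ensemble. 2 * t \<le> cmod (?Z x - ?m)} \<le> measure ensemble ((D 1 \<union> D (- 1)) \<union> (D \<i> \<union> D (- \<i>)))"
    using Dm by (intro ensemble.finite_measure_mono[OF sub]) auto
  also have "\<dots> \<le> measure ensemble (D 1 \<union> D (- 1)) + measure ensemble (D \<i> \<union> D (- \<i>))" using Dm by (intro un) auto
  also have "\<dots> \<le> (measure ensemble (D 1) + measure ensemble (D (- 1))) + (measure ensemble (D \<i>) + measure ensemble (D (- \<i>)))"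
    using Dm by (intro add_mono un) auto
  also have "\<dots> \<le> (?p + ?p) + (?p + ?p)" by (intro add_mono D) auto
  finally show ?thesis by simp
qed

section \<open>Sign symmetry and the mean of off-diagonal entries\<close>

lemma law_reflection:
  fixes f :: "complex \<Rightarrow> 'b :: {banach, second_countable_topology}"
  assumes "f \<in> borel_measurable borel"
  shows "(LINT y|\<nu> k. f (- y)) = (LINT y|\<nu> k. f y)"
proof -
  have "(LINT y|distr (\<nu> k) borel (\<lambda>w. - w). f y) = (LINT y|\<nu> k. f (- y))"
    using assms by (intro integral_distr) measurable
  then show ?thesis by (simp add: law_sym)
qed

definition reflect :: "(nat \<times> nat) set \<Rightarrow> (nat \<times> nat \<Rightarrow> complex) \<Rightarrow> nat \<times> nat \<Rightarrow> complex" where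
  "reflect K x = (\<lambda>k. if k \<in> K then - x k else x k)"

text \<open>One coordinate at a time: resampling isolates it, and its law is symmetric.\<close>

lemma integral_reflect:
  fixes f :: "(nat \<times> nat \<Rightarrow> complex) \<Rightarrow> 'b :: {banach, second_countable_topology}"
  assumes "K \<subseteq> coords" "f \<in> borel_measurable ensemble" "\<And>x. norm (f x) \<le> B"
  shows "(LINT x|ensemble. f (reflect K x)) = (LINT x|ensemble. f x)"
proof -
  have "finite K" using assms(1) finite_coords by (rule finite_subset)
  then show ?thesis using assms
  proof (induction K arbitrary: f rule: finite_induct)
    case empty
    show ?case by (simp add: reflect_def)
  next
    case (insert k K)
    define f' where "f' x = f (x(k := - x k))" for x
    have k: "k \<in> coords" using insert.prems by auto
    have u: "(\<lambda>x. x(k := - x k)) \<in> ensemble \<rightarrow>\<^sub>M ensemble"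
    proof -
      have "(\<lambda>x. - x k) \<in> ensemble \<rightarrow>\<^sub>M \<nu> k"
        using borel_measurable_uminus[OF component_measurable[OF k]] by (simp cong: measurable_cong_sets)
      then show ?thesis using k unfolding ensemble_def by (intro measurable_fun_upd[where J = coords]) auto
    qed
    have f'm: "f' \<in> borel_measurable ensemble"
      unfolding f'_def using measurable_compose[OF u insert.prems(2)] .
    have fi: "integrable ensemble f" "integrable ensemble f'"
      using insert.prems f'm by (auto intro!: ensemble.integrable_of_bound[of _ B] simp: f'_def)
    have "reflect (insert k K) x = (reflect K x)(k := - (reflect K x) k)" for x
      using insert.hyps by (auto simp: reflect_def fun_eq_iff)
    then have "(LINT x|ensemble. f (reflect (insert k K) x)) = (LINT x|ensemble. f' (reflect K x))"
      by (simp only: f'_def)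
    also have "\<dots> = (LINT x|ensemble. f' x)"
      using insert.prems by (intro insert.IH[OF _ f'm]) (auto simp: f'_def)
    also have "\<dots> = (LINT x|ensemble. (LINT y|\<nu> k. f' (x(k := y))))"
      by (rule integral_resample(1)[OF k fi(2)])
    also have "\<dots> = (LINT x|ensemble. (LINT y|\<nu> k. f (x(k := y))))"
    proof (rule Bochner_Integration.integral_cong[OF refl])
      fix x assume x: "x \<in> space ensemble"
      show "(LINT y|\<nu> k. f' (x(k := y))) = (LINT y|\<nu> k. f (x(k := y)))"
        unfolding f'_def fun_upd_upd fun_upd_same by (rule law_reflection[OF update_measurable[OF k x insert.prems(2)]])
    qed
    also have "\<dots> = (LINT x|ensemble. f x)" by (rule integral_resample(1)[OF k fi(1), symmetric])
    finally show ?case .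
  qed
qed

text \<open>Flipping the off-diagonal entries of row and column i conjugates H by the diagonal sign
  matrix with -1 at i. The resolvent is conjugated likewise, so \<open>green x i j\<close> with j
  different from i changes sign and has mean 0.\<close>

lemma green_reflect:
  assumes "i < N" "p < N" "q < N"
  defines "s \<equiv> \<lambda>k. if k = i then - 1 else (1 :: complex)"
  shows "green (reflect {k \<in> coords. (fst k = i) \<noteq> (snd k = i)} x) p q = s p * s q * green x p q"
proof -
  let ?K = "{k \<in> coords. (fst k = i) \<noteq> (snd k = i)}"
  have h: "hmat (reflect ?K x) k l = s k * s l * hmat x k l" if "k < N" "l < N" for k l
    using that by (cases k l rule: linorder_cases) (auto simp: hmat_def reflect_def s_def coords_def)
  have ss: "s k * s k = 1" for k by (simp add: s_def)
  define y where "y k = s k * s q * green x k q" for k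
  have "y p = (\<Sum>k<N. green (reflect ?K x) p k * (if k = q then 1 else 0))"
    unfolding green_def
  proof (rule resolvent_unique[OF hmat_hermitian eta_pos _ assms(2)])
    fix k assume k: "k < N"
    have "(\<Sum>j<N. hmat (reflect ?K x) k j * y j) = (\<Sum>j<N. s k * s q * (hmat x k j * green x j q))"
    proof (rule sum.cong[OF refl])
      fix j assume "j \<in> {..<N}"
      then have "hmat (reflect ?K x) k j * y j = s k * s q * (s j * s j) * (hmat x k j * green x j q)"
        using h[OF k] by (simp add: y_def)
      then show "hmat (reflect ?K x) k j * y j = s k * s q * (hmat x k j * green x j q)" by (simp add: ss)
    qed
    then have "\<i> * of_real \<eta> * y k - (\<Sum>j<N. hmat (reflect ?K x) k j * y j) =
        s k * s q * (\<i> * of_real \<eta> * green x k q - (\<Sum>j<N. hmat x k j * green x j q))"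
      by (simp add: y_def sum_distrib_left algebra_simps)
    also have "\<dots> = s k * s q * (if k = q then 1 else 0)"
      unfolding green_def using resolvent_right[OF hmat_hermitian eta_pos k assms(3)] by simp
    also have "\<dots> = (if k = q then 1 else 0)" using ss by simp
    finally show "\<i> * of_real \<eta> * y k - (\<Sum>j<N. hmat (reflect ?K x) k j * y j) = (if k = q then 1 else 0)" .
  qed
  also have "\<dots> = green (reflect ?K x) p q" by (rule sum_mult_delta(1)[OF assms(3)])
  finally show ?thesis by (simp add: y_def)
qed

lemma cmod_green_le: "i < N \<Longrightarrow> j < N \<Longrightarrow> cmod (green x i j) \<le> 1 / 2"
proof -
  assume "i < N" "j < N"
  then have "cmod (green x i j) \<le> 1 / \<eta>" using cmod_resolvent_le[OF hmat_hermitian eta_pos] by (simp add: green_def)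
  also have "1 / \<eta> \<le> 1 / 2" using eta_ge by (simp add: field_simps)
  finally show ?thesis .
qed

lemma integral_green_off_diagonal:
  assumes "i < N" "j < N" "i \<noteq> j"
  shows "(LINT x|ensemble. green x i j) = 0"
proof -
  let ?K = "{k \<in> coords. (fst k = i) \<noteq> (snd k = i)}"
  have "(LINT x|ensemble. green (reflect ?K x) i j) = (LINT x|ensemble. green x i j)"
    by (rule integral_reflect[OF _ green_measurable[OF assms(1,2)] cmod_green_le[OF assms(1,2)]]) auto
  moreover have "green (reflect ?K x) i j = - green x i j" for x
    using green_reflect[OF assms(1) assms(1,2), of x] assms(3) by simp
  ultimately have "- (LINT x|ensemble. green x i j) = (LINT x|ensemble. green x i j)" by simp
  then show ?thesis by (simp add: eq_neg_iff_add_eq_0 neg_eq_iff_add_eq_0)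
qed

lemma green_row_sum: "i < N \<Longrightarrow> (\<Sum>k<N. (cmod (green x k i))\<^sup>2) \<le> 1 / 4"
proof -
  assume i: "i < N"
  let ?S = "\<Sum>k<N. (cmod (green x k i))\<^sup>2"
  have "norm_sq N (\<lambda>k. \<Sum>j<N. green x k j * (if j = i then 1 else 0)) = ?S"
    by (simp only: sum_mult_delta[OF i] norm_sq_def)
  then have "\<eta>\<^sup>2 * ?S \<le> 1"
    using norm_sq_resolvent_apply[OF hmat_hermitian eta_pos, of x "\<lambda>k. if k = i then 1 else 0"]
    unfolding green_def[symmetric] norm_sq_delta[OF i] by (simp only:)
  moreover have "2\<^sup>2 * ?S \<le> \<eta>\<^sup>2 * ?S" using eta_ge by (intro mult_right_mono power_mono sum_nonneg) auto
  ultimately show ?thesis by simp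
qed

section \<open>The equation for the mean diagonal\<close>

lemma hmat_entry_norm: "i < N \<Longrightarrow> k < N \<Longrightarrow> cmod (hmat x i k) \<le> \<sigma> i k * cmod (x (min i k, max i k))"
  using sigma_nonneg[of i k] by (cases i k rule: linorder_cases)
    (auto simp: hmat_def norm_mult min_def max_def intro!: mult_left_mono abs_Re_le_cmod)

lemma component_norm_integrable:
  assumes k: "k \<in> coords" shows "integrable ensemble (\<lambda>x. cmod (x k))"
proof -
  interpret L: subgaussian_law "\<nu> k" g by (rule law)
  have d: "distr ensemble (\<nu> k) (\<lambda>x. x k) = \<nu> k"
    unfolding ensemble_def by (rule distr_PiM_component[OF _ k]) (rule prob_space_law)
  have "(\<lambda>x. x k) \<in> ensemble \<rightarrow>\<^sub>M \<nu> k" using component_measurable[OF k] by (simp cong: measurable_cong_sets)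
  moreover have "(\<lambda>w. cmod w) \<in> borel_measurable (\<nu> k)" by measurable
  ultimately show ?thesis using integrable_distr_eq[of "\<lambda>x. x k" ensemble "\<nu> k" cmod] L.low_moments(1)[OF g_ge] by (simp add: d)
qed

lemma hmat_green_integrable:
  assumes "i < N" "k < N"
  shows "integrable ensemble (\<lambda>x. hmat x i k * green x k i)"
proof -
  have c: "(min i k, max i k) \<in> coords" using assms by (auto simp: coords_def)
  show ?thesis
  proof (rule Bochner_Integration.integrable_bound)
    show "integrable ensemble (\<lambda>x. \<sigma> i k * cmod (x (min i k, max i k)) * (1 / 2))"
      using component_norm_integrable[OF c] by simp
    show "(\<lambda>x. hmat x i k * green x k i) \<in> borel_measurable ensemble"
      using assms by (intro borel_measurable_times hmat_measurable green_measurable)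
    show "AE x in ensemble. norm (hmat x i k * green x k i) \<le> norm (\<sigma> i k * cmod (x (min i k, max i k)) * (1 / 2))"
    proof (rule AE_I2)
      fix x
      have "norm (hmat x i k * green x k i) \<le> \<sigma> i k * cmod (x (min i k, max i k)) * (1 / 2)"
        unfolding norm_mult using hmat_entry_norm[OF assms, of x] cmod_green_le[OF assms(2,1), of x] sigma_nonneg[OF assms]
        by (intro mult_mono) auto
      then show "norm (hmat x i k * green x k i) \<le> norm (\<sigma> i k * cmod (x (min i k, max i k)) * (1 / 2))" by simp
    qed
  qed
qed

text \<open>
  One step of the cumulant expansion: integrating out the entry \<open>h\<^sub>i\<^sub>k\<close> replaces it by its variance
  times \<open>G\<^sub>k\<^sub>k G\<^sub>i\<^sub>i\<close>; the term \<open>E h\<^sub>i\<^sub>k\<^sup>2 G\<^sub>k\<^sub>i\<^sup>2\<close> is kept in the error, since it vanishes only in the complex case.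
\<close>

lemma resampled_entry:
  assumes i: "i < N" and k: "k < N" and x: "x \<in> space ensemble"
  defines "c \<equiv> (min i k, max i k)"
  shows "cmod ((LINT y|\<nu> c. hmat (x(c := y)) i k * green (x(c := y)) k i) -
      (\<sigma> i k)\<^sup>2 * (LINT y|\<nu> c. green (x(c := y)) k k * green (x(c := y)) i i))
    \<le> (\<sigma> i k)\<^sup>2 * (LINT y|\<nu> c. (cmod (green (x(c := y)) k i))\<^sup>2) + 2 * g\<^sup>2 * smax * (\<sigma> i k)\<^sup>2 + (if k = i then g * smax\<^sup>2 else 0)"
proof -
  have c: "c \<in> coords" using i k by (auto simp: coords_def c_def)
  interpret L: subgaussian_law "\<nu> c" g by (rule law)
  note mom = L.low_moments[OF g_ge]
  let ?s = "\<sigma> i k"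
  have s: "0 \<le> ?s" "?s \<le> smax" "?s\<^sup>2 \<le> smax\<^sup>2" using sigma_nonneg sigma_le sigma_sq_le i k by auto
  have g0: "0 \<le> g" using g_ge by simp
  define G where "G y = green (x(c := y))" for y
  define h where "h y = hmat (x(c := y)) i k" for y
  have Gm: "(\<lambda>y. G y p q) \<in> borel_measurable (\<nu> c)" if "p < N" "q < N" for p q
    using update_measurable[OF c x green_measurable[OF that]] by (simp add: G_def)
  have Gb: "cmod (G y p q) \<le> 1 / 2" if "p < N" "q < N" for p q y
    unfolding G_def by (rule cmod_green_le[OF that])
  have Gd: "cmod (G y p q - G 0 p q) \<le> ?s * cmod y / 2" if "p < N" "q < N" for p q y
  proof -
    have sc: "\<sigma> (min i k) (max i k) = ?s" using sigma_sym[OF i k] by (auto simp: min_def max_def)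
    interpret E: entry_perturbation N "hmat (x(c := y))" "hmat (x(c := 0))" \<eta> "min i k" "max i k" "?s * cmod y"
      using entry_perturbation_hmat[of "min i k" "max i k" x y] c unfolding sc c_def by simp
    have "cmod (G y p q - G 0 p q) \<le> 2 * (?s * cmod y) / \<eta>\<^sup>2"
      unfolding G_def green_def by (rule E.cmod_resolvent_entry_diff_le[OF that])
    also have "\<dots> \<le> 2 * (?s * cmod y) / 2\<^sup>2"
      using eta_ge s by (intro divide_left_mono power_mono mult_pos_pos) auto
    finally show ?thesis by (simp add: mult.commute)
  qed
  have hb: "cmod (h y) \<le> ?s * cmod y" for y
    using hmat_entry_norm[OF i k, of "x(c := y)"] by (simp add: h_def c_def)
  have hm: "h \<in> borel_measurable (\<nu> c)"
    unfolding h_def[abs_def] using update_measurable[OF c x hmat_measurable[OF i k]] by simp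
  have hi: "integrable (\<nu> c) h"
  proof (rule Bochner_Integration.integrable_bound)
    show "integrable (\<nu> c) (\<lambda>y. ?s * cmod y)" using mom(1) by simp
    show "AE y in \<nu> c. norm (h y) \<le> norm (?s * cmod y)" using hb s by (intro AE_I2) simp
  qed (rule hm)
  have h0: "(LINT y|\<nu> c. h y) = 0"
  proof -
    have "h (- y) = - h y" for y
      by (cases i k rule: linorder_cases) (auto simp: h_def c_def hmat_def)
    then have "- (LINT y|\<nu> c. h y) = (LINT y|\<nu> c. h (- y))" by simp
    also have "\<dots> = (LINT y|\<nu> c. h y)" by (rule law_reflection) (use hm in simp)
    finally show ?thesis by (simp add: eq_neg_iff_add_eq_0 neg_eq_iff_add_eq_0)
  qed
  have hGi: "integrable (\<nu> c) (\<lambda>y. h y * G y k i)"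
  proof (rule Bochner_Integration.integrable_bound)
    show "integrable (\<nu> c) (\<lambda>y. ?s * cmod y * (1 / 2))" using mom(1) by simp
    show "(\<lambda>y. h y * G y k i) \<in> borel_measurable (\<nu> c)" using hm Gm[OF k i] by simp
    have "norm (h y * G y k i) \<le> ?s * cmod y * (1 / 2)" for y
      unfolding norm_mult using hb[of y] Gb[OF k i, of y] s by (intro mult_mono) auto
    then show "AE y in \<nu> c. norm (h y * G y k i) \<le> norm (?s * cmod y * (1 / 2))" using s by (intro AE_I2) simp
  qed
  have GGi: "integrable (\<nu> c) (\<lambda>y. G y k k * G y i i)"
  proof (rule L.integrable_of_bound)
    show "(\<lambda>y. G y k k * G y i i) \<in> borel_measurable (\<nu> c)" using Gm i k by (intro borel_measurable_times) auto
    show "norm (G y k k * G y i i) \<le> 1 / 2 * (1 / 2)" for y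
      unfolding norm_mult using Gb[OF k k, of y] Gb[OF i i, of y] by (intro mult_mono) auto
  qed
  have Fi: "integrable (\<nu> c) (\<lambda>y. (cmod (G y k i))\<^sup>2)"
  proof (rule L.integrable_of_bound)
    show "(\<lambda>y. (cmod (G y k i))\<^sup>2) \<in> borel_measurable (\<nu> c)" using Gm[OF k i] by simp
    show "norm ((cmod (G y k i))\<^sup>2) \<le> (1 / 2)\<^sup>2" for y
      using Gb[OF k i, of y] by (simp add: power_mono[of _ "1/2" 2, simplified])
  qed
  \<comment> \<open>The expansion is made at y = 0, but only the average over y sums up over k after
    resampling; the difference costs one more factor of \<sigma>.\<close>
  have F0: "(cmod (G 0 k i))\<^sup>2 \<le> (LINT y|\<nu> c. (cmod (G y k i))\<^sup>2) + ?s * g / 2"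
  proof -
    have pt: "(cmod (G 0 k i))\<^sup>2 \<le> (cmod (G y k i))\<^sup>2 + ?s * cmod y / 2" for y
    proof -
      let ?a = "cmod (G 0 k i)" and ?b = "cmod (G y k i)"
      have "?a - ?b \<le> ?s * cmod y / 2"
        using Gd[OF k i, of y] norm_triangle_ineq2[of "G 0 k i" "G y k i"] by (simp add: norm_minus_commute)
      moreover have "0 \<le> ?a + ?b" "?a + ?b \<le> 1" using Gb[OF k i, of 0] Gb[OF k i, of y] by auto
      ultimately have "(?a - ?b) * (?a + ?b) \<le> ?s * cmod y / 2 * 1"
        using s by (intro mult_mono) auto
      then show ?thesis by (simp add: power2_eq_square algebra_simps)
    qed
    have "(cmod (G 0 k i))\<^sup>2 = (LINT y|\<nu> c. (cmod (G 0 k i))\<^sup>2)" using L.prob_space by simp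
    also have "\<dots> \<le> (LINT y|\<nu> c. (cmod (G y k i))\<^sup>2 + ?s * cmod y / 2)"
      using Fi mom(1) by (intro integral_mono pt) auto
    also have "\<dots> = (LINT y|\<nu> c. (cmod (G y k i))\<^sup>2) + ?s * (LINT y|\<nu> c. cmod y) / 2" using Fi mom(1) by simp
    also have "\<dots> \<le> (LINT y|\<nu> c. (cmod (G y k i))\<^sup>2) + ?s * g / 2"
      using mult_left_mono[OF mom(4) s(1)] by simp
    finally show ?thesis .
  qed
  have Fnn: "0 \<le> (LINT y|\<nu> c. (cmod (G y k i))\<^sup>2)" by simp
  have main: "cmod ((LINT y|\<nu> c. h y * G y k i) - ?s\<^sup>2 * (LINT y|\<nu> c. G y k k * G y i i))
    \<le> ?s\<^sup>2 * (LINT y|\<nu> c. (cmod (G y k i))\<^sup>2) + 2 * g\<^sup>2 * smax * ?s\<^sup>2 + (if k = i then g * smax\<^sup>2 else 0)"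
  proof (cases "k = i")
    case True
    \<comment> \<open>On the diagonal no expansion is made. Subtracting \<open>G 0\<close> costs
      nothing since h has mean 0 and leaves order \<sigma>^2, while the product of diagonal entries
      has modulus |G_ki|^2 and is covered by the first error term.\<close>
    have "(LINT y|\<nu> c. h y * G y k i) = (LINT y|\<nu> c. h y * (G y k i - G 0 k i))"
      using hGi hi h0 by (simp add: right_diff_distrib)
    also have "cmod \<dots> \<le> (LINT y|\<nu> c. ?s\<^sup>2 / 2 * (cmod y)\<^sup>2)"
    proof (rule order.trans[OF integral_norm_bound integral_mono'])
      show "integrable (\<nu> c) (\<lambda>y. ?s\<^sup>2 / 2 * (cmod y)\<^sup>2)" using mom(2) by simp
      fix y
      have "norm (h y * (G y k i - G 0 k i)) \<le> (?s * cmod y) * (?s * cmod y / 2)"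
        unfolding norm_mult using hb[of y] Gd[OF k i, of y] s by (intro mult_mono) auto
      then show "norm (h y * (G y k i - G 0 k i)) \<le> ?s\<^sup>2 / 2 * (cmod y)\<^sup>2" by (simp add: power2_eq_square algebra_simps)
    qed auto
    also have "\<dots> \<le> ?s\<^sup>2 / 2 * g" using mult_left_mono[OF mom(5), of "?s\<^sup>2 / 2"] by simp
    also have "\<dots> \<le> smax\<^sup>2 * g"
    proof (rule mult_right_mono[OF _ g0])
      show "?s\<^sup>2 / 2 \<le> smax\<^sup>2" using s(3) zero_le_power2[of ?s] by linarith
    qed
    finally have a: "cmod (LINT y|\<nu> c. h y * G y k i) \<le> g * smax\<^sup>2" by (simp only: mult.commute)
    have "cmod (LINT y|\<nu> c. G y k k * G y i i) \<le> (LINT y|\<nu> c. (cmod (G y k i))\<^sup>2)"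
      using integral_norm_bound[of "\<nu> c" "\<lambda>y. G y k k * G y i i"] True by (simp add: norm_mult power2_eq_square)
    then have "?s\<^sup>2 * cmod (LINT y|\<nu> c. G y k k * G y i i) \<le> ?s\<^sup>2 * (LINT y|\<nu> c. (cmod (G y k i))\<^sup>2)" by (intro mult_left_mono) auto
    then have b: "cmod (?s\<^sup>2 * (LINT y|\<nu> c. G y k k * G y i i)) \<le> ?s\<^sup>2 * (LINT y|\<nu> c. (cmod (G y k i))\<^sup>2)"
      by (simp add: norm_mult norm_power)
    have "0 \<le> 2 * g\<^sup>2 * smax * ?s\<^sup>2" using smax_pos by simp
    then show ?thesis unfolding if_P[OF True] using order.trans[OF norm_triangle_ineq4 add_mono[OF a b]] by linarith
  next
    case False
    have hn: "cmod (h y) = ?s * cmod y" for y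
      using False s sigma_sym[OF i k] by (cases i k rule: linorder_cases) (auto simp: h_def c_def hmat_def norm_mult)
    \<comment> \<open>The remainder after the linear term, whose mean is 0, and the leading
      quadratic term. The latter has |h|^2 and not h^2, which has the same mean in both symmetry
      classes.\<close>
    define R where "R y = h y * G y k i - h y * G 0 k i - of_real ((cmod (h y))\<^sup>2) * (G 0 k k * G 0 i i)" for y
    \<comment> \<open>The entry vanishes at y = 0, so the exact two-term identity is already an
      expansion in h and needs no differentiation.\<close>
    have exp: "G y k i - G 0 k i = G y k k * cnj (h y) * G 0 i i + G y k i * h y * G 0 k i" for y
    proof -
      interpret E: entry_perturbation N "hmat (x(c := y))" "hmat (x(c := 0))" \<eta> "min i k" "max i k" "\<sigma> (min i k) (max i k) * cmod y"
        using entry_perturbation_hmat[of "min i k" "max i k" x y] c unfolding c_def by simp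
      have z: "hmat (x(c := 0)) i k = 0" "hmat (x(c := 0)) k i = 0"
        using False by (cases i k rule: linorder_cases; simp add: hmat_def c_def)+
      have z0: "h 0 = 0" using z by (simp add: h_def)
      have hc: "hmat (x(c := y)) k i = cnj (h y)" unfolding h_def by (rule hermitian_onD[OF hmat_hermitian i k])
      have "min i k \<noteq> max i k" using False by auto
      note e = E.resolvent_entry_diff[OF this k i, folded green_def, folded G_def]
      show ?thesis
      proof (cases "i < k")
        case True
        then show ?thesis using e by (simp add: z z0 hc h_def[symmetric] min_def max_def)
      next
        case False
        then show ?thesis using e \<open>k \<noteq> i\<close> by (simp add: z z0 hc h_def[symmetric] min_def max_def)
      qed
    qed
    have hh: "cmod (h y * h y) = (?s * cmod y)\<^sup>2" "cmod (h y * cnj (h y)) = (?s * cmod y)\<^sup>2" for y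
      by (simp_all only: norm_mult complex_mod_cnj hn power2_eq_square)
    have Rb: "cmod (R y) \<le> ?s\<^sup>2 * (cmod (G 0 k i))\<^sup>2 * (cmod y)\<^sup>2 + ?s ^ 3 / 2 * cmod y ^ 3" for y
    proof -
      have e: "h y * (G y k i - G 0 k i) = h y * cnj (h y) * (G y k k * G 0 i i) + h y * h y * (G y k i * G 0 k i)"
        by (subst exp) (simp add: algebra_simps)
      have "R y = h y * (G y k i - G 0 k i) - h y * cnj (h y) * (G 0 k k * G 0 i i)"
        by (simp only: R_def right_diff_distrib complex_norm_square)
      also have "\<dots> = h y * cnj (h y) * ((G y k k - G 0 k k) * G 0 i i) + h y * h y * (G 0 k i * G 0 k i + (G y k i - G 0 k i) * G 0 k i)"
        unfolding e by (simp add: algebra_simps)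
      finally have "cmod (R y) \<le> cmod (h y * cnj (h y) * ((G y k k - G 0 k k) * G 0 i i)) +
          cmod (h y * h y * (G 0 k i * G 0 k i + (G y k i - G 0 k i) * G 0 k i))" by (simp only: norm_triangle_ineq)
      also have "\<dots> \<le> (?s * cmod y)\<^sup>2 * (?s * cmod y / 2 * (1 / 2)) +
          (?s * cmod y)\<^sup>2 * ((cmod (G 0 k i))\<^sup>2 + ?s * cmod y / 2 * (1 / 2))"
      proof (rule add_mono)
        have "cmod (G y k k - G 0 k k) * cmod (G 0 i i) \<le> ?s * cmod y / 2 * (1 / 2)"
          using s by (intro mult_mono Gd Gb i k) auto
        then show "cmod (h y * cnj (h y) * ((G y k k - G 0 k k) * G 0 i i)) \<le> (?s * cmod y)\<^sup>2 * (?s * cmod y / 2 * (1 / 2))"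
          unfolding norm_mult[of "h y * cnj (h y)"] hh norm_mult[of "G y k k - G 0 k k"] by (rule mult_left_mono) simp
        have "cmod (G 0 k i * G 0 k i + (G y k i - G 0 k i) * G 0 k i) \<le> cmod (G 0 k i * G 0 k i) + cmod ((G y k i - G 0 k i) * G 0 k i)"
          by (rule norm_triangle_ineq)
        also have "\<dots> \<le> (cmod (G 0 k i))\<^sup>2 + ?s * cmod y / 2 * (1 / 2)"
          unfolding norm_mult power2_eq_square using s by (intro add_mono mult_mono Gd Gb i k order_refl) auto
        finally show "cmod (h y * h y * (G 0 k i * G 0 k i + (G y k i - G 0 k i) * G 0 k i)) \<le>
            (?s * cmod y)\<^sup>2 * ((cmod (G 0 k i))\<^sup>2 + ?s * cmod y / 2 * (1 / 2))"
          unfolding norm_mult[of "h y * h y"] hh by (rule mult_left_mono) simp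
      qed
      also have "\<dots> = ?s\<^sup>2 * (cmod (G 0 k i))\<^sup>2 * (cmod y)\<^sup>2 + ?s ^ 3 / 2 * cmod y ^ 3"
        by (simp add: power2_eq_square power3_eq_cube algebra_simps)
      finally show ?thesis .
    qed
    have h2: "integrable (\<nu> c) (\<lambda>y. complex_of_real ((cmod (h y))\<^sup>2))" "(LINT y|\<nu> c. complex_of_real ((cmod (h y))\<^sup>2)) = ?s\<^sup>2"
    proof -
      have "(LINT y|\<nu> c. (cmod y)\<^sup>2) = 1"
        using law_var[of "min i k" "max i k"] False i k by (simp add: c_def)
      moreover have "(\<lambda>y. complex_of_real ((cmod (h y))\<^sup>2)) = (\<lambda>y. complex_of_real (?s\<^sup>2 * (cmod y)\<^sup>2))"
        by (simp only: hn power_mult_distrib)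
      moreover have "integrable (\<nu> c) (\<lambda>y. complex_of_real (?s\<^sup>2 * (cmod y)\<^sup>2))"
        by (rule integrable_of_real) (use mom(2) in simp)
      moreover have "(LINT y|\<nu> c. complex_of_real (?s\<^sup>2 * (cmod y)\<^sup>2)) = complex_of_real (?s\<^sup>2 * (LINT y|\<nu> c. (cmod y)\<^sup>2))"
        unfolding integral_complex_of_real by simp
      ultimately show "integrable (\<nu> c) (\<lambda>y. complex_of_real ((cmod (h y))\<^sup>2))" "(LINT y|\<nu> c. complex_of_real ((cmod (h y))\<^sup>2)) = ?s\<^sup>2"
        by (simp_all only: mult_1_right of_real_power)
    qed
    have Ri: "(LINT y|\<nu> c. R y) = (LINT y|\<nu> c. h y * G y k i) - ?s\<^sup>2 * (G 0 k k * G 0 i i)"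
    proof -
      have "(LINT y|\<nu> c. R y) = (LINT y|\<nu> c. h y * G y k i) - (LINT y|\<nu> c. h y) * G 0 k i - (LINT y|\<nu> c. complex_of_real ((cmod (h y))\<^sup>2)) * (G 0 k k * G 0 i i)"
      proof -
        have i1: "integrable (\<nu> c) (\<lambda>y. h y * G 0 k i)" using hi by simp
        have i2: "integrable (\<nu> c) (\<lambda>y. complex_of_real ((cmod (h y))\<^sup>2) * (G 0 k k * G 0 i i))"
          by (rule integrable_mult_left) (use h2(1) in simp)
        show ?thesis
          unfolding R_def Bochner_Integration.integral_diff[OF Bochner_Integration.integrable_diff[OF hGi i1] i2]
            Bochner_Integration.integral_diff[OF hGi i1] integral_mult_left_zero ..
      qed
      then show ?thesis unfolding h0 h2(2) by simp
    qed
    have "cmod (LINT y|\<nu> c. R y) \<le> (LINT y|\<nu> c. ?s\<^sup>2 * (cmod (G 0 k i))\<^sup>2 * (cmod y)\<^sup>2 + ?s ^ 3 / 2 * cmod y ^ 3)"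
      by (rule order.trans[OF integral_norm_bound integral_mono']) (use mom(2,3) Rb s in auto)
    also have "\<dots> = ?s\<^sup>2 * (cmod (G 0 k i))\<^sup>2 * (LINT y|\<nu> c. (cmod y)\<^sup>2) + ?s ^ 3 / 2 * (LINT y|\<nu> c. cmod y ^ 3)"
      using mom(2,3) by simp
    also have "(LINT y|\<nu> c. (cmod y)\<^sup>2) = 1" using law_var[of "min i k" "max i k"] False i k by (simp add: c_def)
    also have "?s\<^sup>2 * (cmod (G 0 k i))\<^sup>2 * 1 + ?s ^ 3 / 2 * (LINT y|\<nu> c. cmod y ^ 3) \<le>
       ?s\<^sup>2 * ((LINT y|\<nu> c. (cmod (G y k i))\<^sup>2) + ?s * g / 2) + ?s ^ 3 / 2 * (2 * g\<^sup>2)"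
      unfolding mult_1_right using F0 mom(6) s by (intro add_mono mult_left_mono) auto
    finally have b1: "cmod ((LINT y|\<nu> c. h y * G y k i) - ?s\<^sup>2 * (G 0 k k * G 0 i i)) \<le>
      ?s\<^sup>2 * (LINT y|\<nu> c. (cmod (G y k i))\<^sup>2) + ?s ^ 3 * (g / 2 + g\<^sup>2)"
      unfolding Ri by (simp add: power2_eq_square power3_eq_cube algebra_simps)
    \<comment> \<open>Back from the values at 0 to averages over the resampled entry, at the cost of
      one more \<sigma>.\<close>
    have "G 0 k k * G 0 i i - (LINT y|\<nu> c. G y k k * G y i i) = (LINT y|\<nu> c. G 0 k k * G 0 i i - G y k k * G y i i)"
      using GGi L.prob_space by simp
    also have "cmod \<dots> \<le> (LINT y|\<nu> c. ?s / 2 * cmod y)"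
    proof (rule order.trans[OF integral_norm_bound integral_mono'])
      show "integrable (\<nu> c) (\<lambda>y. ?s / 2 * cmod y)" using mom(1) by simp
      fix y
      have "G 0 k k * G 0 i i - G y k k * G y i i = - ((G y k k - G 0 k k) * G 0 i i + G y k k * (G y i i - G 0 i i))"
        by (simp add: algebra_simps)
      then have "cmod (G 0 k k * G 0 i i - G y k k * G y i i) \<le> cmod (G y k k - G 0 k k) * cmod (G 0 i i) + cmod (G y k k) * cmod (G y i i - G 0 i i)"
        using norm_triangle_ineq[of "(G y k k - G 0 k k) * G 0 i i" "G y k k * (G y i i - G 0 i i)"] by (simp only: norm_minus_cancel norm_mult)
      also have "\<dots> \<le> ?s * cmod y / 2 * (1 / 2) + 1 / 2 * (?s * cmod y / 2)"
        using s by (intro add_mono mult_mono Gd Gb i k) auto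
      finally show "norm (G 0 k k * G 0 i i - G y k k * G y i i) \<le> ?s / 2 * cmod y" by (simp add: mult.commute)
    qed (use s in auto)
    also have "\<dots> \<le> ?s / 2 * g" using mult_left_mono[OF mom(4), of "?s / 2"] s by simp
    finally have gd: "?s\<^sup>2 * cmod (G 0 k k * G 0 i i - (LINT y|\<nu> c. G y k k * G y i i)) \<le> ?s\<^sup>2 * (?s / 2 * g)"
      by (intro mult_left_mono) auto
    have b2: "cmod (?s\<^sup>2 * (G 0 k k * G 0 i i) - ?s\<^sup>2 * (LINT y|\<nu> c. G y k k * G y i i)) \<le> ?s ^ 3 * (g / 2)"
    proof -
      have "cmod (?s\<^sup>2 * w) = ?s\<^sup>2 * cmod w" for w :: complex by (simp add: norm_mult norm_power)
      moreover have "?s\<^sup>2 * (?s / 2 * g) = ?s ^ 3 * (g / 2)" by (simp add: power2_eq_square power3_eq_cube)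
      ultimately show ?thesis using gd by (simp only: right_diff_distrib[symmetric])
    qed
    have "g * 1 \<le> g * g" using g_ge by (intro mult_left_mono) auto
    then have "?s ^ 3 * (g / 2 + g\<^sup>2) + ?s ^ 3 * (g / 2) \<le> ?s ^ 3 * (2 * g\<^sup>2)"
      unfolding distrib_left[symmetric] using s by (intro mult_left_mono) (auto simp: power2_eq_square)
    also have "\<dots> \<le> 2 * g\<^sup>2 * smax * ?s\<^sup>2"
    proof -
      have "?s * (?s\<^sup>2 * (2 * g\<^sup>2)) \<le> smax * (?s\<^sup>2 * (2 * g\<^sup>2))" using s by (intro mult_right_mono) auto
      then show ?thesis by (simp add: power2_eq_square power3_eq_cube mult_ac)
    qed
    finally have "?s ^ 3 * (g / 2 + g\<^sup>2) + ?s ^ 3 * (g / 2) \<le> 2 * g\<^sup>2 * smax * ?s\<^sup>2" .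
    then show ?thesis using False b1 b2
      norm_triangle_ineq[of "(LINT y|\<nu> c. h y * G y k i) - ?s\<^sup>2 * (G 0 k k * G 0 i i)" "?s\<^sup>2 * (G 0 k k * G 0 i i) - ?s\<^sup>2 * (LINT y|\<nu> c. G y k k * G y i i)"]
      by simp
  qed
  then show ?thesis by (simp only: h_def G_def)
qed

lemma green_product_integrable:
  assumes "i < N" "j < N" "k < N" "l < N"
  shows "integrable ensemble (\<lambda>x. green x i j * green x k l)"
proof (rule ensemble.integrable_of_bound)
  show "(\<lambda>x. green x i j * green x k l) \<in> borel_measurable ensemble" using assms by (intro borel_measurable_times green_measurable)
  show "norm (green x i j * green x k l) \<le> 1 / 2 * (1 / 2)" for x
    unfolding norm_mult using assms by (intro mult_mono cmod_green_le) auto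
qed

lemma green_integrable: "i < N \<Longrightarrow> j < N \<Longrightarrow> integrable ensemble (\<lambda>x. green x i j)"
  by (rule ensemble.integrable_of_bound[OF green_measurable cmod_green_le])

lemma green_norm_sq_integrable:
  assumes "i < N" "j < N" shows "integrable ensemble (\<lambda>x. (cmod (green x i j))\<^sup>2)"
  using integrable_norm[OF green_product_integrable[OF assms assms]] by (simp only: norm_mult power2_eq_square)

text \<open>The diagonal of (z - H) G = 1 is averaged entry by entry. The errors can be summed over
  k because each carries \<sigma>_ik^2, with row sum 1, or |G_ki|^2, with column sum at most 1/4,
  except for the single diagonal term.\<close>

lemma self_consistent_equation:
  assumes i: "i < N" and smax1: "smax \<le> 1"
  shows "cmod (\<i> * of_real \<eta> * (LINT x|ensemble. green x i i) - 1 -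
    (\<Sum>k<N. (\<sigma> i k)\<^sup>2 * (LINT x|ensemble. green x k k * green x i i))) \<le> 4 * g\<^sup>2 * smax"
proof -
  have entry: "cmod ((LINT x|ensemble. hmat x i k * green x k i) - (\<sigma> i k)\<^sup>2 * (LINT x|ensemble. green x k k * green x i i))
    \<le> smax\<^sup>2 * (LINT x|ensemble. (cmod (green x k i))\<^sup>2) + 2 * g\<^sup>2 * smax * (\<sigma> i k)\<^sup>2 + (if k = i then g * smax\<^sup>2 else 0)"
    if k: "k < N" for k
  proof -
    let ?c = "(min i k, max i k)"
    let ?C = "2 * g\<^sup>2 * smax * (\<sigma> i k)\<^sup>2 + (if k = i then g * smax\<^sup>2 else 0)"
    have c: "?c \<in> coords" using i k by (auto simp: coords_def)
    note r1 = integral_resample[OF c hmat_green_integrable[OF i k]]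
    note r2 = integral_resample[OF c green_product_integrable[OF k k i i]]
    note r3 = integral_resample[OF c green_norm_sq_integrable[OF k i]]
    let ?I1 = "\<lambda>x. LINT y|\<nu> ?c. hmat (x(?c := y)) i k * green (x(?c := y)) k i"
    let ?I2 = "\<lambda>x. LINT y|\<nu> ?c. green (x(?c := y)) k k * green (x(?c := y)) i i"
    let ?I3 = "\<lambda>x. LINT y|\<nu> ?c. (cmod (green (x(?c := y)) k i))\<^sup>2"
    have i2: "integrable ensemble (\<lambda>x. complex_of_real ((\<sigma> i k)\<^sup>2) * ?I2 x)" using r2(2) by (rule integrable_mult_right)
    have eq: "(LINT x|ensemble. hmat x i k * green x k i) - (\<sigma> i k)\<^sup>2 * (LINT x|ensemble. green x k k * green x i i) =
        (LINT x|ensemble. ?I1 x - (\<sigma> i k)\<^sup>2 * ?I2 x)"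
      unfolding r1(1) r2(1) Bochner_Integration.integral_diff[OF r1(2) i2] integral_mult_right_zero ..
    have "cmod (LINT x|ensemble. ?I1 x - (\<sigma> i k)\<^sup>2 * ?I2 x) \<le> (LINT x|ensemble. cmod (?I1 x - (\<sigma> i k)\<^sup>2 * ?I2 x))" by (rule integral_norm_bound)
    also have "\<dots> \<le> (LINT x|ensemble. (\<sigma> i k)\<^sup>2 * ?I3 x + ?C)"
    proof (rule integral_mono)
      show "integrable ensemble (\<lambda>x. cmod (?I1 x - (\<sigma> i k)\<^sup>2 * ?I2 x))"
        by (rule integrable_norm[OF Bochner_Integration.integrable_diff[OF r1(2) i2]])
      show "integrable ensemble (\<lambda>x. (\<sigma> i k)\<^sup>2 * ?I3 x + ?C)"
        by (intro Bochner_Integration.integrable_add integrable_mult_right r3(2) ensemble.integrable_const)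
      fix x assume "x \<in> space ensemble"
      from resampled_entry[OF i k this]
      show "cmod (?I1 x - (\<sigma> i k)\<^sup>2 * ?I2 x) \<le> (\<sigma> i k)\<^sup>2 * ?I3 x + ?C" by (simp only: add.assoc)
    qed
    also have "\<dots> = (LINT x|ensemble. (\<sigma> i k)\<^sup>2 * ?I3 x) + ?C"
      by (subst Bochner_Integration.integral_add[OF integrable_mult_right[OF r3(2)] ensemble.integrable_const])
        (simp only: lebesgue_integral_const ensemble.prob_space scaleR_one)
    also have "\<dots> = (\<sigma> i k)\<^sup>2 * (LINT x|ensemble. (cmod (green x k i))\<^sup>2) + ?C"
      unfolding r3(1) integral_mult_right_zero ..
    also have "\<dots> \<le> smax\<^sup>2 * (LINT x|ensemble. (cmod (green x k i))\<^sup>2) + ?C"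
      by (intro add_right_mono mult_right_mono sigma_sq_le i k Bochner_Integration.integral_nonneg) simp
    finally show ?thesis unfolding eq by (simp only: add.assoc)
  qed
  have gd: "\<i> * of_real \<eta> * green x i i - 1 = (\<Sum>k<N. hmat x i k * green x k i)" for x
    using resolvent_right[OF hmat_hermitian eta_pos i i, of x, folded green_def] by (simp add: algebra_simps)
  have "\<i> * of_real \<eta> * (LINT x|ensemble. green x i i) - 1 = (LINT x|ensemble. \<i> * of_real \<eta> * green x i i - 1)"
    using green_integrable[OF i i] ensemble.prob_space by simp
  also have "\<dots> = (\<Sum>k<N. LINT x|ensemble. hmat x i k * green x k i)"
    unfolding gd using hmat_green_integrable[OF i] by (intro Bochner_Integration.integral_sum) auto
  finally have eq: "\<i> * of_real \<eta> * (LINT x|ensemble. green x i i) - 1 - (\<Sum>k<N. (\<sigma> i k)\<^sup>2 * (LINT x|ensemble. green x k k * green x i i)) =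
    (\<Sum>k<N. (LINT x|ensemble. hmat x i k * green x k i) - (\<sigma> i k)\<^sup>2 * (LINT x|ensemble. green x k k * green x i i))"
    by (simp only: sum_subtractf)
  have "cmod (\<Sum>k<N. (LINT x|ensemble. hmat x i k * green x k i) - (\<sigma> i k)\<^sup>2 * (LINT x|ensemble. green x k k * green x i i))
    \<le> (\<Sum>k<N. smax\<^sup>2 * (LINT x|ensemble. (cmod (green x k i))\<^sup>2) + 2 * g\<^sup>2 * smax * (\<sigma> i k)\<^sup>2 + (if k = i then g * smax\<^sup>2 else 0))"
    by (rule sum_norm_le) (use entry in auto)
  also have "\<dots> = smax\<^sup>2 * (\<Sum>k<N. LINT x|ensemble. (cmod (green x k i))\<^sup>2) + 2 * g\<^sup>2 * smax * (\<Sum>k<N. (\<sigma> i k)\<^sup>2) + g * smax\<^sup>2"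
    using i by (simp add: sum.distrib sum_distrib_left sum.delta)
  also have "(\<Sum>k<N. LINT x|ensemble. (cmod (green x k i))\<^sup>2) = (LINT x|ensemble. (\<Sum>k<N. (cmod (green x k i))\<^sup>2))"
    using green_norm_sq_integrable[OF _ i] by (subst Bochner_Integration.integral_sum) auto
  also have "smax\<^sup>2 * (LINT x|ensemble. (\<Sum>k<N. (cmod (green x k i))\<^sup>2)) + 2 * g\<^sup>2 * smax * (\<Sum>k<N. (\<sigma> i k)\<^sup>2) + g * smax\<^sup>2
    \<le> smax\<^sup>2 * (1 / 4) + 2 * g\<^sup>2 * smax * 1 + g * smax\<^sup>2"
  proof (intro add_mono mult_left_mono order_refl)
    have "integrable ensemble (\<lambda>x. \<Sum>k<N. (cmod (green x k i))\<^sup>2)" using green_norm_sq_integrable[OF _ i] by auto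
    then have "(LINT x|ensemble. (\<Sum>k<N. (cmod (green x k i))\<^sup>2)) \<le> (LINT x|ensemble. 1 / 4)"
      by (rule integral_mono) (use green_row_sum[OF i] in auto)
    then show "(LINT x|ensemble. (\<Sum>k<N. (cmod (green x k i))\<^sup>2)) \<le> 1 / 4" using ensemble.prob_space by simp
  qed (use sigma_row[OF i] smax_pos g_ge in auto)
  also have "\<dots> \<le> 4 * g\<^sup>2 * smax"
  proof -
    have s2: "smax\<^sup>2 \<le> smax" using smax1 smax_pos by (simp add: power2_eq_square mult_left_le)
    have gg: "1 \<le> g\<^sup>2" "g \<le> g\<^sup>2" using g_ge by (simp_all add: one_le_power self_le_power)
    have "smax\<^sup>2 * 1 \<le> smax * g\<^sup>2" using s2 gg smax_pos by (intro mult_mono) auto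
    moreover have "g * smax\<^sup>2 \<le> g\<^sup>2 * smax" using s2 gg g_ge by (intro mult_mono) auto
    moreover have "0 \<le> g\<^sup>2 * smax" using smax_pos by simp
    moreover have "smax * g\<^sup>2 = g\<^sup>2 * smax" by simp
    ultimately show ?thesis by linarith
  qed
  finally show ?thesis unfolding eq .
qed

text \<open>Replaces the mean of a product by the product of the means: outside the tail event the
  deviation of G_kk is below \<tau>, on it at most 1, and the other factor is at most 1/2.\<close>

lemma green_covariance_le:
  assumes k: "k < N" and i: "i < N"
    and tail: "measure ensemble {x \<in> space ensemble. \<tau> \<le> cmod (green x k k - (LINT x|ensemble. green x k k))} \<le> \<pi>"
    and \<tau>: "0 \<le> \<tau>"
  shows "cmod ((LINT x|ensemble. green x k k * green x i i) - (LINT x|ensemble. green x k k) * (LINT x|ensemble. green x i i)) \<le> (\<tau> + \<pi>) / 2"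
proof -
  let ?m = "LINT x|ensemble. green x k k"
  define E where "E = {x \<in> space ensemble. \<tau> \<le> cmod (green x k k - ?m)}"
  note [measurable] = green_measurable[OF k k]
  have E: "E \<in> sets ensemble" unfolding E_def by measurable
  have mb: "cmod ?m \<le> 1 / 2"
  proof -
    have "cmod ?m \<le> (LINT x|ensemble. cmod (green x k k))" by (rule integral_norm_bound)
    also have "\<dots> \<le> (LINT x|ensemble. 1 / 2)"
      using green_integrable[OF k k] by (intro integral_mono cmod_green_le k integrable_norm) auto
    finally show ?thesis using ensemble.prob_space by simp
  qed
  have pt: "cmod ((green x k k - ?m) * green x i i) \<le> \<tau> / 2 + indicat_real E x / 2" if x: "x \<in> space ensemble" for x
  proof -
    have a: "cmod (green x k k - ?m) \<le> 1"
      using norm_triangle_ineq4[of "green x k k" ?m] cmod_green_le[OF k k, of x] mb by linarith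
    have "cmod (green x k k - ?m) \<le> \<tau> + indicat_real E x"
      using a x \<tau> by (cases "x \<in> E") (auto simp: E_def)
    then have "cmod (green x k k - ?m) * cmod (green x i i) \<le> (\<tau> + indicat_real E x) * (1 / 2)"
      using \<tau> by (intro mult_mono cmod_green_le i) auto
    then show ?thesis by (simp add: norm_mult add_divide_distrib)
  qed
  have eq: "(LINT x|ensemble. green x k k * green x i i) - ?m * (LINT x|ensemble. green x i i) = (LINT x|ensemble. (green x k k - ?m) * green x i i)"
    using green_product_integrable[OF k k i i] green_integrable[OF i i] by (simp add: left_diff_distrib)
  have "cmod (LINT x|ensemble. (green x k k - ?m) * green x i i) \<le> (LINT x|ensemble. cmod ((green x k k - ?m) * green x i i))" by (rule integral_norm_bound)
  also have "\<dots> \<le> (LINT x|ensemble. \<tau> / 2 + indicat_real E x / 2)"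
  proof (rule integral_mono[OF _ _ pt])
    show "integrable ensemble (\<lambda>x. cmod ((green x k k - ?m) * green x i i))"
      using green_product_integrable[OF k k i i] green_integrable[OF i i] by (intro integrable_norm) (simp add: left_diff_distrib)
    show "integrable ensemble (\<lambda>x. \<tau> / 2 + indicat_real E x / 2)" using E by (auto simp: ensemble.emeasure_eq_measure)
  qed
  also have "\<dots> = \<tau> / 2 + measure ensemble E / 2"
    using E ensemble.prob_space by (subst Bochner_Integration.integral_add) (auto simp: ensemble.emeasure_eq_measure)
  also have "\<dots> \<le> (\<tau> + \<pi>) / 2" using tail by (simp add: E_def add_divide_distrib)
  finally show ?thesis unfolding eq .
qed

text \<open>
  The equation \<open>z m = 1 + m\<^sup>2\<close> is stable for \<open>z = \<i>\<eta>\<close>, \<open>\<eta> \<ge> 2\<close>, because \<open>\<bar>m\<bar>\<close> and the diagonal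
  resolvent entries are both at most \<open>1/2\<close>.
\<close>

theorem expected_green_diagonal:
  fixes \<kappa> :: real
  assumes i: "i < N" and smax1: "smax \<le> 1" and \<tau>: "0 \<le> \<tau>"
    and tail: "\<And>k. k < N \<Longrightarrow> measure ensemble {x \<in> space ensemble. \<tau> \<le> cmod (green x k k - (LINT x|ensemble. green x k k))} \<le> \<pi>"
    and \<kappa>: "0 < \<kappa>" "\<eta> = 1 / \<kappa> - \<kappa>"
  shows "cmod ((LINT x|ensemble. green x i i) - (- \<i> * of_real \<kappa>)) \<le> 4 * g\<^sup>2 * smax + (\<tau> + \<pi>) / 2"
proof -
  define m where "m = - \<i> * complex_of_real \<kappa>"
  define h where "h k = (LINT x|ensemble. green x k k)" for k
  define e where "e = 4 * g\<^sup>2 * smax + (\<tau> + \<pi>) / 2"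
  let ?z = "\<i> * complex_of_real \<eta>"
  have zm: "?z * m = 1 + m * m"
    using \<kappa>(1) by (simp add: m_def \<kappa>(2) algebra_simps flip: of_real_mult)
  have mle: "cmod m \<le> 1 / 2"
  proof -
    have "2 * \<kappa> \<le> \<eta> * \<kappa>" using eta_ge \<kappa>(1) by (intro mult_right_mono) auto
    also have "\<eta> * \<kappa> = 1 - \<kappa> * \<kappa>" using \<kappa>(1) by (simp add: \<kappa>(2) algebra_simps)
    finally have "2 * \<kappa> \<le> 1" using zero_le_square[of \<kappa>] by linarith
    then show ?thesis using \<kappa>(1) by (simp add: m_def norm_mult)
  qed
  have hle: "cmod (h k) \<le> 1 / 2" if k: "k < N" for k
  proof -
    have "cmod (h k) \<le> (LINT x|ensemble. cmod (green x k k))" unfolding h_def by (rule integral_norm_bound)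
    also have "\<dots> \<le> (LINT x|ensemble. 1 / 2)"
      using green_integrable[OF k k] by (intro integral_mono cmod_green_le k integrable_norm) auto
    finally show ?thesis using ensemble.prob_space by simp
  qed
  \<comment> \<open>The largest deviation d over all diagonal entries satisfies \<eta> d <= e + d:
    the quadratic term has Lipschitz constant 1/2 in each factor and the rows of \<sigma>^2 sum to
    1. As \<eta> >= 2, it follows that d <= e.\<close>
  define d where "d = Max ((\<lambda>k. cmod (h k - m)) ` {..<N})"
  have dge: "cmod (h k - m) \<le> d" if "k < N" for k unfolding d_def using that by (intro Max_ge) auto
  have d0: "0 \<le> d" using dge[OF N_pos] norm_ge_zero order.trans by blast
  have step: "\<eta> * cmod (h k - m) \<le> e + d" if k: "k < N" for k
  proof -
    let ?P = "\<lambda>l. LINT x|ensemble. green x l l * green x k k"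
    let ?S = "\<lambda>l. complex_of_real ((\<sigma> k l)\<^sup>2)"
    have row: "(\<Sum>l<N. ?S l) = 1" using sigma_row[OF k] by (simp only: of_real_sum[symmetric]) simp
    have w: "(\<Sum>l<N. (\<sigma> k l)\<^sup>2 * c) = c" for c using sigma_row[OF k] by (simp add: sum_distrib_right[symmetric])
    have "?z * (h k - m) = (?z * h k - 1 - (\<Sum>l<N. ?S l * ?P l)) + ((\<Sum>l<N. ?S l * ?P l) - (\<Sum>l<N. ?S l * (m * m)))"
    proof -
      have "(\<Sum>l<N. ?S l * (m * m)) = m * m" by (simp only: sum_distrib_right[symmetric] row mult_1_left)
      then show ?thesis using zm by (simp add: algebra_simps)
    qed
    also have "(\<Sum>l<N. ?S l * ?P l) - (\<Sum>l<N. ?S l * (m * m)) = (\<Sum>l<N. ?S l * (?P l - h l * h k)) + (\<Sum>l<N. ?S l * (h l * h k - m * m))"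
      by (simp only: sum_subtractf[symmetric] sum.distrib[symmetric] right_diff_distrib) simp
    finally have eq: "?z * (h k - m) = (?z * h k - 1 - (\<Sum>l<N. ?S l * ?P l)) + ((\<Sum>l<N. ?S l * (?P l - h l * h k)) + (\<Sum>l<N. ?S l * (h l * h k - m * m)))" .
    have b1: "cmod (?z * h k - 1 - (\<Sum>l<N. ?S l * ?P l)) \<le> 4 * g\<^sup>2 * smax"
      using self_consistent_equation[OF k smax1] by (simp only: h_def)
    have b2: "cmod (\<Sum>l<N. ?S l * (?P l - h l * h k)) \<le> (\<Sum>l<N. (\<sigma> k l)\<^sup>2 * ((\<tau> + \<pi>) / 2))"
    proof (rule sum_norm_le)
      fix l assume "l \<in> {..<N}"
      then have "cmod (?P l - h l * h k) \<le> (\<tau> + \<pi>) / 2" unfolding h_def by (intro green_covariance_le k tail \<tau>) auto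
      then show "norm (?S l * (?P l - h l * h k)) \<le> (\<sigma> k l)\<^sup>2 * ((\<tau> + \<pi>) / 2)"
        unfolding norm_mult norm_of_real by (intro mult_mono) auto
    qed
    have b3: "cmod (\<Sum>l<N. ?S l * (h l * h k - m * m)) \<le> (\<Sum>l<N. (\<sigma> k l)\<^sup>2 * d)"
    proof (rule sum_norm_le)
      fix l assume "l \<in> {..<N}"
      then have l: "l < N" by simp
      have "h l * h k - m * m = (h l - m) * h k + m * (h k - m)" by (simp add: algebra_simps)
      then have "cmod (h l * h k - m * m) \<le> cmod (h l - m) * cmod (h k) + cmod m * cmod (h k - m)"
        using norm_triangle_ineq[of "(h l - m) * h k" "m * (h k - m)"] by (simp only: norm_mult)
      also have "\<dots> \<le> d * (1 / 2) + 1 / 2 * d"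
        using d0 by (intro add_mono mult_mono dge hle mle k l) auto
      finally have "cmod (h l * h k - m * m) \<le> d" by simp
      then show "norm (?S l * (h l * h k - m * m)) \<le> (\<sigma> k l)\<^sup>2 * d"
        unfolding norm_mult norm_of_real by (intro mult_mono) auto
    qed
    have "cmod (?z * (h k - m)) \<le> 4 * g\<^sup>2 * smax + ((\<tau> + \<pi>) / 2 + d)"
      unfolding eq using b1 b2 b3 unfolding w by (intro norm_triangle_mono) auto
    then show ?thesis using eta_pos by (simp add: norm_mult e_def)
  qed
  have "d \<in> (\<lambda>k. cmod (h k - m)) ` {..<N}" unfolding d_def using N_pos by (intro Max_in) auto
  then obtain k where k: "k < N" "d = cmod (h k - m)" by auto
  have "2 * d \<le> \<eta> * d" using eta_ge d0 by (intro mult_right_mono) auto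
  also have "\<dots> \<le> e + d" using step[OF k(1)] k(2) by simp
  finally have "d \<le> e" by simp
  then show ?thesis using dge[OF i] unfolding h_def m_def e_def by linarith
qed

text \<open>The mean of the form is diagonal, with entries close to m, so Cauchy-Schwarz bounds its
  distance from m times the sum of u_i v_i without any dimension factor.\<close>

theorem form_deviation:
  fixes \<kappa> t :: real
  assumes u: "norm_sq N u \<le> 1" and v: "norm_sq N v \<le> 1" and small: "16 * g * smax\<^sup>2 \<le> 1"
    and t: "0 < t" "t \<le> 2000" and \<kappa>: "0 < \<kappa>" "\<eta> = 1 / \<kappa> - \<kappa>"
  defines "\<pi> \<equiv> 4 * exp (- t\<^sup>2 / (8 * variance_proxy))"
  shows "measure ensemble {x \<in> space ensemble. 3 * t + 4 * g\<^sup>2 * smax + \<pi> \<le>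
     cmod (bilinear_form N u (green x) v - (- \<i> * of_real \<kappa>) * (\<Sum>i<N. u i * v i))} \<le> \<pi>"
proof -
  define m where "m = - \<i> * complex_of_real \<kappa>"
  let ?Z = "\<lambda>x. bilinear_form N u (green x) v"
  let ?E = "LINT x|ensemble. ?Z x"
  define h where "h i = (LINT x|ensemble. green x i i)" for i
  \<comment> \<open>The diagonal tails at level 2 t contribute t + \<pi> / 2 to the error of the
    mean. Adding the fluctuation 2 t of the form itself explains the threshold 3 t.\<close>
  define e where "e = 4 * g\<^sup>2 * smax + (2 * t + \<pi>) / 2"
  have p0: "0 \<le> \<pi>" by (simp add: \<pi>_def)
  have smax1: "smax \<le> 1"
  proof (rule power2_le_imp_le)
    have "1 * smax\<^sup>2 \<le> g * smax\<^sup>2" using g_ge by (intro mult_right_mono) auto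
    then show "smax\<^sup>2 \<le> 1\<^sup>2" using small by simp
  qed simp
  have hm: "cmod (h i - m) \<le> e" if i: "i < N" for i
    unfolding h_def m_def e_def
  proof (rule expected_green_diagonal[OF i smax1 _ _ \<kappa>])
    fix k assume k: "k < N"
    let ?\<delta> = "\<lambda>l. if l = k then 1 else (0 :: complex)"
    have "norm_sq N ?\<delta> \<le> 1" by (simp only: norm_sq_delta[OF k])
    from form_tail[OF this this small t]
    show "measure ensemble {x \<in> space ensemble. 2 * t \<le> cmod (green x k k - (LINT x|ensemble. green x k k))} \<le> \<pi>"
      unfolding bilinear_form_delta_left[OF k] col_form_delta[OF k] \<pi>_def .
  qed (use t in simp)
  have e0: "0 \<le> e" using hm[OF N_pos] norm_ge_zero order.trans by blast
  have ii: "integrable ensemble (\<lambda>x. u i * green x i j * v j)" if "i < N" "j < N" for i j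
    using green_integrable[OF that] by simp
  have "?E = (\<Sum>i<N. (LINT x|ensemble. (\<Sum>j<N. u i * green x i j * v j)))"
    unfolding bilinear_form_def
    by (rule Bochner_Integration.integral_sum) (auto intro!: Bochner_Integration.integrable_sum ii)
  also have "\<dots> = (\<Sum>i<N. \<Sum>j<N. LINT x|ensemble. u i * green x i j * v j)"
    by (intro sum.cong refl Bochner_Integration.integral_sum ii) auto
  also have "\<dots> = (\<Sum>i<N. \<Sum>j<N. u i * (LINT x|ensemble. green x i j) * v j)" by simp
  also have "\<dots> = (\<Sum>i<N. \<Sum>j<N. u i * (h i * v i) * (if j = i then 1 else 0))"
    using integral_green_off_diagonal by (intro sum.cong refl) (auto simp: h_def)
  also have "\<dots> = (\<Sum>i<N. u i * (h i * v i))" by (intro sum.cong refl sum_mult_delta(1)) auto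
  finally have E: "?E - m * (\<Sum>i<N. u i * v i) = (\<Sum>i<N. u i * ((h i - m) * v i))"
    by (simp add: sum_distrib_left sum_subtractf algebra_simps)
  have "(cmod (\<Sum>i<N. u i * ((h i - m) * v i)))\<^sup>2 \<le> norm_sq N u * norm_sq N (\<lambda>i. (h i - m) * v i)"
    using cmod_sum_mult_le[of u "\<lambda>i. (h i - m) * v i" "{..<N}"] by (simp only: norm_sq_def)
  also have "\<dots> \<le> 1 * (e\<^sup>2 * norm_sq N v)"
  proof (intro mult_mono u)
    show "norm_sq N (\<lambda>i. (h i - m) * v i) \<le> e\<^sup>2 * norm_sq N v"
      unfolding norm_sq_def sum_distrib_left norm_mult power_mult_distrib
      by (intro sum_mono mult_right_mono power_mono hm) auto
  qed auto
  also have "\<dots> \<le> 1 * (e\<^sup>2 * 1)" by (intro mult_left_mono v) auto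
  finally have "(cmod (\<Sum>i<N. u i * ((h i - m) * v i)))\<^sup>2 \<le> e\<^sup>2" by simp
  then have Em: "cmod (?E - m * (\<Sum>i<N. u i * v i)) \<le> e" unfolding E using e0 by (rule power2_le_imp_le)
  note [measurable] = form_measurable[OF u v]
  have "measure ensemble {x \<in> space ensemble. 3 * t + 4 * g\<^sup>2 * smax + \<pi> \<le> cmod (?Z x - m * (\<Sum>i<N. u i * v i))} \<le>
    measure ensemble {x \<in> space ensemble. 2 * t \<le> cmod (?Z x - ?E)}"
  proof (rule ensemble.finite_measure_mono)
    show "{x \<in> space ensemble. 2 * t \<le> cmod (?Z x - ?E)} \<in> sets ensemble" by measurable
    have "2 * t \<le> cmod (?Z x - ?E)" if "3 * t + 4 * g\<^sup>2 * smax + \<pi> \<le> cmod (?Z x - m * (\<Sum>i<N. u i * v i))" for x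
    proof -
      have "2 * t \<le> C" if "3 * t + s + \<pi> \<le> A" "B \<le> s + (2 * t + \<pi>) / 2" "A \<le> C + B" for A B C s :: real
        using that p0 by (simp add: field_simps)
      from this[OF that Em[unfolded e_def] dist_triangle[of "?Z x" "m * (\<Sum>i<N. u i * v i)" ?E, unfolded dist_norm]]
      show ?thesis .
    qed
    then show "{x \<in> space ensemble. 3 * t + 4 * g\<^sup>2 * smax + \<pi> \<le> cmod (?Z x - m * (\<Sum>i<N. u i * v i))} \<subseteq>
      {x \<in> space ensemble. 2 * t \<le> cmod (?Z x - ?E)}" by blast
  qed
  also have "\<dots> \<le> \<pi>" unfolding \<pi>_def by (rule form_tail[OF u v small t])
  finally show ?thesis by (simp only: m_def)
qed

end

section \<open>Almost sure convergence\<close>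

text \<open>An almost sure statement may use only countably many \<eta>. The transforms of
  probability measures are uniformly Lipschitz in \<eta>, so rational points suffice. The finitely
  many n at which no distribution is guaranteed are overwritten by \<nu>.\<close>

lemma weak_conv_of_rational_stieltjes:
  fixes \<mu> :: "nat \<Rightarrow> real measure" and \<nu> :: "real measure"
  assumes ev: "\<forall>\<^sub>F n in sequentially. real_distribution (\<mu> n)" and \<nu>: "real_distribution \<nu>"
    and S: "\<And>\<eta>. \<eta> \<in> \<rat> \<Longrightarrow> \<eta> > 2 \<Longrightarrow> (\<lambda>n. LINT x|\<mu> n. stieltjes_kernel \<eta> x) \<longlonglongrightarrow> (LINT x|\<nu>. stieltjes_kernel \<eta> x)"
  shows "weak_conv_m \<mu> \<nu>"
proof -
  define \<mu>' where "\<mu>' n = (if real_distribution (\<mu> n) then \<mu> n else \<nu>)" for n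
  have rd: "real_distribution (\<mu>' n)" for n using \<nu> by (simp add: \<mu>'_def)
  have ev': "\<forall>\<^sub>F n in sequentially. \<mu>' n = \<mu> n" using ev by eventually_elim (simp add: \<mu>'_def)
  have lip: "dist (LINT x|\<rho>. stieltjes_kernel \<eta> x) (LINT x|\<rho>. stieltjes_kernel \<theta> x) \<le> \<bar>\<theta> - \<eta>\<bar>"
    if "real_distribution \<rho>" "2 < \<eta>" "2 < \<theta>" for \<rho> and \<eta> \<theta> :: real
  proof -
    interpret real_distribution \<rho> by fact
    have i: "integrable \<rho> (stieltjes_kernel \<zeta>)" if "2 < \<zeta>" for \<zeta>
      by (rule integrable_of_bound[OF _ norm_stieltjes_kernel_le]) (use that in auto)
    have "(LINT x|\<rho>. stieltjes_kernel \<eta> x) - (LINT x|\<rho>. stieltjes_kernel \<theta> x) = (LINT x|\<rho>. stieltjes_kernel \<eta> x - stieltjes_kernel \<theta> x)"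
      using i that by simp
    then have "dist (LINT x|\<rho>. stieltjes_kernel \<eta> x) (LINT x|\<rho>. stieltjes_kernel \<theta> x) \<le> (LINT x|\<rho>. norm (stieltjes_kernel \<eta> x - stieltjes_kernel \<theta> x))"
      unfolding dist_norm by (simp only: integral_norm_bound)
    also have "\<dots> \<le> (LINT x|\<rho>. \<bar>\<theta> - \<eta>\<bar>)"
      using i that by (intro integral_mono norm_stieltjes_kernel_diff_le integrable_norm Bochner_Integration.integrable_diff) auto
    finally show ?thesis using prob_space by simp
  qed
  have "weak_conv_m \<mu>' \<nu>"
  proof (rule weak_conv_of_stieltjes[OF rd \<nu>])
    fix \<eta> :: real assume \<eta>: "2 < \<eta>"
    show "(\<lambda>n. LINT x|\<mu>' n. stieltjes_kernel \<eta> x) \<longlonglongrightarrow> (LINT x|\<nu>. stieltjes_kernel \<eta> x)"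
    proof (rule metric_LIMSEQ_I)
      fix e :: real assume e: "0 < e"
      obtain \<theta> where \<theta>: "\<theta> \<in> \<rat>" "\<eta> < \<theta>" "\<theta> < \<eta> + e / 4"
        using Rats_dense_in_real[of \<eta> "\<eta> + e / 4"] e by auto
      have "(\<lambda>n. LINT x|\<mu>' n. stieltjes_kernel \<theta> x) \<longlonglongrightarrow> (LINT x|\<nu>. stieltjes_kernel \<theta> x)"
        using S[OF \<theta>(1)] \<theta>(2) \<eta> by (subst tendsto_cong[OF eventually_mono[OF ev']]) auto
      then obtain n0 where n0: "\<And>n. n0 \<le> n \<Longrightarrow> dist (LINT x|\<mu>' n. stieltjes_kernel \<theta> x) (LINT x|\<nu>. stieltjes_kernel \<theta> x) < e / 4"
        using metric_LIMSEQ_D[of _ _ "e / 4"] e by (metis zero_less_divide_iff zero_less_numeral)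
      have "dist (LINT x|\<mu>' n. stieltjes_kernel \<eta> x) (LINT x|\<nu>. stieltjes_kernel \<eta> x) < e" if n: "n0 \<le> n" for n
      proof -
        let ?a = "LINT x|\<mu>' n. stieltjes_kernel \<eta> x" and ?b = "LINT x|\<mu>' n. stieltjes_kernel \<theta> x"
          and ?c = "LINT x|\<nu>. stieltjes_kernel \<theta> x" and ?d = "LINT x|\<nu>. stieltjes_kernel \<eta> x"
        have "dist ?a ?b < e / 4" using lip[OF rd[of n] \<eta>, of \<theta>] \<theta> \<eta> by linarith
        moreover have "dist ?c ?d < e / 4" using lip[OF \<nu> _ \<eta>, of \<theta>] \<theta> \<eta> by linarith
        ultimately show ?thesis
          using n0[OF n] dist_triangle[of ?a ?d ?b] dist_triangle[of ?b ?d ?c] e by linarith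
      qed
      then show "\<exists>no. \<forall>n\<ge>no. dist (LINT x|\<mu>' n. stieltjes_kernel \<eta> x) (LINT x|\<nu>. stieltjes_kernel \<eta> x) < e" by blast
    qed
  qed
  moreover have "(\<lambda>n. cdf (\<mu>' n) x) \<longlonglongrightarrow> l \<longleftrightarrow> (\<lambda>n. cdf (\<mu> n) x) \<longlonglongrightarrow> l" for x l
    by (rule tendsto_cong) (use ev' in \<open>eventually_elim; simp\<close>)
  ultimately show ?thesis unfolding weak_conv_m_def weak_conv_def by simp
qed

section \<open>From the random matrices to the product ensemble\<close>

lemma has_symmetry_hermitian:
  assumes "has_symmetry \<beta> A" "A \<in> carrier_mat N N"
  shows "hermitian_on N (\<lambda>i j. A $$ (i, j))"
  unfolding hermitian_on_def
proof (intro allI impI)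
  fix i j assume ij: "i < N" "j < N"
  show "A $$ (j, i) = cnj (A $$ (i, j))"
  proof (cases \<beta>)
    case Real_Symmetric
    then have t: "transpose_mat A = A" and r: "elements_mat A \<subseteq> \<real>" using assms(1) by auto
    have "A $$ (i, j) \<in> \<real>" using r assms(2) ij by blast
    moreover have "transpose_mat A $$ (j, i) = A $$ (i, j)" using assms(2) ij by simp
    ultimately show ?thesis unfolding t by (simp add: Reals_cnj_iff)
  next
    case Complex_Hermitian
    then have t: "mat_adjoint A = A" using assms(1) by auto
    have "mat_adjoint A $$ (j, i) = cnj (A $$ (i, j))"
      using assms(2) ij by (simp add: mat_adjoint_def mat_of_rows_def)
    then show ?thesis unfolding t .
  qed
qed

lemma resolvent_cong:
  assumes "\<And>i j. i < N \<Longrightarrow> j < N \<Longrightarrow> H i j = H' i j"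
  shows "resolvent N z H = resolvent N z H'"
proof -
  have "shifted_matrix N z H = shifted_matrix N z H'"
    unfolding shifted_matrix_def using assms by (intro eq_matI) auto
  then show ?thesis by (simp add: resolvent_def fun_eq_iff)
qed

lemma max_entry_ge:
  assumes "S \<in> carrier_mat N N" "i < N" "j < N"
  shows "S $$ (i, j) \<le> max_entry S"
proof -
  have "finite (elements_mat S)" by (simp add: elements_mat_def)
  then show ?thesis unfolding max_entry_def by (rule Max_ge[OF _ elements_matI[OF assms refl]])
qed

text \<open>The point mass at 0 outside the upper triangle is symmetric and sub-Gaussian, so the
  requirements of \<open>profile_model\<close> hold at every index.\<close>

definition entry_law :: "'w measure \<Rightarrow> nat \<Rightarrow> ('w \<Rightarrow> complex Matrix.mat) \<Rightarrow> nat \<times> nat \<Rightarrow> complex measure" where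
  "entry_law M N W k = (if fst k \<le> snd k \<and> snd k < N then distr M borel (\<lambda>\<omega>. W \<omega> $$ k) else return borel 0)"

locale wigner_matrix = prob_space M for M :: "'w measure" +
  fixes \<beta> :: symmetry_class and \<gamma> :: real and N :: nat and W :: "'w \<Rightarrow> complex Matrix.mat" and S :: "real Matrix.mat"
  assumes \<gamma>: "0 < \<gamma>" and N: "1 \<le> N" and W: "sub_gaussian_wigner \<beta> \<gamma> M N W" and S: "variance_profile N S"
begin

abbreviation "\<nu> \<equiv> entry_law M N W"
text \<open>The 2 covers the diagonal variance of the real case, and a base above 1 turns the given
  power k - 1 into the power k used in \<open>subgaussian_law\<close>.\<close>

abbreviation "moment_const \<equiv> max \<gamma> 2"

lemma W_carrier: "\<omega> \<in> space M \<Longrightarrow> W \<omega> \<in> carrier_mat N N"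
  and W_symmetry: "\<omega> \<in> space M \<Longrightarrow> has_symmetry \<beta> (W \<omega>)"
  using W by (auto simp: sub_gaussian_wigner_def)

lemma W_hermitian: "\<omega> \<in> space M \<Longrightarrow> hermitian_on N (\<lambda>i j. W \<omega> $$ (i, j))"
  by (rule has_symmetry_hermitian[OF W_symmetry W_carrier])

lemma indep: "indep_vars (\<lambda>_. borel) (\<lambda>k \<omega>. W \<omega> $$ k) {(i, j). i \<le> j \<and> j < N}"
  using W by (simp add: sub_gaussian_wigner_def case_prod_beta')

lemma entry_measurable: "i \<le> j \<Longrightarrow> j < N \<Longrightarrow> (\<lambda>\<omega>. W \<omega> $$ (i, j)) \<in> borel_measurable M"
  using indep unfolding indep_vars_def2 by auto

lemma entry_law_eq: "i \<le> j \<Longrightarrow> j < N \<Longrightarrow> \<nu> (i, j) = distr M borel (\<lambda>\<omega>. W \<omega> $$ (i, j))"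
  by (simp add: entry_law_def)

text \<open>Several variances are prescribed for the square of an entry and not for its squared
  modulus; the two agree where the entry is real.\<close>

lemma entry_second_moment:
  assumes ij: "i \<le> j" "j < N"
  shows "(LINT \<omega>|M. (cmod (W \<omega> $$ (i, j)))\<^sup>2) = (if i = j \<and> \<beta> = Real_Symmetric then 2 else 1)"
proof -
  have real: "(LINT \<omega>|M. (cmod (W \<omega> $$ (i, j)))\<^sup>2) = Re (LINT \<omega>|M. (W \<omega> $$ (i, j))\<^sup>2)"
    if "\<And>\<omega>. \<omega> \<in> space M \<Longrightarrow> W \<omega> $$ (i, j) \<in> \<real>"
  proof -
    have "(W \<omega> $$ (i, j))\<^sup>2 = of_real ((cmod (W \<omega> $$ (i, j)))\<^sup>2)" if "\<omega> \<in> space M" for \<omega>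
      using \<open>\<And>\<omega>. \<omega> \<in> space M \<Longrightarrow> W \<omega> $$ (i, j) \<in> \<real>\<close>[OF that] by (elim Reals_cases) (simp add: power2_eq_square flip: of_real_mult)
    then have "(LINT \<omega>|M. (W \<omega> $$ (i, j))\<^sup>2) = (LINT \<omega>|M. complex_of_real ((cmod (W \<omega> $$ (i, j)))\<^sup>2))"
      by (intro Bochner_Integration.integral_cong) auto
    then show ?thesis by (simp only: integral_complex_of_real Re_complex_of_real)
  qed
  have v: "entry_variances \<beta> M N W" using W by (simp add: sub_gaussian_wigner_def)
  show ?thesis
  proof (cases \<beta>)
    case Real_Symmetric
    have "W \<omega> $$ (i, j) \<in> \<real>" if "\<omega> \<in> space M" for \<omega>
    proof -
      have "elements_mat (W \<omega>) \<subseteq> \<real>" using W_symmetry[OF that] Real_Symmetric by simp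
      then show ?thesis using W_carrier[OF that] ij by (meson elements_matI le_less_trans subsetD)
    qed
    note real[OF this]
    moreover have "(LINT \<omega>|M. (W \<omega> $$ (i, j))\<^sup>2) = (if i = j then 2 else 1)" using v Real_Symmetric ij by auto
    ultimately show ?thesis using Real_Symmetric by simp
  next
    case Complex_Hermitian
    show ?thesis
    proof (cases "i = j")
      case True
      have "W \<omega> $$ (i, j) \<in> \<real>" if "\<omega> \<in> space M" for \<omega>
        using hermitian_onD[OF W_hermitian[OF that], of j j] ij True by (simp add: Reals_cnj_iff)
      note real[OF this]
      moreover have "(LINT \<omega>|M. (W \<omega> $$ (i, j))\<^sup>2) = 1" using v Complex_Hermitian ij True by auto
      ultimately show ?thesis using Complex_Hermitian by simp
    next
      case False
      then show ?thesis using v Complex_Hermitian ij by auto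
    qed
  qed
qed

lemma entry_subgaussian: "subgaussian_law (\<nu> k) moment_const"
proof (cases "fst k \<le> snd k \<and> snd k < N")
  case False
  then have e: "\<nu> k = return borel 0" unfolding entry_law_def by (rule if_not_P)
  have 1: "1 \<le> moment_const ^ p * odd_double_factorial p" for p
  proof -
    have "1 \<le> odd_double_factorial p" by (induction p) (auto simp: odd_double_factorial_Suc intro!: mult_ge1_I)
    then show ?thesis by (intro mult_ge1_I one_le_power) auto
  qed
  have R: "prob_space (return borel (0 :: complex))" by (rule prob_space_return) simp
  show ?thesis unfolding e
  proof (rule subgaussian_law.intro[OF R subgaussian_law_axioms.intro])
    fix p
    show "integrable (return borel (0 :: complex)) (\<lambda>w. cmod w ^ (2 * p))"
      by (rule finite_measure.integrable_const_bound[OF prob_space.finite_measure[OF R], where B = "cmod 0 ^ (2 * p)"])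
        (simp_all add: AE_return)
    have "(LINT w|return borel (0 :: complex). cmod w ^ (2 * p)) = cmod 0 ^ (2 * p)" by (rule integral_return) auto
    also have "\<dots> \<le> 1" by (cases p) auto
    finally show "(LINT w|return borel (0 :: complex). cmod w ^ (2 * p)) \<le> moment_const ^ p * odd_double_factorial p"
      using 1[of p] by linarith
  qed auto
next
  case True
  then obtain i j where k: "k = (i, j)" and ij: "i \<le> j" "j < N" by (cases k) auto
  have e: "\<nu> k = distr M borel (\<lambda>\<omega>. W \<omega> $$ (i, j))" unfolding k by (rule entry_law_eq[OF ij])
  note m [measurable] = entry_measurable[OF ij]
  have D: "prob_space (distr M borel (\<lambda>\<omega>. W \<omega> $$ (i, j)))" by (rule prob_space_distr[OF m])
  have mom: "integrable M (\<lambda>\<omega>. cmod (W \<omega> $$ (i, j)) ^ (2 * p)) \<and>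
      (LINT \<omega>|M. cmod (W \<omega> $$ (i, j)) ^ (2 * p)) \<le> \<gamma> ^ (p - 1) * odd_double_factorial p" if "2 \<le> p" for p
    using W that ij by (auto simp: sub_gaussian_wigner_def)
  \<comment> \<open>The moment assumption starts at k = 2, so integrability for p = 1 is drawn from
    the fourth moment.\<close>
  have i2: "integrable M (\<lambda>\<omega>. (cmod (W \<omega> $$ (i, j)))\<^sup>2)"
  proof (rule Bochner_Integration.integrable_bound)
    show "integrable M (\<lambda>\<omega>. 1 + cmod (W \<omega> $$ (i, j)) ^ 4)" using mom[of 2] by simp
    have "t\<^sup>2 \<le> 1 + t ^ 4" for t :: real
    proof -
      have "2 * t\<^sup>2 \<le> 1 + t ^ 4" using zero_le_power2[of "t\<^sup>2 - 1"] by (simp add: power2_diff flip: power_mult)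
      then show ?thesis using zero_le_power2[of t] by linarith
    qed
    then show "AE \<omega> in M. norm ((cmod (W \<omega> $$ (i, j)))\<^sup>2) \<le> norm (1 + cmod (W \<omega> $$ (i, j)) ^ 4)" by (intro AE_I2) simp
  qed measurable
  have all: "integrable M (\<lambda>\<omega>. cmod (W \<omega> $$ (i, j)) ^ (2 * p)) \<and>
      (LINT \<omega>|M. cmod (W \<omega> $$ (i, j)) ^ (2 * p)) \<le> moment_const ^ p * odd_double_factorial p" for p
  proof -
    consider "p = 0" | "p = 1" | "2 \<le> p" by linarith
    then show ?thesis
    proof cases
      case 1
      then show ?thesis using prob_space by simp
    next
      case 2
      then show ?thesis using i2 entry_second_moment[OF ij] by (auto simp: odd_double_factorial_def max_def)
    next
      case 3
      have "\<gamma> ^ (p - 1) \<le> moment_const ^ (p - 1)" using \<gamma> by (intro power_mono) auto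
      also have "\<dots> \<le> moment_const ^ p" by (intro power_increasing) auto
      finally have "\<gamma> ^ (p - 1) * odd_double_factorial p \<le> moment_const ^ p * odd_double_factorial p"
        using odd_double_factorial_pos[of p] by (intro mult_right_mono) auto
      then show ?thesis using mom[OF 3] by linarith
    qed
  qed
  show ?thesis unfolding e
  proof (rule subgaussian_law.intro[OF D subgaussian_law_axioms.intro])
    fix p
    show "integrable (distr M borel (\<lambda>\<omega>. W \<omega> $$ (i, j))) (\<lambda>w. cmod w ^ (2 * p))"
      using all[of p] by (subst integrable_distr_eq) auto
    show "(LINT w|distr M borel (\<lambda>\<omega>. W \<omega> $$ (i, j)). cmod w ^ (2 * p)) \<le> moment_const ^ p * odd_double_factorial p"
      using all[of p] by (subst integral_distr) auto
  qed auto
qed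

lemma entry_law_symmetric: "distr (\<nu> k) borel (\<lambda>w. - w) = \<nu> k"
proof (cases "fst k \<le> snd k \<and> snd k < N")
  case False
  then have "\<nu> k = return borel 0" unfolding entry_law_def by (rule if_not_P)
  then show ?thesis by (simp add: distr_return)
next
  case True
  then obtain i j where k: "k = (i, j)" and ij: "i \<le> j" "j < N" by (cases k) auto
  have "symmetrically_distributed M (\<lambda>\<omega>. W \<omega> $$ (i, j))" using W ij by (simp add: sub_gaussian_wigner_def)
  then show ?thesis
    unfolding k entry_law_eq[OF ij] symmetrically_distributed_def
    using entry_measurable[OF ij] by (subst distr_distr) (auto simp: comp_def)
qed

lemma profile_model: "2 \<le> \<eta> \<Longrightarrow> profile_model N (\<lambda>i j. S $$ (i, j)) \<nu> moment_const (max_entry S) \<eta>"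
proof (rule profile_model.intro)
  have S': "S \<in> carrier_mat N N" "transpose_mat S = S" using S by (simp_all only: variance_profile_def)
  show "S $$ (j, i) = S $$ (i, j)" if "i < N" "j < N" for i j
  proof -
    have "transpose_mat S $$ (j, i) = S $$ (i, j)" using S'(1) that by simp
    then show ?thesis unfolding S'(2) .
  qed
  show "S $$ (i, j) \<le> max_entry S" if "i < N" "j < N" for i j by (rule max_entry_ge[OF S'(1) that])
  show "0 \<le> S $$ (i, j)" if "i < N" "j < N" for i j using S that by (simp add: variance_profile_def)
  show "(\<Sum>j<N. (S $$ (i, j))\<^sup>2) = 1" if "i < N" for i using S that by (simp add: variance_profile_def)
  show "subgaussian_law (\<nu> k) moment_const" for k by (rule entry_subgaussian)
  show "distr (\<nu> k) borel (\<lambda>w. - w) = \<nu> k" for k by (rule entry_law_symmetric)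
  show "(LINT w|\<nu> (i, j). (cmod w)\<^sup>2) = 1" if "i < j" "j < N" for i j
  proof -
    have ij: "i \<le> j" using that by simp
    have "(LINT w|\<nu> (i, j). (cmod w)\<^sup>2) = (LINT \<omega>|M. (cmod (W \<omega> $$ (i, j)))\<^sup>2)"
      unfolding entry_law_eq[OF ij that(2)] by (rule integral_distr[OF entry_measurable[OF ij that(2)]]) measurable
    then show ?thesis using entry_second_moment[OF ij that(2)] that by simp
  qed
qed (use N in auto)

text \<open>By independence the upper triangle of W has the product law \<open>ensemble\<close>.
  Hermitian symmetry recovers the rest of W from it, so D is a function of the ensemble point and
  inherits the tail bound.\<close>

lemma form_deviation_W:
  fixes \<kappa> \<eta> t :: real
  assumes u: "norm_sq N u \<le> 1" and v: "norm_sq N v \<le> 1" and small: "16 * moment_const * (max_entry S)\<^sup>2 \<le> 1"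
    and t: "0 < t" "t \<le> 2000" and \<kappa>: "0 < \<kappa>" "\<eta> = 1 / \<kappa> - \<kappa>" and \<eta>: "2 \<le> \<eta>"
  defines "\<pi> \<equiv> 4 * exp (- t\<^sup>2 / (8 * (150000 * moment_const\<^sup>2 * (max_entry S)\<^sup>2)))"
    and "D \<equiv> \<lambda>\<omega>. cmod (bilinear_form N u (resolvent N (\<i> * of_real \<eta>) (\<lambda>i j. hadamard_product S (W \<omega>) $$ (i, j))) v -
      (- \<i> * of_real \<kappa>) * (\<Sum>i<N. u i * v i))"
  shows "D \<in> borel_measurable M"
    and "prob {\<omega> \<in> space M. 3 * t + 4 * moment_const\<^sup>2 * max_entry S + \<pi> \<le> D \<omega>} \<le> \<pi>"
proof -
  interpret P: profile_model N "\<lambda>i j. S $$ (i, j)" \<nu> moment_const "max_entry S" \<eta> by (rule profile_model[OF \<eta>])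
  define x where "x \<omega> = restrict (\<lambda>k. W \<omega> $$ k) P.coords" for \<omega>
  define E where "E y = cmod (bilinear_form N u (P.green y) v - (- \<i> * of_real \<kappa>) * (\<Sum>i<N. u i * v i))" for y
  have sets: "sets P.ensemble = sets (PiM P.coords (\<lambda>_. borel))"
    unfolding P.ensemble_def by (rule sets_PiM_cong) auto
  have xm: "x \<in> M \<rightarrow>\<^sub>M PiM P.coords (\<lambda>_. borel)"
    unfolding x_def[abs_def] using entry_measurable by (intro measurable_restrict) (auto simp: P.coords_def)
  then have xm': "x \<in> M \<rightarrow>\<^sub>M P.ensemble" using sets by (simp cong: measurable_cong_sets)
  have Em: "E \<in> borel_measurable P.ensemble" unfolding E_def[abs_def] using P.form_measurable[OF u v] by measurable
  have law: "distr M P.ensemble x = P.ensemble"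
  proof -
    have "distr M P.ensemble x = distr M (PiM P.coords (\<lambda>_. borel)) x" by (rule distr_cong) (auto simp: sets)
    also have "\<dots> = PiM P.coords (\<lambda>k. distr M borel (\<lambda>\<omega>. W \<omega> $$ k))"
    proof -
      have "(0, 0) \<in> P.coords" using N by (simp add: P.coords_def)
      then have ne: "P.coords \<noteq> {}" by blast
      have rv: "random_variable borel (\<lambda>\<omega>. W \<omega> $$ k)" if "k \<in> P.coords" for k
        using that entry_measurable by (cases k) (simp add: P.coords_def)
      show ?thesis unfolding x_def[abs_def]
        by (rule indep_vars_iff_distr_eq_PiM'[OF ne rv, THEN iffD1, OF _ indep[folded P.coords_def]])
    qed
    also have "\<dots> = P.ensemble"
      unfolding P.ensemble_def by (rule PiM_cong) (auto simp: P.coords_def entry_law_def)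
    finally show ?thesis .
  qed
  have h: "P.hmat (x \<omega>) i j = hadamard_product S (W \<omega>) $$ (i, j)" if \<omega>: "\<omega> \<in> space M" and ij: "i < N" "j < N" for \<omega> i j
  proof -
    have "hadamard_product S (W \<omega>) $$ (i, j) = complex_of_real (S $$ (i, j)) * W \<omega> $$ (i, j)"
      using W_carrier[OF \<omega>] ij by (simp add: hadamard_product_def)
    moreover have "W \<omega> $$ (i, j) = cnj (W \<omega> $$ (j, i))" by (rule hermitian_onD[OF W_hermitian[OF \<omega>] ij(2,1)])
    moreover have "W \<omega> $$ (i, i) = of_real (Re (W \<omega> $$ (i, i)))"
      using hermitian_onD[OF W_hermitian[OF \<omega>] ij(1) ij(1)] by (auto simp: complex_eq_iff)
    ultimately show ?thesis using ij
      by (cases i j rule: linorder_cases) (auto simp: P.hmat_def x_def P.coords_def)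
  qed
  have DE: "D \<omega> = E (x \<omega>)" if \<omega>: "\<omega> \<in> space M" for \<omega>
  proof -
    have "P.green (x \<omega>) = resolvent N (\<i> * of_real \<eta>) (\<lambda>i j. hadamard_product S (W \<omega>) $$ (i, j))"
      unfolding P.green_def by (rule resolvent_cong) (rule h[OF \<omega>])
    then show ?thesis by (simp add: D_def E_def)
  qed
  have "(\<lambda>\<omega>. E (x \<omega>)) \<in> borel_measurable M" by (rule measurable_compose[OF xm' Em])
  then show "D \<in> borel_measurable M" using DE by (simp cong: measurable_cong)
  let ?c = "3 * t + 4 * moment_const\<^sup>2 * max_entry S + \<pi>"
  have "prob {\<omega> \<in> space M. ?c \<le> D \<omega>} = prob (x -` {y \<in> space P.ensemble. ?c \<le> E y} \<inter> space M)"
    using DE measurable_space[OF xm'] by (intro arg_cong[where f = prob]) auto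
  also have "\<dots> = measure (distr M P.ensemble x) {y \<in> space P.ensemble. ?c \<le> E y}"
    using Em by (intro measure_distr[symmetric] xm') measurable
  also have "\<dots> \<le> \<pi>"
    unfolding law E_def \<pi>_def using P.form_deviation[OF u v small t \<kappa>] by (simp only: P.variance_proxy_def)
  finally show "prob {\<omega> \<in> space M. ?c \<le> D \<omega>} \<le> \<pi>" .
qed

end

section \<open>From resolvent forms to spectral measures\<close>

lemma norm_sq_of_unit_vec:
  fixes q :: "complex Matrix.vec"
  assumes "q \<in> carrier_vec N" "q \<bullet>c q = 1"
  shows "(\<Sum>k<N. cnj (q $ k) * q $ k) = 1" "norm_sq N (\<lambda>k. q $ k) = 1"
proof -
  have "q \<bullet>c q = (\<Sum>k<N. q $ k * cnj (q $ k))"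
    using assms(1) by (auto simp: scalar_prod_def atLeast0LessThan intro!: sum.cong)
  then show e: "(\<Sum>k<N. cnj (q $ k) * q $ k) = 1" using assms(2) by (simp add: mult.commute)
  have "complex_of_real (norm_sq N (\<lambda>k. q $ k)) = (\<Sum>k<N. cnj (q $ k) * q $ k)"
    unfolding norm_sq_def of_real_sum by (intro sum.cong refl) (simp add: complex_norm_square[symmetric] mult.commute)
  then show "norm_sq N (\<lambda>k. q $ k) = 1" unfolding e by simp
qed

lemma norm_sq_cnj: "norm_sq N (\<lambda>k. cnj (v k)) = norm_sq N v"
  by (simp add: norm_sq_def)

lemma unit_eigenvectorD:
  fixes q :: "complex Matrix.vec"
  assumes "unit_eigenvector A q a" "A \<in> carrier_mat N N"
  shows "q \<in> carrier_vec N" "q \<bullet>c q = 1" "\<And>k. k < N \<Longrightarrow> (\<Sum>l<N. A $$ (k, l) * q $ l) = of_real a * q $ k"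
proof -
  have q: "q \<in> carrier_vec N" and e: "A *\<^sub>v q = of_real a \<cdot>\<^sub>v q" and 1: "q \<bullet>c q = 1"
    using assms by (auto simp: unit_eigenvector_def eigenvector_def)
  show "q \<in> carrier_vec N" "q \<bullet>c q = 1" by (rule q 1)+
  show "(\<Sum>l<N. A $$ (k, l) * q $ l) = of_real a * q $ k" if "k < N" for k
  proof -
    have "(A *\<^sub>v q) $ k = (\<Sum>l<N. A $$ (k, l) * q $ l)"
      using that assms(2) q by (auto simp: scalar_prod_def atLeast0LessThan intro!: sum.cong)
    then show ?thesis unfolding e using that q by simp
  qed
qed

lemma block_deformationD:
  assumes "block_deformation \<beta> N r A"
  shows "A \<in> carrier_mat N N" "hermitian_on N (\<lambda>i j. A $$ (i, j))"
    and "\<exists>B\<subseteq>{..<N}. card B \<le> r \<and> (\<forall>k<N. \<forall>l<N. \<not> (k \<in> B \<and> l \<in> B) \<longrightarrow> A $$ (k, l) = 0)"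
    and "1 \<le> r" "r \<le> N"
proof -
  obtain a m where m: "m ` {1..r} \<subseteq> {..<N}"
    and A: "A = Matrix.mat N N (\<lambda>(k, l). \<Sum>i = 1..r. \<Sum>j = 1..r. a i j * matrix_unit N (m i) (m j) $$ (k, l))"
    using assms unfolding block_deformation_def by blast
  show c: "A \<in> carrier_mat N N" unfolding A by simp
  have "has_symmetry \<beta> A" using assms unfolding block_deformation_def by blast
  then show "hermitian_on N (\<lambda>i j. A $$ (i, j))" by (rule has_symmetry_hermitian[OF _ c])
  have "card (m ` {1..r}) \<le> r" using card_image_le[of "{1..r}" m] by simp
  moreover have "A $$ (k, l) = 0" if "k < N" "l < N" "\<not> (k \<in> m ` {1..r} \<and> l \<in> m ` {1..r})" for k l
  proof -
    have "A $$ (k, l) = (\<Sum>i = 1..r. \<Sum>j = 1..r. a i j * matrix_unit N (m i) (m j) $$ (k, l))"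
      unfolding A using that by simp
    also have "\<dots> = 0" using that by (intro sum.neutral ballI) (auto simp: matrix_unit_def)
    finally show ?thesis .
  qed
  ultimately show "\<exists>B\<subseteq>{..<N}. card B \<le> r \<and> (\<forall>k<N. \<forall>l<N. \<not> (k \<in> B \<and> l \<in> B) \<longrightarrow> A $$ (k, l) = 0)"
    using m by blast
  show "1 \<le> r" "r \<le> N" using assms unfolding block_deformation_def by blast+
qed

context wigner_matrix
begin

lemma hadamard_entry:
  "\<omega> \<in> space M \<Longrightarrow> i < N \<Longrightarrow> j < N \<Longrightarrow> hadamard_product S (W \<omega>) $$ (i, j) = complex_of_real (S $$ (i, j)) * W \<omega> $$ (i, j)"
  using W_carrier[of \<omega>] by (simp add: hadamard_product_def)

lemma hadamard_hermitian:
  assumes \<omega>: "\<omega> \<in> space M" shows "hermitian_on N (\<lambda>i j. hadamard_product S (W \<omega>) $$ (i, j))"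
  unfolding hermitian_on_def
proof (intro allI impI)
  fix i j assume ij: "i < N" "j < N"
  have S': "S \<in> carrier_mat N N" "transpose_mat S = S" using S by (simp_all only: variance_profile_def)
  have "transpose_mat S $$ (j, i) = S $$ (i, j)" using S'(1) ij by simp
  then have "S $$ (j, i) = S $$ (i, j)" unfolding S'(2) .
  then show "hadamard_product S (W \<omega>) $$ (j, i) = cnj (hadamard_product S (W \<omega>) $$ (i, j))"
    using hadamard_entry[OF \<omega> ij] hadamard_entry[OF \<omega> ij(2,1)] hermitian_onD[OF W_hermitian[OF \<omega>] ij] by simp
qed

lemma deformed_matrix_hermitian:
  assumes \<omega>: "\<omega> \<in> space M" and A: "A \<in> carrier_mat N N" "hermitian_on N (\<lambda>i j. A $$ (i, j))"
  shows "deformed_matrix S W A \<omega> \<in> carrier_mat N N"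
    and "i < N \<Longrightarrow> j < N \<Longrightarrow> deformed_matrix S W A \<omega> $$ (i, j) = hadamard_product S (W \<omega>) $$ (i, j) + A $$ (i, j)"
    and "hermitian_on N (\<lambda>i j. deformed_matrix S W A \<omega> $$ (i, j))"
proof -
  show c: "deformed_matrix S W A \<omega> \<in> carrier_mat N N" using A(1) by (simp add: deformed_matrix_def)
  show e: "deformed_matrix S W A \<omega> $$ (i, j) = hadamard_product S (W \<omega>) $$ (i, j) + A $$ (i, j)" if "i < N" "j < N" for i j
    using A(1) that by (simp add: deformed_matrix_def)
  show "hermitian_on N (\<lambda>i j. deformed_matrix S W A \<omega> $$ (i, j))"
    unfolding hermitian_on_def
  proof (intro allI impI)
    fix i j assume ij: "i < N" "j < N"
    show "deformed_matrix S W A \<omega> $$ (j, i) = cnj (deformed_matrix S W A \<omega> $$ (i, j))"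
      unfolding e[OF ij] e[OF ij(2,1)] complex_cnj_add
      using hermitian_onD[OF hadamard_hermitian[OF \<omega>] ij] hermitian_onD[OF A(2) ij] by simp
  qed
qed

text \<open>The estimate is stated off an event E defined through resolvent forms, whose
  measurability is known, so that the spectral measure enters only pointwise in \<omega>.\<close>

lemma spectral_stieltjes_tail:
  fixes \<kappa> \<eta> t a :: real and q :: "complex Matrix.vec"
  assumes A: "block_deformation \<beta> N r A" and q: "unit_eigenvector A q a"
    and small: "16 * moment_const * (max_entry S)\<^sup>2 \<le> 1"
    and t: "0 < t" "t \<le> 2000" and \<kappa>: "0 < \<kappa>" "\<eta> = 1 / \<kappa> - \<kappa>" and \<eta>: "2 \<le> \<eta>"
  defines "\<pi> \<equiv> 4 * exp (- t\<^sup>2 / (8 * (150000 * moment_const\<^sup>2 * (max_entry S)\<^sup>2)))"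
  defines "\<tau> \<equiv> 3 * t + 4 * moment_const\<^sup>2 * max_entry S + \<pi>"
    and "c \<equiv> (- \<i> * complex_of_real \<kappa>) / (1 - of_real a * (- \<i> * complex_of_real \<kappa>))"
  assumes small_r: "real r * \<tau> \<le> \<kappa> / 2" and \<tau>0: "0 \<le> \<tau>"
  shows "\<exists>E\<in>events. prob E \<le> (real N + 1)\<^sup>2 * \<pi> \<and>
    (\<forall>\<omega>\<in>space M - E. cmod ((LINT x|spectral_measure (deformed_matrix S W A \<omega>) q. stieltjes_kernel \<eta> x) - c)
      \<le> real r * \<tau> * (4 + 4 * cmod (c * of_real a)))"
proof -
  note Ad = block_deformationD[OF A]
  note qd = unit_eigenvectorD[OF q Ad(1)]
  obtain B where B: "B \<subseteq> {..<N}" "card B \<le> r" and supp: "\<And>k l. k < N \<Longrightarrow> l < N \<Longrightarrow> \<not> (k \<in> B \<and> l \<in> B) \<Longrightarrow> A $$ (k, l) = 0"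
    using Ad(3) by blast
  define qf where "qf k = q $ k" for k
  define m where "m = - \<i> * complex_of_real \<kappa>"
  define G where "G \<omega> = resolvent N (\<i> * of_real \<eta>) (\<lambda>i j. hadamard_product S (W \<omega>) $$ (i, j))" for \<omega>
  \<comment> \<open>Indices below N stand for unit vectors, and index N for the eigenvector,
    conjugated on the left. The (N + 1)^2 pairs thus contain the entries, both kinds of mixed forms
    and the form in q that the perturbation bound asks for.\<close>
  define U where "U x = (if x < N then (\<lambda>k. if k = x then 1 else 0) else (\<lambda>k. cnj (qf k)))" for x
  define V where "V x = (if x < N then (\<lambda>k. if k = x then 1 else 0) else qf)" for x
  note qq = norm_sq_of_unit_vec[OF qd(1,2), folded qf_def]
  have q1: "norm_sq N qf = 1" using qq(2) by (simp add: qf_def[abs_def])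
  have U1: "norm_sq N (U x) \<le> 1" and V1: "norm_sq N (V x) \<le> 1" for x
    using norm_sq_delta[of x N] q1 norm_sq_cnj[of N qf] by (simp_all only: U_def V_def if_True if_False order_refl split: if_split) auto
  define D where "D x b \<omega> = cmod (bilinear_form N (U x) (G \<omega>) (V b) - m * (\<Sum>i<N. U x i * V b i))" for x b \<omega>
  note dev = form_deviation_W[OF U1 V1 small t \<kappa> \<eta>, folded \<pi>_def, folded \<tau>_def G_def m_def, folded D_def]
  have Dm: "D x b \<in> borel_measurable M" for x b using dev(1)[of x b] by (simp only: D_def[abs_def] G_def m_def)
  define E where "E = (\<Union>p\<in>{..N} \<times> {..N}. {\<omega> \<in> space M. \<tau> \<le> D (fst p) (snd p) \<omega>})"
  have ev: "{\<omega> \<in> space M. \<tau> \<le> D x b \<omega>} \<in> events" for x b using Dm[of x b] by measurable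
  have "E \<in> events" unfolding E_def using ev by (intro sets.finite_UN) auto
  moreover have "prob E \<le> (real N + 1)\<^sup>2 * \<pi>"
  proof -
    have "prob E \<le> (\<Sum>p\<in>{..N} \<times> {..N}. prob {\<omega> \<in> space M. \<tau> \<le> D (fst p) (snd p) \<omega>})"
      unfolding E_def using ev by (intro measure_UNION_le) auto
    also have "\<dots> \<le> (\<Sum>p\<in>{..N} \<times> {..N}. \<pi>)" by (intro sum_mono dev(2))
    finally show ?thesis by (simp add: power2_eq_square algebra_simps)
  qed
  moreover have "cmod ((LINT x|spectral_measure (deformed_matrix S W A \<omega>) q. stieltjes_kernel \<eta> x) - c)
      \<le> real r * \<tau> * (4 + 4 * cmod (c * of_real a))" if \<omega>: "\<omega> \<in> space M - E" for \<omega>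
  proof -
    have \<omega>': "\<omega> \<in> space M" using \<omega> by simp
    have lt: "D x b \<omega> \<le> \<tau>" if "x \<le> N" "b \<le> N" for x b
      using \<omega> that unfolding E_def by force
    note X = deformed_matrix_hermitian[OF \<omega>' Ad(1,2)]
    have \<eta>0: "0 < \<eta>" using \<eta> by simp
    obtain y where y: "\<And>i. i < N \<Longrightarrow> \<i> * of_real \<eta> * y i - (\<Sum>k<N. deformed_matrix S W A \<omega> $$ (i, k) * y k) = q $ i"
      and ys: "(LINT x|spectral_measure (deformed_matrix S W A \<omega>) q. stieltjes_kernel \<eta> x) = (\<Sum>i<N. y i * cnj (q $ i))"
      using spectral_measure_hermitian(2)[OF X(1,3) qd(1,2) \<eta>0] by blast
    have small': "real r * \<tau> + 0 \<le> \<kappa> / 2" using small_r by simp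
    have "cmod ((\<Sum>i<N. y i * cnj (qf i)) - c) \<le> (real r * \<tau> + 0) * (4 + 4 * cmod (c * of_real a))"
      unfolding c_def
    proof (rule finite_rank_perturbation_bound[OF \<kappa>(1) \<eta>0 hadamard_hermitian[OF \<omega>'] Ad(2) B Ad(4) supp q1 _ _ \<tau>0 order_refl _ _ _ _ small'])
      show "(\<Sum>l<N. A $$ (k, l) * qf l) = of_real a * qf k" if "k < N" for k unfolding qf_def by (rule qd(3)[OF that])
      show "\<i> * of_real \<eta> * y k - (\<Sum>l<N. (hadamard_product S (W \<omega>) $$ (k, l) + A $$ (k, l)) * y l) = qf k" if k: "k < N" for k
      proof -
        have "(\<Sum>l<N. (hadamard_product S (W \<omega>) $$ (k, l) + A $$ (k, l)) * y l) = (\<Sum>l<N. deformed_matrix S W A \<omega> $$ (k, l) * y l)"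
          using X(2)[OF k] by (intro sum.cong) auto
        then show ?thesis using y[OF k] by (simp only: qf_def)
      qed
      fix x b assume xB: "x \<in> B"
      then have x: "x < N" "x \<le> N" using B(1) by auto
      have UV: "U x = (\<lambda>k. if k = x then 1 else 0)" "V x = (\<lambda>k. if k = x then 1 else 0)" "U N = (\<lambda>k. cnj (qf k))" "V N = qf"
        using x by (simp_all add: U_def V_def)
      show "cmod (col_form N (resolvent N (\<i> * of_real \<eta>) (\<lambda>i j. hadamard_product S (W \<omega>) $$ (i, j))) qf x - - \<i> * of_real \<kappa> * qf x) \<le> \<tau> + 0 * cmod (qf x)"
        using lt[OF x(2) order_refl] unfolding D_def UV sum_mult_delta[OF x(1)] bilinear_form_delta_left[OF x(1)] G_def m_def by simp
      show "cmod (row_form N (\<lambda>k. cnj (qf k)) (resolvent N (\<i> * of_real \<eta>) (\<lambda>i j. hadamard_product S (W \<omega>) $$ (i, j))) x - - \<i> * of_real \<kappa> * cnj (qf x)) \<le> \<tau> + 0 * cmod (qf x)"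
        using lt[OF order_refl x(2)] unfolding D_def UV sum_mult_delta[OF x(1)] bilinear_form_delta_right[OF x(1)] G_def m_def by simp
      assume bB: "b \<in> B"
      then have b: "b < N" "b \<le> N" using B(1) by auto
      have Vb: "V b = (\<lambda>k. if k = b then 1 else 0)" using b by (simp add: V_def)
      have "m * (if x = b then 1 else 0) = (if x = b then m else 0)" by simp
      then show "cmod (resolvent N (\<i> * of_real \<eta>) (\<lambda>i j. hadamard_product S (W \<omega>) $$ (i, j)) x b - (if x = b then - \<i> * of_real \<kappa> else 0)) \<le> \<tau> + (if x = b then 0 else 0)"
        using lt[OF x(2) b(2)] unfolding D_def UV Vb sum_mult_delta[OF x(1)] sum_mult_delta[OF b(1)] bilinear_form_delta_left[OF x(1)] col_form_delta[OF b(1)] G_def m_def by simp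
    next
      have "(\<Sum>i<N. U N i * V N i) = 1" using qq(1) by (simp add: U_def V_def qf_def)
      then show "cmod (bilinear_form N (\<lambda>k. cnj (qf k)) (resolvent N (\<i> * of_real \<eta>) (\<lambda>i j. hadamard_product S (W \<omega>) $$ (i, j))) qf - - \<i> * of_real \<kappa>) \<le> \<tau> + 0"
        using lt[of N N] by (simp add: D_def U_def V_def G_def m_def)
    qed
    then show ?thesis unfolding ys by (simp add: qf_def)
  qed
  ultimately show ?thesis by blast
qed

end

section \<open>Rates and the Borel-Cantelli lemma\<close>

lemma exists_kappa:
  fixes \<eta> :: real
  assumes "2 < \<eta>"
  shows "\<exists>\<kappa>. 0 < \<kappa> \<and> \<kappa> < 1 \<and> \<eta> = 1 / \<kappa> - \<kappa>"
proof -
  define \<rho> where "\<rho> = sqrt (\<eta>\<^sup>2 + 4)"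
  define \<kappa> where "\<kappa> = (\<rho> - \<eta>) / 2"
  have r2: "\<rho>\<^sup>2 = \<eta>\<^sup>2 + 4" by (simp add: \<rho>_def)
  have a: "\<eta> < \<rho>" unfolding \<rho>_def by (rule real_less_rsqrt) simp
  have b: "\<rho> < \<eta> + 2"
    unfolding \<rho>_def using assms by (intro real_less_lsqrt) (auto simp: power2_sum)
  have "\<kappa> + \<eta> = (\<rho> + \<eta>) / 2" by (simp add: \<kappa>_def field_simps)
  then have "\<kappa> * (\<kappa> + \<eta>) = (\<rho>\<^sup>2 - \<eta>\<^sup>2) / 4" by (simp add: \<kappa>_def power2_eq_square field_simps)
  then have "\<kappa> * (\<kappa> + \<eta>) = 1" by (simp add: r2)
  moreover have "0 < \<kappa>" "\<kappa> < 1" using a b by (auto simp: \<kappa>_def)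
  ultimately show ?thesis by (intro exI[of _ \<kappa>]) (auto simp: field_simps)
qed

text \<open>
  The constant \<open>2200\<close> satisfies \<open>2200\<^sup>2 \<ge> 4 \<cdot> 8 \<cdot> 150000\<close>, which beats the union bound over the
  \<open>(N + 1)\<^sup>2\<close> pairs of vectors with a summable factor to spare.
\<close>

lemma tail_exponent_le:
  assumes "0 < g" "0 < s" "1 \<le> N"
  shows "exp (- (2200 * g * s * sqrt (ln (real N)))\<^sup>2 / (8 * (150000 * g\<^sup>2 * s\<^sup>2))) \<le> 1 / real N ^ 4"
proof -
  have l: "0 \<le> ln (real N)" using assms by simp
  have "(2200 * g * s * sqrt (ln (real N)))\<^sup>2 = 4840000 * (g\<^sup>2 * s\<^sup>2) * ln (real N)"
    using l by (simp add: power_mult_distrib)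
  then have "- (2200 * g * s * sqrt (ln (real N)))\<^sup>2 / (8 * (150000 * g\<^sup>2 * s\<^sup>2)) = - (4840000 / 1200000) * ln (real N)"
    using assms by simp
  also have "\<dots> \<le> - (4 * ln (real N))" using l by simp
  finally have "exp (- (2200 * g * s * sqrt (ln (real N)))\<^sup>2 / (8 * (150000 * g\<^sup>2 * s\<^sup>2))) \<le> exp (- (4 * ln (real N)))" by simp
  also have "\<dots> = 1 / exp (ln (real N)) ^ 4" by (simp add: exp_minus exp_of_nat_mult[symmetric] inverse_eq_divide)
  also have "exp (ln (real N)) = real N" using assms by simp
  finally show ?thesis .
qed

text \<open>The deviation t is a multiple of s sqrt (log N), large enough that (N + 1)^2 exceptional
  events of probability O(N^-4) are summable, and small enough that r \<tau> tends to 0 by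
  assumption.\<close>

lemma stieltjes_transform_AE_convergent:
  fixes M :: "'w measure" and W :: "nat \<Rightarrow> 'w \<Rightarrow> complex Matrix.mat" and S :: "nat \<Rightarrow> real Matrix.mat"
    and A :: "nat \<Rightarrow> complex Matrix.mat" and r :: "nat \<Rightarrow> nat" and a \<eta> :: real and q :: "nat \<Rightarrow> complex Matrix.vec"
  assumes M: "prob_space M" and \<gamma>: "\<gamma> > 0"
    and W: "\<And>N. N \<ge> 1 \<Longrightarrow> sub_gaussian_wigner \<beta> \<gamma> M N (W N)"
    and S: "\<And>N. N \<ge> 1 \<Longrightarrow> variance_profile N (S N)"
    and A: "\<And>N. N \<ge> 1 \<Longrightarrow> block_deformation \<beta> N (r N) (A N)"
    and lim: "(\<lambda>N. (real (r N) + 1) * max_entry (S N) * sqrt (ln (real N))) \<longlonglongrightarrow> 0"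
    and q: "\<forall>\<^sub>F N in sequentially. unit_eigenvector (A N) (q N) a"
    and \<eta>: "2 < \<eta>"
  shows "AE \<omega> in M. (\<lambda>N. LINT x|spectral_measure (deformed_matrix (S N) (W N) (A N) \<omega>) (q N). stieltjes_kernel \<eta> x)
    \<longlonglongrightarrow> (LINT x|limit_measure a. stieltjes_kernel \<eta> x)"
proof -
  interpret prob_space M by (rule M)
  obtain \<kappa> where \<kappa>: "0 < \<kappa>" "\<kappa> < 1" "\<eta> = 1 / \<kappa> - \<kappa>" using exists_kappa[OF \<eta>] by blast
  define c where "c = (- \<i> * complex_of_real \<kappa>) / (1 - of_real a * (- \<i> * complex_of_real \<kappa>))"
  have c: "(LINT x|limit_measure a. stieltjes_kernel \<eta> x) = c"
    using stieltjes_limit_measure[OF \<kappa>] by (simp add: c_def stieltjes_kernel_def mult_ac)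
  define g where "g = max \<gamma> 2"
  have g: "2 \<le> g" by (simp add: g_def)
  define s where "s N = max_entry (S N)" for N
  define w where "w N = (real (r N) + 1) * s N * sqrt (ln (real N))" for N
  define t where "t N = 2200 * g * s N * sqrt (ln (real N))" for N
  define \<pi> where "\<pi> N = 4 * exp (- (t N)\<^sup>2 / (8 * (150000 * g\<^sup>2 * (s N)\<^sup>2)))" for N
  define \<tau> where "\<tau> N = 3 * t N + 4 * g\<^sup>2 * s N + \<pi> N" for N
  define C where "C = 4 + 4 * cmod (c * of_real a)"
  define e where "e N = (6600 * g + 4 * g\<^sup>2) * w N + 4 * inverse (real N)" for N
  define Z where "Z N \<omega> = (LINT x|spectral_measure (deformed_matrix (S N) (W N) (A N) \<omega>) (q N). stieltjes_kernel \<eta> x)" for N \<omega>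
  have w0: "w \<longlonglongrightarrow> 0" using lim by (simp add: w_def[abs_def] s_def)
  have e0: "e \<longlonglongrightarrow> 0"
    unfolding e_def[abs_def] using tendsto_add[OF tendsto_mult_left[OF w0, of "6600 * g + 4 * g\<^sup>2"] tendsto_mult_left[OF lim_inverse_n, of 4]]
    by simp
  have wm: "wigner_matrix M \<beta> \<gamma> N (W N) (S N)" if "1 \<le> N" for N
    using that \<gamma> W S by (intro wigner_matrix.intro[OF M] wigner_matrix_axioms.intro) auto
  have s_pos: "0 < s N" if N: "1 \<le> N" for N
    unfolding s_def using \<eta> by (intro profile_model.smax_pos[OF wigner_matrix.profile_model[OF wm[OF N], of \<eta>]]) simp
  have pi_le: "0 \<le> \<pi> N" "\<pi> N \<le> 4 / real N ^ 4" if N: "1 \<le> N" for N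
    using tail_exponent_le[OF _ s_pos[OF N] N, of g] g by (auto simp: \<pi>_def t_def)
  have rates: "1 \<le> r N" "r N \<le> N" "s N \<le> w N" "t N \<le> 2200 * g * w N" "0 < t N" "0 \<le> \<tau> N" "real (r N) * \<tau> N \<le> e N" if N: "3 \<le> N" for N
  proof -
    have N1: "1 \<le> N" using N by simp
    show r: "1 \<le> r N" "r N \<le> N" using block_deformationD(4,5)[OF A[OF N1]] by auto
    \<comment> \<open>From N = 3 on ln N >= 1, so the error of order s in the mean is dominated by s
      sqrt (ln N), the scale of the fluctuations.\<close>
    have "exp 1 \<le> real N" using exp_le N by linarith
    then have ln1: "1 \<le> ln (real N)" using N by (simp add: ln_ge_iff)
    then have sq: "1 \<le> sqrt (ln (real N))" by simp
    note sp = s_pos[OF N1]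
    have ss: "s N * 1 \<le> s N * sqrt (ln (real N))" using sp sq by (intro mult_left_mono) auto
    have nn: "0 \<le> s N * sqrt (ln (real N))" using sp sq by simp
    have w_eq: "w N = real (r N) * (s N * sqrt (ln (real N))) + s N * sqrt (ln (real N))"
      by (simp add: w_def algebra_simps)
    have rn: "0 \<le> real (r N) * (s N * sqrt (ln (real N)))" using nn by simp
    show sw: "s N \<le> w N" using ss rn w_eq by linarith
    have t_eq: "t N = 2200 * g * (s N * sqrt (ln (real N)))" by (simp add: t_def)
    have "s N * sqrt (ln (real N)) \<le> w N" using rn w_eq by linarith
    then show "t N \<le> 2200 * g * w N" unfolding t_eq using g by (intro mult_left_mono) auto
    show "0 < t N" unfolding t_def using g sp sq by (intro mult_pos_pos) auto
    then show "0 \<le> \<tau> N" unfolding \<tau>_def using pi_le(1)[OF N1] sp by simp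
    have "real (r N) * (s N * sqrt (ln (real N))) \<le> w N" using nn w_eq by linarith
    then have 1: "6600 * g * (real (r N) * (s N * sqrt (ln (real N)))) \<le> 6600 * g * w N" using g by (intro mult_left_mono) auto
    have "real (r N) * (s N * 1) \<le> real (r N) * (s N * sqrt (ln (real N)))" by (rule mult_left_mono[OF ss]) simp
    then have "real (r N) * s N \<le> w N" using nn w_eq by linarith
    then have 2: "4 * g\<^sup>2 * (real (r N) * s N) \<le> 4 * g\<^sup>2 * w N" by (intro mult_left_mono) auto
    \<comment> \<open>No rate for r is known here beyond r <= N, but \<pi> decays like N^-4.\<close>
    have "real (r N) * \<pi> N \<le> real N * (4 / real N ^ 4)" using r pi_le[OF N1] by (intro mult_mono) auto
    also have "\<dots> = 4 * (1 / real N ^ 3)" using N by (simp add: power_numeral_reduce)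
    also have "\<dots> \<le> 4 * (1 / real N ^ 1)" using N by (intro mult_left_mono divide_left_mono power_increasing) auto
    finally have 3: "real (r N) * \<pi> N \<le> 4 * inverse (real N)" by (simp add: inverse_eq_divide)
    have "real (r N) * \<tau> N = 6600 * g * (real (r N) * (s N * sqrt (ln (real N)))) + 4 * g\<^sup>2 * (real (r N) * s N) + real (r N) * \<pi> N"
      by (simp add: \<tau>_def t_def algebra_simps)
    then show "real (r N) * \<tau> N \<le> e N" using 1 2 3 by (simp add: e_def algebra_simps)
  qed
  have step: "\<exists>E\<in>events. prob E \<le> 16 * inverse (real N ^ 2) \<and> (\<forall>\<omega>\<in>space M - E. cmod (Z N \<omega> - c) \<le> e N * C)"
    if N: "3 \<le> N" and uq: "unit_eigenvector (A N) (q N) a" and wN: "w N < 1 / (16 * g)" and tN: "2200 * g * w N < 2000" and eN: "e N < \<kappa> / 2" for N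
  proof -
    have N1: "1 \<le> N" using N by simp
    interpret X: wigner_matrix M \<beta> \<gamma> N "W N" "S N" by (rule wm[OF N1])
    note rt = rates[OF N]
    have sg: "16 * g * s N \<le> 1"
      using mult_left_mono[OF order.trans[OF rt(3) less_imp_le[OF wN]], of "16 * g"] g by simp
    have "s N * s N \<le> s N * 1"
    proof (rule mult_left_mono)
      have "1 * s N \<le> 16 * g * s N" using g s_pos[OF N1] by (intro mult_right_mono) auto
      then show "s N \<le> 1" using sg by linarith
    qed (use s_pos[OF N1] in simp)
    then have "16 * g * (s N)\<^sup>2 \<le> 16 * g * s N" using g by (simp add: power2_eq_square)
    then have small: "16 * g * (s N)\<^sup>2 \<le> 1" using sg by linarith
    have t2000: "t N \<le> 2000" using rt(4) tN by linarith
    have small_r: "real (r N) * \<tau> N \<le> \<kappa> / 2" using rt(7) eN by linarith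
    have \<eta>2: "2 \<le> \<eta>" using \<eta> by simp
    obtain E where E: "E \<in> events" "prob E \<le> (real N + 1)\<^sup>2 * \<pi> N"
      and b: "\<And>\<omega>. \<omega> \<in> space M - E \<Longrightarrow> cmod (Z N \<omega> - c) \<le> real (r N) * \<tau> N * C"
      using X.spectral_stieltjes_tail[OF A[OF N1] uq, folded g_def s_def, OF small rt(5) t2000 \<kappa>(1,3) \<eta>2, folded \<pi>_def, folded \<tau>_def c_def, OF small_r rt(6), folded C_def]
      unfolding Z_def by blast
    have "(real N + 1)\<^sup>2 * \<pi> N \<le> (2 * real N)\<^sup>2 * (4 / real N ^ 4)"
      using N pi_le[OF N1] by (intro mult_mono power_mono) auto
    also have "\<dots> = 16 * inverse (real N ^ 2)" using N by (simp add: power_numeral_reduce field_simps)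
    finally have "prob E \<le> 16 * inverse (real N ^ 2)" using E(2) by linarith
    moreover have "cmod (Z N \<omega> - c) \<le> e N * C" if "\<omega> \<in> space M - E" for \<omega>
    proof -
      have "real (r N) * \<tau> N * C \<le> e N * C" using rt(7) by (intro mult_right_mono) (auto simp: C_def)
      then show ?thesis using b[OF that] by linarith
    qed
    ultimately show ?thesis using E(1) by blast
  qed
  have ev: "\<forall>\<^sub>F N in sequentially. \<exists>E\<in>events. prob E \<le> 16 * inverse (real N ^ 2) \<and> (\<forall>\<omega>\<in>space M - E. cmod (Z N \<omega> - c) \<le> e N * C)"
  proof -
    have "\<forall>\<^sub>F N in sequentially. w N < 1 / (16 * g)" using order_tendstoD(2)[OF w0, of "1 / (16 * g)"] g by simp
    moreover have "\<forall>\<^sub>F N in sequentially. 2200 * g * w N < 2000"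
      using order_tendstoD(2)[OF tendsto_mult_left[OF w0, of "2200 * g"], of 2000] by simp
    moreover have "\<forall>\<^sub>F N in sequentially. e N < \<kappa> / 2" using order_tendstoD(2)[OF e0, of "\<kappa> / 2"] \<kappa> by simp
    ultimately show ?thesis using q eventually_ge_at_top[of 3] by eventually_elim (rule step)
  qed
  \<comment> \<open>The estimate holds only for large N. For the others the empty set is taken, so
    that one sequence of events is defined for all N and Borel-Cantelli applies.\<close>
  have "\<exists>E. E \<in> events \<and> prob E \<le> 16 * inverse (real N ^ 2) \<and>
     ((\<exists>E\<in>events. prob E \<le> 16 * inverse (real N ^ 2) \<and> (\<forall>\<omega>\<in>space M - E. cmod (Z N \<omega> - c) \<le> e N * C)) \<longrightarrow>
       (\<forall>\<omega>\<in>space M - E. cmod (Z N \<omega> - c) \<le> e N * C))" for N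
  proof (cases "\<exists>E\<in>events. prob E \<le> 16 * inverse (real N ^ 2) \<and> (\<forall>\<omega>\<in>space M - E. cmod (Z N \<omega> - c) \<le> e N * C)")
    case True
    then show ?thesis by blast
  next
    case False
    moreover have "{} \<in> events \<and> prob {} \<le> 16 * inverse (real N ^ 2)" by simp
    ultimately show ?thesis by blast
  qed
  then obtain E where E: "\<And>N. E N \<in> events" "\<And>N. prob (E N) \<le> 16 * inverse (real N ^ 2)"
    and Eb: "\<And>N. \<exists>E\<in>events. prob E \<le> 16 * inverse (real N ^ 2) \<and> (\<forall>\<omega>\<in>space M - E. cmod (Z N \<omega> - c) \<le> e N * C) \<Longrightarrow>
       \<forall>\<omega>\<in>space M - E N. cmod (Z N \<omega> - c) \<le> e N * C" by metis
  have "summable (\<lambda>N. prob (E N))"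
  proof (rule summable_comparison_test')
    show "summable (\<lambda>N. 16 * inverse (real N ^ 2))" by (intro summable_mult inverse_power_summable) simp
    show "norm (prob (E N)) \<le> 16 * inverse (real N ^ 2)" if "0 \<le> N" for N using E(2)[of N] by simp
  qed
  then have "AE \<omega> in M. \<forall>\<^sub>F N in sequentially. \<omega> \<in> space M - E N"
    by (intro borel_cantelli_AE1 E(1)) (auto simp: emeasure_eq_measure)
  then show ?thesis
  proof eventually_elim
    case (elim \<omega>)
    have "\<forall>\<^sub>F N in sequentially. norm (Z N \<omega> - c) \<le> e N * C"
      using elim ev by eventually_elim (use Eb in blast)
    moreover have "(\<lambda>N. e N * C) \<longlonglongrightarrow> 0" using tendsto_mult_left_zero[OF e0] .
    ultimately have "(\<lambda>N. Z N \<omega> - c) \<longlonglongrightarrow> 0" by (rule Lim_null_comparison)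
    then show ?case unfolding c Z_def[symmetric] by (rule LIM_zero_cancel)
  qed
qed

theorem theorem1p5:
  fixes M :: "'w measure"
    and \<beta> :: symmetry_class
    and \<gamma> :: real
    and W :: "nat \<Rightarrow> 'w \<Rightarrow> complex Matrix.mat"
    and S :: "nat \<Rightarrow> real Matrix.mat"
    and A :: "nat \<Rightarrow> complex Matrix.mat"
    and r :: "nat \<Rightarrow> nat"
    and a :: "nat \<Rightarrow> real"
    and q :: "nat \<Rightarrow> nat \<Rightarrow> complex Matrix.vec"
    and i :: nat
  assumes "prob_space M"
    and "\<gamma> > 0"
    and "\<And>N. N \<ge> 1 \<Longrightarrow> sub_gaussian_wigner \<beta> \<gamma> M N (W N)"
    and "\<And>N. N \<ge> 1 \<Longrightarrow> variance_profile N (S N)"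
    and "\<And>N. N \<ge> 1 \<Longrightarrow> block_deformation \<beta> N (r N) (A N)"
    and "(\<lambda>N. (real (r N) + 1) * max_entry (S N) * sqrt (ln (real N))) \<longlonglongrightarrow> 0"
    and "1 \<le> i"
    and "\<forall>\<^sub>F N in sequentially. i \<le> r N"
    and "\<And>N. N \<ge> 1 \<Longrightarrow> i \<le> r N \<Longrightarrow> unit_eigenvector (A N) (q N i) (a i)"
  shows "AE \<omega> in M.
    weak_conv_m (\<lambda>N. spectral_measure (deformed_matrix (S N) (W N) (A N) \<omega>) (q N i)) (limit_measure (a i))"
proof -
  have q: "\<forall>\<^sub>F N in sequentially. unit_eigenvector (A N) (q N i) (a i)"
    using assms(8) eventually_ge_at_top[of 1] by eventually_elim (rule assms(9))
  have "AE \<omega> in M. \<forall>\<eta>\<in>\<rat> \<inter> {2<..}. (\<lambda>N. LINT x|spectral_measure (deformed_matrix (S N) (W N) (A N) \<omega>) (q N i). stieltjes_kernel \<eta> x)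
      \<longlonglongrightarrow> (LINT x|limit_measure (a i). stieltjes_kernel \<eta> x)"
    by (subst AE_ball_countable)
      (use stieltjes_transform_AE_convergent[OF assms(1-6) q] in \<open>auto intro: countable_subset[OF _ countable_rat]\<close>)
  with AE_space show ?thesis
  proof eventually_elim
    case (elim \<omega>)
    \<comment> \<open>Only eventually: q N i is known to be a unit eigenvector once i <= r N, and
      before that the definite description may denote anything.\<close>
    have "\<forall>\<^sub>F N in sequentially. real_distribution (spectral_measure (deformed_matrix (S N) (W N) (A N) \<omega>) (q N i))"
      using q eventually_ge_at_top[of 1]
    proof eventually_elim
      case (elim N)
      interpret wigner_matrix M \<beta> \<gamma> N "W N" "S N"
        using assms(2-4) elim by (intro wigner_matrix.intro[OF assms(1)] wigner_matrix_axioms.intro) auto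
      note Ad = block_deformationD[OF assms(5)[OF elim(2)]]
      show ?case
        by (rule spectral_measure_hermitian(1)[OF deformed_matrix_hermitian(1,3)[OF \<open>\<omega> \<in> space M\<close> Ad(1,2)] unit_eigenvectorD(1,2)[OF elim(1) Ad(1)]])
    qed
    then show ?case using elim by (intro weak_conv_of_rational_stieltjes real_distribution_limit_measure) auto
  qed
qed

end
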